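(* Let $G$ be a simply connected, $2$-step nilpotent Lie group equipped with a left-invariant sub-Riemannian metric $d$, and denote by $d_\infty$ the canonical asymptotic metric of $(G,d)$. Then the identity map $\mathrm{id}:(G,d)\to(G,d_\infty)$ is a rough isometry, i.e., there exists $C>0$ such that $\lvert d_\infty(p,q)-d(p,q)\rvert\le C$ for every $p,q\in G$.
   Context: Let $G$ be a connected Lie group with identity $e$ and Lie algebra $\mathfrak g=T_eG$; $L_p$ denotes left translation by $p$. The group is $2$-step nilpotent if its nilpotency step is $2$, i.e. $[\mathfrak g,[\mathfrak g,\mathfrak g]]=0$ and $[\mathfrak g,\mathfrak g]\neq 0$. A sub-Riemannian structure $(\Delta,\rho)$ on $G$ consists of a left-invariant subbundle $\Delta\subseteq TG$ that is bracket-generating (the Lie algebra generated by $\Delta_e$ is $\mathfrak g$) and a left-invariant metric tensor $\rho$ on $\Delta$. The case $\Delta=TG$ (Riemannian) is included. An absolutely continuous curve $\gamma:[0,1]\to G$ is $\Delta$-horizontal if $\dot\gamma(t)\in\Delta_{\gamma(t)}$ for a.e. $t$; its length is $\ell(\gamma)=\int_0^1\sqrt{\rho(\dot\gamma(t),\dot\gamma(t))}\,dt$. The associated (left-invariant) sub-Riemannian metric is $d(p,q)=\inf\{\ell(\gamma): \gamma \text{ is } \Delta\text{-horizontal},\ p,q\in\gamma([0,1])\}$. Canonical asymptotic metric: given $(\Delta,\rho)$ with metric $d$, let $V=\{v\in\Delta_e: \rho(v,w)=0 \text{ for every } w\in\Delta_e\cap[\mathfrak g,\mathfrak g]\}$ and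 $\Delta_\infty=\bigcup_{p\in G}dL_p(V)\subseteq\Delta$. Then $d_\infty(p,q)=\inf\{\ell(\gamma):\gamma:[0,1]\to G\text{ is }\Delta_\infty\text{-horizontal},\ p,q\in\gamma([0,1])\}$. *)

theory Defs
  imports "HOL-Analysis.Analysis" "HOL-Library.Function_Algebras"
begin

section \<open>Functionals as a real vector space\<close>

text \<open>Tangent vectors are real-valued functionals on functions; with the pointwise structure on
  function types, the library notions \<^const>\<open>subspace\<close> and \<^const>\<open>span\<close> apply to them.\<close>

instantiation "fun" :: (type, scaleR) scaleR
begin

definition scaleR_fun_def: "c *\<^sub>R f = (\<lambda>x. c *\<^sub>R f x)"

instance ..

end

lemma scaleR_fun_apply [simp]: "(c *\<^sub>R f) x = c *\<^sub>R f x"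
  by (simp add: scaleR_fun_def)

instance "fun" :: (type, real_vector) real_vector
  by standard (simp_all add: fun_eq_iff scaleR_add_right scaleR_add_left)


section \<open>Smooth manifolds\<close>

text \<open>\<open>Ck_on\<close> and \<open>smooth_on\<close> are meant for open sets \<open>S\<close> only, since the derivatives are
  two-sided. The derivative of order \<open>k\<close> is controlled through all its directional evaluations,
  which is equivalent to \<open>C\<^sup>k\<close> in finite dimension.\<close>

primrec Ck_on :: "nat \<Rightarrow> 'a::real_normed_vector set \<Rightarrow> ('a \<Rightarrow> 'b::real_normed_vector) \<Rightarrow> bool" where
  "Ck_on 0 S f \<longleftrightarrow> continuous_on S f"
| "Ck_on (Suc k) S f \<longleftrightarrow>
     (\<forall>x\<in>S. f differentiable (at x)) \<and> (\<forall>v. Ck_on k S (\<lambda>x. frechet_derivative f (at x) v))"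

definition smooth_on :: "'a::real_normed_vector set \<Rightarrow> ('a \<Rightarrow> 'b::real_normed_vector) \<Rightarrow> bool" where
  "smooth_on S f \<longleftrightarrow> (\<forall>k. Ck_on k S f)"

text \<open>A chart is a pair of its domain and its coordinate map. Atlases need not be maximal.\<close>

type_synonym ('g, 'e) atlas = "('g set \<times> ('g \<Rightarrow> 'e)) set"

definition smooth_atlas :: "('g::topological_space, 'e::euclidean_space) atlas \<Rightarrow> bool" where
  "smooth_atlas A \<longleftrightarrow>
     \<Union> (fst ` A) = UNIV \<and>
     (\<forall>(U, \<phi>)\<in>A. open U \<and> open (\<phi> ` U) \<and> homeomorphism U (\<phi> ` U) \<phi> (inv_into U \<phi>)) \<and>
     (\<forall>(U, \<phi>)\<in>A. \<forall>(V, \<psi>)\<in>A. smooth_on (\<phi> ` (U \<inter> V)) (\<psi> \<circ> inv_into U \<phi>))"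

definition smooth_near ::
    "('g::topological_space, 'e::euclidean_space) atlas \<Rightarrow> 'g \<Rightarrow> ('g \<Rightarrow> real) \<Rightarrow> bool" where
  "smooth_near A p f \<longleftrightarrow>
     (\<exists>(U, \<phi>)\<in>A. \<exists>W. open W \<and> p \<in> W \<and> W \<subseteq> U \<and> smooth_on (\<phi> ` W) (f \<circ> inv_into U \<phi>))"

text \<open>Tangent vectors at \<open>p\<close> are the derivations at \<open>p\<close> of the functions smooth near \<open>p\<close>. Such a
  derivation depends only on the germ of its argument at \<open>p\<close>, by the product rule. The value \<open>0\<close>
  on all other functions is a convention, making equality of functionals the right one.\<close>

type_synonym 'g tangent = "('g \<Rightarrow> real) \<Rightarrow> real"

definition tangent_space ::
    "('g::topological_space, 'e::euclidean_space) atlas \<Rightarrow> 'g \<Rightarrow> 'g tangent set" where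
  "tangent_space A p = {X.
     (\<forall>f g. smooth_near A p f \<and> smooth_near A p g \<longrightarrow>
        X (\<lambda>q. f q + g q) = X f + X g \<and>
        X (\<lambda>q. f q * g q) = f p * X g + g p * X f) \<and>
     (\<forall>c f. smooth_near A p f \<longrightarrow> X (\<lambda>q. c * f q) = c * X f) \<and>
     (\<forall>f. \<not> smooth_near A p f \<longrightarrow> X f = 0)}"

text \<open>Lie bracket of vector fields, \<open>[X, Y] f = X (Y f) - Y (X f)\<close>, evaluated at \<open>p\<close>.\<close>

definition field_bracket ::
    "('g::topological_space, 'e::euclidean_space) atlas \<Rightarrow>
      ('g \<Rightarrow> 'g tangent) \<Rightarrow> ('g \<Rightarrow> 'g tangent) \<Rightarrow> 'g \<Rightarrow> 'g tangent" where
  "field_bracket A X Y p =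
     (\<lambda>f. if smooth_near A p f then X p (\<lambda>q. Y q f) - Y p (\<lambda>q. X q f) else 0)"


section \<open>Lie groups\<close>

text \<open>The group is written additively, following the class \<^class>\<open>topological_group_add\<close>, which does
  not assume commutativity: \<open>p + q\<close> is the product, \<open>- p\<close> the inverse and \<open>0\<close> the identity element.\<close>

definition lie_group ::
    "('g::{topological_group_add, t2_space, second_countable_topology}, 'e::euclidean_space) atlas
      \<Rightarrow> bool" where
  "lie_group A \<longleftrightarrow>
     smooth_atlas A \<and>
     (\<forall>(U, \<phi>)\<in>A. \<forall>(V, \<psi>)\<in>A. \<forall>(W, \<theta>)\<in>A.
        smooth_on ((\<lambda>(p, q). (\<phi> p, \<psi> q)) ` {(p, q). p \<in> U \<and> q \<in> V \<and> p + q \<in> W})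
          (\<lambda>(x, y). \<theta> (inv_into U \<phi> x + inv_into V \<psi> y))) \<and>
     (\<forall>(U, \<phi>)\<in>A. \<forall>(V, \<psi>)\<in>A.
        smooth_on (\<phi> ` {p \<in> U. - p \<in> V}) (\<lambda>x. \<psi> (- inv_into U \<phi> x)))"

text \<open>The differential of left translation by \<open>p\<close>.\<close>

definition dL :: "'g::group_add \<Rightarrow> 'g tangent \<Rightarrow> 'g tangent" where
  "dL p X = (\<lambda>f. X (\<lambda>q. f (p + q)))"

definition lie_algebra ::
    "('g::{topological_space, group_add}, 'e::euclidean_space) atlas \<Rightarrow> 'g tangent set" where
  "lie_algebra A = tangent_space A 0"

text \<open>Bracket of the left-invariant vector fields extending \<open>u\<close> and \<open>v\<close>.\<close>

definition lie_bracket ::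
    "('g::{topological_space, group_add}, 'e::euclidean_space) atlas \<Rightarrow>
      'g tangent \<Rightarrow> 'g tangent \<Rightarrow> 'g tangent" where
  "lie_bracket A u v = field_bracket A (\<lambda>p. dL p u) (\<lambda>p. dL p v) 0"

definition bracket_span ::
    "('g::{topological_space, group_add}, 'e::euclidean_space) atlas \<Rightarrow>
      'g tangent set \<Rightarrow> 'g tangent set \<Rightarrow> 'g tangent set" where
  "bracket_span A S T = span {lie_bracket A u v | u v. u \<in> S \<and> v \<in> T}"

definition derived_algebra ::
    "('g::{topological_space, group_add}, 'e::euclidean_space) atlas \<Rightarrow> 'g tangent set" where
  "derived_algebra A = bracket_span A (lie_algebra A) (lie_algebra A)"

definition two_step_nilpotent ::
    "('g::{topological_space, group_add}, 'e::euclidean_space) atlas \<Rightarrow> bool" where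
  "two_step_nilpotent A \<longleftrightarrow>
     bracket_span A (lie_algebra A) (derived_algebra A) = {0} \<and> derived_algebra A \<noteq> {0}"

definition lie_subalgebra ::
    "('g::{topological_space, group_add}, 'e::euclidean_space) atlas \<Rightarrow> 'g tangent set \<Rightarrow> bool" where
  "lie_subalgebra A H \<longleftrightarrow>
     subspace H \<and> H \<subseteq> lie_algebra A \<and> (\<forall>u\<in>H. \<forall>v\<in>H. lie_bracket A u v \<in> H)"


section \<open>Left-invariant sub-Riemannian structures\<close>

definition inner_product_on :: "'v::real_vector set \<Rightarrow> ('v \<Rightarrow> 'v \<Rightarrow> real) \<Rightarrow> bool" where
  "inner_product_on S r \<longleftrightarrow>
     (\<forall>u\<in>S. \<forall>v\<in>S. \<forall>w\<in>S. r (u + v) w = r u w + r v w) \<and>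
     (\<forall>c. \<forall>u\<in>S. \<forall>v\<in>S. r (c *\<^sub>R u) v = c * r u v) \<and>
     (\<forall>u\<in>S. \<forall>v\<in>S. r u v = r v u) \<and>
     (\<forall>u\<in>S. u \<noteq> 0 \<longrightarrow> r u u > 0)"

text \<open>\<open>\<Delta> p\<close> is the fibre at \<open>p\<close> of the subbundle, and \<open>\<rho> p\<close> the inner product on that fibre.
  Smoothness of both in \<open>p\<close> is a consequence of left-invariance.\<close>

definition subriemannian_structure ::
    "('g::{topological_space, group_add}, 'e::euclidean_space) atlas \<Rightarrow>
      ('g \<Rightarrow> 'g tangent set) \<Rightarrow> ('g \<Rightarrow> 'g tangent \<Rightarrow> 'g tangent \<Rightarrow> real) \<Rightarrow> bool" where
  "subriemannian_structure A \<Delta> \<rho> \<longleftrightarrow>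
     (\<forall>p. subspace (\<Delta> p) \<and> \<Delta> p \<subseteq> tangent_space A p) \<and>
     (\<forall>p q. \<Delta> (p + q) = dL p ` \<Delta> q) \<and>
     lie_subalgebra A hull \<Delta> 0 = lie_algebra A \<and>
     (\<forall>p. inner_product_on (\<Delta> p) (\<rho> p)) \<and>
     (\<forall>p q. \<forall>u\<in>\<Delta> q. \<forall>v\<in>\<Delta> q. \<rho> (p + q) (dL p u) (dL p v) = \<rho> q u v)"

definition abs_continuous_on :: "real set \<Rightarrow> (real \<Rightarrow> 'b::real_normed_vector) \<Rightarrow> bool" where
  "abs_continuous_on S f \<longleftrightarrow>
     (\<forall>\<epsilon>>0. \<exists>\<delta>>0. \<forall>D. D division_of \<Union>D \<and> \<Union>D \<subseteq> S \<and> (\<Sum>k\<in>D. Sup k - Inf k) < \<delta> \<longrightarrow>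
        (\<Sum>k\<in>D. norm (f (Sup k) - f (Inf k))) < \<epsilon>)"

text \<open>Curves are parametrised by \<open>[0, 1]\<close>; their values elsewhere are irrelevant.\<close>

definition abs_continuous_curve ::
    "('g::topological_space, 'e::euclidean_space) atlas \<Rightarrow> (real \<Rightarrow> 'g) \<Rightarrow> bool" where
  "abs_continuous_curve A \<gamma> \<longleftrightarrow>
     continuous_on {0..1} \<gamma> \<and>
     (\<forall>(U, \<phi>)\<in>A. \<forall>a b. {a..b} \<subseteq> {0..1} \<and> \<gamma> ` {a..b} \<subseteq> U \<longrightarrow> abs_continuous_on {a..b} (\<phi> \<circ> \<gamma>))"

definition has_velocity ::
    "('g::topological_space, 'e::euclidean_space) atlas \<Rightarrow>
      (real \<Rightarrow> 'g) \<Rightarrow> 'g tangent \<Rightarrow> real \<Rightarrow> bool" where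
  "has_velocity A \<gamma> X t \<longleftrightarrow>
     X \<in> tangent_space A (\<gamma> t) \<and>
     (\<forall>f. smooth_near A (\<gamma> t) f \<longrightarrow>
        ((\<lambda>s. f (\<gamma> s)) has_real_derivative X f) (at t within {0..1}))"

definition velocity ::
    "('g::topological_space, 'e::euclidean_space) atlas \<Rightarrow> (real \<Rightarrow> 'g) \<Rightarrow> real \<Rightarrow> 'g tangent" where
  "velocity A \<gamma> t = (THE X. has_velocity A \<gamma> X t)"

definition horizontal_curve ::
    "('g::topological_space, 'e::euclidean_space) atlas \<Rightarrow>
      ('g \<Rightarrow> 'g tangent set) \<Rightarrow> (real \<Rightarrow> 'g) \<Rightarrow> bool" where
  "horizontal_curve A \<Delta> \<gamma> \<longleftrightarrow>
     abs_continuous_curve A \<gamma> \<and>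
     (AE t in lebesgue_on {0..1}. \<exists>X\<in>\<Delta> (\<gamma> t). has_velocity A \<gamma> X t)"

definition curve_length ::
    "('g::topological_space, 'e::euclidean_space) atlas \<Rightarrow>
      ('g \<Rightarrow> 'g tangent \<Rightarrow> 'g tangent \<Rightarrow> real) \<Rightarrow> (real \<Rightarrow> 'g) \<Rightarrow> real" where
  "curve_length A \<rho> \<gamma> =
     (LINT t|lebesgue_on {0..1}. sqrt (\<rho> (\<gamma> t) (velocity A \<gamma> t) (velocity A \<gamma> t)))"

text \<open>The infimum is taken in the extended reals, so that it is \<open>\<infinity>\<close> if no horizontal curve passes
  through both points.\<close>

definition cc_dist ::
    "('g::topological_space, 'e::euclidean_space) atlas \<Rightarrow>
      ('g \<Rightarrow> 'g tangent set) \<Rightarrow> ('g \<Rightarrow> 'g tangent \<Rightarrow> 'g tangent \<Rightarrow> real) \<Rightarrow> 'g \<Rightarrow> 'g \<Rightarrow> ereal" where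
  "cc_dist A \<Delta> \<rho> p q =
     (INF \<gamma>\<in>{\<gamma>. horizontal_curve A \<Delta> \<gamma> \<and> p \<in> \<gamma> ` {0..1} \<and> q \<in> \<gamma> ` {0..1}}.
        ereal (curve_length A \<rho> \<gamma>))"

definition asymptotic_distribution ::
    "('g::{topological_space, group_add}, 'e::euclidean_space) atlas \<Rightarrow>
      ('g \<Rightarrow> 'g tangent set) \<Rightarrow> ('g \<Rightarrow> 'g tangent \<Rightarrow> 'g tangent \<Rightarrow> real) \<Rightarrow> 'g \<Rightarrow> 'g tangent set" where
  "asymptotic_distribution A \<Delta> \<rho> p =
     dL p ` {v \<in> \<Delta> 0. \<forall>w \<in> \<Delta> 0 \<inter> derived_algebra A. \<rho> 0 v w = 0}"

definition asymptotic_dist ::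
    "('g::{topological_space, group_add}, 'e::euclidean_space) atlas \<Rightarrow>
      ('g \<Rightarrow> 'g tangent set) \<Rightarrow> ('g \<Rightarrow> 'g tangent \<Rightarrow> 'g tangent \<Rightarrow> real) \<Rightarrow> 'g \<Rightarrow> 'g \<Rightarrow> ereal" where
  "asymptotic_dist A \<Delta> \<rho> = cc_dist A (asymptotic_distribution A \<Delta> \<rho>) \<rho>"

end

theory Submission
  imports Defs
begin

text \<open>
  The group law of a two-step nilpotent group is \<open>x + y + B x y / 2\<close> in exponential coordinates, so a curve
  with horizontal left velocity \<open>c\<close> is determined by the indefinite integral \<open>C\<close> of
  \<open>c\<close> and the area \<open>\<integral> B C c / 2\<close> swept out by it, which is a vector in the derived
  algebra \<open>Z\<close>. Let \<open>V\<close> be the orthogonal complement of \<open>\<Delta> \<inter> Z\<close> in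
  the distribution \<open>\<Delta>\<close>. Every curve that is horizontal for \<open>V\<close> is horizontal for
  \<open>\<Delta>\<close>, so the original distance is at most the asymptotic one.

  For the converse bound, project the velocity of a horizontal curve of length \<open>M\<close> orthogonally to
  \<open>V\<close>. The curve does not become longer, and since the dropped part is central, the new curve misses the
  old endpoint by a vector of \<open>Z\<close> of norm at most a multiple of \<open>M\<close>. This error is an area
  that has to be added to a \<open>V\<close>-horizontal curve of length at most \<open>M\<close>, at a cost in length
  that does not depend on \<open>M\<close> (\<open>central_shift\<close>). A single large loop would cost about
  \<open>sqrt M\<close>. Instead, small loops of several frequencies are distributed along the whole curve,
  proportionally to its speed, with amplitudes chosen such that length and area do not change to first order
  (\<open>area_shift_nonpos\<close>). The added area is quadratic in the amplitudes, which therefore have order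
  \<open>sqrt M\<close>, and the increase in length is of second order: amplitude squared over \<open>M\<close>, a
  constant. This gives \<open>horizontal_replacement\<close>.

  The remaining work connects this computation with the abstract group: the Lie bracket in a chart at the identity
  (\<open>lie_bracket_T\<close>), the exponential map with its product formula (\<open>Exp_add\<close>), which is onto
  by connectedness (\<open>Exp_surj\<close>), and the correspondence between absolutely continuous curves and integrable
  controls (\<open>abs_continuous_curve_lifts\<close>, \<open>lifts_control\<close>,
  \<open>Exp_indefinite_integral_abs_continuous\<close>). Finiteness of both distances follows from surjectivity and
  \<open>reachable\<close>.
\<close>

section \<open>Absolutely continuous curves and indefinite integrals\<close>

lemma abs_continuous_on_subset:
  assumes "abs_continuous_on S f" "T \<subseteq> S"
  shows "abs_continuous_on T f"
  using assms unfolding abs_continuous_on_def by (meson subset_trans)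

text \<open>The exceptional set \<open>N\<close> is covered by an open set of small measure. In a fine tagged division the
  intervals tagged in \<open>N\<close> have small total length, so absolute continuity bounds the increments of
  \<open>f\<close> over them; on all other intervals the increment is close to the derivative times the length, by
  differentiability at the tag.\<close>

lemma abs_continuous_imp_has_integral:
  fixes f :: "real \<Rightarrow> 'b::euclidean_space"
  assumes ac: "abs_continuous_on {a..b} f" and "a \<le> b" and N: "negligible N"
    and der: "\<And>t. t \<in> {a..b} - N \<Longrightarrow> (f has_vector_derivative g t) (at t within {a..b})"
  shows "(g has_integral (f b - f a)) {a..b}"
proof -
  define g0 where "g0 t = (if t \<in> N then 0 else g t)" for t
  have "(g0 has_integral (f b - f a)) {a..b}"
    unfolding has_integral_real
  proof (intro allI impI)
    fix e :: real assume "e > 0"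
    obtain \<delta> where \<delta>: "\<delta> > 0" and
      ac': "\<And>D. D division_of \<Union>D \<Longrightarrow> \<Union>D \<subseteq> {a..b} \<Longrightarrow> (\<Sum>k\<in>D. Sup k - Inf k) < \<delta> \<Longrightarrow>
        (\<Sum>k\<in>D. norm (f (Sup k) - f (Inf k))) < e/2"
      using ac \<open>e > 0\<close> unfolding abs_continuous_on_def by (meson half_gt_zero)
    obtain T where T: "open T" "N \<subseteq> T" "T - N \<in> lmeasurable" "emeasure lebesgue (T - N) < ennreal \<delta>"
      using sets_lebesgue_outer_open[OF _ \<delta>, of N] N negligible_imp_sets by blast
    have Tm: "T \<in> lmeasurable" "measure lebesgue T < \<delta>"
    proof -
      have "T = (T - N) \<union> N" using T by blast
      then show Tl: "T \<in> lmeasurable"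
        using fmeasurable.Un[OF T(3) negligible_imp_measurable[OF N]] by simp
      have "measure lebesgue T = measure lebesgue (T - N)"
        using N Tl by (simp add: measure_Diff_null_set negligible_iff_null_sets fmeasurableD)
      also have "\<dots> < \<delta>"
        using T(3,4) \<delta> by (simp add: emeasure_eq_measure2 ennreal_less_iff)
      finally show "measure lebesgue T < \<delta>" .
    qed
    define e' where "e' = e / (4 * (b - a + 1))"
    have "e' > 0" using \<open>e > 0\<close> \<open>a \<le> b\<close> by (simp add: e'_def)
    have "\<exists>d>0. t \<in> {a..b} - N \<longrightarrow>
         (\<forall>y\<in>{a..b}. norm (y-t) < d \<longrightarrow> norm (f y - f t - (y-t) *\<^sub>R g t) \<le> e' * norm (y-t))" for t
      using der[of t, unfolded has_vector_derivative_def has_derivative_within_alt] \<open>e' > 0\<close>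
      by (cases "t \<in> {a..b} - N") (auto intro: zero_less_one)
    then obtain d where d: "\<And>t. 0 < d t"
      "\<And>t y. \<lbrakk>t \<in> {a..b} - N; y \<in> {a..b}; norm (y-t) < d t\<rbrakk>
         \<Longrightarrow> norm (f y - f t - (y-t) *\<^sub>R g t) \<le> e' * norm (y-t)"
      by metis
    define \<gamma> where "\<gamma> t = (if t \<in> N then T else ball t (d t))" for t
    have "gauge \<gamma>"
      unfolding gauge_def \<gamma>_def using T d by auto
    moreover have "norm ((\<Sum>(x,K)\<in>p. measure lborel K *\<^sub>R g0 x) - (f b - f a)) < e"
      if p: "p tagged_division_of {a..b}" and fine: "\<gamma> fine p" for p
    proof -
      have finp: "finite p" using p by blast
      have ba: "b - a = (\<Sum>(x,K)\<in>p. Sup K - Inf K)" "f b - f a = (\<Sum>(x,K)\<in>p. f(Sup K) - f(Inf K))"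
        using additive_tagged_division_1[where f= "\<lambda>x. x"] additive_tagged_division_1[where f= f]
            \<open>a \<le> b\<close> p by auto
      define q where "q = {(x,K)\<in>p. x \<in> N}"
      define r where "r = {(x,K)\<in>p. x \<notin> N}"
      have pqr: "p = q \<union> r" "q \<inter> r = {}" "finite q" "finite r"
        using finp unfolding q_def r_def by (auto intro: finite_subset[of _ p])
      have int: "\<exists>u v. K = {u..v} \<and> u \<le> v \<and> x \<in> {u..v} \<and> u \<in> {a..b} \<and> v \<in> {a..b}" if "(x,K) \<in> p" for x K
      proof -
        have "x \<in> K" "K \<subseteq> {a..b}" "\<exists>u v. K = cbox u v" using p that by blast+
        then show ?thesis by (auto simp: box_real)
      qed
      have qpart: "q tagged_partial_division_of {a..b}"
        using p unfolding tagged_division_of_def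
        by (rule_tac tagged_partial_division_subset[of p]) (auto simp: q_def)
      define D where "D = snd ` q"
      have Ddiv: "D division_of \<Union>D"
        unfolding D_def by (rule partial_division_of_tagged_division[OF qpart])
      have DT: "\<Union>D \<subseteq> T \<inter> {a..b}"
      proof -
        have "K \<subseteq> T" if "(x,K) \<in> q" for x K
          using fine that unfolding fine_def q_def \<gamma>_def by force
        moreover have "K \<subseteq> {a..b}" if "(x,K) \<in> q" for x K
          using tagged_partial_division_ofD(3)[OF qpart that] .
        ultimately show ?thesis unfolding D_def by fastforce
      qed
      have Dint: "\<exists>u v. K = {u..v} \<and> u \<le> v" if "K \<in> D" for K
        using int that unfolding D_def q_def by fastforce
      have "(\<Sum>k\<in>D. Sup k - Inf k) = (\<Sum>k\<in>D. measure lebesgue k)"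
        proof (intro sum.cong refl)
          fix k assume "k \<in> D"
          with Dint obtain u v where "k = {u..v}" "u \<le> v" by blast
          then show "Sup k - Inf k = measure lebesgue k" by simp
        qed
      also have "\<dots> = measure lebesgue (\<Union>D)"
        using content_division[OF Ddiv] by auto
      also have "\<dots> \<le> measure lebesgue T"
        using DT Tm Ddiv by (intro measure_mono_fmeasurable) (auto dest!: lmeasurable_division)
      finally have "(\<Sum>k\<in>D. Sup k - Inf k) < \<delta>" using Tm by simp
      then have "(\<Sum>k\<in>D. norm (f (Sup k) - f (Inf k))) < e/2"
        using ac'[OF Ddiv] DT by blast
      moreover have "(\<Sum>(x,K)\<in>q. norm (f (Sup K) - f (Inf K))) = (\<Sum>k\<in>D. norm (f (Sup k) - f (Inf k)))"
      proof -
        define h where "h K = (if K = {} then 0 else norm (f (Sup K) - f (Inf K)))" for K :: "real set"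
        have ne: "K \<noteq> {}" if "(x,K) \<in> q" for x K
          using tagged_partial_division_ofD(2)[OF qpart that] by blast
        have deg: "h (cbox u v) = 0" if "box u v = {}" for u v
          using that by (cases "u = v") (auto simp: h_def)
        have "(\<Sum>(x,K)\<in>q. h K) = (\<Sum>k\<in>D. h k)"
          unfolding D_def
          by (rule sum.over_tagged_division_lemma[OF tagged_partial_division_of_Union_self[OF qpart]]) (rule deg)
        moreover have "(\<Sum>(x,K)\<in>q. h K) = (\<Sum>(x,K)\<in>q. norm (f (Sup K) - f (Inf K)))"
          by (rule sum.cong) (auto simp: h_def dest: ne)
        moreover have "(\<Sum>k\<in>D. h k) = (\<Sum>k\<in>D. norm (f (Sup k) - f (Inf k)))"
          by (rule sum.cong) (auto simp: h_def D_def dest: ne)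
        ultimately show ?thesis by simp
      qed
      ultimately have 1: "(\<Sum>(x,K)\<in>q. norm (f (Sup K) - f (Inf K))) < e/2" by simp
      have 2: "(\<Sum>(x,K)\<in>r. norm (measure lborel K *\<^sub>R g0 x - (f(Sup K) - f(Inf K)))) \<le> (\<Sum>(x,K)\<in>r. 2 * e' * (Sup K - Inf K))"
      proof (rule sum_mono, clarify)
        fix x K assume xK: "(x,K) \<in> r"
        then have xp: "(x,K) \<in> p" and xN: "x \<notin> N" by (auto simp: r_def)
        then obtain u v where uv: "K = {u..v}" "u \<le> v" "x \<in> {u..v}" "u \<in> {a..b}" "v \<in> {a..b}"
          using int by blast
        have sub: "K \<subseteq> ball x (d x)" using fine xp xN unfolding fine_def \<gamma>_def by force
        moreover have "u \<in> K" "v \<in> K" using uv by auto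
        ultimately have "norm (u - x) < d x" "norm (v - x) < d x"
          by (auto simp: subset_iff dist_norm norm_minus_commute)
        then have A: "norm (f u - f x - (u-x) *\<^sub>R g x) \<le> e' * norm (u-x)"
          "norm (f v - f x - (v-x) *\<^sub>R g x) \<le> e' * norm (v-x)"
          using d(2)[of x u] d(2)[of x v] uv xN by auto
        have "measure lborel K *\<^sub>R g0 x - (f(Sup K) - f(Inf K))
             = (f u - f x - (u-x) *\<^sub>R g x) - (f v - f x - (v-x) *\<^sub>R g x)"
          using uv xN by (simp add: g0_def algebra_simps)
        also have "norm \<dots> \<le> e' * norm (u-x) + e' * norm (v-x)"
          using A by (meson add_mono norm_triangle_ineq4 order_trans)
        also have "\<dots> \<le> e' * (v-u) + e' * (v - u)"
          using uv \<open>e' > 0\<close> by (intro add_mono mult_left_mono) auto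
        finally show "norm (measure lborel K *\<^sub>R g0 x - (f(Sup K) - f(Inf K))) \<le> 2 * e' * (Sup K - Inf K)"
          using uv by simp
      qed
      also have "\<dots> \<le> (\<Sum>(x,K)\<in>p. 2 * e' * (Sup K - Inf K))"
      proof (rule sum_mono2[OF finp])
        show "r \<subseteq> p" using pqr by blast
        fix z assume "z \<in> p - r"
        then obtain x K where "z = (x,K)" "(x,K) \<in> p" by (cases z) auto
        then show "0 \<le> (case z of (x,K) \<Rightarrow> 2 * e' * (Sup K - Inf K))"
          using int[of x K] \<open>e' > 0\<close> by auto
      qed
      also have "\<dots> = 2 * e' * (b - a)"
        unfolding ba by (simp add: sum_distrib_left case_prod_unfold)
      also have "\<dots> \<le> e/2"
        using \<open>e > 0\<close> \<open>a \<le> b\<close> unfolding e'_def by (simp add: field_simps)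
      finally have 3: "(\<Sum>(x,K)\<in>r. norm (measure lborel K *\<^sub>R g0 x - (f(Sup K) - f(Inf K)))) \<le> e/2" .
      have "(\<Sum>(x,K)\<in>p. measure lborel K *\<^sub>R g0 x) - (f b - f a)
          = (\<Sum>(x,K)\<in>p. measure lborel K *\<^sub>R g0 x - (f(Sup K) - f(Inf K)))"
        unfolding ba by (simp add: sum_subtractf case_prod_unfold)
      also have "\<dots> = (\<Sum>(x,K)\<in>q. measure lborel K *\<^sub>R g0 x - (f(Sup K) - f(Inf K)))
                  + (\<Sum>(x,K)\<in>r. measure lborel K *\<^sub>R g0 x - (f(Sup K) - f(Inf K)))"
        using pqr by (simp add: sum.union_disjoint)
      also have "norm \<dots> \<le> (\<Sum>(x,K)\<in>q. norm (measure lborel K *\<^sub>R g0 x - (f(Sup K) - f(Inf K))))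
                  + (\<Sum>(x,K)\<in>r. norm (measure lborel K *\<^sub>R g0 x - (f(Sup K) - f(Inf K))))"
        by (rule order_trans[OF norm_triangle_ineq add_mono]; rule order_trans[OF norm_sum]; simp add: case_prod_unfold)
      also have "(\<Sum>(x,K)\<in>q. norm (measure lborel K *\<^sub>R g0 x - (f(Sup K) - f(Inf K))))
          = (\<Sum>(x,K)\<in>q. norm (f (Sup K) - f (Inf K)))"
        by (rule sum.cong) (auto simp: q_def g0_def norm_minus_commute)
      finally show ?thesis using 1 3 by linarith
    qed
    ultimately show "\<exists>\<gamma>. gauge \<gamma> \<and> (\<forall>p. p tagged_division_of {a..b} \<and> \<gamma> fine p \<longrightarrow>
        norm ((\<Sum>(x,K)\<in>p. measure lborel K *\<^sub>R g0 x) - (f b - f a)) < e)" by (intro exI[of _ \<gamma>]) simp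
  qed
  then show ?thesis
    using has_integral_spike[OF N, of "{a..b}" g g0] by (auto simp: g0_def)
qed

text \<open>Absolute integrability holds because the variation of \<open>f\<close> over an interval shorter than the
  \<open>\<delta>\<close> that belongs to \<open>\<epsilon> = 1\<close> is at most 1; Bolzano's principle joins finitely
  many such intervals.\<close>

lemma abs_continuous_imp_indefinite_integral:
  fixes f :: "real \<Rightarrow> 'b::euclidean_space"
  assumes ac: "abs_continuous_on {a..b} f" and "a \<le> b" and N: "negligible N"
    and der: "\<And>t. t \<in> {a..b} - N \<Longrightarrow> (f has_vector_derivative g t) (at t within {a..b})"
  shows "g absolutely_integrable_on {a..b}"
    and "\<And>t. t \<in> {a..b} \<Longrightarrow> (g has_integral (f t - f a)) {a..t}"
proof -
  have int: "(g has_integral (f d - f c)) {c..d}" if "a \<le> c" "c \<le> d" "d \<le> b" for c d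
  proof (rule abs_continuous_imp_has_integral[OF _ \<open>c \<le> d\<close> N])
    show "abs_continuous_on {c..d} f"
      using that by (intro abs_continuous_on_subset[OF ac]) auto
    show "(f has_vector_derivative g t) (at t within {c..d})" if "t \<in> {c..d} - N" for t
      using that \<open>a \<le> c\<close> \<open>d \<le> b\<close>
      by (intro has_vector_derivative_within_subset[OF der[of t]]) auto
  qed
  show "(g has_integral (f t - f a)) {a..t}" if "t \<in> {a..b}" for t
    using int[of a t] that by auto
  obtain \<delta> where \<delta>: "\<delta> > 0" and
      ac': "\<And>D. D division_of \<Union>D \<Longrightarrow> \<Union>D \<subseteq> {a..b} \<Longrightarrow> (\<Sum>k\<in>D. Sup k - Inf k) < \<delta> \<Longrightarrow>
        (\<Sum>k\<in>D. norm (f (Sup k) - f (Inf k))) < 1"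
    using ac unfolding abs_continuous_on_def by (meson zero_less_one)
  have loc: "g absolutely_integrable_on {c..d}" if cd: "a \<le> c" "c \<le> d" "d \<le> b" "d - c < \<delta>" for c d
    unfolding box_real[symmetric]
  proof (rule bounded_variation_absolutely_integrable_interval)
    show "g integrable_on cbox c d" using int[OF cd(1-3)] by (auto simp: box_real)
    fix D assume D: "D division_of cbox c d"
    have K: "\<exists>u v. K = {u..v} \<and> u \<le> v \<and> c \<le> u \<and> v \<le> d" if "K \<in> D" for K
    proof -
      have "K \<subseteq> {c..d}" "K \<noteq> {}" "\<exists>u v. K = cbox u v"
        using division_ofD[OF D] that by (auto simp: box_real)
      then show ?thesis by (metis atLeastatMost_empty_iff atLeastatMost_subset_iff box_real(2))
    qed
    have U: "\<Union>D = {c..d}" using D by (auto simp: division_of_def)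
    have "(\<Sum>K\<in>D. norm (integral K g)) = (\<Sum>k\<in>D. norm (f (Sup k) - f (Inf k)))"
    proof (rule sum.cong[OF refl])
      fix k assume "k \<in> D"
      then obtain u v where uv: "k = {u..v}" "u \<le> v" "c \<le> u" "v \<le> d" using K by blast
      then show "norm (integral k g) = norm (f (Sup k) - f (Inf k))"
        using integral_unique[OF int[of u v]] cd by auto
    qed
    also have "\<dots> < 1"
    proof (rule ac')
      show "D division_of \<Union>D" using D U by (simp add: box_real)
      show "\<Union>D \<subseteq> {a..b}" using U cd by auto
      have "(\<Sum>k\<in>D. Sup k - Inf k) = (\<Sum>k\<in>D. measure lborel k)"
      proof (rule sum.cong[OF refl])
        fix k assume "k \<in> D"
        then obtain u v where uv: "k = {u..v}" "u \<le> v" using K by blast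
        then show "Sup k - Inf k = measure lborel k" by auto
      qed
      also have "\<dots> = d - c" using additive_content_division[OF D] cd by (simp add: box_real)
      finally show "(\<Sum>k\<in>D. Sup k - Inf k) < \<delta>" using cd by simp
    qed
    finally show "(\<Sum>K\<in>D. norm (integral K g)) \<le> 1" by simp
  qed
  define P where "P c d \<longleftrightarrow> (a \<le> c \<and> d \<le> b \<longrightarrow> g absolutely_integrable_on {c..d})" for c d
  have "P a b"
    using \<open>a \<le> b\<close>
  proof (induction rule: Bolzano)
    case (trans x y z)
    show ?case
      unfolding P_def
    proof
      assume "a \<le> x \<and> z \<le> b"
      then have "g absolutely_integrable_on {x..y} \<union> {y..z}"
        using trans by (intro set_integrable_Un) (auto simp: P_def)
      moreover have "{x..y} \<union> {y..z} = {x..z}" using trans by auto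
      ultimately show "g absolutely_integrable_on {x..z}" by simp
    qed
  next
    case (local x)
    show ?case
      by (rule exI[of _ \<delta>]) (auto simp: \<delta> P_def intro!: loc)
  qed
  then show "g absolutely_integrable_on {a..b}" by (simp add: P_def)
qed

lemma negligible_uminus_image:
  fixes N :: "real set"
  assumes "negligible N" shows "negligible (uminus ` N)"
  using assms by (intro negligible_differentiable_image_negligible) (auto intro!: derivative_intros)

text \<open>On the line, Lebesgue's theorem for cubes with the point at a corner concerns the derivative from the right.\<close>

lemma one_sided_lebesgue_differentiation:
  fixes h :: "real \<Rightarrow> 'b::euclidean_space"
  assumes "\<And>a b. h integrable_on {a..b}"
  obtains N where "negligible N"
    "\<And>x e. x \<notin> N \<Longrightarrow> 0 < e \<Longrightarrow> \<exists>d>0. \<forall>y. x \<le> y \<and> y < x + d \<longrightarrow>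
        norm (integral {x..y} h - (y - x) *\<^sub>R h x) \<le> e * (y - x)"
proof -
  obtain N where N: "negligible N"
    "\<And>x e. \<lbrakk>x \<notin> N; 0 < e\<rbrakk> \<Longrightarrow> \<exists>d>0. \<forall>r. 0 < r \<and> r < d \<longrightarrow>
        norm (integral (cbox x (x + r *\<^sub>R One)) h /\<^sub>R r ^ DIM(real) - h x) < e"
    using integrable_ccontinuous_explicit[of h] assms by (auto simp: box_real)
  show thesis
  proof (rule that[OF N(1)])
    fix x and e :: real assume "x \<notin> N" "0 < e"
    then obtain d where d: "d > 0" "\<And>r. 0 < r \<and> r < d \<Longrightarrow> norm (integral {x..x + r} h /\<^sub>R r - h x) < e"
      using N(2)[of x e] by (auto simp: box_real)
    show "\<exists>d>0. \<forall>y. x \<le> y \<and> y < x + d \<longrightarrow>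
        norm (integral {x..y} h - (y - x) *\<^sub>R h x) \<le> e * (y - x)"
    proof (intro exI[of _ d] conjI allI impI d(1))
      fix y assume y: "x \<le> y \<and> y < x + d"
      show "norm (integral {x..y} h - (y - x) *\<^sub>R h x) \<le> e * (y - x)"
      proof (cases "y = x")
        case False
        define r where "r = y - x"
        have r: "0 < r" "r < d" "y = x + r" using y False by (auto simp: r_def)
        have "integral {x..y} h - r *\<^sub>R h x = r *\<^sub>R (integral {x..x + r} h /\<^sub>R r - h x)"
          using r by (simp add: algebra_simps)
        then have "norm (integral {x..y} h - r *\<^sub>R h x) = r * norm (integral {x..x + r} h /\<^sub>R r - h x)"
          using r by simp
        also have "\<dots> \<le> r * e" using d(2)[of r] r by (intro mult_left_mono) auto
        finally show ?thesis by (simp add: r_def mult.commute)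
      qed simp
    qed
  qed
qed

text \<open>The derivative from the left is the derivative from the right of the reflected function.\<close>

lemma lebesgue_differentiation:
  fixes g :: "real \<Rightarrow> 'b::euclidean_space"
  assumes g: "g integrable_on {a..b}"
  obtains N where "negligible N"
    "\<And>t. t \<in> {a..b} - N \<Longrightarrow> ((\<lambda>t. integral {a..t} g) has_vector_derivative g t) (at t within {a..b})"
proof -
  define h where "h t = (if t \<in> {a..b} then g t else 0)" for t
  have hU: "h integrable_on UNIV"
    unfolding h_def using g integrable_restrict_UNIV by blast
  have h: "h integrable_on {c..d}" for c d
    using integrable_on_subcbox[OF hU, of c d] by (simp add: box_real)
  have h': "(\<lambda>t. h (- t)) integrable_on {c..d}" for c d
    using Henstock_Kurzweil_Integration.integrable_reflect_real[where f=h and a="-d" and b="-c"] h[of "-d" "-c"] by simp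
  obtain N1 where N1: "negligible N1"
    "\<And>x e. x \<notin> N1 \<Longrightarrow> 0 < e \<Longrightarrow> \<exists>d>0. \<forall>y. x \<le> y \<and> y < x + d \<longrightarrow>
        norm (integral {x..y} h - (y - x) *\<^sub>R h x) \<le> e * (y - x)"
    using one_sided_lebesgue_differentiation[of h] h by blast
  obtain N2 where N2: "negligible N2"
    "\<And>x e. x \<notin> N2 \<Longrightarrow> 0 < e \<Longrightarrow> \<exists>d>0. \<forall>y. x \<le> y \<and> y < x + d \<longrightarrow>
        norm (integral {x..y} (\<lambda>t. h (-t)) - (y - x) *\<^sub>R h (-x)) \<le> e * (y - x)"
    using one_sided_lebesgue_differentiation[of "\<lambda>t. h (-t)"] h' by blast
  show thesis
  proof (rule that[of "N1 \<union> uminus ` N2"])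
    show "negligible (N1 \<union> uminus ` N2)" using N1 N2 negligible_uminus_image by auto
    fix t assume t: "t \<in> {a..b} - (N1 \<union> uminus ` N2)"
    then have tn: "t \<notin> N1" "- t \<notin> N2" by (auto simp: image_iff)
    have gh: "integral {c..d} h = integral {c..d} g" if "{c..d} \<subseteq> {a..b}" for c d
      using that by (intro integral_cong) (auto simp: h_def)
    show "((\<lambda>t. integral {a..t} g) has_vector_derivative g t) (at t within {a..b})"
      unfolding has_vector_derivative_def has_derivative_within_alt
    proof (intro conjI allI impI bounded_linear_scaleR_left)
      fix e :: real assume "e > 0"
      obtain d1 where d1: "d1 > 0" "\<And>y. t \<le> y \<and> y < t + d1 \<Longrightarrow>
          norm (integral {t..y} h - (y - t) *\<^sub>R h t) \<le> e * (y - t)"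
        using N1(2)[OF tn(1) \<open>e > 0\<close>] by blast
      obtain d2 where d2: "d2 > 0" "\<And>y. -t \<le> y \<and> y < -t + d2 \<Longrightarrow>
          norm (integral {-t..y} (\<lambda>t. h (-t)) - (y - (-t)) *\<^sub>R h (-(-t))) \<le> e * (y - (-t))"
        using N2(2)[OF tn(2) \<open>e > 0\<close>] by blast
      show "\<exists>d>0. \<forall>y\<in>{a..b}. norm (y - t) < d \<longrightarrow>
          norm (integral {a..y} g - integral {a..t} g - (y - t) *\<^sub>R g t) \<le> e * norm (y - t)"
      proof (intro exI[of _ "min d1 d2"] conjI ballI impI)
        show "min d1 d2 > 0" using d1 d2 by simp
        fix y assume y: "y \<in> {a..b}" "norm (y - t) < min d1 d2"
        show "norm (integral {a..y} g - integral {a..t} g - (y - t) *\<^sub>R g t) \<le> e * norm (y - t)"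
        proof (cases "t \<le> y")
          case True
          have "integral {a..t} g + integral {t..y} g = integral {a..y} g"
            using True t y by (intro Henstock_Kurzweil_Integration.integral_combine integrable_on_subinterval[OF g]) auto
          then have "integral {a..y} g - integral {a..t} g = integral {t..y} g" by (simp add: algebra_simps)
          then show ?thesis
            using d1(2)[of y] True y t gh[of t y] by (auto simp: h_def)
        next
          case False
          have c: "integral {a..y} g + integral {y..t} g = integral {a..t} g"
            using False t y by (intro Henstock_Kurzweil_Integration.integral_combine integrable_on_subinterval[OF g]) auto
          have r: "integral {-t..-y} (\<lambda>t. h (-t)) = integral {y..t} g"
            using integral_reflect_real[of t y h] gh[of y t] t y by simp
          have "integral {a..y} g - integral {a..t} g - (y - t) *\<^sub>R g t = - (integral {y..t} g - (t - y) *\<^sub>R g t)"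
            by (simp add: c[symmetric] algebra_simps)
          then have "norm (integral {a..y} g - integral {a..t} g - (y - t) *\<^sub>R g t) = norm (integral {y..t} g - (t - y) *\<^sub>R g t)"
            by (metis norm_minus_cancel)
          also have "\<dots> \<le> e * (t - y)"
            using d2(2)[of "-y"] False y t r by (auto simp: h_def)
          finally show ?thesis using False by simp
        qed
      qed
    qed
  qed
qed

text \<open>Truncation of the bounding function \<open>h\<close> at height \<open>n\<close>: the part above \<open>n\<close> has
  small integral by dominated convergence, and the part below contributes at most \<open>n\<close> times the total
  length of the intervals.\<close>

lemma abs_continuous_onI_indefinite_integral:
  fixes f :: "real \<Rightarrow> 'b::real_normed_vector" and h :: "real \<Rightarrow> real"
  assumes h: "h absolutely_integrable_on {a..b}" and h0: "\<And>t. t \<in> {a..b} \<Longrightarrow> h t \<ge> 0"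
    and le: "\<And>x y. a \<le> x \<Longrightarrow> x \<le> y \<Longrightarrow> y \<le> b \<Longrightarrow> norm (f y - f x) \<le> integral {x..y} h"
  shows "abs_continuous_on {a..b} f"
  unfolding abs_continuous_on_def
proof (intro allI impI)
  fix e :: real assume "e > 0"
  define m where "m k t = max (h t - real k) 0" for k :: nat and t
  have hi: "h integrable_on {a..b}" using h set_lebesgue_integral_eq_integral(1) by blast
  have mi: "m k integrable_on {a..b}" for k
  proof -
    have "(\<lambda>t. h t - real k) absolutely_integrable_on {a..b}"
      by (rule set_integral_diff(1)[OF h]) (simp add: absolutely_integrable_on_const)
    then have "(\<lambda>t. max (h t - real k) 0) absolutely_integrable_on {a..b}"
      by (rule absolutely_integrable_max_1) (simp add: absolutely_integrable_on_const)
    then show ?thesis unfolding m_def using set_lebesgue_integral_eq_integral(1) by blast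
  qed
  have "(\<lambda>k. integral {a..b} (m k)) \<longlonglongrightarrow> integral {a..b} (\<lambda>t. 0)"
  proof (rule dominated_convergence(2)[OF mi hi])
    show "norm (m k t) \<le> h t" if "t \<in> {a..b}" for k t
      using h0[OF that] by (auto simp: m_def)
    show "(\<lambda>k. m k t) \<longlonglongrightarrow> 0" for t
    proof -
      have "eventually (\<lambda>k. m k t = 0) sequentially"
        using eventually_ge_at_top[of "nat \<lceil>h t\<rceil>"] by eventually_elim (auto simp: m_def)
      then show ?thesis by (simp add: tendsto_eventually)
    qed
  qed
  then have "eventually (\<lambda>k. integral {a..b} (m k) < e/2) sequentially"
    using \<open>e > 0\<close> by (intro order_tendstoD(2)[of _ "0"]) auto
  then obtain n where n: "integral {a..b} (m n) < e/2"
    using eventually_happens by fastforce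
  show "\<exists>\<delta>>0. \<forall>D. D division_of \<Union>D \<and> \<Union>D \<subseteq> {a..b} \<and> (\<Sum>k\<in>D. Sup k - Inf k) < \<delta> \<longrightarrow>
        (\<Sum>k\<in>D. norm (f (Sup k) - f (Inf k))) < e"
  proof (intro exI[of _ "e / (2 * (real n + 1))"] conjI allI impI)
    show "0 < e / (2 * (real n + 1))" using \<open>e > 0\<close> by simp
    fix D assume D: "D division_of \<Union>D \<and> \<Union>D \<subseteq> {a..b} \<and> (\<Sum>k\<in>D. Sup k - Inf k) < e / (2 * (real n + 1))"
    have K: "\<exists>u v. K = {u..v} \<and> u \<le> v \<and> a \<le> u \<and> v \<le> b" if "K \<in> D" for K
    proof -
      have "K \<subseteq> {a..b}" "K \<noteq> {}" "\<exists>u v. K = cbox u v"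
        using D that by (auto simp: division_of_def)
      then show ?thesis by (metis atLeastatMost_empty_iff atLeastatMost_subset_iff box_real(2))
    qed
    have mU: "m n integrable_on \<Union>D"
      using integrable_on_subdivision[of D "\<Union>D" "m n" "{a..b}"] D mi by auto
    have "(\<Sum>k\<in>D. norm (f (Sup k) - f (Inf k))) \<le> (\<Sum>k\<in>D. integral k (m n) + real n * (Sup k - Inf k))"
    proof (rule sum_mono)
      fix k assume "k \<in> D"
      then obtain u v where uv: "k = {u..v}" "u \<le> v" "a \<le> u" "v \<le> b" using K by blast
      have i: "h integrable_on {u..v}" "m n integrable_on {u..v}"
        using uv by (auto intro: integrable_on_subinterval[OF hi] integrable_on_subinterval[OF mi])
      have "norm (f (Sup k) - f (Inf k)) \<le> integral {u..v} h" using le[of u v] uv by simp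
      also have "\<dots> \<le> integral {u..v} (\<lambda>t. m n t + real n)"
        by (intro integral_le integrable_add i integrable_const_ivl) (auto simp: m_def)
      also have "\<dots> = integral k (m n) + real n * (Sup k - Inf k)"
        using i uv by (subst Henstock_Kurzweil_Integration.integral_add) auto
      finally show "norm (f (Sup k) - f (Inf k)) \<le> integral k (m n) + real n * (Sup k - Inf k)" .
    qed
    also have "\<dots> = integral (\<Union>D) (m n) + real n * (\<Sum>k\<in>D. Sup k - Inf k)"
      using integral_combine_division_topdown[OF mU, of D] D by (simp add: sum.distrib sum_distrib_left)
    also have "\<dots> \<le> integral {a..b} (m n) + real n * (e / (2 * (real n + 1)))"
      using D mU mi by (intro add_mono integral_subset_le mult_left_mono) (auto simp: m_def)
    also have "\<dots> < e/2 + e/2"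
      using n \<open>e > 0\<close> by (intro add_less_le_mono) (auto simp: field_simps)
    finally show "(\<Sum>k\<in>D. norm (f (Sup k) - f (Inf k))) < e" by simp
  qed
qed

lemma absolutely_integrable_bilinear_continuous:
  fixes f :: "real \<Rightarrow> 'a::euclidean_space" and g :: "real \<Rightarrow> 'b::euclidean_space"
    and h :: "'a \<Rightarrow> 'b \<Rightarrow> 'c::euclidean_space"
  assumes h: "bounded_bilinear h" and f: "continuous_on {a..b} f" and g: "g absolutely_integrable_on {a..b}"
  shows "(\<lambda>t. h (f t) (g t)) absolutely_integrable_on {a..b}"
proof (rule absolutely_integrable_bounded_measurable_product[where h=h and f=f, OF _ _ _ _ g])
  show "bilinear h" using h by (simp add: bilinear_conv_bounded_bilinear)
  show "f \<in> borel_measurable (lebesgue_on {a..b})"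
    by (rule continuous_imp_measurable_on_sets_lebesgue[OF f]) simp
  show "bounded (f ` {a..b})"
    using f by (intro compact_imp_bounded compact_continuous_image) auto
qed simp

lemma absolutely_integrable_bilinear_continuous':
  fixes f :: "real \<Rightarrow> 'a::euclidean_space" and g :: "real \<Rightarrow> 'b::euclidean_space"
    and h :: "'b \<Rightarrow> 'a \<Rightarrow> 'c::euclidean_space"
  assumes h: "bounded_bilinear h" and f: "continuous_on {a..b} f" and g: "g absolutely_integrable_on {a..b}"
  shows "(\<lambda>t. h (g t) (f t)) absolutely_integrable_on {a..b}"
  using absolutely_integrable_bilinear_continuous[OF bounded_bilinear.flip[OF h] f g] .

lemma indefinite_integral_continuous_on:
  fixes g :: "real \<Rightarrow> 'b::euclidean_space"
  assumes "g absolutely_integrable_on {a..b}"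
  shows "continuous_on {a..b} (\<lambda>t. integral {a..t} g)"
  using assms set_lebesgue_integral_eq_integral(1) by (intro indefinite_integral_continuous_1) blast

text \<open>The change of parameter \<open>\<sigma>\<close> is merely absolutely continuous. Since \<open>H\<close> is Lipschitz,
  \<open>H \<circ> \<sigma>\<close> is absolutely continuous as well, and the chain rule holds wherever
  \<open>\<sigma>\<close> is differentiable.\<close>

lemma has_integral_substitution_indefinite_integral:
  fixes s :: "real \<Rightarrow> real" and H h :: "real \<Rightarrow> real"
  assumes s: "s absolutely_integrable_on {a..b}" and s0: "\<And>t. t \<in> {a..b} \<Longrightarrow> s t \<ge> 0"
    and H: "\<And>x. (H has_real_derivative h x) (at x)" and K: "\<And>x. \<bar>h x\<bar> \<le> K"
    and "c \<in> {a..b}"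
  defines "\<sigma> \<equiv> \<lambda>t. integral {a..t} s"
  shows "((\<lambda>t. s t * h (\<sigma> t)) has_integral (H (\<sigma> c) - H 0)) {a..c}"
proof -
  have si: "s integrable_on {a..b}" using s set_lebesgue_integral_eq_integral(1) by blast
  have "K \<ge> 0" using K[of 0] by linarith
  have \<sigma>diff: "\<sigma> y - \<sigma> x = integral {x..y} s" if "a \<le> x" "x \<le> y" "y \<le> b" for x y
    using Henstock_Kurzweil_Integration.integral_combine[of a x y s] that
      integrable_on_subinterval[OF si, of a y] by (auto simp: \<sigma>_def)
  have Hl: "\<bar>H y - H x\<bar> \<le> K * \<bar>y - x\<bar>" for x y
    using field_differentiable_bound[of UNIV H h K y x] H K by auto
  have ac: "abs_continuous_on {a..b} (\<lambda>t. H (\<sigma> t))"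
  proof (rule abs_continuous_onI_indefinite_integral)
    show "(\<lambda>t. K * s t) absolutely_integrable_on {a..b}"
      using absolutely_integrable_scaleR_left[OF s, of K] by simp
    show "K * s t \<ge> 0" if "t \<in> {a..b}" for t using s0[OF that] \<open>K \<ge> 0\<close> by simp
    fix x y assume xy: "a \<le> x" "x \<le> y" "y \<le> b"
    have "\<sigma> y - \<sigma> x \<ge> 0"
      unfolding \<sigma>diff[OF xy] using xy s0 by (intro integral_nonneg integrable_on_subinterval[OF si]) auto
    then have "norm (H (\<sigma> y) - H (\<sigma> x)) \<le> K * (\<sigma> y - \<sigma> x)"
      using Hl[of "\<sigma> y" "\<sigma> x"] by simp
    then show "norm (H (\<sigma> y) - H (\<sigma> x)) \<le> integral {x..y} (\<lambda>t. K * s t)"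
      by (simp add: \<sigma>diff[OF xy])
  qed
  obtain N where N: "negligible N"
    "\<And>t. t \<in> {a..b} - N \<Longrightarrow> (\<sigma> has_vector_derivative s t) (at t within {a..b})"
    unfolding \<sigma>_def using lebesgue_differentiation[OF si] by blast
  have der: "((\<lambda>t. H (\<sigma> t)) has_vector_derivative s t * h (\<sigma> t)) (at t within {a..b})"
    if "t \<in> {a..b} - N" for t
    using DERIV_chain2[OF H, of \<sigma> "s t" t "{a..b}"] N(2)[OF that]
    by (simp add: has_real_derivative_iff_has_vector_derivative mult.commute)
  have "a \<le> b" using \<open>c \<in> {a..b}\<close> by auto
  have "\<sigma> a = 0" by (simp add: \<sigma>_def)
  then show ?thesis
    using abs_continuous_imp_indefinite_integral(2)[OF ac \<open>a \<le> b\<close> N(1) der \<open>c \<in> {a..b}\<close>] by simp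
qed

lemma nontrivial_linear_relation:
  fixes f :: "nat \<Rightarrow> 'a::euclidean_space"
  assumes "finite J" "card J > DIM('a)"
  obtains c where "(\<Sum>j\<in>J. c j *\<^sub>R f j) = 0" "\<exists>j\<in>J. c j \<noteq> 0"
proof (cases "inj_on f J")
  case True
  then have "card (f ` J) > DIM('a)" using assms by (simp add: card_image)
  then have "dependent (f ` J)"
    using independent_bound[of "f ` J"] by auto
  then obtain u where u: "\<exists>v\<in>f ` J. u v \<noteq> 0" "(\<Sum>v\<in>f ` J. u v *\<^sub>R v) = 0"
    using dependent_finite[of "f ` J"] assms by auto
  then show thesis
  proof (intro that[of "\<lambda>j. u (f j)"])
    show "(\<Sum>j\<in>J. u (f j) *\<^sub>R f j) = 0" using u(2) True by (simp add: sum.reindex)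
    show "\<exists>j\<in>J. u (f j) \<noteq> 0" using u(1) by blast
  qed
next
  case False
  then obtain i j where ij: "i \<in> J" "j \<in> J" "i \<noteq> j" "f i = f j" by (auto simp: inj_on_def)
  have "(\<Sum>k\<in>J. (if k = i then 1 else if k = j then -1 else 0) *\<^sub>R f k)
     = (\<Sum>k\<in>{i,j}. (if k = i then 1 else if k = j then -1 else 0) *\<^sub>R f k)"
    using ij assms by (intro sum.mono_neutral_right) auto
  also have "\<dots> = 0" using ij by simp
  finally show thesis
    by (rule that) (use ij in auto)
qed

section \<open>Controls and their endpoints\<close>

text \<open>Coordinates of a two-step nilpotent group, \<open>B\<close> being the bracket and \<open>x + y + B x y / 2\<close> the
  product. A curve from the origin whose left velocity is the control \<open>v\<close> satisfies \<open>X' = v + B X v /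
  2\<close>. If brackets are central, this solves to \<open>X t = C t + (1/2) \<integral> B C v\<close> with
  \<open>C\<close> the indefinite integral of \<open>v\<close>; hence the formula for the endpoint, whose second summand
  is the area swept out by \<open>C\<close>.\<close>

locale horizontal_model =
  fixes B :: "'e::euclidean_space \<Rightarrow> 'e \<Rightarrow> 'e" and R :: "'e \<Rightarrow> 'e \<Rightarrow> real" and V :: "'e set"
  assumes B: "bounded_bilinear B" and B_self: "\<And>x. B x x = 0"
    and R: "bounded_bilinear R" and R_sym: "\<And>x y. R x y = R y x" and R_nonneg: "\<And>x. R x x \<ge> 0"
    and V: "subspace V"
begin

sublocale B: bounded_bilinear B by (rule B)
sublocale R: bounded_bilinear R by (rule R)

lemma B_anti: "B x y = - B y x"
proof -
  have "B (x + y) (x + y) = B x y + B y x" unfolding B.add_left B.add_right by (simp add: B_self)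
  then have "B x y + B y x = 0" by (simp only: B_self)
  then show ?thesis by (rule eq_neg_iff_add_eq_0[THEN iffD2])
qed

definition speed :: "'e \<Rightarrow> real" where "speed x = sqrt (R x x)"

definition control :: "(real \<Rightarrow> 'e) \<Rightarrow> bool" where
  "control v \<longleftrightarrow> v absolutely_integrable_on {0..1} \<and> range v \<subseteq> V"

definition endpoint :: "(real \<Rightarrow> 'e) \<Rightarrow> 'e" where
  "endpoint v = integral {0..1} v + (1/2) *\<^sub>R integral {0..1} (\<lambda>t. B (integral {0..t} v) (v t))"

lemma speed_nonneg: "speed x \<ge> 0" by (simp add: speed_def R_nonneg)

lemma speed_sq: "speed x * speed x = R x x" by (simp add: speed_def R_nonneg)

lemma speed_bound: "\<exists>K>0. \<forall>x. speed x \<le> K * norm x \<and> R x x \<le> K\<^sup>2 * (norm x)\<^sup>2"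
proof -
  obtain K where K: "K > 0" "\<And>a b. norm (R a b) \<le> norm a * norm b * K" using R.pos_bounded by blast
  have *: "R x x \<le> (sqrt K)\<^sup>2 * (norm x)\<^sup>2" for x
    using K(2)[of x x] K(1) by (simp add: power2_eq_square algebra_simps)
  have "speed x \<le> sqrt K * norm x" for x
    unfolding speed_def using * by (intro real_le_lsqrt) (auto simp: power_mult_distrib K(1) less_imp_le)
  then show ?thesis using * K by (intro exI[of _ "sqrt K"]) auto
qed

lemma continuous_on_speed: "continuous_on S speed"
  unfolding speed_def by (intro continuous_intros R.continuous_on)

lemma speed_integrable:
  assumes v: "v absolutely_integrable_on {a..b::real}"
  shows "(\<lambda>t. speed (v t)) absolutely_integrable_on {a..b}"
proof -
  obtain K where K: "K > 0" "\<forall>x. speed x \<le> K * norm x \<and> R x x \<le> K\<^sup>2 * (norm x)\<^sup>2"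
    using speed_bound by blast
  have "v \<in> borel_measurable (lebesgue_on {a..b})"
    by (rule absolutely_integrable_imp_borel_measurable[OF v]) simp
  then have "(\<lambda>t. speed (v t)) \<in> borel_measurable (lebesgue_on {a..b})"
    by (rule measurable_compose[OF _ borel_measurable_continuous_onI[OF continuous_on_speed]])
  moreover have "(\<lambda>t. K * norm (v t)) integrable_on {a..b}"
    using set_lebesgue_integral_eq_integral(1)[OF absolutely_integrable_norm[OF v]]
    by (intro integrable_on_mult_right) (simp add: comp_def)
  moreover have "norm (speed (v t)) \<le> K * norm (v t)" for t using K(2) speed_nonneg[of "v t"] by simp
  ultimately show ?thesis
    by (intro measurable_bounded_by_integrable_imp_absolutely_integrable[where g="\<lambda>t. K * norm (v t)"]) simp_all
qed


text \<open>The heart of the proof: the area of a horizontal curve can be changed by an amount comparable to its length at a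
  bounded cost in length. Loops in the plane of \<open>x\<close> and \<open>y\<close>, run through with a speed
  proportional to that of the given curve (plus a constant), are superposed on it; the frequencies are distinct
  integers, so that two different loops have no mutual area. The change of the endpoint then consists of a linear and a
  quadratic term in the amplitudes \<open>c j\<close>. The linear term, which is the mutual area with the given curve,
  forms together with the first variation of the length a vector of dimension \<open>DIM('e) + 1\<close>. As there are
  more frequencies than that, suitable nonzero amplitudes make it vanish. The quadratic term is a negative multiple of
  \<open>B x y\<close>, so scaling realizes every \<open>s \<le> 0\<close>. Amplitudes of order \<open>sqrt M\<close>
  suffice, and the second variation of the length is of the order of their square divided by \<open>M\<close>, that is,
  bounded.\<close>

lemma area_shift_nonpos:
  assumes xV: "x \<in> V" and yV: "y \<in> V"
  shows "\<exists>C\<ge>0. \<forall>v M s. control v \<and> integral {0..1} (\<lambda>t. speed (v t)) \<le> M \<and> s \<le> 0 \<and> - s \<le> M \<longrightarrow>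
    (\<exists>w. control w \<and> endpoint w = endpoint v + s *\<^sub>R B x y \<and> integral {0..1} (\<lambda>t. speed (w t)) \<le> M + C)"
proof -
  obtain Kr where Kr: "Kr > 0" "\<forall>x. speed x \<le> Kr * norm x \<and> R x x \<le> Kr\<^sup>2 * (norm x)\<^sup>2"
    using speed_bound by blast
  \<comment> \<open>One frequency more than the \<open>DIM('e) + 1\<close> coordinates of the pairs \<open>(D j, E j)\<close> below.\<close>
  define J where "J = {1..DIM('e) + 2}"
  define \<omega> where "\<omega> j = 2 * pi * real j" for j :: nat
  define W where "W = (\<Sum>j\<in>J. \<omega> j * (norm x + norm y))"
  have \<omega>1: "\<omega> j / 2 \<ge> 1" if "j \<in> J" for j
  proof -
    have "1 * 1 \<le> pi * real j" using that pi_gt3 by (intro mult_mono) (auto simp: J_def)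
    then show ?thesis by (simp add: \<omega>_def)
  qed
  have \<omega>0: "\<omega> j \<ge> 0" for j by (simp add: \<omega>_def)
  have W0: "W \<ge> 0" unfolding W_def using \<omega>0 by (intro sum_nonneg) auto
  define C where "C = 1 + Kr\<^sup>2 * W\<^sup>2 / 2"
  show ?thesis
  proof (intro exI[of _ C] conjI allI impI)
    show "C \<ge> 0" by (simp add: C_def)
    fix v M and s :: real
    assume "control v \<and> integral {0..1} (\<lambda>t. speed (v t)) \<le> M \<and> s \<le> 0 \<and> - s \<le> M"
    then have v: "control v" and lenM: "integral {0..1} (\<lambda>t. speed (v t)) \<le> M"
      and s0: "s \<le> 0" and sM: "- s \<le> M" by auto
    have va: "v absolutely_integrable_on {0..1}" and vV: "\<And>t. v t \<in> V"
      using v by (auto simp: control_def)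
    define len where "len = integral {0..1} (\<lambda>t. speed (v t))"
    have spa: "(\<lambda>t. speed (v t)) absolutely_integrable_on {0..1}" by (rule speed_integrable[OF va])
    have spi: "(\<lambda>t. speed (v t)) integrable_on {0..1}" using spa set_lebesgue_integral_eq_integral(1) by blast
    define M' where "M' = M + 1"
    \<comment> \<open>\<open>m\<close> dominates the speed, stays away from 0 and has integral \<open>M + 1\<close>. Moving the loops with
        the density \<open>\<mu>\<close> of total mass 1 keeps the perturbation within a fixed multiple of \<open>m / sqrt (M
        + 1)\<close>.\<close>
    define m where "m t = speed (v t) + (M + 1 - len)" for t
    have m_ge: "m t \<ge> 1" "m t \<ge> speed (v t)" for t
      using lenM speed_nonneg[of "v t"] by (auto simp: m_def len_def)
    have M0: "M \<ge> 0" "M' > 0" using s0 sM by (auto simp: M'_def)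
    define \<mu> where "\<mu> t = m t / M'" for t
    have \<mu>0: "\<mu> t > 0" for t using m_ge(1)[of t] M0 by (simp add: \<mu>_def)
    have \<mu>a: "\<mu> absolutely_integrable_on {0..1}"
    proof -
      have "(\<lambda>t. speed (v t) + (M + 1 - len)) absolutely_integrable_on {0..1}"
        by (rule set_integral_add(1)[OF spa]) (simp add: absolutely_integrable_on_const)
      from absolutely_integrable_scaleR_left[OF this, of "1/M'"]
      show ?thesis by (simp add: \<mu>_def[abs_def] m_def)
    qed
    have mi: "(m has_integral M') {0..1}"
    proof -
      have "((\<lambda>t. speed (v t) + (M + 1 - len)) has_integral (len + (M + 1 - len))) {0..1}"
        unfolding len_def using has_integral_const_real[of "M + 1 - len" 0 1]
        by (intro has_integral_add integrable_integral[OF spi]) (simp add: len_def)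
      then show ?thesis by (simp add: m_def[abs_def] M'_def)
    qed
    have \<mu>i: "(\<mu> has_integral 1) {0..1}"
      using has_integral_divide[OF mi, of M'] M0 by (simp add: \<mu>_def[abs_def])
    define \<sigma> where "\<sigma> t = integral {0..t} \<mu>" for t
    have \<sigma>1: "\<sigma> 1 = 1" using \<mu>i by (simp add: \<sigma>_def integral_unique)
    have \<sigma>c: "continuous_on {0..1} \<sigma>"
      unfolding \<sigma>_def[abs_def] by (rule indefinite_integral_continuous_on[OF \<mu>a])
    note subst = has_integral_substitution_indefinite_integral[OF \<mu>a less_imp_le[OF \<mu>0], folded \<sigma>_def]
    have cosint: "((\<lambda>t. \<mu> t * cos (2 * pi * of_int q * \<sigma> t)) has_integral (if q = 0 then 1 else 0)) {0..1}" for q :: int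
    proof (cases "q = 0")
      case True then show ?thesis using \<mu>i by simp
    next
      case False
      define a where "a = 2 * pi * real_of_int q"
      have a: "a \<noteq> 0" using False by (simp add: a_def)
      have "((\<lambda>t. \<mu> t * cos (a * \<sigma> t)) has_integral (sin (a * \<sigma> 1) / a - sin (a * 0) / a)) {0..1}"
        by (rule subst[where H="\<lambda>z. sin (a * z) / a" and h="\<lambda>z. cos (a * z)" and K=1])
           (use a in \<open>auto intro!: derivative_eq_intros\<close>)
      moreover have "sin (a * \<sigma> 1) = 0" unfolding \<sigma>1 a_def using sin_int_2pin[of q] by (simp add: mult.commute)
      ultimately show ?thesis using False by (simp add: a_def)
    qed
    define cs where "cs j t = cos (\<omega> j * \<sigma> t)" for j t
    define sn where "sn j t = sin (\<omega> j * \<sigma> t)" for j t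
    \<comment> \<open>\<open>P j\<close> is the velocity of the loop of frequency \<open>j\<close>, and \<open>Q j\<close> its position.\<close>
    define e where "e j t = \<omega> j *\<^sub>R (cs j t *\<^sub>R x - sn j t *\<^sub>R y)" for j t
    define P where "P j t = \<mu> t *\<^sub>R e j t" for j t
    define Q where "Q j t = sn j t *\<^sub>R x + (cs j t - 1) *\<^sub>R y" for j t
    have ec: "continuous_on {0..1} (e j)" for j
      unfolding e_def[abs_def] cs_def sn_def by (intro continuous_intros \<sigma>c)
    have Qc: "continuous_on {0..1} (Q j)" for j
      unfolding Q_def[abs_def] cs_def sn_def by (intro continuous_intros \<sigma>c)
    have Pa: "P j absolutely_integrable_on {0..1}" for j
      unfolding P_def[abs_def]
      by (rule absolutely_integrable_bilinear_continuous'[OF bounded_bilinear_scaleR ec \<mu>a])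
    have PQ: "(P j has_integral Q j t) {0..t}" if "t \<in> {0..1}" for j t
    proof -
      have 1: "((\<lambda>t. \<mu> t * (\<omega> j * cos (\<omega> j * \<sigma> t))) has_integral (sin (\<omega> j * \<sigma> t) - sin (\<omega> j * 0))) {0..t}"
        by (rule subst[where H="\<lambda>z. sin (\<omega> j * z)" and h="\<lambda>z. \<omega> j * cos (\<omega> j * z)" and K="\<bar>\<omega> j\<bar>"])
           (use that in \<open>auto intro!: derivative_eq_intros simp: abs_mult mult_left_le\<close>)
      have 2: "((\<lambda>t. \<mu> t * (- \<omega> j * sin (\<omega> j * \<sigma> t))) has_integral (cos (\<omega> j * \<sigma> t) - cos (\<omega> j * 0))) {0..t}"
        by (rule subst[where H="\<lambda>z. cos (\<omega> j * z)" and h="\<lambda>z. - \<omega> j * sin (\<omega> j * z)" and K="\<bar>\<omega> j\<bar>"])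
           (use that in \<open>auto intro!: derivative_eq_intros simp: abs_mult mult_left_le\<close>)
      have "((\<lambda>t. (\<mu> t * (\<omega> j * cos (\<omega> j * \<sigma> t))) *\<^sub>R x + (\<mu> t * (- \<omega> j * sin (\<omega> j * \<sigma> t))) *\<^sub>R y)
         has_integral ((sin (\<omega> j * \<sigma> t) - sin (\<omega> j * 0)) *\<^sub>R x + (cos (\<omega> j * \<sigma> t) - cos (\<omega> j * 0)) *\<^sub>R y)) {0..t}"
        by (intro has_integral_add has_integral_scaleR_left 1 2)
      then show ?thesis
        by (simp add: P_def[abs_def] Q_def e_def cs_def sn_def algebra_simps)
    qed
    have Q1: "Q j 1 = 0" for j
      using sin_int_2pin[of "int j"] cos_int_2pin[of "int j"]
      by (simp add: Q_def cs_def sn_def \<sigma>1 \<omega>_def)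
    \<comment> \<open>Mutual area of two loops: orthogonality of the cosines in the parameter \<open>\<sigma>\<close>.\<close>
    have BQP: "((\<lambda>t. B (Q j t) (P k t)) has_integral ((if j = k then - \<omega> k else 0) *\<^sub>R B x y)) {0..1}"
      if "k \<in> J" for j k
    proof -
      have "B (Q j t) (P k t) = (- \<omega> k * (\<mu> t * cos (2 * pi * of_int (int j - int k) * \<sigma> t) - \<mu> t * cos (2 * pi * of_int (int k) * \<sigma> t))) *\<^sub>R B x y" for t
      proof -
        have "2 * pi * of_int (int j - int k) * \<sigma> t = \<omega> j * \<sigma> t - \<omega> k * \<sigma> t"
          by (simp add: \<omega>_def algebra_simps)
        then have c: "cos (2 * pi * of_int (int j - int k) * \<sigma> t) = cs j t * cs k t + sn j t * sn k t"
          by (simp add: cos_diff cs_def sn_def)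
        have ck: "cos (2 * pi * of_int (int k) * \<sigma> t) = cs k t" by (simp add: cs_def \<omega>_def)
        show ?thesis
          unfolding c ck Q_def P_def e_def
          by (simp add: B.add_left B.add_right B.diff_right B.scaleR_left B.scaleR_right B_self
              B_anti[of y x] scaleR_diff_left[symmetric] scaleR_diff_right scaleR_add_left[symmetric])
             (simp add: algebra_simps)
      qed
      moreover have "((\<lambda>t. (- \<omega> k * (\<mu> t * cos (2 * pi * of_int (int j - int k) * \<sigma> t) - \<mu> t * cos (2 * pi * of_int (int k) * \<sigma> t))) *\<^sub>R B x y)
         has_integral ((- \<omega> k * ((if int j - int k = 0 then 1 else 0) - (if int k = 0 then 1 else 0))) *\<^sub>R B x y)) {0..1}"
        by (intro has_integral_scaleR_left has_integral_mult_right has_integral_diff cosint)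
      ultimately show ?thesis using that by (auto simp: J_def)
    qed
    define X where "X t = integral {0..t} v" for t
    have Xc: "continuous_on {0..1} X"
      unfolding X_def[abs_def] by (rule indefinite_integral_continuous_on[OF va])
    have ii: "f integrable_on {0..1}" if "f absolutely_integrable_on {0..1}" for f :: "real \<Rightarrow> 'b::euclidean_space"
      using that set_lebesgue_integral_eq_integral(1) by blast
    note bil = absolutely_integrable_bilinear_continuous and bil' = absolutely_integrable_bilinear_continuous'
    \<comment> \<open>The effect of a loop to first order, on the area and on the length.\<close>
    define D where "D j = integral {0..1} (\<lambda>t. B (X t) (P j t)) + integral {0..1} (\<lambda>t. B (Q j t) (v t))" for j
    define E where "E j = integral {0..1} (\<lambda>t. R (v t) (e j t))" for j
    obtain c0 where c0: "(\<Sum>j\<in>J. c0 j *\<^sub>R (D j, E j)) = 0" "\<exists>j\<in>J. c0 j \<noteq> 0"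
    proof (rule nontrivial_linear_relation[of J "\<lambda>j. (D j, E j)"])
      show "finite J" "DIM('e \<times> real) < card J" by (auto simp: J_def)
    qed
    define S0 where "S0 = (\<Sum>j\<in>J. \<omega> j / 2 * (c0 j)\<^sup>2)"
    have S0: "S0 > 0"
    proof -
      obtain j where j: "j \<in> J" "c0 j \<noteq> 0" using c0 by blast
      have "0 < \<omega> j / 2 * (c0 j)\<^sup>2" using j \<omega>1[of j] by auto
      also have "\<dots> \<le> S0" unfolding S0_def
        using j(1) by (rule member_le_sum) (auto simp: \<omega>0 J_def)
      finally show ?thesis .
    qed
    define c where "c j = sqrt (- s / S0) * c0 j" for j
    have csum: "(\<Sum>j\<in>J. \<omega> j / 2 * (c j)\<^sup>2) = - s"
    proof -
      have "(\<Sum>j\<in>J. \<omega> j / 2 * (c j)\<^sup>2) = (\<Sum>j\<in>J. (- s / S0) * (\<omega> j / 2 * (c0 j)\<^sup>2))"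
      proof (intro sum.cong refl)
        fix j
        have "(sqrt (- s / S0))\<^sup>2 = - s / S0" using s0 S0 by (intro real_sqrt_pow2) (simp add: field_simps)
        then show "\<omega> j / 2 * (c j)\<^sup>2 = (- s / S0) * (\<omega> j / 2 * (c0 j)\<^sup>2)"
          unfolding c_def power_mult_distrib by (simp add: mult.commute mult.left_commute)
      qed
      also have "\<dots> = (- s / S0) * S0" by (simp add: S0_def sum_distrib_left)
      finally show ?thesis using S0 by simp
    qed
    have "(\<Sum>j\<in>J. c j *\<^sub>R (D j, E j)) = sqrt (- s / S0) *\<^sub>R (\<Sum>j\<in>J. c0 j *\<^sub>R (D j, E j))"
      by (simp add: c_def scaleR_sum_right del: scaleR_Pair)
    then have cDE: "(\<Sum>j\<in>J. c j *\<^sub>R (D j, E j)) = 0" using c0 by simp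
    have cD: "(\<Sum>j\<in>J. c j *\<^sub>R D j) = 0" and cE: "(\<Sum>j\<in>J. c j * E j) = 0"
      using arg_cong[OF cDE, of fst] arg_cong[OF cDE, of snd] by (simp_all add: fst_sum snd_sum)
    have cle: "\<bar>c j\<bar> \<le> sqrt M" if "j \<in> J" for j
    proof -
      have "(c j)\<^sup>2 \<le> \<omega> j / 2 * (c j)\<^sup>2" using mult_right_mono[OF \<omega>1[OF that], of "(c j)\<^sup>2"] by simp
      also have "\<dots> \<le> (\<Sum>j\<in>J. \<omega> j / 2 * (c j)\<^sup>2)"
        using that by (rule member_le_sum) (auto simp: \<omega>0 J_def)
      also have "\<dots> \<le> M" using csum sM by simp
      finally show ?thesis by (simp add: real_le_rsqrt)
    qed
    define u where "u t = (\<Sum>j\<in>J. c j *\<^sub>R P j t)" for t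
    define \<eta> where "\<eta> t = (\<Sum>j\<in>J. c j *\<^sub>R Q j t)" for t
    define F where "F t = (\<Sum>j\<in>J. c j *\<^sub>R e j t)" for t
    have u\<eta>: "(u has_integral \<eta> t) {0..t}" if "t \<in> {0..1}" for t
      unfolding u_def[abs_def] \<eta>_def
      by (intro has_integral_sum has_integral_cmul PQ that) (simp add: J_def)
    have ua: "u absolutely_integrable_on {0..1}"
      unfolding u_def[abs_def] by (intro absolutely_integrable_sum absolutely_integrable_scaleR_left Pa) (simp add: J_def)
    have uF: "u t = \<mu> t *\<^sub>R F t" for t
      by (simp add: u_def F_def P_def scaleR_sum_right mult.commute)
    have wa: "(\<lambda>t. v t + u t) absolutely_integrable_on {0..1}"
      using va ua by (rule set_integral_add(1))
    have uV: "u t \<in> V" for t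
      unfolding u_def P_def e_def using xV yV V
      by (intro subspace_sum subspace_scale subspace_diff) auto
    have w: "control (\<lambda>t. v t + u t)"
      using wa vV uV V by (auto simp: control_def subspace_add)
    have wX: "integral {0..t} (\<lambda>t. v t + u t) = X t + \<eta> t" if "t \<in> {0..1}" for t
    proof (rule integral_unique)
      have "v integrable_on {0..t}" using integrable_on_subinterval[OF ii[OF va], of 0 t] that by auto
      then show "((\<lambda>t. v t + u t) has_integral X t + \<eta> t) {0..t}"
        unfolding X_def by (intro has_integral_add integrable_integral u\<eta> that)
    qed
    have \<eta>1: "\<eta> 1 = 0" by (simp add: \<eta>_def Q1)
    have I1: "((\<lambda>t. B (X t) (v t)) has_integral (integral {0..1} (\<lambda>t. B (X t) (v t)))) {0..1}"
      by (intro integrable_integral ii bil[OF B Xc va])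
    have I2: "((\<lambda>t. B (X t) (u t) + B (\<eta> t) (v t)) has_integral 0) {0..1}"
    proof -
      have "((\<lambda>t. \<Sum>j\<in>J. c j *\<^sub>R (B (X t) (P j t) + B (Q j t) (v t))) has_integral (\<Sum>j\<in>J. c j *\<^sub>R D j)) {0..1}"
        unfolding D_def
        by (intro has_integral_sum has_integral_cmul has_integral_add integrable_integral ii bil[OF B Xc Pa] bil[OF B Qc va])
           (simp add: J_def)
      then show ?thesis
        by (simp add: cD u_def \<eta>_def B.sum_right B.sum_left B.scaleR_right B.scaleR_left sum.distrib scaleR_add_right)
    qed
    have I3: "((\<lambda>t. B (\<eta> t) (u t)) has_integral (2 * s) *\<^sub>R B x y) {0..1}"
    proof -
      have "((\<lambda>t. \<Sum>k\<in>J. \<Sum>j\<in>J. (c k * c j) *\<^sub>R B (Q j t) (P k t)) has_integral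
          (\<Sum>k\<in>J. \<Sum>j\<in>J. (c k * c j) *\<^sub>R ((if j = k then - \<omega> k else 0) *\<^sub>R B x y))) {0..1}"
        by (intro has_integral_sum has_integral_cmul BQP) (simp_all add: J_def)
      moreover have "(\<Sum>k\<in>J. \<Sum>j\<in>J. (c k * c j) *\<^sub>R B (Q j t) (P k t)) = B (\<eta> t) (u t)" for t
        by (simp add: u_def \<eta>_def B.sum_right B.sum_left B.scaleR_right B.scaleR_left scaleR_sum_right)
      moreover have "(\<Sum>k\<in>J. \<Sum>j\<in>J. (c k * c j) *\<^sub>R ((if j = k then - \<omega> k else 0) *\<^sub>R B x y)) = (2 * s) *\<^sub>R B x y"
      proof -
        have "(\<Sum>j\<in>J. (c k * c j) *\<^sub>R ((if j = k then - \<omega> k else 0) *\<^sub>R B x y)) = (- 2 * (\<omega> k / 2 * (c k)\<^sup>2)) *\<^sub>R B x y"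
          if "k \<in> J" for k
        proof -
          have "(\<Sum>j\<in>J. (c k * c j) *\<^sub>R ((if j = k then - \<omega> k else 0) *\<^sub>R B x y))
              = (\<Sum>j\<in>J. if j = k then (c k * c k * (- \<omega> k)) *\<^sub>R B x y else 0)"
            by (intro sum.cong) auto
          also have "\<dots> = (c k * c k * (- \<omega> k)) *\<^sub>R B x y" using that by (simp add: J_def)
          finally show ?thesis by (simp add: power2_eq_square algebra_simps)
        qed
        then have "(\<Sum>k\<in>J. \<Sum>j\<in>J. (c k * c j) *\<^sub>R ((if j = k then - \<omega> k else 0) *\<^sub>R B x y))
            = (\<Sum>k\<in>J. (- 2 * (\<omega> k / 2 * (c k)\<^sup>2)) *\<^sub>R B x y)" by simp
        also have "\<dots> = (- 2 * (\<Sum>k\<in>J. \<omega> k / 2 * (c k)\<^sup>2)) *\<^sub>R B x y"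
          by (simp only: scaleR_sum_left[symmetric] sum_distrib_left[symmetric])
        finally show ?thesis by (simp only: csum) simp
      qed
      ultimately show ?thesis by simp
    qed
    have "((\<lambda>t. B (integral {0..t} (\<lambda>t. v t + u t)) (v t + u t)) has_integral
        (integral {0..1} (\<lambda>t. B (X t) (v t)) + 0 + (2 * s) *\<^sub>R B x y)) {0..1}"
    proof (rule has_integral_eq)
      show "((\<lambda>t. B (X t) (v t) + (B (X t) (u t) + B (\<eta> t) (v t)) + B (\<eta> t) (u t)) has_integral
        (integral {0..1} (\<lambda>t. B (X t) (v t)) + 0 + (2 * s) *\<^sub>R B x y)) {0..1}"
        by (intro has_integral_add I1 I2 I3)
      fix t :: real assume "t \<in> {0..1}"
      then show "B (X t) (v t) + (B (X t) (u t) + B (\<eta> t) (v t)) + B (\<eta> t) (u t)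
          = B (integral {0..t} (\<lambda>t. v t + u t)) (v t + u t)"
        by (simp add: wX B.add_left B.add_right)
    qed
    then have ep: "endpoint (\<lambda>t. v t + u t) = endpoint v + s *\<^sub>R B x y"
      using wX[of 1] \<eta>1 unfolding endpoint_def by (simp add: integral_unique X_def scaleR_add_right)
    have normF: "(norm (F t))\<^sup>2 \<le> W\<^sup>2 * M" for t
    proof -
      have "norm (F t) \<le> (\<Sum>j\<in>J. norm (c j *\<^sub>R e j t))" unfolding F_def by (rule norm_sum)
      also have "\<dots> \<le> (\<Sum>j\<in>J. sqrt M * (\<omega> j * (norm x + norm y)))"
      proof (rule sum_mono)
        fix j assume j: "j \<in> J"
        have "norm (cs j t *\<^sub>R x - sn j t *\<^sub>R y) \<le> \<bar>cs j t\<bar> * norm x + \<bar>sn j t\<bar> * norm y"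
          by (rule order_trans[OF norm_triangle_ineq4]) simp
        also have "\<dots> \<le> norm x + norm y"
          by (intro add_mono) (auto simp: cs_def sn_def mult_left_le_one_le)
        finally have "norm (e j t) \<le> \<omega> j * (norm x + norm y)"
          unfolding e_def using \<omega>0[of j] by (simp add: mult_left_mono)
        then show "norm (c j *\<^sub>R e j t) \<le> sqrt M * (\<omega> j * (norm x + norm y))"
          using cle[OF j] M0 by (auto intro!: mult_mono)
      qed
      also have "\<dots> = sqrt M * W" by (simp add: W_def sum_distrib_left)
      finally have "(norm (F t))\<^sup>2 \<le> (sqrt M * W)\<^sup>2" by (intro power_mono) auto
      then show ?thesis using M0 by (simp add: power_mult_distrib mult.commute)
    qed
    have pw: "speed (v t + u t) \<le> m t + R (v t) (F t) / M' + \<mu> t * (Kr\<^sup>2 * (W\<^sup>2 * M) / (2 * M'))" for t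
    proof -
      define Z where "Z = R (v t + u t) (v t + u t)"
      have mp: "m t > 0" using m_ge(1)[of t] by simp
      have Z: "Z = R (v t) (v t) + 2 * R (v t) (u t) + R (u t) (u t)"
        by (simp add: Z_def R.add_left R.add_right R_sym[of "u t" "v t"])
      have "R (v t) (v t) \<le> m t * m t"
        unfolding speed_sq[symmetric] using m_ge(2)[of t] speed_nonneg by (intro mult_mono) (auto intro: order_trans)
      then have Zle: "Z \<le> m t * m t + 2 * R (v t) (u t) + R (u t) (u t)" by (simp add: Z)
      \<comment> \<open>The tangent line of the square root at \<open>m t * m t\<close> bounds the new speed.\<close>
      have "0 \<le> (sqrt Z - m t)\<^sup>2" by simp
      then have "2 * m t * sqrt Z \<le> Z + m t * m t"
        using R_nonneg[of "v t + u t", folded Z_def] by (simp add: power2_eq_square algebra_simps)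
      also have "\<dots> \<le> 2 * m t * m t + 2 * R (v t) (u t) + R (u t) (u t)" using Zle by simp
      finally have 1: "sqrt Z \<le> m t + R (v t) (u t) / m t + R (u t) (u t) / (2 * m t)"
        using mp by (simp add: field_simps)
      have 2: "R (v t) (u t) / m t = R (v t) (F t) / M'"
        using mp M0 by (simp add: uF R.scaleR_right \<mu>_def)
      have "R (u t) (u t) / (2 * m t) = \<mu> t * (R (F t) (F t) / (2 * M'))"
        using mp M0 by (simp add: uF R.scaleR_right R.scaleR_left \<mu>_def)
      also have "\<dots> \<le> \<mu> t * (Kr\<^sup>2 * (W\<^sup>2 * M) / (2 * M'))"
      proof (intro mult_left_mono divide_right_mono)
        show "R (F t) (F t) \<le> Kr\<^sup>2 * (W\<^sup>2 * M)"
          using Kr(2)[rule_format, of "F t"] mult_left_mono[OF normF[of t], of "Kr\<^sup>2"] by simp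
      qed (use M0 \<mu>0[of t] in auto)
      finally show ?thesis using 1 2 unfolding speed_def Z_def[symmetric] by linarith
    qed
    have RvF: "((\<lambda>t. R (v t) (F t)) has_integral 0) {0..1}"
    proof -
      have "((\<lambda>t. \<Sum>j\<in>J. c j *\<^sub>R R (v t) (e j t)) has_integral (\<Sum>j\<in>J. c j *\<^sub>R E j)) {0..1}"
        unfolding E_def
        by (intro has_integral_sum has_integral_cmul integrable_integral ii bil'[OF R ec va]) (simp add: J_def)
      then show ?thesis using cE by (simp add: F_def R.sum_right R.scaleR_right)
    qed
    have "((\<lambda>t. m t + R (v t) (F t) / M' + \<mu> t * (Kr\<^sup>2 * (W\<^sup>2 * M) / (2 * M'))) has_integral
        (M' + 0 / M' + 1 * (Kr\<^sup>2 * (W\<^sup>2 * M) / (2 * M')))) {0..1}"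
      by (intro has_integral_add mi has_integral_divide RvF has_integral_mult_left \<mu>i)
    then have "integral {0..1} (\<lambda>t. speed (v t + u t)) \<le> M' + Kr\<^sup>2 * (W\<^sup>2 * M) / (2 * M')"
      using has_integral_le[OF integrable_integral[OF ii[OF speed_integrable[OF wa]]] _ pw] by simp
    also have "Kr\<^sup>2 * (W\<^sup>2 * M) / (2 * M') = (Kr\<^sup>2 * W\<^sup>2 / 2) * (M / M')" by simp
    also have "\<dots> \<le> (Kr\<^sup>2 * W\<^sup>2 / 2) * 1"
      using M0 by (intro mult_left_mono) (auto simp: M'_def)
    finally have "integral {0..1} (\<lambda>t. speed (v t + u t)) \<le> M + C" by (simp add: M'_def C_def)
    with w ep show "\<exists>w. control w \<and> endpoint w = endpoint v + s *\<^sub>R B x y \<and> integral {0..1} (\<lambda>t. speed (w t)) \<le> M + C"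
      by (intro exI[of _ "\<lambda>t. v t + u t"]) simp
  qed
qed

text \<open>Interchanging \<open>x\<close> and \<open>y\<close> reverses the sign of the area.\<close>

lemma area_shift:
  assumes xV: "x \<in> V" and yV: "y \<in> V"
  shows "\<exists>C\<ge>0. \<forall>v M s. control v \<and> integral {0..1} (\<lambda>t. speed (v t)) \<le> M \<and> \<bar>s\<bar> \<le> M \<longrightarrow>
    (\<exists>w. control w \<and> endpoint w = endpoint v + s *\<^sub>R B x y \<and> integral {0..1} (\<lambda>t. speed (w t)) \<le> M + C)"
proof -
  obtain C1 where C1: "C1 \<ge> 0" "\<And>v M s. control v \<and> integral {0..1} (\<lambda>t. speed (v t)) \<le> M \<and> s \<le> 0 \<and> - s \<le> M \<Longrightarrow>
    (\<exists>w. control w \<and> endpoint w = endpoint v + s *\<^sub>R B x y \<and> integral {0..1} (\<lambda>t. speed (w t)) \<le> M + C1)"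
    using area_shift_nonpos[OF xV yV] by (elim exE conjE) simp
  obtain C2 where C2: "C2 \<ge> 0" "\<And>v M s. control v \<and> integral {0..1} (\<lambda>t. speed (v t)) \<le> M \<and> s \<le> 0 \<and> - s \<le> M \<Longrightarrow>
    (\<exists>w. control w \<and> endpoint w = endpoint v + s *\<^sub>R B y x \<and> integral {0..1} (\<lambda>t. speed (w t)) \<le> M + C2)"
    using area_shift_nonpos[OF yV xV] by (elim exE conjE) simp
  show ?thesis
  proof (intro exI[of _ "max C1 C2"] conjI allI impI)
    show "max C1 C2 \<ge> 0" using C1 by simp
    fix v M and s :: real
    assume v: "control v \<and> integral {0..1} (\<lambda>t. speed (v t)) \<le> M \<and> \<bar>s\<bar> \<le> M"
    show "\<exists>w. control w \<and> endpoint w = endpoint v + s *\<^sub>R B x y \<and> integral {0..1} (\<lambda>t. speed (w t)) \<le> M + max C1 C2"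
    proof (cases "s \<le> 0")
      case True
      with C1(2)[of v M s] v show ?thesis by force
    next
      case False
      have "(- s) *\<^sub>R B y x = s *\<^sub>R B x y" using B_anti[of y x] by simp
      with C2(2)[of v M "- s"] v False show ?thesis by force
    qed
  qed
qed


lemma area_shift_sum:
  assumes "finite F" "F \<subseteq> V \<times> V"
  shows "\<exists>C\<ge>0. \<forall>v M s. control v \<and> integral {0..1} (\<lambda>t. speed (v t)) \<le> M \<and> (\<forall>p\<in>F. \<bar>s p\<bar> \<le> M) \<longrightarrow>
    (\<exists>w. control w \<and> endpoint w = endpoint v + (\<Sum>p\<in>F. s p *\<^sub>R B (fst p) (snd p)) \<and>
      integral {0..1} (\<lambda>t. speed (w t)) \<le> M + C)"
  using assms
proof (induction F rule: finite_induct)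
  case empty
  then show ?case by (intro exI[of _ 0]) auto
next
  case (insert p F)
  obtain C1 where C1: "C1 \<ge> 0" "\<And>v M s. control v \<and> integral {0..1} (\<lambda>t. speed (v t)) \<le> M \<and> (\<forall>p\<in>F. \<bar>s p\<bar> \<le> M) \<Longrightarrow>
    (\<exists>w. control w \<and> endpoint w = endpoint v + (\<Sum>p\<in>F. s p *\<^sub>R B (fst p) (snd p)) \<and>
      integral {0..1} (\<lambda>t. speed (w t)) \<le> M + C1)"
    using insert.IH[OF insert_subset[THEN iffD1, OF insert.prems, THEN conjunct2]] by (elim exE conjE) simp
  have pV: "fst p \<in> V" "snd p \<in> V" using insert.prems by auto
  obtain C2 where C2: "C2 \<ge> 0" "\<And>v M s. control v \<and> integral {0..1} (\<lambda>t. speed (v t)) \<le> M \<and> \<bar>s\<bar> \<le> M \<Longrightarrow>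
    (\<exists>w. control w \<and> endpoint w = endpoint v + s *\<^sub>R B (fst p) (snd p) \<and> integral {0..1} (\<lambda>t. speed (w t)) \<le> M + C2)"
    using area_shift[OF pV] by (elim exE conjE) simp
  show ?case
  proof (intro exI[of _ "C1 + C2"] conjI allI impI)
    show "C1 + C2 \<ge> 0" using C1 C2 by simp
    fix v M s
    assume v: "control v \<and> integral {0..1} (\<lambda>t. speed (v t)) \<le> M \<and> (\<forall>q\<in>insert p F. \<bar>s q\<bar> \<le> M)"
    then obtain w where w: "control w" "endpoint w = endpoint v + (\<Sum>p\<in>F. s p *\<^sub>R B (fst p) (snd p))"
      "integral {0..1} (\<lambda>t. speed (w t)) \<le> M + C1" using C1(2)[of v M s] by auto
    then obtain w' where w': "control w'" "endpoint w' = endpoint w + s p *\<^sub>R B (fst p) (snd p)"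
      "integral {0..1} (\<lambda>t. speed (w' t)) \<le> (M + C1) + C2" using C2(2)[of w "M + C1" "s p"] v C1(1) by force
    show "\<exists>w. control w \<and> endpoint w = endpoint v + (\<Sum>p\<in>insert p F. s p *\<^sub>R B (fst p) (snd p)) \<and>
      integral {0..1} (\<lambda>t. speed (w t)) \<le> M + (C1 + C2)"
      by (rule exI[of _ w']) (use w w' insert.hyps in \<open>simp add: algebra_simps\<close>)
  qed
qed

text \<open>A central vector is a combination of brackets from a basis of their span, with coefficients bounded by a multiple of
  its norm. Scaling one entry of each bracket by \<open>L\<close> brings the coefficients below \<open>M\<close>.\<close>

lemma central_shift:
  assumes "K \<ge> 0"
  shows "\<exists>C\<ge>0. \<forall>v M z. control v \<and> integral {0..1} (\<lambda>t. speed (v t)) \<le> M \<and>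
      z \<in> span {B x y |x y. x \<in> V \<and> y \<in> V} \<and> norm z \<le> K * M \<longrightarrow>
    (\<exists>w. control w \<and> endpoint w = endpoint v + z \<and> integral {0..1} (\<lambda>t. speed (w t)) \<le> M + C)"
proof -
  define S where "S = {B x y |x y. x \<in> V \<and> y \<in> V}"
  obtain bs where bs: "bs \<subseteq> S" "independent bs" "S \<subseteq> span bs"
    using maximal_independent_subset[of S] by blast
  have fin: "finite bs" using bs(2) independent_bound by blast
  have "\<forall>b\<in>bs. \<exists>p. p \<in> V \<times> V \<and> b = B (fst p) (snd p)" using bs(1) by (fastforce simp: S_def)
  then obtain f where f: "\<And>b. b \<in> bs \<Longrightarrow> f b \<in> V \<times> V" "\<And>b. b \<in> bs \<Longrightarrow> b = B (fst (f b)) (snd (f b))"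
    by metis
  have "\<exists>g. linear g \<and> (\<forall>x\<in>bs. g x = (if x = b then 1 else 0 :: real))" for b
    using linear_independent_extend[OF bs(2), of "\<lambda>x. if x = b then 1 else 0"] by auto
  then obtain g where g: "\<And>b. linear (g b)" "\<And>b x. x \<in> bs \<Longrightarrow> g b x = (if x = b then 1 else 0 :: real)"
    by metis
  have "\<exists>k. \<forall>x. norm (g b x) \<le> k * norm x" for b using linear_bounded[OF g(1)] by blast
  then obtain k where k: "\<And>b x. norm (g b x) \<le> k b * norm x" by metis
  define L where "L = 1 + K * (\<Sum>b\<in>bs. \<bar>k b\<bar>)"
  have L: "L \<ge> 1" unfolding L_def using assms by (simp add: sum_nonneg)
  have kL: "K * \<bar>k b\<bar> \<le> L" if "b \<in> bs" for b
    using mult_left_mono[OF member_le_sum[of b bs "\<lambda>b. \<bar>k b\<bar>"] assms] fin that by (auto simp: L_def)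
  define F where "F = (\<lambda>b. (L *\<^sub>R fst (f b), snd (f b))) ` bs"
  have inj: "inj_on (\<lambda>b. (L *\<^sub>R fst (f b), snd (f b))) bs"
  proof (rule inj_onI)
    fix b b' assume b: "b \<in> bs" "b' \<in> bs" "(L *\<^sub>R fst (f b), snd (f b)) = (L *\<^sub>R fst (f b'), snd (f b'))"
    then have "fst (f b) = fst (f b')" "snd (f b) = snd (f b')" using L by auto
    then show "b = b'" using f(2)[OF b(1)] f(2)[OF b(2)] by simp
  qed
  have "finite F" "F \<subseteq> V \<times> V" using fin f(1) V by (force simp: F_def subspace_scale)+
  from area_shift_sum[OF this] obtain C where C: "C \<ge> 0"
    "\<And>v M s. control v \<and> integral {0..1} (\<lambda>t. speed (v t)) \<le> M \<and> (\<forall>p\<in>F. \<bar>s p\<bar> \<le> M) \<Longrightarrow>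
    (\<exists>w. control w \<and> endpoint w = endpoint v + (\<Sum>p\<in>F. s p *\<^sub>R B (fst p) (snd p)) \<and>
      integral {0..1} (\<lambda>t. speed (w t)) \<le> M + C)" by (elim exE conjE) simp
  show ?thesis
  proof (intro exI[of _ C] conjI allI impI C(1), elim conjE)
    fix v M z
    assume v: "control v" and len: "integral {0..1} (\<lambda>t. speed (v t)) \<le> M"
      and z: "z \<in> span {B x y |x y. x \<in> V \<and> y \<in> V}" and zM: "norm z \<le> K * M"
    have "0 \<le> integral {0..1} (\<lambda>t. speed (v t))"
      using v speed_nonneg by (intro integral_nonneg set_lebesgue_integral_eq_integral(1)[OF speed_integrable]) (auto simp: control_def)
    with len have M: "M \<ge> 0" by linarith
    have "z \<in> span bs" using z span_mono[OF bs(3)] by (auto simp: S_def[symmetric] span_span)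
    then obtain u where u: "z = (\<Sum>b\<in>bs. u b *\<^sub>R b)" using span_finite[OF fin] by auto
    have gz: "g b z = u b" if "b \<in> bs" for b
    proof -
      have "g b z = (\<Sum>x\<in>bs. u x *\<^sub>R g b x)"
        unfolding u using g(1) by (simp add: linear_sum linear_scale)
      also have "\<dots> = (\<Sum>x\<in>bs. if x = b then u x else 0)" using g(2) by (intro sum.cong) auto
      finally show ?thesis using that fin by simp
    qed
    define s where "s p = g (B (fst p) (snd p) /\<^sub>R L) z / L" for p
    have fB: "B (L *\<^sub>R fst (f b)) (snd (f b)) = L *\<^sub>R b" if "b \<in> bs" for b
      using f(2)[OF that] by (simp add: B.scaleR_left)
    have sF: "\<bar>s p\<bar> \<le> M" if "p \<in> F" for p
    proof -
      obtain b where b: "b \<in> bs" "p = (L *\<^sub>R fst (f b), snd (f b))" using \<open>p \<in> F\<close> by (auto simp: F_def)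
      have "\<bar>g b z\<bar> \<le> k b * norm z" using k[of b z] by simp
      also have "\<dots> \<le> \<bar>k b\<bar> * norm z" by (intro mult_right_mono) auto
      also have "\<dots> \<le> \<bar>k b\<bar> * (K * M)" using zM by (simp add: mult_left_mono)
      also have "\<dots> = (K * \<bar>k b\<bar>) * M" by simp
      also have "\<dots> \<le> L * M" using kL[OF b(1)] M by (rule mult_right_mono)
      finally have "\<bar>g b z\<bar> / L \<le> M" using L by (simp add: field_simps)
      then show ?thesis using b fB[OF b(1)] L by (simp add: s_def)
    qed
    have "(\<Sum>p\<in>F. s p *\<^sub>R B (fst p) (snd p)) = (\<Sum>b\<in>bs. s (L *\<^sub>R fst (f b), snd (f b)) *\<^sub>R (L *\<^sub>R b))"
      unfolding F_def by (subst sum.reindex[OF inj]) (auto intro!: sum.cong simp: fB)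
    also have "\<dots> = (\<Sum>b\<in>bs. u b *\<^sub>R b)"
    proof (rule sum.cong[OF refl])
      fix b assume b: "b \<in> bs"
      have "s (L *\<^sub>R fst (f b), snd (f b)) = u b / L"
        using L by (simp add: s_def fB[OF b] gz[OF b])
      then show "s (L *\<^sub>R fst (f b), snd (f b)) *\<^sub>R (L *\<^sub>R b) = u b *\<^sub>R b"
        using L by simp
    qed
    also have "\<dots> = z" using u by simp
    finally have e: "(\<Sum>p\<in>F. s p *\<^sub>R B (fst p) (snd p)) = z" .
    have "control v \<and> integral {0..1} (\<lambda>t. speed (v t)) \<le> M \<and> (\<forall>p\<in>F. \<bar>s p\<bar> \<le> M)"
      using v len sF by blast
    from C(2)[OF this] show "\<exists>w. control w \<and> endpoint w = endpoint v + z \<and> integral {0..1} (\<lambda>t. speed (w t)) \<le> M + C"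
      unfolding e .
  qed
qed

end

section \<open>Replacing a horizontal control by an asymptotic one\<close>

lemma integral_in_subspace:
  fixes f :: "real \<Rightarrow> 'e::euclidean_space"
  assumes S: "subspace S" and f: "(f has_integral I) T" and fS: "\<And>t. t \<in> T \<Longrightarrow> f t \<in> S"
  shows "I \<in> S"
proof -
  obtain y z where yz: "y \<in> span S" "\<And>w. w \<in> span S \<Longrightarrow> orthogonal z w" "I = y + z"
    using orthogonal_subspace_decomp_exists[of S I] by metis
  have "((\<lambda>t. z \<bullet> f t) has_integral z \<bullet> I) T"
    using has_integral_linear[OF f bounded_linear_inner_right] by (simp add: comp_def)
  then have "((\<lambda>t. 0) has_integral z \<bullet> I) T"
  proof (rule has_integral_eq[rotated])
    show "z \<bullet> f t = 0" if "t \<in> T" for t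
      using yz(2)[OF span_base[OF fS[OF that]]] by (simp add: orthogonal_def)
  qed
  then have "z \<bullet> I = 0" by simp
  moreover have "z \<bullet> y = 0" using yz(2)[OF yz(1)] by (simp add: orthogonal_def)
  ultimately have "z = 0" using yz(3) by (simp add: inner_add_right)
  then show ?thesis using yz(1,3) span_eq_iff[THEN iffD2, OF S] by simp
qed

text \<open>\<open>D\<close> is the distribution at the identity, and \<open>R\<close> its metric extended to the whole space;
  \<open>R\<close> may be degenerate outside \<open>D\<close>. In these coordinates \<open>Z\<close> is the derived
  algebra and \<open>V\<close> the horizontal space of the asymptotic metric.\<close>

locale subriemannian_step_two =
  fixes B :: "'e::euclidean_space \<Rightarrow> 'e \<Rightarrow> 'e" and R :: "'e \<Rightarrow> 'e \<Rightarrow> real" and D :: "'e set"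
  assumes B: "bounded_bilinear B" and B_self: "\<And>x. B x x = 0"
    and B_nil: "\<And>x y z. B (B x y) z = 0"
    and R: "bounded_bilinear R" and R_sym: "\<And>x y. R x y = R y x" and R_nonneg: "\<And>x. R x x \<ge> 0"
    and R_pos: "\<And>x. x \<in> D \<Longrightarrow> R x x = 0 \<Longrightarrow> x = 0"
    and D: "subspace D"
    and gen: "\<And>x. \<exists>d\<in>D. x - d \<in> span {B d e |d e. d \<in> D \<and> e \<in> D}"
begin

definition Z :: "'e set" where "Z = span {B x y |x y. True}"
definition W :: "'e set" where "W = D \<inter> Z"
definition V :: "'e set" where "V = {v \<in> D. \<forall>w\<in>W. R v w = 0}"

lemma subspace_Z: "subspace Z" by (simp add: Z_def)
lemma subspace_W: "subspace W" by (simp add: W_def D subspace_Z subspace_inter)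

lemma subspace_V: "subspace V"
proof -
  interpret R: bounded_bilinear R by (rule R)
  show ?thesis
    using D by (auto simp: subspace_def V_def R.add_left R.scaleR_left R.zero_left)
qed

sublocale horizontal_model B R V
  by (intro horizontal_model.intro B B_self R R_sym R_nonneg subspace_V)

lemma B_Z_left: "z \<in> Z \<Longrightarrow> B z x = 0"
  unfolding Z_def
  by (induction rule: span_induct_alt) (auto simp: B.add_left B.scaleR_left B_nil B.zero_left)

lemma B_Z_right: "z \<in> Z \<Longrightarrow> B x z = 0"
  using B_Z_left[of z x] B_anti[of x z] by simp

lemma B_in_Z: "B x y \<in> Z" unfolding Z_def by (rule span_base) auto

text \<open>\<open>R\<close> is definite on \<open>W\<close>, so that representing \<open>R x\<close> on \<open>W\<close> by the
  Euclidean product gives a map \<open>T\<close> which is invertible on \<open>W\<close>; the projection is the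
  composition of \<open>T\<close> with that inverse.\<close>

lemma orthogonal_projection_exists:
  "\<exists>Q. linear Q \<and> (\<forall>x. Q x \<in> W) \<and> (\<forall>x. \<forall>w\<in>W. R (x - Q x) w = 0)"
proof -
  obtain bs where bs: "bs \<subseteq> W" "pairwise orthogonal bs" "\<And>x. x \<in> bs \<Longrightarrow> norm x = 1"
    "independent bs" "card bs = dim W" "span bs = W"
    using orthonormal_basis_subspace[OF subspace_W] by metis
  have fin: "finite bs" using bs(4) independent_bound by blast
  define T where "T x = (\<Sum>b\<in>bs. R x b *\<^sub>R b)" for x
  have linT: "linear T"
    by (rule linearI) (simp_all add: T_def R.add_left R.scaleR_left scaleR_add_left sum.distrib scaleR_sum_right)
  have TW: "T x \<in> W" for x
    unfolding T_def using bs(1) subspace_W by (intro subspace_sum subspace_scale) auto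
  have Tin: "T x \<bullet> w = R x w" if "w \<in> W" for x w
  proof -
    have "w = (\<Sum>b\<in>bs. (w \<bullet> b) *\<^sub>R b)"
    proof -
      obtain u where u: "w = (\<Sum>b\<in>bs. u b *\<^sub>R b)"
        using \<open>w \<in> W\<close> bs(6) span_finite[OF fin] by auto
      have "w \<bullet> b = u b" if "b \<in> bs" for b
      proof -
        have "w \<bullet> b = (\<Sum>c\<in>bs. u c * (c \<bullet> b))" unfolding u by (simp add: inner_sum_left)
        also have "\<dots> = (\<Sum>c\<in>bs. if c = b then u c else 0)"
          using bs(2,3) that by (intro sum.cong) (auto simp: pairwise_def orthogonal_def dot_square_norm)
        finally show ?thesis using fin that by simp
      qed
      then show ?thesis using u by simp
    qed
    then have "R x w = R x (\<Sum>b\<in>bs. (w \<bullet> b) *\<^sub>R b)" by (rule arg_cong)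
    then have "R x w = (\<Sum>b\<in>bs. (w \<bullet> b) * R x b)" by (simp only: R.sum_right R.scaleR_right real_scaleR_def)
    then show ?thesis by (simp add: T_def inner_sum_left inner_sum_right inner_commute mult.commute)
  qed
  have T_inj: "inj_on T W"
  proof (rule linear_inj_on_span_iff_independent_image[THEN iffD2, of T W, THEN _] | rule inj_onI)+
    fix x y assume "x \<in> W" "y \<in> W" "T x = T y"
    then have xy: "x - y \<in> W" "T (x - y) = 0"
      using subspace_W linT by (auto simp: subspace_diff linear_diff)
    then have "R (x - y) (x - y) = 0" using Tin[OF xy(1), of "x - y"] by simp
    then show "x = y" using R_pos[of "x - y"] xy(1) by (simp add: W_def)
  qed
  have "T ` W = W"
  proof (rule subspace_dim_equal)
    show "subspace (T ` W)" by (rule linear_subspace_image[OF linT subspace_W])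
    show "T ` W \<subseteq> W" using TW by auto
    have "dim (T ` W) = dim W"
      using T_inj by (intro dim_image_eq[OF linT]) (simp add: span_eq_iff[THEN iffD2, OF subspace_W])
    then show "dim W \<le> dim (T ` W)" by simp
  qed (rule subspace_W)
  then have "\<exists>w\<in>W. T w = T x" for x using TW[of x] by (metis imageE)
  then obtain Q where Q: "\<And>x. Q x \<in> W" "\<And>x. T (Q x) = T x" by metis
  have "linear Q"
  proof (rule linearI)
    show "Q (x + y) = Q x + Q y" for x y
      using T_inj by (rule inj_onD) (use Q subspace_W linT in \<open>auto simp: subspace_add linear_add\<close>)
    show "Q (r *\<^sub>R x) = r *\<^sub>R Q x" for r x
      using T_inj by (rule inj_onD) (use Q subspace_W linT in \<open>auto simp: subspace_scale linear_scale\<close>)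
  qed
  moreover have "R (x - Q x) w = 0" if "w \<in> W" for x w
    using Tin[OF that, of "x - Q x"] Q(2)[of x] linT by (simp add: linear_diff)
  ultimately show ?thesis using Q by blast
qed

definition Q :: "'e \<Rightarrow> 'e" where
  "Q = (SOME Q. linear Q \<and> (\<forall>x. Q x \<in> W) \<and> (\<forall>x. \<forall>w\<in>W. R (x - Q x) w = 0))"

lemma Q: "linear Q" "Q x \<in> W" "w \<in> W \<Longrightarrow> R (x - Q x) w = 0"
  using someI_ex[OF orthogonal_projection_exists] unfolding Q_def by blast+

lemma Q_V: "x \<in> D \<Longrightarrow> x - Q x \<in> V"
  using Q D by (auto simp: V_def W_def subspace_diff)

lemma speed_Q: "speed (x - Q x) \<le> speed x"
proof -
  have "R x x = R ((x - Q x) + Q x) ((x - Q x) + Q x)" by simp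
  also have "\<dots> = R (x - Q x) (x - Q x) + R (Q x) (Q x)"
    unfolding R.add_left R.add_right
    using Q(3)[OF Q(2), of x x] R_sym[of "Q x" "x - Q x"] by simp
  finally show ?thesis unfolding speed_def using R_nonneg[of "Q x"] by simp
qed

text \<open>Modifying the arguments by central vectors does not change a bracket. Modulo \<open>Z\<close> every vector lies in
  \<open>D\<close> by the generating condition, and then even in \<open>V\<close>.\<close>

lemma Z_eq: "Z = span {B x y |x y. x \<in> V \<and> y \<in> V}"
proof -
  let ?S = "{B x y |x y. x \<in> V \<and> y \<in> V}"
  have DZ: "B x y = B d e" if "x - d \<in> Z" "y - e \<in> Z" for x y d e
  proof -
    have "B x y = B ((x - d) + d) ((y - e) + e)" by simp
    then show ?thesis unfolding B.add_left B.add_right using that B_Z_left B_Z_right by simp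
  qed
  have "{B d e |d e. d \<in> D \<and> e \<in> D} \<subseteq> {B x y |x y. True}" by auto
  then have gen': "\<exists>d\<in>D. x - d \<in> Z" for x
    using gen[of x] span_mono unfolding Z_def by blast
  have "B x y \<in> ?S" for x y
  proof -
    obtain d e where de: "d \<in> D" "x - d \<in> Z" "e \<in> D" "y - e \<in> Z" using gen' by metis
    have "B x y = B d e" using de by (intro DZ) auto
    also have "\<dots> = B (d - Q d) (e - Q e)" using Q(2) by (intro DZ) (auto simp: W_def)
    finally show ?thesis using Q_V de by blast
  qed
  then have "{B x y |x y. True} \<subseteq> ?S" by blast
  then have "{B x y |x y. True} = ?S" by auto
  then show ?thesis unfolding Z_def by simp
qed

lemma decompose: "\<exists>v\<in>V. x - v \<in> Z"
proof -
  obtain d where d: "d \<in> D" "x - d \<in> span {B d e |d e. d \<in> D \<and> e \<in> D}" using gen by blast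
  have "span {B d e |d e. d \<in> D \<and> e \<in> D} \<subseteq> Z" unfolding Z_def by (rule span_mono) auto
  then have "(x - d) + Q d \<in> Z" using d Q(2)[of d] by (intro subspace_add[OF subspace_Z]) (auto simp: W_def)
  then show ?thesis using Q_V[OF d(1)] by (intro bexI[of _ "d - Q d"]) (auto simp: algebra_simps)
qed

text \<open>\<open>R\<close> is positive on the compact unit sphere of \<open>D\<close>.\<close>

lemma norm_le_speed: "\<exists>K\<ge>0. \<forall>x\<in>D. norm x \<le> K * speed x"
proof (cases "D \<subseteq> {0}")
  case True
  then show ?thesis using speed_nonneg by (intro exI[of _ 0]) auto
next
  case False
  define S where "S = D \<inter> sphere 0 1"
  have "compact S" unfolding S_def using closed_subspace[OF D] by (intro closed_Int_compact) auto
  moreover have "S \<noteq> {}"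
  proof -
    obtain x where "x \<in> D" "x \<noteq> 0" using False by blast
    then have "x /\<^sub>R norm x \<in> S" using D by (auto simp: S_def subspace_scale)
    then show ?thesis by blast
  qed
  ultimately have "\<exists>x0\<in>S. \<forall>x\<in>S. speed x0 \<le> speed x"
    by (intro continuous_attains_inf continuous_on_speed)
  then obtain x0 where x0: "x0 \<in> S" "\<And>x. x \<in> S \<Longrightarrow> speed x0 \<le> speed x" by blast
  have sp: "speed x0 > 0"
  proof -
    have "x0 \<in> D" "x0 \<noteq> 0" using x0(1) by (auto simp: S_def)
    then have "R x0 x0 > 0" using R_pos R_nonneg[of x0] by force
    then show ?thesis by (simp add: speed_def)
  qed
  show ?thesis
  proof (intro exI[of _ "1 / speed x0"] conjI ballI)
    show "0 \<le> 1 / speed x0" using sp by simp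
    fix x assume x: "x \<in> D"
    show "norm x \<le> 1 / speed x0 * speed x"
    proof (cases "x = 0")
      case True then show ?thesis by (simp add: speed_def R.zero_left)
    next
      case False
      then have "x /\<^sub>R norm x \<in> S" using D x by (auto simp: S_def subspace_scale)
      then have "speed x0 \<le> speed (x /\<^sub>R norm x)" by (rule x0(2))
      also have "\<dots> = speed x / norm x"
        using False by (simp add: speed_def R.scaleR_left R.scaleR_right real_sqrt_mult divide_inverse)
      finally show ?thesis using False sp by (simp add: field_simps)
    qed
  qed
qed

text \<open>A constant control reaches every element of \<open>V\<close>; its endpoint is then corrected by a central vector.\<close>

lemma reachable: "\<exists>w. control w \<and> endpoint w = x"
proof -
  obtain v where v: "v \<in> V" "x - v \<in> Z" using decompose by blast
  have c: "control (\<lambda>t. v)" using v by (simp add: control_def absolutely_integrable_on_const)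
  have "endpoint (\<lambda>t. v) = v"
    unfolding endpoint_def by (simp add: B.scaleR_left B_self)
  moreover obtain C where "C \<ge> 0" and C: "\<And>u M z. control u \<and> integral {0..1} (\<lambda>t. speed (u t)) \<le> M \<and>
      z \<in> span {B x y |x y. x \<in> V \<and> y \<in> V} \<and> norm z \<le> 1 * M \<Longrightarrow>
    (\<exists>w. control w \<and> endpoint w = endpoint u + z \<and> integral {0..1} (\<lambda>t. speed (w t)) \<le> M + C)"
    using central_shift[OF zero_le_one] by (elim exE conjE) simp
  from C[of "\<lambda>t. v" "speed v + norm (x - v)" "x - v"]
  obtain w where "control w" "endpoint w = endpoint (\<lambda>t. v) + (x - v)"
    using c v(2) speed_nonneg[of v] by (auto simp: Z_eq)
  ultimately show ?thesis by (intro exI[of _ w]) simp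
qed

text \<open>Projecting a control \<open>c\<close> to \<open>V\<close> does not increase its speed. The component \<open>Q
  c\<close> that is dropped is central, so that the endpoint changes by the central vector \<open>\<integral> Q
  c\<close> only. Its norm is at most a multiple of the length of \<open>c\<close>, and \<open>central_shift\<close>
  restores it at a bounded cost. The interval is arbitrary because the two points whose distance is measured need not be
  the ends of the curve; outside of it the new control rests.\<close>

theorem horizontal_replacement:
  "\<exists>C\<ge>0. \<forall>(a::real) b c X. 0 \<le> a \<and> a \<le> b \<and> b \<le> 1 \<and> c absolutely_integrable_on {a..b} \<and> (\<forall>t\<in>{a..b}. c t \<in> D) \<and>
      (\<forall>t\<in>{a..b}. ((\<lambda>t. c t + (1/2) *\<^sub>R B (X t) (c t)) has_integral X t) {a..t}) \<longrightarrow>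
    (\<exists>w. control w \<and> endpoint w = X b \<and>
      integral {0..1} (\<lambda>t. speed (w t)) \<le> integral {a..b} (\<lambda>t. speed (c t)) + C)"
proof -
  obtain K1 where K1: "K1 \<ge> 0" "\<And>x. x \<in> D \<Longrightarrow> norm x \<le> K1 * speed x" using norm_le_speed by blast
  obtain K3 where K3: "\<forall>x. norm (Q x) \<le> K3 * norm x" using linear_bounded[OF Q(1)] by (elim exE) simp
  define K2 where "K2 = \<bar>K3\<bar> + 1"
  have K2: "K2 > 0" "norm (Q x) \<le> K2 * norm x" for x
    using order_trans[OF K3[rule_format, of x] mult_right_mono[of K3 K2 "norm x"]] by (auto simp: K2_def)
  define K where "K = K2 * K1"
  have K0: "K \<ge> 0" using K1 K2 by (simp add: K_def)
  have K: "norm (Q x) \<le> K * speed x" if "x \<in> D" for x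
  proof -
    have "norm (Q x) \<le> K2 * norm x" by (rule K2(2))
    also have "\<dots> \<le> K2 * (K1 * speed x)" using K2(1) K1(2)[OF that] by (intro mult_left_mono) auto
    finally show ?thesis by (simp add: K_def)
  qed
  obtain C where C: "C \<ge> 0" "\<And>v M z. control v \<and> integral {0..1} (\<lambda>t. speed (v t)) \<le> M \<and>
      z \<in> span {B x y |x y. x \<in> V \<and> y \<in> V} \<and> norm z \<le> K * M \<Longrightarrow>
    (\<exists>w. control w \<and> endpoint w = endpoint v + z \<and> integral {0..1} (\<lambda>t. speed (w t)) \<le> M + C)"
    using central_shift[OF K0] by (elim exE conjE) simp
  show ?thesis
  proof (intro exI[of _ C] conjI allI impI C(1))
    fix a b :: real and c X :: "real \<Rightarrow> 'e"
    assume hyp: "0 \<le> a \<and> a \<le> b \<and> b \<le> 1 \<and> c absolutely_integrable_on {a..b} \<and> (\<forall>t\<in>{a..b}. c t \<in> D) \<and>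
      (\<forall>t\<in>{a..b}. ((\<lambda>t. c t + (1/2) *\<^sub>R B (X t) (c t)) has_integral X t) {a..t})"
    then have ab: "0 \<le> a" "a \<le> b" "b \<le> 1" and ca: "c absolutely_integrable_on {a..b}"
      and cD: "\<forall>t\<in>{a..b}. c t \<in> D"
      and X: "\<forall>t\<in>{a..b}. ((\<lambda>t. c t + (1/2) *\<^sub>R B (X t) (c t)) has_integral X t) {a..t}" by auto
    define v where "v t = (if t \<in> {a..b} then c t - Q (c t) else 0)" for t
    have Qb: "bounded_linear Q" using Q(1) by (simp add: linear_conv_bounded_linear)
    have Qca: "(\<lambda>t. Q (c t)) absolutely_integrable_on {a..b}"
      using absolutely_integrable_linear[OF ca Qb] by (simp add: comp_def)
    have cQa: "(\<lambda>t. c t - Q (c t)) absolutely_integrable_on {a..b}"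
      using ca Qca by (rule set_integral_diff(1))
    have restr: "(\<lambda>t. if t \<in> {a..b} then f t else 0) absolutely_integrable_on {0..1}"
      if "f absolutely_integrable_on {a..b}" for f :: "real \<Rightarrow> 'b::euclidean_space"
    proof -
      have "(\<lambda>t. if t \<in> {a..b} then f t else 0) absolutely_integrable_on UNIV"
        using that absolutely_integrable_restrict_UNIV by blast
      then show ?thesis by (rule absolutely_integrable_on_subinterval) simp
    qed
    have restr_int: "integral {0..t} (\<lambda>t. if t \<in> {a..b} then f t else 0) = integral {a..t} f" if "t \<in> {a..b}"
      for f :: "real \<Rightarrow> 'b::euclidean_space" and t
    proof -
      have "integral {0..t} (\<lambda>t. if t \<in> {a..t'} then f t else 0) = integral ({a..t'} \<inter> {0..t}) f" for t'
        using integral_restrict_Int[of "{0..t}" "{a..t'}" f] by (simp add: Int_commute)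
      from this[of b] show ?thesis using that ab by (cases "t = b") (auto simp: max_def min_def)
    qed
    have restr_int1: "integral {0..1} (\<lambda>t. if t \<in> {a..b} then f t else 0) = integral {a..b} f"
      for f :: "real \<Rightarrow> 'b::euclidean_space"
      using integral_restrict_Int[of "{0..1}" "{a..b}" f] ab by (simp add: Int_commute max_def min_def)
    have va: "v absolutely_integrable_on {0..1}" unfolding v_def[abs_def] by (rule restr[OF cQa])
    have vV: "v t \<in> V" for t
      using Q_V cD subspace_0[OF subspace_V] by (auto simp: v_def)
    have ctrl: "control v" using va vV by (auto simp: control_def)
    define Y where "Y t = integral {a..t} (\<lambda>t. c t - Q (c t))" for t
    have ii: "f integrable_on S" if "f absolutely_integrable_on S" for f :: "real \<Rightarrow> 'b::euclidean_space" and S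
      using that set_lebesgue_integral_eq_integral(1) by blast
    have vY: "integral {0..t} v = Y t" if "t \<in> {a..b}" for t
      unfolding v_def[abs_def] Y_def by (rule restr_int[OF that])
    have XY: "X t - Y t \<in> Z" if "t \<in> {a..b}" for t
    proof -
      have "((\<lambda>t. c t - Q (c t)) has_integral Y t) {a..t}"
        unfolding Y_def using that integrable_on_subinterval[OF ii[OF cQa], of a t] by (intro integrable_integral) auto
      then have "((\<lambda>t. (c t + (1/2) *\<^sub>R B (X t) (c t)) - (c t - Q (c t))) has_integral X t - Y t) {a..t}"
        using X that by (intro has_integral_diff) auto
      then show ?thesis
      proof (rule integral_in_subspace[OF subspace_Z])
        show "(c s + (1/2) *\<^sub>R B (X s) (c s)) - (c s - Q (c s)) \<in> Z" for s
          using subspace_add[OF subspace_Z subspace_scale[OF subspace_Z B_in_Z, of "1/2" "X s" "c s"], of "Q (c s)"] Q(2)[of "c s"]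
          by (simp add: W_def)
      qed
    qed
    have BXY: "B (X t) (c t) = B (Y t) (c t - Q (c t))" if "t \<in> {a..b}" for t
    proof -
      have "B (X t) (c t) = B ((X t - Y t) + Y t) ((c t - Q (c t)) + Q (c t))" by simp
      then show ?thesis unfolding B.add_left B.add_right using XY[OF that] B_Z_left B_Z_right Q(2)[of "c t"] by (simp add: W_def)
    qed
    define z where "z = integral {a..b} (\<lambda>t. Q (c t))"
    have z: "z \<in> Z"
      by (rule integral_in_subspace[OF subspace_Z integrable_integral[OF ii[OF Qca]], folded z_def])
         (use Q(2) in \<open>auto simp: W_def\<close>)
    have Yc: "continuous_on {a..b} Y" unfolding Y_def[abs_def] by (rule indefinite_integral_continuous_on[OF cQa])
    have BYi: "((\<lambda>t. B (Y t) (c t - Q (c t))) has_integral integral {a..b} (\<lambda>t. B (Y t) (c t - Q (c t)))) {a..b}"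
      by (intro integrable_integral ii absolutely_integrable_bilinear_continuous[OF B Yc cQa])
    have ep: "endpoint v = Y b + (1/2) *\<^sub>R integral {a..b} (\<lambda>t. B (Y t) (c t - Q (c t)))"
    proof -
      have "integral {0..1} (\<lambda>t. B (integral {0..t} v) (v t))
          = integral {0..1} (\<lambda>t. if t \<in> {a..b} then B (Y t) (c t - Q (c t)) else 0)"
        by (rule integral_cong) (auto simp: vY v_def B.zero_right)
      moreover have "integral {0..1} v = Y b"
        unfolding v_def[abs_def] Y_def by (rule restr_int1)
      ultimately show ?thesis unfolding endpoint_def by (simp only: restr_int1)
    qed
    have Xb: "X b = endpoint v + z"
    proof -
      have h1: "((\<lambda>t. (c t - Q (c t)) + Q (c t) + (1/2) *\<^sub>R B (Y t) (c t - Q (c t))) has_integral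
          (Y b + z + (1/2) *\<^sub>R integral {a..b} (\<lambda>t. B (Y t) (c t - Q (c t))))) {a..b}"
        unfolding Y_def z_def
        by (intro has_integral_add has_integral_cmul BYi[unfolded Y_def] integrable_integral ii cQa Qca)
      have "((\<lambda>t. c t + (1/2) *\<^sub>R B (X t) (c t)) has_integral X b) {a..b}" using X ab by auto
      then have h2: "((\<lambda>t. (c t - Q (c t)) + Q (c t) + (1/2) *\<^sub>R B (Y t) (c t - Q (c t))) has_integral X b) {a..b}"
        by (rule has_integral_eq[rotated]) (simp add: BXY)
      show ?thesis unfolding ep has_integral_unique[OF h2 h1] by (simp add: algebra_simps)
    qed
    define M where "M = integral {a..b} (\<lambda>t. speed (c t))"
    have spc: "(\<lambda>t. speed (c t)) integrable_on {a..b}" by (rule ii[OF speed_integrable[OF ca]])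
    have len: "integral {0..1} (\<lambda>t. speed (v t)) \<le> M"
    proof -
      have "integral {0..1} (\<lambda>t. speed (v t)) = integral {0..1} (\<lambda>t. if t \<in> {a..b} then speed (c t - Q (c t)) else 0)"
        by (rule integral_cong) (auto simp: v_def speed_def R.zero_left)
      also have "\<dots> = integral {a..b} (\<lambda>t. speed (c t - Q (c t)))" by (rule restr_int1)
      also have "\<dots> \<le> M"
        unfolding M_def by (intro integral_le ii[OF speed_integrable[OF cQa]] spc speed_Q)
      finally show ?thesis .
    qed
    have zM: "norm z \<le> K * M"
    proof -
      have "norm z \<le> integral {a..b} (\<lambda>t. K * speed (c t))"
        unfolding z_def using K cD by (intro integral_norm_bound_integral ii[OF Qca] integrable_on_mult_right spc) auto
      then show ?thesis by (simp add: M_def)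
    qed
    show "\<exists>w. control w \<and> endpoint w = X b \<and>
      integral {0..1} (\<lambda>t. speed (w t)) \<le> integral {a..b} (\<lambda>t. speed (c t)) + C"
      unfolding Xb M_def[symmetric] using ctrl len z zM by (intro C(2)) (auto simp: Z_eq[symmetric])
  qed
qed

end

section \<open>Smooth functions\<close>

lemma Ck_on_subset: "Ck_on k S f \<Longrightarrow> T \<subseteq> S \<Longrightarrow> Ck_on k T f"
  by (induction k arbitrary: f) (auto intro: continuous_on_subset)

lemma Ck_on_cong:
  assumes "open S" "\<And>x. x \<in> S \<Longrightarrow> f x = g x" "Ck_on k S f"
  shows "Ck_on k S g"
  using assms(2,3)
proof (induction k arbitrary: f g)
  case 0
  then show ?case using continuous_on_cong[of S S f g] by simp
next
  case (Suc k)
  have hd: "(g has_derivative frechet_derivative f (at x)) (at x)" if "x \<in> S" for x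
  proof (rule has_derivative_transform_within_open[OF _ \<open>open S\<close> that])
    show "(f has_derivative frechet_derivative f (at x)) (at x)"
      using Suc.prems(2) that by (simp add: frechet_derivative_works)
  qed (use Suc.prems(1) in auto)
  show ?case
    unfolding Ck_on.simps
  proof (intro conjI ballI allI)
    show "g differentiable (at x)" if "x \<in> S" for x
      using hd[OF that] by (auto simp: differentiable_def)
    fix v
    show "Ck_on k S (\<lambda>x. frechet_derivative g (at x) v)"
    proof (rule Suc.IH[where f="\<lambda>x. frechet_derivative f (at x) v"])
      show "frechet_derivative f (at x) v = frechet_derivative g (at x) v" if "x \<in> S" for x
        using frechet_derivative_at[OF hd[OF that]] by simp
      show "Ck_on k S (\<lambda>x. frechet_derivative f (at x) v)" using Suc.prems(2) by simp
    qed
  qed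
qed

lemma Ck_onI:
  assumes "open S" "\<And>x. x \<in> S \<Longrightarrow> (f has_derivative f' x) (at x)" "\<And>v. Ck_on k S (\<lambda>x. f' x v)"
  shows "Ck_on (Suc k) S f"
  unfolding Ck_on.simps
proof (intro conjI allI ballI)
  show "f differentiable (at x)" if "x \<in> S" for x using assms(2)[OF that] by (auto simp: differentiable_def)
  have "f' x = frechet_derivative f (at x)" if "x \<in> S" for x using assms(2)[OF that] by (rule frechet_derivative_at)
  then show "Ck_on k S (\<lambda>x. frechet_derivative f (at x) v)" for v
    by (intro Ck_on_cong[OF assms(1) _ assms(3)[of v]]) simp
qed

lemma Ck_onD:
  assumes "Ck_on (Suc k) S f" "x \<in> S"
  shows "(f has_derivative frechet_derivative f (at x)) (at x)"
  using assms by (simp add: frechet_derivative_works)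

lemma Ck_on_Suc_imp: "Ck_on (Suc k) S f \<Longrightarrow> Ck_on k S f"
proof (induction k arbitrary: f)
  case 0
  then show ?case by (auto intro!: continuous_at_imp_continuous_on differentiable_imp_continuous_within)
next
  case (Suc k)
  then show ?case by (simp only: Ck_on.simps) blast
qed

lemma Ck_on_le: "j \<le> k \<Longrightarrow> Ck_on k S f \<Longrightarrow> Ck_on j S f"
  by (rule inc_induct[where P="\<lambda>k. Ck_on k S f"]) (assumption | erule Ck_on_Suc_imp)+

lemma Ck_on_const: "open S \<Longrightarrow> Ck_on k S (\<lambda>x. c)"
proof (induction k arbitrary: c)
  case (Suc k)
  show ?case by (rule Ck_onI[OF Suc.prems has_derivative_const Suc.IH[OF Suc.prems]])
qed simp

lemma Ck_on_bounded_linear_compose: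
  assumes L: "bounded_linear L" and "open S"
  shows "Ck_on k S f \<Longrightarrow> Ck_on k S (\<lambda>x. L (f x))"
proof (induction k arbitrary: f)
  case 0
  then show ?case using bounded_linear.continuous_on[OF L] by auto
next
  case (Suc k)
  show ?case
    by (rule Ck_onI[OF \<open>open S\<close> bounded_linear.has_derivative[OF L Ck_onD[OF Suc.prems]] Suc.IH])
       (use Suc.prems in auto)
qed

lemma Ck_on_bounded_linear:
  assumes L: "bounded_linear L" and "open S"
  shows "Ck_on k S L"
proof (cases k)
  case 0
  then show ?thesis using bounded_linear.continuous_on[OF L continuous_on_id] by simp
next
  case (Suc m)
  show ?thesis unfolding Suc
    by (rule Ck_onI[OF \<open>open S\<close> bounded_linear_imp_has_derivative[OF L] Ck_on_const[OF \<open>open S\<close>]])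
qed

lemma Ck_on_add:
  assumes "open S"
  shows "Ck_on k S f \<Longrightarrow> Ck_on k S g \<Longrightarrow> Ck_on k S (\<lambda>x. f x + g x)"
proof (induction k arbitrary: f g)
  case 0
  then show ?case by (auto intro: continuous_intros)
next
  case (Suc k)
  show ?case
    by (rule Ck_onI[OF assms has_derivative_add[OF Ck_onD[OF Suc.prems(1)] Ck_onD[OF Suc.prems(2)]] Suc.IH])
       (use Suc.prems in auto)
qed

lemma Ck_on_sum:
  assumes "open S" "\<And>i. i \<in> I \<Longrightarrow> Ck_on k S (f i)"
  shows "Ck_on k S (\<lambda>x. \<Sum>i\<in>I. f i x)"
  using assms by (induction I rule: infinite_finite_induct) (auto intro: Ck_on_const Ck_on_add)

lemma Ck_on_bilinear:
  assumes "open S" and h: "bounded_bilinear h"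
  shows "Ck_on k S f \<Longrightarrow> Ck_on k S g \<Longrightarrow> Ck_on k S (\<lambda>x. h (f x) (g x))"
proof (induction k arbitrary: f g)
  case 0
  then show ?case by (auto intro: bounded_bilinear.continuous_on[OF h])
next
  case (Suc k)
  have "Ck_on k S f" "Ck_on k S g" using Suc.prems Ck_on_Suc_imp by blast+
  then show ?case
    by (intro Ck_onI[OF assms(1) bounded_bilinear.FDERIV[OF h Ck_onD[OF Suc.prems(1)] Ck_onD[OF Suc.prems(2)]]]
          Ck_on_add[OF assms(1)] Suc.IH)
       (use Suc.prems in auto)
qed

lemma linear_basis_expansion:
  fixes L :: "'a::euclidean_space \<Rightarrow> 'b::real_vector"
  assumes "linear L"
  shows "L v = (\<Sum>i\<in>Basis. (v \<bullet> i) *\<^sub>R L i)"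
proof -
  have "L v = L (\<Sum>i\<in>Basis. (v \<bullet> i) *\<^sub>R i)" by (simp add: euclidean_representation)
  then show ?thesis using assms by (simp add: linear_sum linear_scale)
qed

text \<open>The derivative of \<open>g\<close> composed with that of \<open>f\<close> is expanded in the standard basis, in order
  to have the directions of differentiation constant.\<close>

lemma Ck_on_compose:
  fixes f :: "'a::real_normed_vector \<Rightarrow> 'b::euclidean_space" and g :: "'b \<Rightarrow> 'c::real_normed_vector"
  assumes "open S" "open T" "f ` S \<subseteq> T"
  shows "Ck_on k S f \<Longrightarrow> Ck_on k T g \<Longrightarrow> Ck_on k S (\<lambda>x. g (f x))"
proof (induction k arbitrary: g)
  case 0
  then show ?case using assms by (auto intro: continuous_on_compose2)
next
  case (Suc k)
  have fk: "Ck_on k S f" using Suc.prems Ck_on_Suc_imp by blast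
  show ?case
  proof (rule Ck_onI[OF \<open>open S\<close>])
    fix x assume x: "x \<in> S"
    then have "f x \<in> T" using assms by auto
    then have "linear (frechet_derivative g (at (f x)))"
      using Ck_onD[OF Suc.prems(2)] by (blast intro: has_derivative_linear)
    moreover have "((\<lambda>x. g (f x)) has_derivative (\<lambda>v. frechet_derivative g (at (f x)) (frechet_derivative f (at x) v))) (at x)"
      using Ck_onD[OF Suc.prems(2) \<open>f x \<in> T\<close>] Ck_onD[OF Suc.prems(1) x]
      by (rule has_derivative_compose[rotated])
    ultimately show "((\<lambda>x. g (f x)) has_derivative (\<lambda>v. \<Sum>i\<in>Basis. (frechet_derivative f (at x) v \<bullet> i) *\<^sub>R frechet_derivative g (at (f x)) i)) (at x)"
      by (simp add: linear_basis_expansion[symmetric])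
  next
    fix v
    show "Ck_on k S (\<lambda>x. \<Sum>i\<in>Basis. (frechet_derivative f (at x) v \<bullet> i) *\<^sub>R frechet_derivative g (at (f x)) i)"
      by (intro Ck_on_sum \<open>open S\<close> Ck_on_bilinear[OF \<open>open S\<close> bounded_bilinear_scaleR]
          Ck_on_bounded_linear_compose[OF bounded_linear_inner_left \<open>open S\<close>] Suc.IH)
         (use Suc.prems fk in auto)
  qed
qed

lemma smooth_on_subset: "smooth_on S f \<Longrightarrow> T \<subseteq> S \<Longrightarrow> smooth_on T f"
  unfolding smooth_on_def by (blast intro: Ck_on_subset)

lemma smooth_on_cong: "open S \<Longrightarrow> (\<And>x. x \<in> S \<Longrightarrow> f x = g x) \<Longrightarrow> smooth_on S f \<Longrightarrow> smooth_on S g"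
  unfolding smooth_on_def by (blast intro: Ck_on_cong)

lemma smooth_on_const: "open S \<Longrightarrow> smooth_on S (\<lambda>x. c)"
  unfolding smooth_on_def by (blast intro: Ck_on_const)

lemma smooth_on_bounded_linear: "bounded_linear L \<Longrightarrow> open S \<Longrightarrow> smooth_on S L"
  unfolding smooth_on_def by (blast intro: Ck_on_bounded_linear)

lemma smooth_on_bounded_linear_compose:
  "bounded_linear L \<Longrightarrow> open S \<Longrightarrow> smooth_on S f \<Longrightarrow> smooth_on S (\<lambda>x. L (f x))"
  unfolding smooth_on_def by (blast intro: Ck_on_bounded_linear_compose)

lemma smooth_on_add:
  "open S \<Longrightarrow> smooth_on S f \<Longrightarrow> smooth_on S g \<Longrightarrow> smooth_on S (\<lambda>x. f x + g x)"
  unfolding smooth_on_def by (blast intro: Ck_on_add)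

lemma smooth_on_bilinear:
  "open S \<Longrightarrow> bounded_bilinear h \<Longrightarrow> smooth_on S f \<Longrightarrow> smooth_on S g \<Longrightarrow> smooth_on S (\<lambda>x. h (f x) (g x))"
  unfolding smooth_on_def by (blast intro: Ck_on_bilinear)

lemma smooth_on_sum:
  "open S \<Longrightarrow> (\<And>i. i \<in> I \<Longrightarrow> smooth_on S (f i)) \<Longrightarrow> smooth_on S (\<lambda>x. \<Sum>i\<in>I. f i x)"
  unfolding smooth_on_def by (blast intro: Ck_on_sum)

lemma smooth_on_mult:
  fixes f g :: "'a::real_normed_vector \<Rightarrow> real"
  shows "open S \<Longrightarrow> smooth_on S f \<Longrightarrow> smooth_on S g \<Longrightarrow> smooth_on S (\<lambda>x. f x * g x)"
  by (rule smooth_on_bilinear[OF _ bounded_bilinear_mult])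

lemma smooth_on_compose:
  fixes f :: "'a::real_normed_vector \<Rightarrow> 'b::euclidean_space" and g :: "'b \<Rightarrow> 'c::real_normed_vector"
  shows "open S \<Longrightarrow> open T \<Longrightarrow> f ` S \<subseteq> T \<Longrightarrow> smooth_on S f \<Longrightarrow> smooth_on T g \<Longrightarrow> smooth_on S (\<lambda>x. g (f x))"
  unfolding smooth_on_def by (blast intro: Ck_on_compose)

lemma smooth_on_id: "open S \<Longrightarrow> smooth_on S (\<lambda>x. x)"
  by (rule smooth_on_bounded_linear[OF bounded_linear_ident])

lemma smooth_on_Pair:
  assumes "open S" "smooth_on S f" "smooth_on S g"
  shows "smooth_on S (\<lambda>x. (f x, g x))"
proof -
  have "bounded_linear (\<lambda>y::'b. (y, 0::'c))" "bounded_linear (\<lambda>z::'c. (0::'b, z))"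
    by (auto intro!: bounded_linear_Pair bounded_linear_ident bounded_linear_zero)
  then have "smooth_on S (\<lambda>x. (f x, 0) + (0, g x))"
    using assms by (intro smooth_on_add smooth_on_bounded_linear_compose[where L="\<lambda>y. (y, 0)"]
        smooth_on_bounded_linear_compose[where L="\<lambda>z. (0, z)"]) auto
  then show ?thesis by simp
qed

lemma smooth_on_has_derivative:
  assumes "smooth_on S f" "x \<in> S"
  shows "(f has_derivative frechet_derivative f (at x)) (at x)"
  using assms Ck_onD[of 0 S f x] unfolding smooth_on_def by blast

lemma smooth_on_continuous_on: "smooth_on S f \<Longrightarrow> continuous_on S f"
  unfolding smooth_on_def by (metis Ck_on.simps(1))

lemma smooth_on_frechet_derivative:
  assumes "smooth_on S f" shows "smooth_on S (\<lambda>x. frechet_derivative f (at x) v)"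
  unfolding smooth_on_def
proof
  fix k
  have "Ck_on (Suc k) S f" using assms by (simp add: smooth_on_def)
  then show "Ck_on k S (\<lambda>x. frechet_derivative f (at x) v)" by simp
qed

text \<open>The partial derivatives are bounded on a compact ball.\<close>

lemma smooth_on_imp_locally_lipschitz:
  fixes f :: "'a::euclidean_space \<Rightarrow> 'b::real_normed_vector"
  assumes "smooth_on S f" "open S" "x \<in> S"
  shows "\<exists>r>0. \<exists>K\<ge>0. cball x r \<subseteq> S \<and>
    (\<forall>y\<in>cball x r. \<forall>z\<in>cball x r. norm (f y - f z) \<le> K * norm (y - z))"
proof -
  obtain r where r: "r > 0" "cball x r \<subseteq> S" using assms(2,3) open_contains_cball by blast
  let ?D = "\<lambda>y. \<Sum>i\<in>Basis. norm (frechet_derivative f (at y) i)"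
  have "continuous_on S ?D"
    using assms(1) by (intro continuous_intros smooth_on_continuous_on smooth_on_frechet_derivative)
  then have "continuous_on (cball x r) ?D" using r(2) by (rule continuous_on_subset)
  then have "bounded (?D ` cball x r)" by (intro compact_imp_bounded compact_continuous_image) auto
  then obtain K where K: "\<forall>y\<in>cball x r. norm (?D y) \<le> K" by (auto simp: bounded_iff)
  have D0: "?D y \<ge> 0" for y by (simp add: sum_nonneg)
  have K': "?D y \<le> K" if "y \<in> cball x r" for y using K that D0[of y] by force
  have "K \<ge> 0" using K'[of x] D0[of x] r(1) by simp
  have on: "onorm (frechet_derivative f (at y)) \<le> K" if "y \<in> cball x r" for y
  proof (rule onorm_bound[OF \<open>K \<ge> 0\<close>])
    fix v
    have "linear (frechet_derivative f (at y))"
      using smooth_on_has_derivative[OF assms(1)] that r(2) by (blast intro: has_derivative_linear)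
    then have "norm (frechet_derivative f (at y) v) = norm (\<Sum>i\<in>Basis. (v \<bullet> i) *\<^sub>R frechet_derivative f (at y) i)"
      by (subst linear_basis_expansion) simp_all
    also have "\<dots> \<le> (\<Sum>i\<in>Basis. norm ((v \<bullet> i) *\<^sub>R frechet_derivative f (at y) i))" by (rule norm_sum)
    also have "\<dots> \<le> (\<Sum>i\<in>Basis. norm v * norm (frechet_derivative f (at y) i))"
      by (intro sum_mono) (auto intro!: mult_right_mono simp: Basis_le_norm)
    also have "\<dots> = ?D y * norm v" by (simp add: sum_distrib_left mult.commute)
    also have "\<dots> \<le> K * norm v" using K'[OF that] by (intro mult_right_mono) auto
    finally show "norm (frechet_derivative f (at y) v) \<le> K * norm v" .
  qed
  show ?thesis
  proof (rule exI[of _ r], rule conjI[OF r(1)], rule exI[of _ K], intro conjI ballI r(2) \<open>K \<ge> 0\<close>)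
    fix y z assume yz: "y \<in> cball x r" "z \<in> cball x r"
    show "norm (f y - f z) \<le> K * norm (y - z)"
    proof (rule differentiable_bound[OF convex_cball[of x r] _ on])
      show "(f has_derivative frechet_derivative f (at w)) (at w within cball x r)" if "w \<in> cball x r" for w
        using smooth_on_has_derivative[OF assms(1), of w] that r(2) has_derivative_at_withinI by blast
    qed (use yz in auto)
  qed
qed

text \<open>The mean value theorem, in the direction of \<open>u\<close> for the difference in the direction of \<open>v\<close>,
  and then in the direction of \<open>v\<close>.\<close>

lemma second_difference_mean_value:
  fixes F :: "'a::real_normed_vector \<Rightarrow> real"
  assumes F: "smooth_on S F" and s: "s > 0"
    and sub: "\<And>a b. 0 \<le> a \<Longrightarrow> a \<le> s \<Longrightarrow> 0 \<le> b \<Longrightarrow> b \<le> s \<Longrightarrow> x + a *\<^sub>R u + b *\<^sub>R v \<in> S"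
  shows "\<exists>a b. 0 < a \<and> a < s \<and> 0 < b \<and> b < s \<and>
    F (x + s *\<^sub>R u + s *\<^sub>R v) - F (x + s *\<^sub>R u) - F (x + s *\<^sub>R v) + F x =
    s * s * frechet_derivative (\<lambda>y. frechet_derivative F (at y) u) (at (x + a *\<^sub>R u + b *\<^sub>R v)) v"
proof -
  define D where "D y = frechet_derivative F (at y) u" for y
  have D: "smooth_on S D" unfolding D_def[abs_def] by (rule smooth_on_frechet_derivative[OF F])
  have der: "((\<lambda>a. F (x + a *\<^sub>R u + b *\<^sub>R v)) has_real_derivative D (x + a *\<^sub>R u + b *\<^sub>R v)) (at a)"
    if "0 \<le> a" "a \<le> s" "0 \<le> b" "b \<le> s" for a b
  proof -
    have *: "(F has_derivative frechet_derivative F (at (x + a *\<^sub>R u + b *\<^sub>R v))) (at (x + a *\<^sub>R u + b *\<^sub>R v))"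
      by (rule smooth_on_has_derivative[OF F sub[OF that]])
    have "((\<lambda>a. x + a *\<^sub>R u + b *\<^sub>R v) has_derivative (\<lambda>h. h *\<^sub>R u)) (at a)"
      by (auto intro!: derivative_eq_intros)
    from has_derivative_compose[OF this *]
    show ?thesis
      using has_derivative_linear[OF *] by (simp add: has_field_derivative_def D_def linear_scale mult.commute[of _ "frechet_derivative F (at (x + a *\<^sub>R u + b *\<^sub>R v)) u"] mult_commute_abs)
  qed
  have "\<exists>a>0. a < s \<and> (F (x + s *\<^sub>R u + s *\<^sub>R v) - F (x + s *\<^sub>R u + 0 *\<^sub>R v)) - (F (x + 0 *\<^sub>R u + s *\<^sub>R v) - F (x + 0 *\<^sub>R u + 0 *\<^sub>R v))
      = (s - 0) * (D (x + a *\<^sub>R u + s *\<^sub>R v) - D (x + a *\<^sub>R u + 0 *\<^sub>R v))"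
    by (rule MVT2[OF s]) (use s in \<open>auto intro!: DERIV_diff der[of _ s] der[of _ 0, simplified]\<close>)
  then obtain a where a: "0 < a" "a < s" "F (x + s *\<^sub>R u + s *\<^sub>R v) - F (x + s *\<^sub>R u) - F (x + s *\<^sub>R v) + F x
      = s * (D (x + a *\<^sub>R u + s *\<^sub>R v) - D (x + a *\<^sub>R u + 0 *\<^sub>R v))" by (auto simp: algebra_simps)
  have der2: "((\<lambda>b. D (x + a *\<^sub>R u + b *\<^sub>R v)) has_real_derivative frechet_derivative D (at (x + a *\<^sub>R u + b *\<^sub>R v)) v) (at b)"
    if "0 \<le> b" "b \<le> s" for b
  proof -
    have *: "(D has_derivative frechet_derivative D (at (x + a *\<^sub>R u + b *\<^sub>R v))) (at (x + a *\<^sub>R u + b *\<^sub>R v))"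
      using a that by (intro smooth_on_has_derivative[OF D] sub) auto
    have "((\<lambda>b. x + a *\<^sub>R u + b *\<^sub>R v) has_derivative (\<lambda>h. h *\<^sub>R v)) (at b)"
      by (auto intro!: derivative_eq_intros)
    from has_derivative_compose[OF this *]
    show ?thesis
      using has_derivative_linear[OF *] by (simp add: has_field_derivative_def linear_scale mult_commute_abs)
  qed
  have "\<exists>b>0. b < s \<and> D (x + a *\<^sub>R u + s *\<^sub>R v) - D (x + a *\<^sub>R u + 0 *\<^sub>R v)
      = (s - 0) * frechet_derivative D (at (x + a *\<^sub>R u + b *\<^sub>R v)) v"
    by (rule MVT2[OF s]) (auto intro!: der2)
  then obtain b where "0 < b" "b < s" "D (x + a *\<^sub>R u + s *\<^sub>R v) - D (x + a *\<^sub>R u + 0 *\<^sub>R v)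
      = s * frechet_derivative D (at (x + a *\<^sub>R u + b *\<^sub>R v)) v" by auto
  then show ?thesis using a unfolding D_def[abs_def] by (intro exI[of _ a] exI[of _ b]) simp
qed

text \<open>The second difference quotient is symmetric in \<open>u\<close> and \<open>v\<close> and tends to the second
  derivative.\<close>

lemma second_derivative_symmetric_real:
  fixes F :: "'a::real_normed_vector \<Rightarrow> real"
  assumes F: "smooth_on S F" and S: "open S" "x \<in> S"
  shows "frechet_derivative (\<lambda>y. frechet_derivative F (at y) u) (at x) v
       = frechet_derivative (\<lambda>y. frechet_derivative F (at y) v) (at x) u"
proof (rule ccontr)
  define P where "P y = frechet_derivative (\<lambda>y. frechet_derivative F (at y) u) (at y) v" for y
  define Q where "Q y = frechet_derivative (\<lambda>y. frechet_derivative F (at y) v) (at y) u" for y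
  assume "\<not> ?thesis"
  then have ne: "\<bar>P x - Q x\<bar> > 0" by (simp add: P_def Q_def)
  have "continuous_on S P" "continuous_on S Q"
    unfolding P_def[abs_def] Q_def[abs_def]
    by (intro smooth_on_continuous_on smooth_on_frechet_derivative F)+
  then have "isCont P x" "isCont Q x" using S by (auto simp: continuous_on_eq_continuous_at)
  then obtain d1 d2 where d: "d1 > 0" "\<And>y. dist y x < d1 \<Longrightarrow> dist (P y) (P x) < \<bar>P x - Q x\<bar> / 2"
    "d2 > 0" "\<And>y. dist y x < d2 \<Longrightarrow> dist (Q y) (Q x) < \<bar>P x - Q x\<bar> / 2"
    using ne unfolding continuous_at_eps_delta by (metis half_gt_zero)
  obtain d3 where d3: "d3 > 0" "ball x d3 \<subseteq> S" using S open_contains_ball by blast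
  define d where "d = min d1 (min d2 d3)"
  define s where "s = d / (2 * (norm u + norm v + 1))"
  have dp: "d > 0" using d d3 by (simp add: d_def)
  have s0: "s > 0" using dp by (simp add: s_def add_nonneg_pos)
  have near: "dist (x + a *\<^sub>R w + b *\<^sub>R z) x < d" if "0 \<le> a" "a \<le> s" "0 \<le> b" "b \<le> s" "norm w + norm z = norm u + norm v" for a b w z
  proof -
    have "dist (x + a *\<^sub>R w + b *\<^sub>R z) x \<le> norm (a *\<^sub>R w) + norm (b *\<^sub>R z)"
      by (simp add: dist_norm add.assoc norm_triangle_ineq del: norm_scaleR)
    also have "\<dots> \<le> s * norm w + s * norm z"
      using that by (intro add_mono) (auto intro: mult_right_mono)
    also have "\<dots> = s * (norm u + norm v)" using that(5) by (metis distrib_left)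
    also have "\<dots> < s * (2 * (norm u + norm v + 1))" using s0 by (intro mult_strict_left_mono) (auto simp: add_nonneg_pos)
    also have "\<dots> = d" by (simp add: s_def add_nonneg_eq_0_iff)
    finally show ?thesis .
  qed
  have sub: "x + a *\<^sub>R w + b *\<^sub>R z \<in> S" if "0 \<le> a" "a \<le> s" "0 \<le> b" "b \<le> s" "norm w + norm z = norm u + norm v" for a b w z
    using near[OF that] d3 by (auto simp: d_def dist_commute subset_iff)
  obtain a b where ab: "0 < a" "a < s" "0 < b" "b < s"
    "F (x + s *\<^sub>R u + s *\<^sub>R v) - F (x + s *\<^sub>R u) - F (x + s *\<^sub>R v) + F x = s * s * P (x + a *\<^sub>R u + b *\<^sub>R v)"
    using second_difference_mean_value[OF F s0, of x u v] sub unfolding P_def by auto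
  obtain a' b' where ab': "0 < a'" "a' < s" "0 < b'" "b' < s"
    "F (x + s *\<^sub>R v + s *\<^sub>R u) - F (x + s *\<^sub>R v) - F (x + s *\<^sub>R u) + F x = s * s * Q (x + a' *\<^sub>R v + b' *\<^sub>R u)"
    using second_difference_mean_value[OF F s0, of x v u] sub[of _ _ v u] unfolding Q_def by (auto simp: add.commute)
  have "s * s * P (x + a *\<^sub>R u + b *\<^sub>R v) = s * s * Q (x + a' *\<^sub>R v + b' *\<^sub>R u)"
    unfolding ab(5)[symmetric] ab'(5)[symmetric] by (simp add: algebra_simps)
  then have eq: "P (x + a *\<^sub>R u + b *\<^sub>R v) = Q (x + a' *\<^sub>R v + b' *\<^sub>R u)" using s0 by simp
  have "dist (P (x + a *\<^sub>R u + b *\<^sub>R v)) (P x) < \<bar>P x - Q x\<bar> / 2"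
    using near[of a b u v] ab by (intro d(2)) (auto simp: d_def)
  moreover have "dist (Q (x + a' *\<^sub>R v + b' *\<^sub>R u)) (Q x) < \<bar>P x - Q x\<bar> / 2"
    using near[of a' b' v u] ab' by (intro d(4)) (auto simp: d_def add.commute)
  ultimately show False unfolding eq dist_real_def by (auto simp: abs_if split: if_splits)
qed

lemma frechet_derivative_inner:
  assumes "smooth_on S F" "y \<in> S"
  shows "frechet_derivative (\<lambda>y. F y \<bullet> i) (at y) u = frechet_derivative F (at y) u \<bullet> i"
proof -
  have "((\<lambda>y. F y \<bullet> i) has_derivative (\<lambda>u. frechet_derivative F (at y) u \<bullet> i)) (at y)"
    by (intro has_derivative_inner_left smooth_on_has_derivative[OF assms])
  then show ?thesis by (metis frechet_derivative_at)
qed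

lemma frechet_derivative_cong:
  assumes "open S" "x \<in> S" "\<And>y. y \<in> S \<Longrightarrow> f y = g y" "(f has_derivative f') (at x)"
  shows "frechet_derivative g (at x) = f'"
  using has_derivative_transform_within_open[OF assms(4,1,2,3)] frechet_derivative_at by metis

lemma second_derivative_symmetric:
  fixes F :: "'a::real_normed_vector \<Rightarrow> 'b::euclidean_space"
  assumes F: "smooth_on S F" and S: "open S" "x \<in> S"
  shows "frechet_derivative (\<lambda>y. frechet_derivative F (at y) u) (at x) v
       = frechet_derivative (\<lambda>y. frechet_derivative F (at y) v) (at x) u"
proof (rule euclidean_eqI)
  fix i :: 'b assume "i \<in> Basis"
  have Fi: "smooth_on S (\<lambda>y. F y \<bullet> i)"
    by (rule smooth_on_bounded_linear_compose[OF bounded_linear_inner_left S(1) F])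
  have *: "frechet_derivative (\<lambda>y. frechet_derivative F (at y) u) (at x) v \<bullet> i
      = frechet_derivative (\<lambda>y. frechet_derivative (\<lambda>y. F y \<bullet> i) (at y) u) (at x) v" for u v
  proof -
    have "((\<lambda>y. frechet_derivative F (at y) u \<bullet> i) has_derivative
        (\<lambda>v. frechet_derivative (\<lambda>y. frechet_derivative F (at y) u) (at x) v \<bullet> i)) (at x)"
      by (intro has_derivative_inner_left smooth_on_has_derivative[OF smooth_on_frechet_derivative[OF F] S(2)])
    then have "frechet_derivative (\<lambda>y. frechet_derivative (\<lambda>y. F y \<bullet> i) (at y) u) (at x)
        = (\<lambda>v. frechet_derivative (\<lambda>y. frechet_derivative F (at y) u) (at x) v \<bullet> i)"
      by (intro frechet_derivative_cong[OF S]) (auto simp: frechet_derivative_inner[OF F])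
    then show ?thesis by simp
  qed
  show "frechet_derivative (\<lambda>y. frechet_derivative F (at y) u) (at x) v \<bullet> i
      = frechet_derivative (\<lambda>y. frechet_derivative F (at y) v) (at x) u \<bullet> i"
    unfolding * by (rule second_derivative_symmetric_real[OF Fi S])
qed

lemma scaleR_mem_ball:
  fixes y :: "'a::real_normed_vector"
  assumes "y \<in> ball 0 r" "s \<in> {0..1}" shows "s *\<^sub>R y \<in> ball 0 r"
proof -
  have "\<bar>s\<bar> * norm y \<le> 1 * norm y" using assms by (intro mult_right_mono) auto
  then show ?thesis using assms by simp
qed

text \<open>Differentiation under the integral sign; the exponent \<open>j\<close> is general because the chain rule produces a
  factor \<open>s\<close>.\<close>

lemma Ck_on_ray_integral:
  fixes h :: "'a::euclidean_space \<Rightarrow> real"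
  shows "Ck_on k (ball 0 r) h \<Longrightarrow> Ck_on k (ball 0 r) (\<lambda>y. integral {0..1} (\<lambda>s. s ^ j * h (s *\<^sub>R y)))"
proof (induction k arbitrary: h j)
  case 0
  have "continuous_on (ball 0 r \<times> cbox 0 1) (\<lambda>(y, s). s ^ j * h (s *\<^sub>R y))"
  proof -
    have "continuous_on (ball 0 r \<times> cbox 0 1) (\<lambda>p. h (snd p *\<^sub>R fst p))"
    proof (rule continuous_on_compose2[of "ball 0 r" h])
      show "continuous_on (ball 0 r) h" using 0 by simp
      show "continuous_on (ball 0 r \<times> cbox 0 1) (\<lambda>p::'a\<times>real. snd p *\<^sub>R fst p)" by (intro continuous_intros)
      show "(\<lambda>p::'a\<times>real. snd p *\<^sub>R fst p) ` (ball 0 r \<times> cbox 0 1) \<subseteq> ball 0 r"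
      proof (rule image_subsetI)
        fix p :: "'a \<times> real" assume "p \<in> ball 0 r \<times> cbox 0 1"
        then show "snd p *\<^sub>R fst p \<in> ball 0 r" by (intro scaleR_mem_ball) auto
      qed
    qed
    then show ?thesis unfolding case_prod_unfold by (intro continuous_intros)
  qed
  then show ?case
    using integral_continuous_on_param[of "ball 0 r" 0 1 "\<lambda>y s. s ^ j * h (s *\<^sub>R y)"] by (simp add: box_real)
next
  case (Suc k)
  define h' where "h' y = frechet_derivative h (at y)" for y
  have hd: "(h has_derivative h' y) (at y)" if "y \<in> ball 0 r" for y
    unfolding h'_def by (rule Ck_onD[OF Suc.prems that])
  have Ckh': "Ck_on k (ball 0 r) (\<lambda>y. h' y v)" for v using Suc.prems by (simp add: h'_def)
  have ch': "continuous_on (ball 0 r) (\<lambda>y. h' y v)" for v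
  proof -
    have "Ck_on (Suc 0) (ball 0 r) h" by (rule Ck_on_le[OF _ Suc.prems]) simp
    then show ?thesis by (simp add: h'_def)
  qed
  define L where "L y s = Blinfun (\<lambda>v. s ^ Suc j * h' (s *\<^sub>R y) v)" for y s
  have Lapp: "blinfun_apply (L y s) = (\<lambda>v. s ^ Suc j * h' (s *\<^sub>R y) v)" if "y \<in> ball 0 r" "s \<in> {0..1}" for y s
    unfolding L_def using has_derivative_bounded_linear[OF hd[OF scaleR_mem_ball[OF that]]]
    by (intro bounded_linear_Blinfun_apply bounded_linear_const_mult)
  have Lc: "continuous_on (ball 0 r \<times> cbox 0 1) (\<lambda>(y, s). L y s)"
  proof (rule continuous_on_blinfun_componentwise)
    fix i :: 'a assume "i \<in> Basis"
    have "continuous_on (ball 0 r \<times> cbox 0 1) (\<lambda>p::'a\<times>real. h' (snd p *\<^sub>R fst p) i)"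
    proof (rule continuous_on_compose2[OF ch'[of i]])
      show "continuous_on (ball 0 r \<times> cbox 0 1) (\<lambda>p::'a\<times>real. snd p *\<^sub>R fst p)" by (intro continuous_intros)
      show "(\<lambda>p::'a\<times>real. snd p *\<^sub>R fst p) ` (ball 0 r \<times> cbox 0 1) \<subseteq> ball 0 r"
      proof (rule image_subsetI)
        fix p :: "'a \<times> real" assume "p \<in> ball 0 r \<times> cbox 0 1"
        then show "snd p *\<^sub>R fst p \<in> ball 0 r" by (intro scaleR_mem_ball) auto
      qed
    qed
    then have "continuous_on (ball 0 r \<times> cbox 0 1) (\<lambda>p. snd p ^ Suc j * h' (snd p *\<^sub>R fst p) i)"
      by (intro continuous_intros)
    then show "continuous_on (ball 0 r \<times> cbox 0 1) (\<lambda>p. blinfun_apply (case p of (y, s) \<Rightarrow> L y s) i)"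
      by (rule continuous_on_eq) (auto simp: Lapp)
  qed
  have hL: "((\<lambda>y. s ^ j * h (s *\<^sub>R y)) has_derivative blinfun_apply (L y s)) (at y within ball 0 r)"
    if y: "y \<in> ball 0 r" and s: "s \<in> cbox 0 1" for y s
  proof -
    have s': "s \<in> {0..1}" using s by simp
    have "((\<lambda>y. s *\<^sub>R y) has_derivative (\<lambda>v. s *\<^sub>R v)) (at y)" by (auto intro!: derivative_eq_intros)
    from has_derivative_compose[OF this hd[OF scaleR_mem_ball[OF y s']]]
    have d1: "((\<lambda>y. s ^ j * h (s *\<^sub>R y)) has_derivative (\<lambda>v. s ^ j * h' (s *\<^sub>R y) (s *\<^sub>R v))) (at y)"
      by (rule has_derivative_mult_right)
    have "h' (s *\<^sub>R y) (s *\<^sub>R v) = s * h' (s *\<^sub>R y) v" for v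
      using has_derivative_linear[OF hd[OF scaleR_mem_ball[OF y s']]] by (simp add: linear_scale)
    then have e1: "(\<lambda>v. s ^ j * h' (s *\<^sub>R y) (s *\<^sub>R v)) = (\<lambda>v. s ^ Suc j * h' (s *\<^sub>R y) v)" by auto
    show ?thesis
      unfolding Lapp[OF y s'] by (rule has_derivative_at_withinI[OF d1[unfolded e1]])
  qed
  have int: "(\<lambda>s. s ^ j * h (s *\<^sub>R y)) integrable_on cbox 0 1" if y: "y \<in> ball 0 r" for y
  proof (rule integrable_continuous)
    have "continuous_on (ball 0 r) h"
      using Ck_on_le[OF _ Suc.prems, of 0] by simp
    then have "continuous_on (cbox 0 1) (\<lambda>s. h (s *\<^sub>R y))"
    proof (rule continuous_on_compose2)
      show "continuous_on (cbox 0 1) (\<lambda>s. s *\<^sub>R y)" by (intro continuous_intros)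
      show "(\<lambda>s. s *\<^sub>R y) ` cbox 0 1 \<subseteq> ball 0 r"
        using scaleR_mem_ball[OF y] by (intro image_subsetI) simp
    qed
    then show "continuous_on (cbox 0 1) (\<lambda>s. s ^ j * h (s *\<^sub>R y))" by (intro continuous_intros)
  qed
  show ?case
  proof (rule Ck_onI[OF open_ball])
    fix y :: 'a assume y: "y \<in> ball 0 r"
    have "((\<lambda>y. integral (cbox 0 1) (\<lambda>s. s ^ j * h (s *\<^sub>R y))) has_derivative
        blinfun_apply (integral (cbox 0 1) (L y))) (at y within ball 0 r)"
      by (rule leibniz_rule[OF hL int Lc y convex_ball])
    then have "((\<lambda>y. integral {0..1} (\<lambda>s. s ^ j * h (s *\<^sub>R y))) has_derivative
        blinfun_apply (integral {0..1} (L y))) (at y)"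
      using y by (simp add: at_within_open[OF _ open_ball] box_real)
    moreover have "blinfun_apply (integral {0..1} (L y)) v = integral {0..1} (\<lambda>s. s ^ Suc j * h' (s *\<^sub>R y) v)" for v
    proof -
      have "continuous_on (cbox 0 1) (L y)"
      proof -
        have "continuous_on (cbox 0 1) (\<lambda>s::real. (y, s))" by (intro continuous_intros)
        moreover have "(\<lambda>s. (y, s)) ` cbox 0 1 \<subseteq> ball 0 r \<times> cbox 0 1" using y by auto
        ultimately have "continuous_on (cbox 0 1) (\<lambda>s. case (y, s) of (y, s) \<Rightarrow> L y s)"
          by (rule continuous_on_compose2[OF Lc])
        then show ?thesis by simp
      qed
      then have "L y integrable_on {0..1}" using integrable_continuous by (metis box_real(2))
      then have "blinfun_apply (integral {0..1} (L y)) v = integral {0..1} (\<lambda>s. blinfun_apply (L y s) v)"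
        by (rule blinfun_apply_integral)
      also have "\<dots> = integral {0..1} (\<lambda>s. s ^ Suc j * h' (s *\<^sub>R y) v)"
        by (rule integral_cong) (simp add: Lapp[OF y])
      finally show ?thesis .
    qed
    then have "blinfun_apply (integral {0..1} (L y)) = (\<lambda>v. integral {0..1} (\<lambda>s. s ^ Suc j * h' (s *\<^sub>R y) v))"
      by auto
    ultimately show "((\<lambda>y. integral {0..1} (\<lambda>s. s ^ j * h (s *\<^sub>R y))) has_derivative
        (\<lambda>v. integral {0..1} (\<lambda>s. s ^ Suc j * h' (s *\<^sub>R y) v))) (at y)" by simp
  next
    show "Ck_on k (ball 0 r) (\<lambda>y. integral {0..1} (\<lambda>s. s ^ Suc j * h' (s *\<^sub>R y) v))" for v
      by (rule Suc.IH[OF Ckh'])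
  qed
qed

text \<open>\<open>F y - F 0\<close> is the integral of the derivative of \<open>s \<mapsto> F (s *\<^sub>R y)\<close>, which is
  linear in \<open>y\<close>.\<close>

lemma smooth_on_hadamard:
  fixes F :: "'a::euclidean_space \<Rightarrow> real"
  assumes F: "smooth_on (ball 0 r) F" and r: "r > 0"
  shows "\<exists>G. (\<forall>i. smooth_on (ball 0 r) (G i) \<and> G i 0 = frechet_derivative F (at 0) i) \<and>
    (\<forall>y\<in>ball 0 r. F y = F 0 + (\<Sum>i\<in>Basis. (y \<bullet> i) * G i y))"
proof -
  define D where "D i y = frechet_derivative F (at y) i" for i y
  define G where "G i y = integral {0..1} (\<lambda>s. D i (s *\<^sub>R y))" for i y
  have Ds: "smooth_on (ball 0 r) (D i)" for i
    unfolding D_def[abs_def] by (rule smooth_on_frechet_derivative[OF F])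
  have Gs: "smooth_on (ball 0 r) (G i)" for i
    unfolding smooth_on_def
  proof
    fix k
    show "Ck_on k (ball 0 r) (G i)"
      using Ck_on_ray_integral[of k r "D i" 0] Ds[of i] by (simp add: smooth_on_def G_def[abs_def])
  qed
  have G0: "G i 0 = frechet_derivative F (at 0) i" for i by (simp add: G_def D_def)
  have "F y = F 0 + (\<Sum>i\<in>Basis. (y \<bullet> i) * G i y)" if y: "y \<in> ball 0 r" for y
  proof -
  note ray = scaleR_mem_ball[OF y]
  have der: "((\<lambda>s. F (s *\<^sub>R y)) has_vector_derivative (\<Sum>i\<in>Basis. (y \<bullet> i) * D i (s *\<^sub>R y))) (at s within {0..1})"
    if s: "s \<in> {0..1}" for s
  proof -
    note * = smooth_on_has_derivative[OF F ray[OF s]]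
    have "((\<lambda>s. s *\<^sub>R y) has_derivative (\<lambda>h. h *\<^sub>R y)) (at s within {0..1})" by (auto intro!: derivative_eq_intros)
    from has_derivative_compose[OF this *]
    have "((\<lambda>s. F (s *\<^sub>R y)) has_derivative (\<lambda>h. h *\<^sub>R frechet_derivative F (at (s *\<^sub>R y)) y)) (at s within {0..1})"
      using has_derivative_linear[OF *] by (simp add: linear_scale)
    then show ?thesis
      unfolding has_vector_derivative_def
      using linear_basis_expansion[OF has_derivative_linear[OF *], of y] by (simp add: D_def)
  qed
  have i: "((\<lambda>s. \<Sum>i\<in>Basis. (y \<bullet> i) * D i (s *\<^sub>R y)) has_integral (F (1 *\<^sub>R y) - F (0 *\<^sub>R y))) {0..1}"
    by (rule fundamental_theorem_of_calculus[OF _ der]) auto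
  have "((\<lambda>s. \<Sum>i\<in>Basis. (y \<bullet> i) * D i (s *\<^sub>R y)) has_integral (\<Sum>i\<in>Basis. (y \<bullet> i) * G i y)) {0..1}"
    unfolding G_def
  proof (intro has_integral_sum has_integral_mult_right integrable_integral finite_Basis)
    fix i :: 'a
    have "continuous_on {0..1} (\<lambda>s. D i (s *\<^sub>R y))"
    proof (rule continuous_on_compose2[OF smooth_on_continuous_on[OF Ds[of i]]])
      show "(\<lambda>s. s *\<^sub>R y) ` {0..1} \<subseteq> ball 0 r" using ray by (intro image_subsetI) simp
    qed (intro continuous_intros)
    then show "(\<lambda>s. D i (s *\<^sub>R y)) integrable_on {0..1}" by (rule integrable_continuous_real)
  qed
  from has_integral_unique[OF i this] show "F y = F 0 + (\<Sum>i\<in>Basis. (y \<bullet> i) * G i y)" by simp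
  qed
  with Gs G0 show ?thesis by (intro exI[of _ G]) simp
qed

section \<open>Charts of a Lie group\<close>

lemma atlas_chart:
  assumes "smooth_atlas A" "(V, \<theta>) \<in> A"
  shows "open V" "open (\<theta> ` V)" "continuous_on V \<theta>" "continuous_on (\<theta> ` V) (inv_into V \<theta>)"
    "\<And>p. p \<in> V \<Longrightarrow> inv_into V \<theta> (\<theta> p) = p" "\<And>x. x \<in> \<theta> ` V \<Longrightarrow> \<theta> (inv_into V \<theta> x) = x"
    "\<And>x. x \<in> \<theta> ` V \<Longrightarrow> inv_into V \<theta> x \<in> V"
proof -
  have "open V \<and> open (\<theta> ` V) \<and> homeomorphism V (\<theta> ` V) \<theta> (inv_into V \<theta>)"
    using assms unfolding smooth_atlas_def by blast
  then show "open V" "open (\<theta> ` V)" "continuous_on V \<theta>" "continuous_on (\<theta> ` V) (inv_into V \<theta>)"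
    "\<And>p. p \<in> V \<Longrightarrow> inv_into V \<theta> (\<theta> p) = p" "\<And>x. x \<in> \<theta> ` V \<Longrightarrow> \<theta> (inv_into V \<theta> x) = x"
    by (auto simp: homeomorphism_def)
  show "\<And>x. x \<in> \<theta> ` V \<Longrightarrow> inv_into V \<theta> x \<in> V" by (rule inv_into_into)
qed

lemma atlas_covers:
  assumes "smooth_atlas A" obtains V \<theta> where "(V, \<theta>) \<in> A" "p \<in> V"
proof -
  have "p \<in> \<Union> (fst ` A)" using assms by (simp add: smooth_atlas_def)
  then show thesis using that by auto
qed

lemma atlas_transition:
  assumes "smooth_atlas A" "(V, \<theta>) \<in> A" "(V', \<theta>') \<in> A"
  shows "smooth_on (\<theta> ` (V \<inter> V')) (\<lambda>x. \<theta>' (inv_into V \<theta> x))"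
  using assms unfolding smooth_atlas_def comp_def by blast

lemma open_chart_image:
  assumes "smooth_atlas A" "(V, \<theta>) \<in> A" "open W" "W \<subseteq> V"
  shows "open (\<theta> ` W)"
proof -
  note c = atlas_chart[OF assms(1,2)]
  have "\<theta> ` W = \<theta> ` V \<inter> inv_into V \<theta> -` W" using c(5,6) assms(4) by force
  then show ?thesis using continuous_open_preimage[OF c(4,2) assms(3)] by simp
qed

lemma open_chart_preimage:
  assumes "smooth_atlas A" "(V, \<theta>) \<in> A" "open O'"
  shows "open {p \<in> V. \<theta> p \<in> O'}"
proof -
  note c = atlas_chart[OF assms(1,2)]
  have "{p \<in> V. \<theta> p \<in> O'} = V \<inter> \<theta> -` O'" by auto
  then show ?thesis using continuous_open_preimage[OF c(3,1) assms(3)] by simp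
qed

text \<open>The definition asks for one chart around the point; since the transition maps are smooth, every chart around it does.\<close>

lemma smooth_near_iff_chart:
  assumes A: "smooth_atlas A" and V: "(V, \<theta>) \<in> A" "p \<in> V"
  shows "smooth_near A p f \<longleftrightarrow>
    (\<exists>S. open S \<and> \<theta> p \<in> S \<and> S \<subseteq> \<theta> ` V \<and> smooth_on S (\<lambda>x. f (inv_into V \<theta> x)))"
proof
  assume "smooth_near A p f"
  then obtain U \<phi> W where U: "(U, \<phi>) \<in> A" and W: "open W" "p \<in> W" "W \<subseteq> U"
    and f: "smooth_on (\<phi> ` W) (f \<circ> inv_into U \<phi>)"
    unfolding smooth_near_def by auto
  note cU = atlas_chart[OF A U] and cV = atlas_chart[OF A V(1)]
  define S where "S = \<theta> ` (V \<inter> W)"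
  have So: "open S" unfolding S_def using cV(1) W by (intro open_chart_image[OF A V(1)]) auto
  have sm: "smooth_on S (\<lambda>x. \<phi> (inv_into V \<theta> x))"
    using W(3) unfolding S_def by (intro smooth_on_subset[OF atlas_transition[OF A V(1) U]]) auto
  have im: "(\<lambda>x. \<phi> (inv_into V \<theta> x)) ` S \<subseteq> \<phi> ` W" using cV(5) by (auto simp: S_def)
  have "smooth_on S (\<lambda>x. (f \<circ> inv_into U \<phi>) (\<phi> (inv_into V \<theta> x)))"
    by (rule smooth_on_compose[OF So open_chart_image[OF A U W(1,3)] im sm f])
  then have "smooth_on S (\<lambda>x. f (inv_into V \<theta> x))"
  proof (rule smooth_on_cong[OF So, rotated])
    fix x assume "x \<in> S"
    then have "inv_into V \<theta> x \<in> U" using cV(5) W(3) by (auto simp: S_def)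
    then show "(f \<circ> inv_into U \<phi>) (\<phi> (inv_into V \<theta> x)) = f (inv_into V \<theta> x)" using cU(5) by simp
  qed
  then show "\<exists>S. open S \<and> \<theta> p \<in> S \<and> S \<subseteq> \<theta> ` V \<and> smooth_on S (\<lambda>x. f (inv_into V \<theta> x))"
    using So V(2) W(2) by (intro exI[of _ S]) (auto simp: S_def)
next
  assume "\<exists>S. open S \<and> \<theta> p \<in> S \<and> S \<subseteq> \<theta> ` V \<and> smooth_on S (\<lambda>x. f (inv_into V \<theta> x))"
  then obtain S where S: "open S" "\<theta> p \<in> S" "S \<subseteq> \<theta> ` V" "smooth_on S (\<lambda>x. f (inv_into V \<theta> x))" by blast
  note cV = atlas_chart[OF A V(1)]
  have "\<theta> ` {q \<in> V. \<theta> q \<in> S} = S" using S(3) by auto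
  then have "smooth_on (\<theta> ` {q \<in> V. \<theta> q \<in> S}) (f \<circ> inv_into V \<theta>)" using S(4) by (simp add: comp_def)
  moreover have "open {q \<in> V. \<theta> q \<in> S}" by (rule open_chart_preimage[OF A V(1) S(1)])
  ultimately show "smooth_near A p f"
    unfolding smooth_near_def using V S(2)
    by (intro bexI[of _ "(V, \<theta>)"]) (auto intro!: exI[of _ "{q \<in> V. \<theta> q \<in> S}"])
qed

text \<open>\<open>\<psi>\<close> is the given chart translated so that the identity has coordinates 0, and
  \<open>\<kappa>\<close> is its inverse on the coordinate domain \<open>E0\<close>. Left translation by
  \<open>p\<close> carries them to a chart around \<open>p\<close>.\<close>

locale lie_group_chart =
  fixes A :: "('g::{topological_group_add, t2_space, second_countable_topology}, 'e::euclidean_space) atlas"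
    and U :: "'g set" and \<phi> :: "'g \<Rightarrow> 'e"
  assumes lie: "lie_group A" and U: "(U, \<phi>) \<in> A" and U0: "0 \<in> U"
begin

definition \<psi> :: "'g \<Rightarrow> 'e" where "\<psi> p = \<phi> p - \<phi> 0"
definition \<kappa> :: "'e \<Rightarrow> 'g" where "\<kappa> y = inv_into U \<phi> (y + \<phi> 0)"
definition E0 :: "'e set" where "E0 = \<psi> ` U"

lemma atlas: "smooth_atlas A" using lie by (simp add: lie_group_def)

lemmas U_chart = atlas_chart[OF atlas U]

lemma E0_eq: "y \<in> E0 \<longleftrightarrow> y + \<phi> 0 \<in> \<phi> ` U"
  by (auto simp: E0_def \<psi>_def image_iff) (metis add_diff_cancel)

lemma open_U: "open U" by (rule U_chart)

lemma E0_translate: "E0 = (\<lambda>x. x - \<phi> 0) ` (\<phi> ` U)"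
  by (auto simp: E0_def \<psi>_def)

lemma open_E0: "open E0"
  unfolding E0_translate using open_translation_subtract[OF U_chart(2)] .

lemma \<psi>_0 [simp]: "\<psi> 0 = 0" by (simp add: \<psi>_def)
lemma E0_0 [simp]: "0 \<in> E0" using U0 by (force simp: E0_def)
lemma \<kappa>_\<psi>: "p \<in> U \<Longrightarrow> \<kappa> (\<psi> p) = p" by (simp add: \<kappa>_def \<psi>_def U_chart)
lemma \<psi>_\<kappa>: "y \<in> E0 \<Longrightarrow> \<psi> (\<kappa> y) = y" by (auto simp: E0_def \<kappa>_\<psi>)
lemma \<kappa>_U: "y \<in> E0 \<Longrightarrow> \<kappa> y \<in> U" by (auto simp: E0_def \<kappa>_\<psi>)
lemma \<psi>_E0: "p \<in> U \<Longrightarrow> \<psi> p \<in> E0" by (simp add: E0_def)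
lemma \<kappa>_0 [simp]: "\<kappa> 0 = 0" using \<kappa>_\<psi>[OF U0] by simp

lemma continuous_on_\<psi>: "continuous_on U \<psi>"
  unfolding \<psi>_def[abs_def] by (intro continuous_intros U_chart)

lemma continuous_on_\<kappa>: "continuous_on E0 \<kappa>"
  unfolding \<kappa>_def[abs_def]
  by (rule continuous_on_compose2[OF U_chart(4)]) (auto intro!: continuous_intros simp: E0_eq)

lemma isCont_\<kappa>: "y \<in> E0 \<Longrightarrow> isCont \<kappa> y"
  using continuous_on_\<kappa> open_E0 continuous_on_eq_continuous_at by blast

lemma isCont_\<psi>: "p \<in> U \<Longrightarrow> isCont \<psi> p"
  using continuous_on_\<psi> open_U continuous_on_eq_continuous_at by blast

lemma smooth_mult_charts:
  assumes "(P, \<pi>) \<in> A" "(V, \<theta>) \<in> A" "(W, \<tau>) \<in> A"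
  shows "smooth_on ((\<lambda>(p, q). (\<pi> p, \<theta> q)) ` {(p, q). p \<in> P \<and> q \<in> V \<and> p + q \<in> W})
          (\<lambda>(x, y). \<tau> (inv_into P \<pi> x + inv_into V \<theta> y))"
  using lie assms unfolding lie_group_def by blast

lemma smooth_inverse_charts:
  assumes "(V, \<theta>) \<in> A" "(W, \<tau>) \<in> A"
  shows "smooth_on (\<theta> ` {p \<in> V. - p \<in> W}) (\<lambda>x. \<tau> (- inv_into V \<theta> x))"
  using lie assms unfolding lie_group_def by blast

lemma mult_chart_image:
  assumes P: "(P, \<pi>) \<in> A" and V: "(V, \<theta>) \<in> A"
  shows "(\<lambda>(p, q). (\<pi> p, \<theta> q)) ` {(p, q). p \<in> P \<and> q \<in> V \<and> p + q \<in> W}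
     = {(x, y). x \<in> \<pi> ` P \<and> y \<in> \<theta> ` V \<and> inv_into P \<pi> x + inv_into V \<theta> y \<in> W}"
  using atlas_chart[OF atlas P] atlas_chart[OF atlas V] by (auto simp: image_iff)

lemma open_mult_chart_image:
  assumes P: "(P, \<pi>) \<in> A" and V: "(V, \<theta>) \<in> A" and "open W"
  shows "open {(x, y). x \<in> \<pi> ` P \<and> y \<in> \<theta> ` V \<and> inv_into P \<pi> x + inv_into V \<theta> y \<in> W}"
proof -
  note cP = atlas_chart[OF atlas P] and cV = atlas_chart[OF atlas V]
  have "continuous_on (\<pi> ` P \<times> \<theta> ` V) (\<lambda>z. inv_into P \<pi> (fst z) + inv_into V \<theta> (snd z))"
    by (intro continuous_on_add continuous_on_compose2[OF cP(4)] continuous_on_compose2[OF cV(4)] continuous_on_fst continuous_on_snd continuous_on_id) auto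
  then have "open (\<pi> ` P \<times> \<theta> ` V \<inter> (\<lambda>z. inv_into P \<pi> (fst z) + inv_into V \<theta> (snd z)) -` W)"
    using cP cV assms by (intro continuous_open_preimage) (auto intro: open_Times)
  moreover have "\<pi> ` P \<times> \<theta> ` V \<inter> (\<lambda>z. inv_into P \<pi> (fst z) + inv_into V \<theta> (snd z)) -` W
      = {(x, y). x \<in> \<pi> ` P \<and> y \<in> \<theta> ` V \<and> inv_into P \<pi> x + inv_into V \<theta> y \<in> W}" by auto
  ultimately show ?thesis by simp
qed

lemma smooth_left_translation:
  assumes V: "(V, \<theta>) \<in> A" and W: "(W, \<tau>) \<in> A"
  shows "open {x \<in> \<theta> ` V. g + inv_into V \<theta> x \<in> W}"
    "smooth_on {x \<in> \<theta> ` V. g + inv_into V \<theta> x \<in> W} (\<lambda>x. \<tau> (g + inv_into V \<theta> x))"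
proof -
  obtain P \<pi> where P: "(P, \<pi>) \<in> A" "g \<in> P" using atlas_covers[OF atlas] by metis
  note cP = atlas_chart[OF atlas P(1)] and cV = atlas_chart[OF atlas V] and cW = atlas_chart[OF atlas W]
  let ?S = "{x \<in> \<theta> ` V. g + inv_into V \<theta> x \<in> W}"
  let ?T = "{(x, y). x \<in> \<pi> ` P \<and> y \<in> \<theta> ` V \<and> inv_into P \<pi> x + inv_into V \<theta> y \<in> W}"
  note T = open_mult_chart_image[OF P(1) V cW(1)]
  have eq: "?S = (\<lambda>x. (\<pi> g, x)) -` ?T" using P(2) cP(5) by auto
  show o: "open ?S" unfolding eq by (intro open_vimage T continuous_intros)
  have "smooth_on ?S (\<lambda>x. (\<lambda>(x, y). \<tau> (inv_into P \<pi> x + inv_into V \<theta> y)) (\<pi> g, x))"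
    by (rule smooth_on_compose[OF o T _ smooth_on_Pair[OF o smooth_on_const[OF o] smooth_on_id[OF o]]
        smooth_mult_charts[OF P(1) V W, unfolded mult_chart_image[OF P(1) V]]])
       (use P(2) cP(5) in auto)
  then show "smooth_on ?S (\<lambda>x. \<tau> (g + inv_into V \<theta> x))" using P(2) cP(5) by simp
qed

lemma smooth_right_translation:
  assumes V: "(V, \<theta>) \<in> A" and W: "(W, \<tau>) \<in> A"
  shows "open {x \<in> \<theta> ` V. inv_into V \<theta> x + g \<in> W}"
    "smooth_on {x \<in> \<theta> ` V. inv_into V \<theta> x + g \<in> W} (\<lambda>x. \<tau> (inv_into V \<theta> x + g))"
proof -
  obtain P \<pi> where P: "(P, \<pi>) \<in> A" "g \<in> P" using atlas_covers[OF atlas] by metis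
  note cP = atlas_chart[OF atlas P(1)] and cV = atlas_chart[OF atlas V] and cW = atlas_chart[OF atlas W]
  let ?S = "{x \<in> \<theta> ` V. inv_into V \<theta> x + g \<in> W}"
  let ?T = "{(x, y). x \<in> \<theta> ` V \<and> y \<in> \<pi> ` P \<and> inv_into V \<theta> x + inv_into P \<pi> y \<in> W}"
  note T = open_mult_chart_image[OF V P(1) cW(1)]
  have eq: "?S = (\<lambda>x. (x, \<pi> g)) -` ?T" using P(2) cP(5) by auto
  show o: "open ?S" unfolding eq by (intro open_vimage T continuous_intros)
  have "smooth_on ?S (\<lambda>x. (\<lambda>(x, y). \<tau> (inv_into V \<theta> x + inv_into P \<pi> y)) (x, \<pi> g))"
    by (rule smooth_on_compose[OF o T _ smooth_on_Pair[OF o smooth_on_id[OF o] smooth_on_const[OF o]]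
        smooth_mult_charts[OF V P(1) W, unfolded mult_chart_image[OF V P(1)]]])
       (use P(2) cP(5) in auto)
  then show "smooth_on ?S (\<lambda>x. \<tau> (inv_into V \<theta> x + g))" using P(2) cP(5) by simp
qed

lemma smooth_on_translate:
  fixes f :: "'a::euclidean_space \<Rightarrow> 'b::real_normed_vector"
  assumes "smooth_on S f" "open S"
  shows "smooth_on {y. y + c \<in> S} (\<lambda>y. f (y + c))" "open {y. y + c \<in> S}"
proof -
  have e: "{y. y + c \<in> S} = (\<lambda>y. y + c) -` S" by auto
  show o: "open {y. y + c \<in> S}" unfolding e by (intro open_vimage assms continuous_intros)
  show "smooth_on {y. y + c \<in> S} (\<lambda>y. f (y + c))"
    by (rule smooth_on_compose[OF o assms(2) _ smooth_on_add[OF o smooth_on_id[OF o] smooth_on_const[OF o]] assms(1)]) auto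
qed

lemma smooth_translated_chart:
  assumes V: "(V, \<theta>) \<in> A"
  shows "open {y \<in> E0. g + \<kappa> y \<in> V}" "smooth_on {y \<in> E0. g + \<kappa> y \<in> V} (\<lambda>y. \<theta> (g + \<kappa> y))"
proof -
  note L = smooth_left_translation[OF U V, of g]
  have e: "{y \<in> E0. g + \<kappa> y \<in> V} = {y. y + \<phi> 0 \<in> {x \<in> \<phi> ` U. g + inv_into U \<phi> x \<in> V}}"
    by (auto simp: E0_eq \<kappa>_def)
  show "open {y \<in> E0. g + \<kappa> y \<in> V}" unfolding e by (rule smooth_on_translate(2)[OF L(2,1)])
  show "smooth_on {y \<in> E0. g + \<kappa> y \<in> V} (\<lambda>y. \<theta> (g + \<kappa> y))"
    using smooth_on_translate(1)[OF L(2,1), of "\<phi> 0"] unfolding e[symmetric] \<kappa>_def .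
qed

lemma smooth_left_translation_to_identity_chart:
  assumes V: "(V, \<theta>) \<in> A"
  shows "open {x \<in> \<theta> ` V. g + inv_into V \<theta> x \<in> U}"
    "smooth_on {x \<in> \<theta> ` V. g + inv_into V \<theta> x \<in> U} (\<lambda>x. \<psi> (g + inv_into V \<theta> x))"
proof -
  note L = smooth_left_translation[OF V U, of g]
  show "open {x \<in> \<theta> ` V. g + inv_into V \<theta> x \<in> U}" by (rule L)
  then have "smooth_on {x \<in> \<theta> ` V. g + inv_into V \<theta> x \<in> U} (\<lambda>x. \<phi> (g + inv_into V \<theta> x) + (- \<phi> 0))"
    by (intro smooth_on_add L smooth_on_const)
  then show "smooth_on {x \<in> \<theta> ` V. g + inv_into V \<theta> x \<in> U} (\<lambda>x. \<psi> (g + inv_into V \<theta> x))"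
    by (simp add: \<psi>_def)
qed

lemma smooth_right_translation_to_identity_chart:
  assumes V: "(V, \<theta>) \<in> A"
  shows "open {x \<in> \<theta> ` V. inv_into V \<theta> x + g \<in> U}"
    "smooth_on {x \<in> \<theta> ` V. inv_into V \<theta> x + g \<in> U} (\<lambda>x. \<psi> (inv_into V \<theta> x + g))"
proof -
  note L = smooth_right_translation[OF V U, of g]
  show "open {x \<in> \<theta> ` V. inv_into V \<theta> x + g \<in> U}" by (rule L)
  then have "smooth_on {x \<in> \<theta> ` V. inv_into V \<theta> x + g \<in> U} (\<lambda>x. \<phi> (inv_into V \<theta> x + g) + (- \<phi> 0))"
    by (intro smooth_on_add L smooth_on_const)
  then show "smooth_on {x \<in> \<theta> ` V. inv_into V \<theta> x + g \<in> U} (\<lambda>x. \<psi> (inv_into V \<theta> x + g))"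
    by (simp add: \<psi>_def)
qed

text \<open>The chart at \<open>p\<close> obtained by left translation is compatible with the atlas, so that smoothness at
  \<open>p\<close> can be tested in it. This reduces statements at \<open>p\<close> to statements at the identity.\<close>

lemma smooth_near_iff_translated:
  "smooth_near A p f \<longleftrightarrow> (\<exists>S. open S \<and> 0 \<in> S \<and> S \<subseteq> E0 \<and> smooth_on S (\<lambda>y. f (p + \<kappa> y)))"
proof -
  obtain V \<theta> where V: "(V, \<theta>) \<in> A" "p \<in> V" using atlas_covers[OF atlas] by metis
  note cV = atlas_chart[OF atlas V(1)]
  note iff = smooth_near_iff_chart[OF atlas V, of f]
  show ?thesis
  proof
    assume "smooth_near A p f"
    then obtain S where S: "open S" "\<theta> p \<in> S" "S \<subseteq> \<theta> ` V" "smooth_on S (\<lambda>x. f (inv_into V \<theta> x))"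
      unfolding iff by blast
    note T = smooth_translated_chart[OF V(1), of p]
    define S' where "S' = {y \<in> E0. p + \<kappa> y \<in> V} \<inter> (\<lambda>y. \<theta> (p + \<kappa> y)) -` S"
    have o: "open S'" unfolding S'_def
      by (rule continuous_open_preimage[OF smooth_on_continuous_on[OF T(2)] T(1) S(1)])
    have "smooth_on S' (\<lambda>y. f (inv_into V \<theta> (\<theta> (p + \<kappa> y))))"
      by (rule smooth_on_compose[OF o S(1) _ smooth_on_subset[OF T(2)] S(4)]) (auto simp: S'_def)
    then have "smooth_on S' (\<lambda>y. f (p + \<kappa> y))"
      by (rule smooth_on_cong[OF o, rotated]) (auto simp: S'_def cV(5))
    then show "\<exists>S. open S \<and> 0 \<in> S \<and> S \<subseteq> E0 \<and> smooth_on S (\<lambda>y. f (p + \<kappa> y))"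
      using o S(2) V(2) by (intro exI[of _ S']) (auto simp: S'_def)
  next
    assume "\<exists>S. open S \<and> 0 \<in> S \<and> S \<subseteq> E0 \<and> smooth_on S (\<lambda>y. f (p + \<kappa> y))"
    then obtain S where S: "open S" "0 \<in> S" "S \<subseteq> E0" "smooth_on S (\<lambda>y. f (p + \<kappa> y))" by blast
    note T = smooth_left_translation_to_identity_chart[OF V(1), of "- p"]
    define S' where "S' = {x \<in> \<theta> ` V. - p + inv_into V \<theta> x \<in> U} \<inter> (\<lambda>x. \<psi> (- p + inv_into V \<theta> x)) -` S"
    have o: "open S'" unfolding S'_def
      by (rule continuous_open_preimage[OF smooth_on_continuous_on[OF T(2)] T(1) S(1)])
    have "smooth_on S' (\<lambda>x. f (p + \<kappa> (\<psi> (- p + inv_into V \<theta> x))))"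
      by (rule smooth_on_compose[OF o S(1) _ smooth_on_subset[OF T(2)] S(4)]) (auto simp: S'_def)
    then have "smooth_on S' (\<lambda>x. f (inv_into V \<theta> x))"
      by (rule smooth_on_cong[OF o, rotated]) (auto simp: S'_def \<kappa>_\<psi> add.assoc[symmetric])
    then show "smooth_near A p f"
      unfolding iff using o S(2) V(2) cV(5) U0 by (intro exI[of _ S']) (auto simp: S'_def)
  qed
qed

lemma smooth_near_left_translate:
  "smooth_near A 0 (\<lambda>q. f (p + q)) \<longleftrightarrow> smooth_near A p f"
  unfolding smooth_near_iff_translated by simp

text \<open>The pairs of coordinates whose product stays within the chart; there \<open>\<mu>\<close> is the multiplication in
  coordinates.\<close>

definition M :: "('e \<times> 'e) set" where "M = {(y, w). y \<in> E0 \<and> w \<in> E0 \<and> \<kappa> y + \<kappa> w \<in> U}"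
definition \<mu> :: "'e \<Rightarrow> 'e \<Rightarrow> 'e" where "\<mu> y w = \<psi> (\<kappa> y + \<kappa> w)"

lemma open_M: "open M" and smooth_\<mu>: "smooth_on M (\<lambda>z. \<mu> (fst z) (snd z))"
proof -
  let ?T = "{(x, y). x \<in> \<phi> ` U \<and> y \<in> \<phi> ` U \<and> inv_into U \<phi> x + inv_into U \<phi> y \<in> U}"
  note T = open_mult_chart_image[OF U U open_U]
  note s = smooth_on_translate[OF smooth_mult_charts[OF U U U, unfolded mult_chart_image[OF U U]] T, of "(\<phi> 0, \<phi> 0)"]
  have e: "M = {z. z + (\<phi> 0, \<phi> 0) \<in> ?T}" by (auto simp: M_def E0_eq \<kappa>_def)
  show o: "open M" unfolding e by (rule s(2))
  have "smooth_on M (\<lambda>z. (case z + (\<phi> 0, \<phi> 0) of (x, y) \<Rightarrow> \<phi> (inv_into U \<phi> x + inv_into U \<phi> y)) + (- \<phi> 0))"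
    by (intro smooth_on_add o smooth_on_const s(1)[folded e])
  then show "smooth_on M (\<lambda>z. \<mu> (fst z) (snd z))"
    by (simp add: \<mu>_def \<psi>_def \<kappa>_def case_prod_unfold)
qed

lemma smooth_inverse: "open {y \<in> E0. - \<kappa> y \<in> U}" "smooth_on {y \<in> E0. - \<kappa> y \<in> U} (\<lambda>y. \<psi> (- \<kappa> y))"
proof -
  have e0: "\<phi> ` {p \<in> U. - p \<in> U} = {x \<in> \<phi> ` U. - inv_into U \<phi> x \<in> U}" using U_chart(5) by auto
  have "open ({x \<in> \<phi> ` U. - inv_into U \<phi> x \<in> U})"
  proof -
    have "{x \<in> \<phi> ` U. - inv_into U \<phi> x \<in> U} = \<phi> ` U \<inter> (\<lambda>x. - inv_into U \<phi> x) -` U" by auto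
    then show ?thesis
      using continuous_open_preimage[OF continuous_on_minus[OF U_chart(4)] U_chart(2) open_U] by simp
  qed
  note s = smooth_on_translate[OF smooth_inverse_charts[OF U U, unfolded e0] this, of "\<phi> 0"]
  have e: "{y \<in> E0. - \<kappa> y \<in> U} = {y. y + \<phi> 0 \<in> {x \<in> \<phi> ` U. - inv_into U \<phi> x \<in> U}}"
    by (auto simp: E0_eq \<kappa>_def)
  show o: "open {y \<in> E0. - \<kappa> y \<in> U}" unfolding e by (rule s(2))
  have "smooth_on {y \<in> E0. - \<kappa> y \<in> U} (\<lambda>y. \<phi> (- inv_into U \<phi> (y + \<phi> 0)) + (- \<phi> 0))"
    by (intro smooth_on_add o smooth_on_const s(1)[folded e])
  then show "smooth_on {y \<in> E0. - \<kappa> y \<in> U} (\<lambda>y. \<psi> (- \<kappa> y))" by (simp add: \<psi>_def \<kappa>_def)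
qed

lemma smooth_conjugation:
  "\<exists>S. open S \<and> 0 \<in> S \<and> S \<subseteq> E0 \<and> (\<forall>y\<in>S. g + \<kappa> y - g \<in> U) \<and> smooth_on S (\<lambda>y. \<psi> (g + \<kappa> y - g))"
proof -
  obtain V \<theta> where V: "(V, \<theta>) \<in> A" "g \<in> V" using atlas_covers[OF atlas] by metis
  note cV = atlas_chart[OF atlas V(1)]
  note L = smooth_translated_chart[OF V(1), of g] and R = smooth_right_translation_to_identity_chart[OF V(1), of "- g"]
  let ?T = "{x \<in> \<theta> ` V. inv_into V \<theta> x + - g \<in> U}"
  define S where "S = {y \<in> E0. g + \<kappa> y \<in> V} \<inter> (\<lambda>y. \<theta> (g + \<kappa> y)) -` ?T"
  have o: "open S" unfolding S_def by (rule continuous_open_preimage[OF smooth_on_continuous_on[OF L(2)] L(1) R(1)])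
  have "smooth_on S (\<lambda>y. \<psi> (inv_into V \<theta> (\<theta> (g + \<kappa> y)) + - g))"
    by (rule smooth_on_compose[OF o R(1) _ smooth_on_subset[OF L(2)] R(2)]) (auto simp: S_def)
  then have "smooth_on S (\<lambda>y. \<psi> (g + \<kappa> y - g))"
    by (rule smooth_on_cong[OF o, rotated]) (auto simp: S_def cV(5))
  moreover have "g + \<kappa> y - g \<in> U" if "y \<in> S" for y
  proof -
    have "inv_into V \<theta> (\<theta> (g + \<kappa> y)) + - g \<in> U" "g + \<kappa> y \<in> V" using that by (simp_all add: S_def)
    then show ?thesis using cV(5) by simp
  qed
  moreover have "0 \<in> S" "S \<subseteq> E0" using V(2) cV(5) U0 by (auto simp: S_def)
  ultimately show ?thesis using o by blast
qed

section \<open>The Lie algebra in coordinates\<close>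

text \<open>The value 0 on the remaining functions agrees with the convention for tangent vectors.\<close>

definition T :: "'e \<Rightarrow> 'g tangent" where
  "T u = (\<lambda>f. if smooth_near A 0 f then frechet_derivative (\<lambda>y. f (\<kappa> y)) (at 0) u else 0)"

lemma smooth_near_0:
  "smooth_near A 0 f \<longleftrightarrow> (\<exists>S. open S \<and> 0 \<in> S \<and> S \<subseteq> E0 \<and> smooth_on S (\<lambda>y. f (\<kappa> y)))"
  using smooth_near_iff_translated[of 0 f] by simp

lemma T_has_derivative:
  assumes "smooth_near A 0 f"
  shows "((\<lambda>y. f (\<kappa> y)) has_derivative (\<lambda>u. T u f)) (at 0)"
proof -
  obtain S where "0 \<in> S" "smooth_on S (\<lambda>y. f (\<kappa> y))" using assms unfolding smooth_near_0 by blast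
  then show ?thesis using smooth_on_has_derivative[of S "\<lambda>y. f (\<kappa> y)" 0] assms by (simp add: T_def)
qed

lemma T_eqI:
  assumes "smooth_near A 0 f" "((\<lambda>y. f (\<kappa> y)) has_derivative D) (at 0)"
  shows "T u f = D u"
  using assms frechet_derivative_at[OF assms(2)] by (simp add: T_def)

lemma T_add: "T (u + v) = T u + T v"
proof
  fix f show "T (u + v) f = (T u + T v) f"
  proof (cases "smooth_near A 0 f")
    case True
    show ?thesis using linear_add[OF has_derivative_linear[OF T_has_derivative[OF True]], of u v] by simp
  qed (simp add: T_def)
qed

lemma T_scaleR: "T (c *\<^sub>R u) = c *\<^sub>R T u"
proof
  fix f show "T (c *\<^sub>R u) f = (c *\<^sub>R T u) f"
  proof (cases "smooth_near A 0 f")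
    case True
    show ?thesis using linear_scale[OF has_derivative_linear[OF T_has_derivative[OF True]], of c u] by simp
  qed (simp add: T_def)
qed

lemma linear_T: "linear T" by (rule linearI) (simp_all add: T_add T_scaleR)

lemma smooth_near_coordinate:
  assumes S: "open S" "0 \<in> S" and F: "smooth_on S F"
  shows "smooth_near A 0 (\<lambda>p. F (\<psi> p))"
proof -
  have "smooth_on (S \<inter> E0) (\<lambda>y. F (\<psi> (\<kappa> y)))"
    by (rule smooth_on_cong[OF _ _ smooth_on_subset[OF F]]) (auto simp: S open_E0 \<psi>_\<kappa> open_Int)
  then show ?thesis unfolding smooth_near_0 using S open_E0 by (intro exI[of _ "S \<inter> E0"]) auto
qed

lemma smooth_near_linear_coordinate: "bounded_linear l \<Longrightarrow> smooth_near A 0 (\<lambda>p. l (\<psi> p))"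
  by (rule smooth_near_coordinate[OF open_UNIV UNIV_I smooth_on_bounded_linear[OF _ open_UNIV]])

text \<open>A tangent vector is determined by its values on the coordinate functions.\<close>

lemma T_linear_coordinate:
  assumes l: "bounded_linear l" shows "T u (\<lambda>p. l (\<psi> p)) = l u"
proof (rule T_eqI[OF smooth_near_linear_coordinate[OF l]])
  show "((\<lambda>y. l (\<psi> (\<kappa> y))) has_derivative l) (at 0)"
    by (rule has_derivative_transform_within_open[OF bounded_linear_imp_has_derivative[OF l] open_E0 E0_0]) (simp add: \<psi>_\<kappa>)
qed

lemma T_inject: "T u = T v \<longleftrightarrow> u = v"
proof
  assume "T u = T v"
  then have "u \<bullet> i = v \<bullet> i" for i
    using T_linear_coordinate[OF bounded_linear_inner_left[of i], of u]
      T_linear_coordinate[OF bounded_linear_inner_left[of i], of v] by metis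
  then show "u = v" by (rule euclidean_eqI)
qed simp

lemma smooth_near_0_binary:
  assumes "smooth_near A 0 f" "smooth_near A 0 g"
    and op: "\<And>S F G :: 'e \<Rightarrow> real. open S \<Longrightarrow> smooth_on S F \<Longrightarrow> smooth_on S G \<Longrightarrow> smooth_on S (\<lambda>x. h (F x) (G x))"
  shows "smooth_near A 0 (\<lambda>q. h (f q) (g q))"
proof -
  obtain S where S: "open S" "0 \<in> S" "S \<subseteq> E0" "smooth_on S (\<lambda>y. f (\<kappa> y))"
    using assms(1) unfolding smooth_near_0 by blast
  obtain S' where S': "open S'" "0 \<in> S'" "S' \<subseteq> E0" "smooth_on S' (\<lambda>y. g (\<kappa> y))"
    using assms(2) unfolding smooth_near_0 by blast
  have "smooth_on (S \<inter> S') (\<lambda>y. h (f (\<kappa> y)) (g (\<kappa> y)))"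
    using S S' by (intro op smooth_on_subset[OF S(4)] smooth_on_subset[OF S'(4)]) auto
  then show ?thesis unfolding smooth_near_0 using S S' by (intro exI[of _ "S \<inter> S'"]) auto
qed

lemma smooth_near_0_add: "smooth_near A 0 f \<Longrightarrow> smooth_near A 0 g \<Longrightarrow> smooth_near A 0 (\<lambda>q. f q + g q)"
  by (rule smooth_near_0_binary) (auto intro: smooth_on_add)

lemma smooth_near_0_mult: "smooth_near A 0 f \<Longrightarrow> smooth_near A 0 g \<Longrightarrow> smooth_near A 0 (\<lambda>q. f q * g q)"
  by (rule smooth_near_0_binary) (auto intro: smooth_on_mult)

lemma smooth_near_0_const: "smooth_near A 0 (\<lambda>q. c)"
  unfolding smooth_near_0 using open_E0 by (intro exI[of _ E0]) (auto intro: smooth_on_const)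

lemma smooth_near_0_sum:
  "(\<And>i. i \<in> I \<Longrightarrow> smooth_near A 0 (f i)) \<Longrightarrow> smooth_near A 0 (\<lambda>q. \<Sum>i\<in>I. f i q)"
  by (induction I rule: infinite_finite_induct) (auto intro: smooth_near_0_add smooth_near_0_const)

lemma T_in_lie_algebra: "T u \<in> lie_algebra A"
  unfolding lie_algebra_def tangent_space_def
proof (intro CollectI conjI allI impI)
  fix f g assume fg: "smooth_near A 0 f \<and> smooth_near A 0 g"
  then have d: "((\<lambda>y. f (\<kappa> y)) has_derivative (\<lambda>u. T u f)) (at 0)" "((\<lambda>y. g (\<kappa> y)) has_derivative (\<lambda>u. T u g)) (at 0)"
    using T_has_derivative by auto
  show "T u (\<lambda>q. f q + g q) = T u f + T u g"
    by (rule T_eqI[OF smooth_near_0_add has_derivative_add[OF d]]) (use fg in auto)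
  show "T u (\<lambda>q. f q * g q) = f 0 * T u g + g 0 * T u f"
    by (rule T_eqI[OF smooth_near_0_mult has_derivative_eq_rhs[OF has_derivative_mult[OF d]]]) (use fg in auto)
next
  fix c f assume f: "smooth_near A 0 f"
  show "T u (\<lambda>q. c * f q) = c * T u f"
    by (rule T_eqI[OF smooth_near_0_mult[OF smooth_near_0_const f] has_derivative_mult_right[OF T_has_derivative[OF f]]])
next
  show "T u f = 0" if "\<not> smooth_near A 0 f" for f using that by (simp add: T_def)
qed

text \<open>Every derivation at the identity is a directional derivative: by Hadamard's lemma a smooth
  function is a constant plus products of coordinates and smooth functions near the identity.\<close>

lemma derivation_is_T:
  assumes X: "X \<in> lie_algebra A" obtains u where "X = T u"
proof -
  have add: "X (\<lambda>q. f q + g q) = X f + X g" and mult: "X (\<lambda>q. f q * g q) = f 0 * X g + g 0 * X f"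
    if "smooth_near A 0 f" "smooth_near A 0 g" for f g
    using X that by (auto simp: lie_algebra_def tangent_space_def)
  have scale: "X (\<lambda>q. c * f q) = c * X f" if "smooth_near A 0 f" for c f
    using X that by (auto simp: lie_algebra_def tangent_space_def)
  have X1: "X (\<lambda>q. 1) = 0" using mult[OF smooth_near_0_const smooth_near_0_const, of 1 1] by simp
  have Xc: "X (\<lambda>q. c) = 0" for c using scale[OF smooth_near_0_const, of c 1] X1 by simp
  have Xsum: "X (\<lambda>q. \<Sum>i\<in>I. f i q) = (\<Sum>i\<in>I. X (f i))" if "finite I" "\<And>i. smooth_near A 0 (f i)" for I :: "'e set" and f
    using that(1) by (induction I rule: finite_induct) (simp_all add: Xc add[OF that(2) smooth_near_0_sum[OF that(2)]])
  have local: "X f = X g" if W: "open W" "0 \<in> W" "\<And>p. p \<in> W \<Longrightarrow> f p = g p" and f: "smooth_near A 0 f" "smooth_near A 0 g" for f g W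
  proof -
    define c where "c p = (if p \<in> W then 1 else 0 :: real)" for p
    have "open (E0 \<inter> \<kappa> -` W)" by (rule continuous_open_preimage[OF continuous_on_\<kappa> open_E0 W(1)])
    then have "smooth_on (E0 \<inter> \<kappa> -` W) (\<lambda>y. c (\<kappa> y))"
      by (intro smooth_on_cong[OF _ _ smooth_on_const[of _ 1]]) (auto simp: c_def)
    then have c: "smooth_near A 0 c"
      unfolding smooth_near_0 using W(2) \<open>open (E0 \<inter> \<kappa> -` W)\<close> by (intro exI[of _ "E0 \<inter> \<kappa> -` W"]) auto
    have "(\<lambda>p. f p * c p) = (\<lambda>p. g p * c p)" using W(3) by (auto simp: c_def)
    then have "f 0 * X c + c 0 * X f = g 0 * X c + c 0 * X g"
      using mult[OF f(1) c] mult[OF f(2) c] by simp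
    then show ?thesis using W by (simp add: c_def)
  qed
  define u where "u = (\<Sum>i\<in>Basis. X (\<lambda>p. \<psi> p \<bullet> i) *\<^sub>R i)"
  have "X f = T u f" for f
  proof (cases "smooth_near A 0 f")
    case False then show ?thesis using X by (auto simp: lie_algebra_def tangent_space_def T_def)
  next
    case True
    then obtain S where S: "open S" "0 \<in> S" "S \<subseteq> E0" "smooth_on S (\<lambda>y. f (\<kappa> y))" unfolding smooth_near_0 by blast
    obtain r where r: "r > 0" "ball 0 r \<subseteq> S" using S open_contains_ball by blast
    have "\<exists>H. (\<forall>i. smooth_on (ball 0 r) (H i) \<and> H i 0 = frechet_derivative (\<lambda>y. f (\<kappa> y)) (at 0) i) \<and>
      (\<forall>y\<in>ball 0 r. f (\<kappa> y) = f (\<kappa> 0) + (\<Sum>i\<in>Basis. (y \<bullet> i) * H i y))"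
      by (rule smooth_on_hadamard[OF smooth_on_subset[OF S(4) r(2)] r(1)])
    then obtain H where H0: "\<forall>i. smooth_on (ball 0 r) (H i) \<and> H i 0 = frechet_derivative (\<lambda>y. f (\<kappa> y)) (at 0) i"
      "\<forall>y\<in>ball 0 r. f (\<kappa> y) = f (\<kappa> 0) + (\<Sum>i\<in>Basis. (y \<bullet> i) * H i y)" by (elim exE conjE)
    then have H: "\<And>i. smooth_on (ball 0 r) (H i)"
      "\<And>y. y \<in> ball 0 r \<Longrightarrow> f (\<kappa> y) = f (\<kappa> 0) + (\<Sum>i\<in>Basis. (y \<bullet> i) * H i y)"
      "\<And>i. H i 0 = frechet_derivative (\<lambda>y. f (\<kappa> y)) (at 0) i" by auto
    have x: "smooth_near A 0 (\<lambda>p. \<psi> p \<bullet> i)" for i by (rule smooth_near_linear_coordinate[OF bounded_linear_inner_left])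
    have Hs: "smooth_near A 0 (\<lambda>p. H i (\<psi> p))" for i
      using r by (intro smooth_near_coordinate[OF open_ball _ H(1)]) simp
    have xH: "smooth_near A 0 (\<lambda>p. (\<psi> p \<bullet> i) * H i (\<psi> p))" for i by (rule smooth_near_0_mult[OF x Hs])
    note sums = smooth_near_0_sum[of "Basis :: 'e set", OF xH]
    have "X f = X (\<lambda>p. f 0 + (\<Sum>i\<in>Basis. (\<psi> p \<bullet> i) * H i (\<psi> p)))"
    proof (rule local[of "{p \<in> U. \<psi> p \<in> ball 0 r}"])
      have "{p \<in> U. \<psi> p \<in> ball 0 r} = U \<inter> \<psi> -` ball 0 r" by auto
      then show "open {p \<in> U. \<psi> p \<in> ball 0 r}"
        using continuous_open_preimage[OF continuous_on_\<psi> open_U open_ball] by simp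
      show "0 \<in> {p \<in> U. \<psi> p \<in> ball 0 r}" using U0 r by simp
      show "f p = f 0 + (\<Sum>i\<in>Basis. (\<psi> p \<bullet> i) * H i (\<psi> p))" if "p \<in> {p \<in> U. \<psi> p \<in> ball 0 r}" for p
        using H(2)[of "\<psi> p"] that by (simp add: \<kappa>_\<psi>)
      show "smooth_near A 0 (\<lambda>p. f 0 + (\<Sum>i\<in>Basis. (\<psi> p \<bullet> i) * H i (\<psi> p)))"
        by (rule smooth_near_0_add[OF smooth_near_0_const sums])
    qed (rule True)
    also have "\<dots> = (\<Sum>i\<in>Basis. X (\<lambda>p. (\<psi> p \<bullet> i) * H i (\<psi> p)))"
      using add[OF smooth_near_0_const sums, of "f 0"] Xsum[OF finite_Basis xH] by (simp add: Xc)
    also have "\<dots> = (\<Sum>i\<in>Basis. X (\<lambda>p. \<psi> p \<bullet> i) * H i 0)"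
      by (intro sum.cong refl, subst mult[OF x Hs]) simp
    also have "\<dots> = (\<Sum>i\<in>Basis. X (\<lambda>p. \<psi> p \<bullet> i) * T i f)" using True by (simp add: H(3) T_def)
    also have "\<dots> = T u f"
    proof -
      have lin: "linear (\<lambda>u. T u f)" by (rule has_derivative_linear[OF T_has_derivative[OF True]])
      show ?thesis
        unfolding u_def using linear_sum[OF lin, of "\<lambda>i. X (\<lambda>p. \<psi> p \<bullet> i) *\<^sub>R i" Basis] linear_scale[OF lin] by simp
    qed
    finally show ?thesis .
  qed
  then show thesis using that[of u] by blast
qed

lemma lie_algebra_eq: "lie_algebra A = range T"
  using T_in_lie_algebra derivation_is_T by blast

text \<open>The differential at 0 of the left translation by \<open>y\<close>: in coordinates the left-invariant field extending
  \<open>w\<close> is \<open>y \<mapsto> L y w\<close>, and \<open>B\<close> is the bracket at 0 of two such fields.\<close>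

definition L :: "'e \<Rightarrow> 'e \<Rightarrow> 'e" where "L y w = frechet_derivative (\<lambda>w. \<mu> y w) (at 0) w"

definition B :: "'e \<Rightarrow> 'e \<Rightarrow> 'e" where
  "B u v = frechet_derivative (\<lambda>y. L y v) (at 0) u - frechet_derivative (\<lambda>y. L y u) (at 0) v"

lemma \<mu>_0_left: "w \<in> E0 \<Longrightarrow> \<mu> 0 w = w" by (simp add: \<mu>_def \<psi>_\<kappa>)
lemma \<mu>_0_right: "y \<in> E0 \<Longrightarrow> \<mu> y 0 = y" by (simp add: \<mu>_def \<psi>_\<kappa>)
lemma M_0_right: "(y, 0) \<in> M \<longleftrightarrow> y \<in> E0" by (auto simp: M_def \<kappa>_U)
lemma M_0_left: "(0, w) \<in> M \<longleftrightarrow> w \<in> E0" by (auto simp: M_def \<kappa>_U)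
lemma \<kappa>_\<mu>: "(y, w) \<in> M \<Longrightarrow> \<kappa> (\<mu> y w) = \<kappa> y + \<kappa> w" by (auto simp: M_def \<mu>_def \<kappa>_\<psi>)

definition D\<mu> :: "'e \<times> 'e \<Rightarrow> 'e \<times> 'e \<Rightarrow> 'e" where
  "D\<mu> z = frechet_derivative (\<lambda>z. \<mu> (fst z) (snd z)) (at z)"

lemma D\<mu>: "z \<in> M \<Longrightarrow> ((\<lambda>z. \<mu> (fst z) (snd z)) has_derivative D\<mu> z) (at z)"
  unfolding D\<mu>_def by (rule smooth_on_has_derivative[OF smooth_\<mu>])

lemma smooth_D\<mu>: "smooth_on M (\<lambda>z. D\<mu> z h)"
  unfolding D\<mu>_def by (rule smooth_on_frechet_derivative[OF smooth_\<mu>])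

lemma \<mu>_right_derivative:
  assumes "(y, w) \<in> M" shows "((\<lambda>w. \<mu> y w) has_derivative (\<lambda>h. D\<mu> (y, w) (0, h))) (at w)"
proof -
  have "((\<lambda>w. (y, w)) has_derivative (\<lambda>h. (0, h))) (at w)" by (auto intro!: derivative_eq_intros)
  from has_derivative_compose[OF this D\<mu>[OF assms]] show ?thesis by simp
qed

lemma \<mu>_left_derivative:
  assumes "(y, w) \<in> M" shows "((\<lambda>y. \<mu> y w) has_derivative (\<lambda>h. D\<mu> (y, w) (h, 0))) (at y)"
proof -
  have "((\<lambda>y. (y, w)) has_derivative (\<lambda>h. (h, 0))) (at y)" by (auto intro!: derivative_eq_intros)
  from has_derivative_compose[OF this D\<mu>[OF assms]] show ?thesis by simp
qed

lemma L_eq: "y \<in> E0 \<Longrightarrow> L y = (\<lambda>w. D\<mu> (y, 0) (0, w))"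
  unfolding L_def using frechet_derivative_at[OF \<mu>_right_derivative, of y 0] by (simp add: M_0_right fun_eq_iff)

lemma L_derivative: "y \<in> E0 \<Longrightarrow> ((\<lambda>w. \<mu> y w) has_derivative L y) (at 0)"
  using \<mu>_right_derivative[of y 0] by (simp add: L_eq M_0_right)

lemma linear_L: "y \<in> E0 \<Longrightarrow> linear (L y)" using L_derivative has_derivative_linear by blast

lemma L_0: "L 0 w = w"
proof -
  have "((\<lambda>w. \<mu> 0 w) has_derivative (\<lambda>w. w)) (at 0)"
    by (rule has_derivative_transform_within_open[OF has_derivative_ident open_E0 E0_0]) (simp add: \<mu>_0_left)
  then show ?thesis using has_derivative_unique[OF L_derivative[OF E0_0]] by metis
qed

lemma smooth_L: "smooth_on E0 (\<lambda>y. L y w)"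
proof (rule smooth_on_cong[OF open_E0])
  show "smooth_on E0 (\<lambda>y. D\<mu> (y, 0) (0, w))"
    by (rule smooth_on_compose[OF open_E0 open_M _ smooth_on_Pair[OF open_E0 smooth_on_id[OF open_E0] smooth_on_const[OF open_E0]] smooth_D\<mu>])
       (auto simp: M_0_right)
qed (simp add: L_eq)

lemma DL: "((\<lambda>y. L y w) has_derivative frechet_derivative (\<lambda>y. L y w) (at 0)) (at 0)"
  by (rule smooth_on_has_derivative[OF smooth_L E0_0])

lemma DL_add: "frechet_derivative (\<lambda>y. L y (v + w)) (at 0) u = frechet_derivative (\<lambda>y. L y v) (at 0) u + frechet_derivative (\<lambda>y. L y w) (at 0) u"
  by (subst frechet_derivative_cong[OF open_E0 E0_0 _ has_derivative_add[OF DL[of v] DL[of w]]])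
     (auto simp: linear_L linear_add)

lemma DL_scale: "frechet_derivative (\<lambda>y. L y (c *\<^sub>R v)) (at 0) u = c *\<^sub>R frechet_derivative (\<lambda>y. L y v) (at 0) u"
  by (subst frechet_derivative_cong[OF open_E0 E0_0 _ has_derivative_scaleR_right[OF DL[of v], of c]])
     (auto simp: linear_L linear_scale)

lemma bounded_bilinear_B: "bounded_bilinear B"
proof -
  note lin = has_derivative_linear[OF DL]
  have "bilinear B"
    unfolding bilinear_def
  proof (intro conjI allI linearI)
  qed (auto simp: B_def DL_add DL_scale linear_add[OF lin] linear_scale[OF lin] algebra_simps)
  then show ?thesis by (simp add: bilinear_conv_bounded_bilinear)
qed

lemma B_self: "B u u = 0" by (simp add: B_def)

lemma dL_T_chart:
  assumes S: "open S" "S \<subseteq> E0" and F: "smooth_on S (\<lambda>y. f (\<kappa> y))" and z: "z \<in> S"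
  shows "smooth_near A (\<kappa> z) f"
    "dL (\<kappa> z) (T v) f = frechet_derivative (\<lambda>y. f (\<kappa> y)) (at z) (L z v)"
proof -
  have zE: "z \<in> E0" using S z by auto
  define S' where "S' = {y. (z, y) \<in> M \<inter> (\<lambda>z. \<mu> (fst z) (snd z)) -` S}"
  have "open (M \<inter> (\<lambda>z. \<mu> (fst z) (snd z)) -` S)"
    by (rule continuous_open_preimage[OF smooth_on_continuous_on[OF smooth_\<mu>] open_M S(1)])
  moreover have "S' = (\<lambda>y. (z, y)) -` (M \<inter> (\<lambda>z. \<mu> (fst z) (snd z)) -` S)" by (auto simp: S'_def)
  ultimately have o: "open S'" by (simp only:) (intro open_vimage continuous_intros)
  have 0: "0 \<in> S'" using z zE by (auto simp: S'_def M_0_right \<mu>_0_right)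
  have sub: "S' \<subseteq> E0" by (auto simp: S'_def M_def)
  have sz: "smooth_on S' (\<lambda>y. \<mu> z y)"
    using smooth_on_compose[OF o open_M _ smooth_on_Pair[OF o smooth_on_const[OF o] smooth_on_id[OF o]] smooth_\<mu>]
    by (auto simp: S'_def)
  have "smooth_on S' (\<lambda>y. f (\<kappa> (\<mu> z y)))"
    by (rule smooth_on_compose[OF o S(1) _ sz F]) (auto simp: S'_def)
  then have "smooth_on S' (\<lambda>y. f (\<kappa> z + \<kappa> y))"
    by (rule smooth_on_cong[OF o, rotated]) (auto simp: S'_def \<kappa>_\<mu>)
  then show sn: "smooth_near A (\<kappa> z) f"
    unfolding smooth_near_iff_translated using o 0 sub by (intro exI[of _ S']) auto
  have "((\<lambda>y. f (\<kappa> (\<mu> z y))) has_derivative (\<lambda>w. frechet_derivative (\<lambda>y. f (\<kappa> y)) (at z) (L z w))) (at 0)"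
    using has_derivative_compose[OF L_derivative[OF zE], of "\<lambda>y. f (\<kappa> y)"] smooth_on_has_derivative[OF F z]
    by (simp add: \<mu>_0_right[OF zE])
  then have "((\<lambda>y. f (\<kappa> z + \<kappa> y)) has_derivative (\<lambda>w. frechet_derivative (\<lambda>y. f (\<kappa> y)) (at z) (L z w))) (at 0)"
    by (rule has_derivative_transform_within_open[OF _ o 0]) (auto simp: S'_def \<kappa>_\<mu>)
  then show "dL (\<kappa> z) (T v) f = frechet_derivative (\<lambda>y. f (\<kappa> y)) (at z) (L z v)"
    unfolding dL_def using sn by (intro T_eqI) (simp_all add: smooth_near_left_translate)
qed

text \<open>In coordinates the field of \<open>v\<close> acts on \<open>f\<close> as \<open>z \<mapsto> D f(z) (L z v)\<close>.
  Differentiating this in the direction \<open>u\<close> gives one term with the second derivative of \<open>f\<close>,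
  which cancels in the commutator, and one with the derivative of \<open>L\<close>.\<close>

lemma lie_bracket_T: "lie_bracket A (T u) (T v) = T (B u v)"
proof
  fix f
  show "lie_bracket A (T u) (T v) f = T (B u v) f"
  proof (cases "smooth_near A 0 f")
    case False then show ?thesis by (simp add: lie_bracket_def field_bracket_def T_def)
  next
    case True
    then obtain S where S: "open S" "0 \<in> S" "S \<subseteq> E0" "smooth_on S (\<lambda>y. f (\<kappa> y))" unfolding smooth_near_0 by blast
    define F where "F y = f (\<kappa> y)" for y
    have F: "smooth_on S F" unfolding F_def[abs_def] by (rule S)
    define D where "D z = frechet_derivative F (at z)" for z
    have D: "(F has_derivative D z) (at z)" if "z \<in> S" for z
      unfolding D_def by (rule smooth_on_has_derivative[OF F that])
    have Ds: "smooth_on S (\<lambda>z. D z i)" for i unfolding D_def by (rule smooth_on_frechet_derivative[OF F])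
    define H where "H v z = (\<Sum>i\<in>Basis. (L z v \<bullet> i) * D z i)" for v z
    have DH: "D z (L z v) = H v z" if "z \<in> S" for z v
      using linear_basis_expansion[OF has_derivative_linear[OF D[OF that]], of "L z v"]
      by (simp only: H_def real_scaleR_def)
    have Hsm: "smooth_on S (H v)" for v
      unfolding H_def[abs_def]
      by (intro smooth_on_sum smooth_on_mult S(1) Ds smooth_on_bounded_linear_compose[OF bounded_linear_inner_left]
          smooth_on_subset[OF smooth_L S(3)])
    have dLH: "dL (\<kappa> z) (T v) f = H v z" if "z \<in> S" for z v
      using dL_T_chart(2)[OF S(1,3,4) that, of v] DH[OF that] by (simp add: D_def F_def[abs_def])
    have sn: "smooth_near A 0 (\<lambda>q. dL q (T v) f)" for v
      unfolding smooth_near_0 using S smooth_on_cong[OF S(1) _ Hsm[of v], of "\<lambda>y. dL (\<kappa> y) (T v) f"] dLH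
      by (intro exI[of _ S]) auto
    define DD where "DD v = frechet_derivative (\<lambda>z. D z v) (at 0)" for v
    have DD: "((\<lambda>z. D z v) has_derivative DD v) (at 0)" for v
      unfolding DD_def by (rule smooth_on_has_derivative[OF Ds S(2)])
    have DDsum: "(\<Sum>i\<in>Basis. (v \<bullet> i) * DD i u) = DD v u" for u v
    proof -
      have "((\<lambda>z. \<Sum>i\<in>Basis. (v \<bullet> i) * D z i) has_derivative (\<lambda>u. \<Sum>i\<in>Basis. (v \<bullet> i) * DD i u)) (at 0)"
        by (intro has_derivative_sum has_derivative_mult_right DD)
      then have "frechet_derivative (\<lambda>z. D z v) (at 0) = (\<lambda>u. \<Sum>i\<in>Basis. (v \<bullet> i) * DD i u)"
      proof (rule frechet_derivative_cong[OF S(1,2), rotated])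
        show "(\<Sum>i\<in>Basis. (v \<bullet> i) * D z i) = D z v" if "z \<in> S" for z
          using linear_basis_expansion[OF has_derivative_linear[OF D[OF that]], of v] by simp
      qed
      then show ?thesis by (simp add: DD_def)
    qed
    have TH: "T u (\<lambda>q. dL q (T v) f) = D 0 (frechet_derivative (\<lambda>y. L y v) (at 0) u) + DD v u" for u v
    proof -
      have "((\<lambda>z. \<Sum>i\<in>Basis. (L z v \<bullet> i) * D z i) has_derivative
         (\<lambda>u. \<Sum>i\<in>Basis. (L 0 v \<bullet> i) * DD i u + (frechet_derivative (\<lambda>y. L y v) (at 0) u \<bullet> i) * D 0 i)) (at 0)"
        by (intro has_derivative_sum has_derivative_mult has_derivative_inner_left DL DD)
      then have "((\<lambda>z. H v z) has_derivative
         (\<lambda>u. \<Sum>i\<in>Basis. (L 0 v \<bullet> i) * DD i u + (frechet_derivative (\<lambda>y. L y v) (at 0) u \<bullet> i) * D 0 i)) (at 0)"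
        by (simp add: H_def)
      then have d: "((\<lambda>z. dL (\<kappa> z) (T v) f) has_derivative
         (\<lambda>u. \<Sum>i\<in>Basis. (L 0 v \<bullet> i) * DD i u + (frechet_derivative (\<lambda>y. L y v) (at 0) u \<bullet> i) * D 0 i)) (at 0)"
        by (rule has_derivative_transform_within_open[OF _ S(1,2)]) (simp add: dLH)
      have "T u (\<lambda>q. dL q (T v) f) =
          (\<Sum>i\<in>Basis. (v \<bullet> i) * DD i u) + (\<Sum>i\<in>Basis. (frechet_derivative (\<lambda>y. L y v) (at 0) u \<bullet> i) * D 0 i)"
        using T_eqI[OF sn d, of u] by (simp only: L_0 sum.distrib)
      also have "(\<Sum>i\<in>Basis. (frechet_derivative (\<lambda>y. L y v) (at 0) u \<bullet> i) * D 0 i)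
          = D 0 (frechet_derivative (\<lambda>y. L y v) (at 0) u)"
        using linear_basis_expansion[OF has_derivative_linear[OF D[OF S(2)]], of "frechet_derivative (\<lambda>y. L y v) (at 0) u"]
        by (simp only: real_scaleR_def)
      finally show ?thesis by (simp only: DDsum add.commute)
    qed
    have sym: "DD v u = DD u v" unfolding DD_def D_def by (rule second_derivative_symmetric[OF F S(1,2)])
    have "lie_bracket A (T u) (T v) f = T u (\<lambda>q. dL q (T v) f) - T v (\<lambda>q. dL q (T u) f)"
      using True by (simp add: lie_bracket_def field_bracket_def dL_def[of 0])
    also have "\<dots> = D 0 (frechet_derivative (\<lambda>y. L y v) (at 0) u) - D 0 (frechet_derivative (\<lambda>y. L y u) (at 0) v)"
      unfolding TH using sym by simp
    also have "\<dots> = D 0 (B u v)"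
      unfolding B_def using linear_diff[OF has_derivative_linear[OF D[OF S(2)]]] by simp
    also have "\<dots> = T (B u v) f"
      using T_eqI[OF True D[OF S(2), unfolded F_def[abs_def]]] by simp
    finally show ?thesis .
  qed
qed

end

section \<open>Left velocities of curves\<close>

lemma has_vector_derivative_compose:
  assumes "(f has_vector_derivative u) (at t within S)" "(F has_derivative D) (at (f t))"
  shows "((\<lambda>s. F (f s)) has_vector_derivative D u) (at t within S)"
proof -
  have "((\<lambda>s. F (f s)) has_derivative (\<lambda>h. D (h *\<^sub>R u))) (at t within S)"
    using has_derivative_compose[OF assms(1)[unfolded has_vector_derivative_def] assms(2)] .
  then show ?thesis
    using has_derivative_linear[OF assms(2)] by (simp add: has_vector_derivative_def linear_scale)
qed

lemma has_vector_derivative_eventually_cong: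
  assumes "(f has_vector_derivative u) (at t within S)" "\<forall>\<^sub>F s in at t within S. f s = g s" "t \<in> S" "f t = g t"
  shows "(g has_vector_derivative u) (at t within S)"
  using has_derivative_transform_eventually[OF assms(1)[unfolded has_vector_derivative_def] assms(2,4,3)]
  by (simp add: has_vector_derivative_def)

lemma has_derivative_eventually_cong:
  assumes "(f has_derivative D) (at x)" "\<forall>\<^sub>F y in nhds x. f y = g y"
  shows "(g has_derivative D) (at x)"
proof -
  obtain S where "open S" "x \<in> S" "\<And>y. y \<in> S \<Longrightarrow> f y = g y" using assms(2) unfolding eventually_nhds by blast
  then show ?thesis using has_derivative_transform_within_open[OF assms(1)] by blast
qed

lemma inverse_translate_add:
  fixes a b c d :: "'a::group_add"
  shows "- (a + b) + (c + d) = (- b + (- a + c) - (- b)) + (- b + d)"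
  by (simp add: diff_conv_add_uminus minus_add add.assoc del: add_uminus_conv_diff)

lemma inverse_translate_cancel:
  fixes p :: "'a::group_add"
  shows "- (p + a) + (p + b) = - a + b"
  by (simp add: diff_conv_add_uminus minus_add add.assoc del: add_uminus_conv_diff)

context lie_group_chart
begin

text \<open>The left velocity \<open>u\<close> of a curve at time \<open>t\<close> is its derivative there, translated to the
  identity and read in the chart. The explicit continuity is needed because \<open>\<psi>\<close> carries no information
  about points outside the chart.\<close>

definition LV :: "(real \<Rightarrow> 'g) \<Rightarrow> 'e \<Rightarrow> real \<Rightarrow> real set \<Rightarrow> bool" where
  "LV \<gamma> u t S \<longleftrightarrow> (\<gamma> \<longlongrightarrow> \<gamma> t) (at t within S) \<and>
     ((\<lambda>s. \<psi> (- \<gamma> t + \<gamma> s)) has_vector_derivative u) (at t within S)"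

definition Ad :: "'g \<Rightarrow> 'e \<Rightarrow> 'e" where
  "Ad g = frechet_derivative (\<lambda>y. \<psi> (g + \<kappa> y - g)) (at 0)"

lemma Ad_derivative: "((\<lambda>y. \<psi> (g + \<kappa> y - g)) has_derivative Ad g) (at 0)"
proof -
  obtain S where S: "open S" "0 \<in> S" "S \<subseteq> E0" "\<And>y. y \<in> S \<Longrightarrow> g + \<kappa> y - g \<in> U"
    "smooth_on S (\<lambda>y. \<psi> (g + \<kappa> y - g))" using smooth_conjugation[of g] by blast
  show ?thesis unfolding Ad_def by (rule smooth_on_has_derivative[OF S(5,2)])
qed

lemma linear_Ad: "linear (Ad g)" using Ad_derivative has_derivative_linear by blast

lemma tendsto_\<kappa>: "(\<kappa> \<longlongrightarrow> 0) (nhds 0)"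
  using isCont_\<kappa>[OF E0_0] unfolding isCont_def tendsto_at_iff_tendsto_nhds by simp

lemma eventually_conj_U: "\<forall>\<^sub>F y in nhds 0. g + \<kappa> y - g \<in> U"
proof -
  obtain S where S: "open S" "0 \<in> S" "S \<subseteq> E0" "\<And>y. y \<in> S \<Longrightarrow> g + \<kappa> y - g \<in> U"
    "smooth_on S (\<lambda>y. \<psi> (g + \<kappa> y - g))" using smooth_conjugation[of g] by blast
  have "\<forall>\<^sub>F y in nhds 0. y \<in> S" using S by (intro eventually_nhds_in_open)
  then show ?thesis by eventually_elim (rule S(4))
qed

lemma LV_tendsto:
  assumes "LV \<gamma> u t S"
  shows "((\<lambda>s. - \<gamma> t + \<gamma> s) \<longlongrightarrow> 0) (at t within S)"
proof -
  have "((\<lambda>s. - \<gamma> t + \<gamma> s) \<longlongrightarrow> - \<gamma> t + \<gamma> t) (at t within S)"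
    using assms unfolding LV_def by (intro tendsto_intros) auto
  then show ?thesis by simp
qed

lemma LV_eventually:
  assumes "LV \<gamma> u t S" "open W" "0 \<in> W"
  shows "\<forall>\<^sub>F s in at t within S. - \<gamma> t + \<gamma> s \<in> W"
  using topological_tendstoD[OF LV_tendsto[OF assms(1)] assms(2,3)] .

lemma LV_eventually_chart:
  assumes "LV \<gamma> u t S" "\<forall>\<^sub>F y in nhds 0. P y"
  shows "\<forall>\<^sub>F s in at t within S. P (\<psi> (- \<gamma> t + \<gamma> s))"
proof -
  have "((\<lambda>s. \<psi> (- \<gamma> t + \<gamma> s)) \<longlongrightarrow> \<psi> 0) (at t within S)"
    by (rule isCont_tendsto_compose[OF isCont_\<psi>[OF U0] LV_tendsto[OF assms(1)]])
  then have "filterlim (\<lambda>s. \<psi> (- \<gamma> t + \<gamma> s)) (nhds 0) (at t within S)" by simp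
  then show ?thesis using assms(2) by (simp add: filterlim_iff)
qed

lemma D\<mu>_00: "D\<mu> (0, 0) (x, y) = x + y"
proof -
  have 00: "(0, 0) \<in> M" by (simp add: M_0_left)
  have lin: "linear (D\<mu> (0, 0))" by (rule has_derivative_linear[OF D\<mu>[OF 00]])
  have "D\<mu> (0, 0) (0, y) = y" using L_0[of y] by (simp add: L_eq)
  moreover have "D\<mu> (0, 0) (x, 0) = x"
  proof -
    have "((\<lambda>y. \<mu> y 0) has_derivative (\<lambda>x. x)) (at 0)"
      by (rule has_derivative_transform_within_open[OF has_derivative_ident open_E0 E0_0]) (simp add: \<mu>_0_right)
    from has_derivative_unique[OF \<mu>_left_derivative[OF 00] this] show ?thesis by metis
  qed
  moreover have "D\<mu> (0, 0) (x, y) = D\<mu> (0, 0) ((x, 0) + (0, y))" by simp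
  ultimately show ?thesis using linear_add[OF lin, of "(x, 0)" "(0, y)"] by simp
qed

text \<open>\<open>- (a + b) + (a' + b')\<close> is the product of the conjugate of \<open>- a + a'\<close> by \<open>- b\<close>
  and of \<open>- b + b'\<close>, and the multiplication has derivative \<open>x + y\<close> at the identity.\<close>

lemma LV_add:
  assumes \<alpha>: "LV \<alpha> u t S" and \<beta>: "LV \<beta> v t S" and "t \<in> S"
  shows "LV (\<lambda>s. \<alpha> s + \<beta> s) (Ad (- \<beta> t) u + v) t S"
  unfolding LV_def
proof
  show "((\<lambda>s. \<alpha> s + \<beta> s) \<longlongrightarrow> \<alpha> t + \<beta> t) (at t within S)"
    using \<alpha> \<beta> unfolding LV_def by (intro tendsto_intros) auto
  define a where "a s = \<psi> (- \<alpha> t + \<alpha> s)" for s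
  define b where "b s = \<psi> (- \<beta> t + \<beta> s)" for s
  define k where "k y = \<psi> (- \<beta> t + \<kappa> y - (- \<beta> t))" for y
  have a: "(a has_vector_derivative u) (at t within S)" and b: "(b has_vector_derivative v) (at t within S)"
    using \<alpha> \<beta> by (auto simp: LV_def a_def[abs_def] b_def[abs_def])
  have a0: "a t = 0" and b0: "b t = 0" and k0: "k 0 = 0" by (simp_all add: a_def b_def k_def)
  have kd: "(k has_derivative Ad (- \<beta> t)) (at 0)" unfolding k_def[abs_def] by (rule Ad_derivative)
  have ka: "((\<lambda>s. k (a s)) has_vector_derivative Ad (- \<beta> t) u) (at t within S)"
    by (rule has_vector_derivative_compose[OF a]) (simp add: a0 kd)
  have pair: "((\<lambda>s. (k (a s), b s)) has_vector_derivative (Ad (- \<beta> t) u, v)) (at t within S)"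
    using has_derivative_Pair[OF ka[unfolded has_vector_derivative_def] b[unfolded has_vector_derivative_def]]
    by (simp add: has_vector_derivative_def)
  have m: "((\<lambda>s. \<mu> (k (a s)) (b s)) has_vector_derivative (Ad (- \<beta> t) u + v)) (at t within S)"
    using has_vector_derivative_compose[OF pair, of "\<lambda>z. \<mu> (fst z) (snd z)" "D\<mu> (0, 0)"] D\<mu>[of "(0, 0)"]
    by (simp add: a0 b0 k0 M_0_left D\<mu>_00)
  have "\<forall>\<^sub>F s in at t within S. \<mu> (k (a s)) (b s) = \<psi> (- (\<alpha> t + \<beta> t) + (\<alpha> s + \<beta> s))"
    using LV_eventually[OF \<alpha> open_U U0] LV_eventually[OF \<beta> open_U U0]
      LV_eventually_chart[OF \<alpha> eventually_conj_U[of "- \<beta> t"]]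
  proof eventually_elim
    case (elim s)
    have "\<kappa> (a s) = - \<alpha> t + \<alpha> s" "\<kappa> (b s) = - \<beta> t + \<beta> s" using elim by (simp_all add: a_def b_def \<kappa>_\<psi>)
    moreover have "\<kappa> (k (a s)) = - \<beta> t + \<kappa> (a s) - (- \<beta> t)" unfolding k_def using elim(3) by (intro \<kappa>_\<psi>) (simp add: a_def)
    ultimately show ?case unfolding \<mu>_def inverse_translate_add by (simp only:)
  qed
  then show "((\<lambda>s. \<psi> (- (\<alpha> t + \<beta> t) + (\<alpha> s + \<beta> s))) has_vector_derivative (Ad (- \<beta> t) u + v)) (at t within S)"
    by (rule has_vector_derivative_eventually_cong[OF m _ \<open>t \<in> S\<close>]) (simp add: a0 b0 k0 \<mu>_0_left)
qed

lemma inverse_derivative: "((\<lambda>y. \<psi> (- \<kappa> y)) has_derivative (\<lambda>u. - u)) (at 0)"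
proof -
  define \<iota> where "\<iota> y = \<psi> (- \<kappa> y)" for y
  have 0: "0 \<in> {y \<in> E0. - \<kappa> y \<in> U}" using U0 by simp
  obtain D where D: "(\<iota> has_derivative D) (at 0)"
    using smooth_on_has_derivative[OF smooth_inverse(2) 0] unfolding \<iota>_def[abs_def] by blast
  have i0: "\<iota> 0 = 0" by (simp add: \<iota>_def)
  have "((\<lambda>y. (y, \<iota> y)) has_derivative (\<lambda>u. (u, D u))) (at 0)" by (intro has_derivative_Pair has_derivative_ident D)
  from has_derivative_compose[OF this, of "\<lambda>z. \<mu> (fst z) (snd z)" "D\<mu> (0, 0)"]
  have "((\<lambda>y. \<mu> y (\<iota> y)) has_derivative (\<lambda>u. u + D u)) (at 0)"
    using D\<mu>[of "(0, 0)"] by (simp add: i0 M_0_left D\<mu>_00)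
  moreover have "((\<lambda>y. \<mu> y (\<iota> y)) has_derivative (\<lambda>u. 0)) (at 0)"
    by (rule has_derivative_transform_within_open[OF has_derivative_const smooth_inverse(1) 0])
       (simp add: \<mu>_def \<iota>_def \<kappa>_\<psi>)
  ultimately have "(\<lambda>u. u + D u) = (\<lambda>u. 0)" by (rule has_derivative_unique)
  then have "u + D u = 0" for u by metis
  then have "D = (\<lambda>u. - u)" by (auto simp: eq_neg_iff_add_eq_0 add.commute)
  then show ?thesis using D by (simp add: \<iota>_def[abs_def])
qed

lemma LV_uminus:
  assumes \<alpha>: "LV \<alpha> u t S" and "t \<in> S"
  shows "LV (\<lambda>s. - \<alpha> s) (- Ad (\<alpha> t) u) t S"
  unfolding LV_def
proof
  show "((\<lambda>s. - \<alpha> s) \<longlongrightarrow> - \<alpha> t) (at t within S)"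
    using \<alpha> unfolding LV_def by (intro tendsto_intros) auto
  define a where "a s = \<psi> (- \<alpha> t + \<alpha> s)" for s
  define k where "k y = \<psi> (\<alpha> t + \<kappa> y - \<alpha> t)" for y
  have a: "(a has_vector_derivative u) (at t within S)" using \<alpha> by (auto simp: LV_def a_def[abs_def])
  have a0: "a t = 0" and k0: "k 0 = 0" by (simp_all add: a_def k_def)
  have kd: "(k has_derivative Ad (\<alpha> t)) (at 0)" unfolding k_def[abs_def] by (rule Ad_derivative)
  have ka: "((\<lambda>s. k (a s)) has_vector_derivative Ad (\<alpha> t) u) (at t within S)"
    by (rule has_vector_derivative_compose[OF a]) (simp add: a0 kd)
  have m: "((\<lambda>s. \<psi> (- \<kappa> (k (a s)))) has_vector_derivative (- Ad (\<alpha> t) u)) (at t within S)"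
    by (rule has_vector_derivative_compose[OF ka, of "\<lambda>y. \<psi> (- \<kappa> y)"]) (simp add: a0 k0 inverse_derivative)
  have "\<forall>\<^sub>F s in at t within S. \<psi> (- \<kappa> (k (a s))) = \<psi> (- (- \<alpha> t) + - \<alpha> s)"
    using LV_eventually[OF \<alpha> open_U U0] LV_eventually_chart[OF \<alpha> eventually_conj_U[of "\<alpha> t"]]
  proof eventually_elim
    case (elim s)
    have "\<kappa> (a s) = - \<alpha> t + \<alpha> s" using elim by (simp add: a_def \<kappa>_\<psi>)
    moreover have "\<kappa> (k (a s)) = \<alpha> t + \<kappa> (a s) - \<alpha> t" unfolding k_def using elim(2) by (intro \<kappa>_\<psi>) (simp add: a_def)
    ultimately show ?case by (simp add: add.assoc[symmetric])
  qed
  then show "((\<lambda>s. \<psi> (- (- \<alpha> t) + - \<alpha> s)) has_vector_derivative (- Ad (\<alpha> t) u)) (at t within S)"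
    by (rule has_vector_derivative_eventually_cong[OF m _ \<open>t \<in> S\<close>]) (simp add: a0 k0)
qed

lemma LV_left_translate: "LV (\<lambda>s. p + \<alpha> s) u t S" if "LV \<alpha> u t S"
  using that unfolding LV_def
  by (auto intro!: tendsto_intros simp: inverse_translate_cancel)

lemma LV_chart:
  assumes \<gamma>: "LV \<gamma> u t S" and "t \<in> S" and U: "- p + \<gamma> t \<in> U"
  shows "((\<lambda>s. \<psi> (- p + \<gamma> s)) has_vector_derivative L (\<psi> (- p + \<gamma> t)) u) (at t within S)"
proof -
  define y where "y = \<psi> (- p + \<gamma> t)"
  have y: "y \<in> E0" "\<kappa> y = - p + \<gamma> t" using U by (simp_all add: y_def \<psi>_E0 \<kappa>_\<psi>)
  have d: "((\<lambda>s. \<mu> y (\<psi> (- \<gamma> t + \<gamma> s))) has_vector_derivative L y u) (at t within S)"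
    using \<gamma> L_derivative[OF y(1)] unfolding LV_def by (intro has_vector_derivative_compose[where F="\<mu> y"]) auto
  have "\<forall>\<^sub>F s in at t within S. \<mu> y (\<psi> (- \<gamma> t + \<gamma> s)) = \<psi> (- p + \<gamma> s)"
    using LV_eventually[OF \<gamma> open_U U0]
    by eventually_elim (simp add: \<mu>_def y \<kappa>_\<psi> add.assoc)
  then show ?thesis unfolding y_def[symmetric]
    by (rule has_vector_derivative_eventually_cong[OF d _ \<open>t \<in> S\<close>]) (simp add: \<mu>_def y)
qed

text \<open>Such a curve is locally constant, as its coordinates in a translated chart have derivative 0.\<close>

lemma LV_zero_constant:
  assumes LV: "\<And>t. t \<in> {a..b} \<Longrightarrow> LV \<delta> 0 t {a..b}" and "t \<in> {a..b}"
  shows "\<delta> t = \<delta> a"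
proof (rule connected_local_const[of "{a..b}"])
  show "connected {a..b}" "t \<in> {a..b}" "a \<in> {a..b}" using \<open>t \<in> {a..b}\<close> by auto
  show "\<forall>t0\<in>{a..b}. \<forall>\<^sub>F s in at t0 within {a..b}. \<delta> t0 = \<delta> s"
  proof
    fix t0 assume t0: "t0 \<in> {a..b}"
    obtain d where d: "d > 0" "\<And>s. s \<in> {a..b} \<Longrightarrow> dist s t0 < d \<Longrightarrow> - \<delta> t0 + \<delta> s \<in> U"
      using LV_eventually[OF LV[OF t0] open_U U0] U0 unfolding eventually_at by (metis add.left_inverse)
    define J where "J = {a..b} \<inter> ball t0 d"
    have JU: "- \<delta> t0 + \<delta> s \<in> U" if "s \<in> J" for s using d(2)[of s] that by (auto simp: J_def dist_commute)
    have "\<exists>c. \<forall>s\<in>J. \<psi> (- \<delta> t0 + \<delta> s) = c"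
    proof (rule has_vector_derivative_zero_constant)
      show "convex J" unfolding J_def by (intro convex_Int) auto
      fix s assume s: "s \<in> J"
      then have "s \<in> {a..b}" by (simp add: J_def)
      have "L (\<psi> (- \<delta> t0 + \<delta> s)) 0 = 0" using linear_L[OF \<psi>_E0[OF JU[OF s]]] by (simp add: linear_0)
      then have "((\<lambda>s. \<psi> (- \<delta> t0 + \<delta> s)) has_vector_derivative 0) (at s within {a..b})"
        using LV_chart[OF LV[OF \<open>s \<in> {a..b}\<close>] \<open>s \<in> {a..b}\<close> JU[OF s]] by simp
      then show "((\<lambda>s. \<psi> (- \<delta> t0 + \<delta> s)) has_vector_derivative 0) (at s within J)"
        by (rule has_vector_derivative_within_subset) (simp add: J_def)
    next
      show "\<exists>c. \<forall>s\<in>J. \<psi> (- \<delta> t0 + \<delta> s) = c" if "\<And>s. s \<in> J \<Longrightarrow> \<psi> (- \<delta> t0 + \<delta> s) = c" for c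
        using that by blast
    qed
    then obtain c where c: "\<And>s. s \<in> J \<Longrightarrow> \<psi> (- \<delta> t0 + \<delta> s) = c" by blast
    have "t0 \<in> J" using t0 d by (simp add: J_def)
    have eq: "\<delta> t0 = \<delta> s" if s: "s \<in> J" for s
    proof -
      have "\<psi> (- \<delta> t0 + \<delta> s) = \<psi> (- \<delta> t0 + \<delta> t0)" using c[OF s] c[OF \<open>t0 \<in> J\<close>] by simp
      then have "- \<delta> t0 + \<delta> s = - \<delta> t0 + \<delta> t0" using \<kappa>_\<psi>[OF JU[OF s]] \<kappa>_\<psi>[OF JU[OF \<open>t0 \<in> J\<close>]] by metis
      then have "\<delta> t0 + (- \<delta> t0 + \<delta> s) = \<delta> t0 + (- \<delta> t0 + \<delta> t0)" by (simp only:)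
      then show ?thesis by (simp only: add_minus_cancel)
    qed
    show "\<forall>\<^sub>F s in at t0 within {a..b}. \<delta> t0 = \<delta> s"
      unfolding eventually_at using d(1) eq by (intro exI[of _ d]) (auto simp: J_def dist_commute)
  qed
qed

text \<open>The quotient of two curves with the same left velocity has left velocity 0.\<close>

lemma LV_unique_curve:
  assumes \<alpha>: "\<And>t. t \<in> {a..b} \<Longrightarrow> LV \<alpha> (u t) t {a..b}" and \<beta>: "\<And>t. t \<in> {a..b} \<Longrightarrow> LV \<beta> (u t) t {a..b}"
    and 0: "\<alpha> a = \<beta> a" and "t \<in> {a..b}"
  shows "\<alpha> t = \<beta> t"
proof -
  have "LV (\<lambda>s. \<alpha> s + - \<beta> s) 0 t {a..b}" if t: "t \<in> {a..b}" for t
    using LV_add[OF \<alpha>[OF t] LV_uminus[OF \<beta>[OF t] t] t] by simp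
  from LV_zero_constant[OF this \<open>t \<in> {a..b}\<close>] show ?thesis using 0 by (simp add: eq_neg_iff_add_eq_0)
qed

lemma Ad_0: "Ad 0 u = u"
proof -
  have "((\<lambda>y. \<psi> (0 + \<kappa> y - 0)) has_derivative (\<lambda>u. u)) (at 0)"
    by (rule has_derivative_transform_within_open[OF has_derivative_ident open_E0 E0_0]) (simp add: \<psi>_\<kappa>)
  from has_derivative_unique[OF Ad_derivative this] show ?thesis by metis
qed

lemma Ad_add: "Ad (g + h) u = Ad g (Ad h u)"
proof -
  have k0: "\<psi> (h + \<kappa> 0 - h) = 0" by simp
  have "((\<lambda>y. \<psi> (g + \<kappa> (\<psi> (h + \<kappa> y - h)) - g)) has_derivative (\<lambda>u. Ad g (Ad h u))) (at 0)"
    using has_derivative_compose[OF Ad_derivative[of h], of "\<lambda>y. \<psi> (g + \<kappa> y - g)" "Ad g"] Ad_derivative[of g]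
    unfolding k0 by simp
  then have "((\<lambda>y. \<psi> ((g + h) + \<kappa> y - (g + h))) has_derivative (\<lambda>u. Ad g (Ad h u))) (at 0)"
  proof (rule has_derivative_eventually_cong)
    show "\<forall>\<^sub>F y in nhds 0. \<psi> (g + \<kappa> (\<psi> (h + \<kappa> y - h)) - g) = \<psi> ((g + h) + \<kappa> y - (g + h))"
      using eventually_conj_U[of h]
    proof eventually_elim
      case (elim y)
      have "g + (h + \<kappa> y - h) - g = (g + h) + \<kappa> y - (g + h)"
        unfolding diff_conv_add_uminus minus_add by (simp only: add.assoc)
      then show ?case using \<kappa>_\<psi>[OF elim] by simp
    qed
  qed
  from has_derivative_unique[OF Ad_derivative this] show ?thesis by metis
qed

lemma Ad_uminus_Ad: "Ad (- g) (Ad g u) = u"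
  using Ad_add[of "- g" g u] by (simp add: Ad_0)

text \<open>In coordinates, conjugation is a smooth function of both elements. Its mixed derivative at the identity is computed
  from \<open>\<kappa> z + \<kappa> w = (\<kappa> z + \<kappa> w - \<kappa> z) + \<kappa> z\<close>, where both sides
  are products, and equality of mixed derivatives yields the two terms of \<open>B\<close>.\<close>

lemma Ad_\<kappa>_derivative: "((\<lambda>z. Ad (\<kappa> z) x) has_derivative (\<lambda>v. B v x)) (at 0)"
proof -
  define \<iota> where "\<iota> y = \<psi> (- \<kappa> y)" for y
  define I where "I = {y \<in> E0. - \<kappa> y \<in> U}"
  have I: "open I" "smooth_on I \<iota>" "0 \<in> I" using smooth_inverse U0 by (auto simp: I_def \<iota>_def[abs_def])
  define N where "N = {z \<in> M. fst z \<in> I}"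
  have N_eq: "N = M \<inter> fst -` I" by (auto simp: N_def)
  have oN: "open N" unfolding N_eq by (intro open_Int open_M open_vimage_fst I)
  have pN: "smooth_on N (\<lambda>z. (\<mu> (fst z) (snd z), \<iota> (fst z)))"
  proof (rule smooth_on_Pair[OF oN])
    show "smooth_on N (\<lambda>z. \<mu> (fst z) (snd z))" by (rule smooth_on_subset[OF smooth_\<mu>]) (auto simp: N_def)
    show "smooth_on N (\<lambda>z. \<iota> (fst z))"
      by (rule smooth_on_compose[OF oN I(1) _ smooth_on_bounded_linear[OF bounded_linear_fst oN] I(2)]) (auto simp: N_def)
  qed
  define N' where "N' = N \<inter> (\<lambda>z. (\<mu> (fst z) (snd z), \<iota> (fst z))) -` M"
  have oN': "open N'" unfolding N'_def by (rule continuous_open_preimage[OF smooth_on_continuous_on[OF pN] oN open_M])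
  define K where "K z = \<mu> (\<mu> (fst z) (snd z)) (\<iota> (fst z))" for z
  have sK: "smooth_on N' K"
    using smooth_on_compose[OF oN' open_M _ smooth_on_subset[OF pN] smooth_\<mu>] by (auto simp: K_def[abs_def] N'_def)
  have K_eq: "K (z, w) = \<psi> (\<kappa> z + \<kappa> w - \<kappa> z)" if "(z, w) \<in> N'" for z w
    using that by (auto simp: K_def N'_def N_def I_def \<mu>_def[of "\<mu> z w"] \<kappa>_\<mu> \<iota>_def \<kappa>_\<psi>)
  define Z where "Z = (\<lambda>z. (z, 0)) -` N'"
  have oZ: "open Z" unfolding Z_def by (intro open_vimage oN' continuous_intros)
  have Z0: "0 \<in> Z" using U0 I(3) by (simp add: Z_def N'_def N_def M_0_left \<mu>_0_left \<iota>_def)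
  have ZE: "Z \<subseteq> E0" by (auto simp: Z_def N'_def N_def M_def)
  have AK: "Ad (\<kappa> z) x = frechet_derivative K (at (z, 0)) (0, x)" if "z \<in> Z" for z
  proof -
    have zN: "(z, 0) \<in> N'" using that by (simp add: Z_def)
    have "((\<lambda>w. (z, w)) has_derivative (\<lambda>h. (0, h))) (at 0)" by (auto intro!: derivative_eq_intros)
    from has_derivative_compose[OF this smooth_on_has_derivative[OF sK zN]]
    have "((\<lambda>w. K (z, w)) has_derivative (\<lambda>h. frechet_derivative K (at (z, 0)) (0, h))) (at 0)" .
    moreover have "open ((\<lambda>w. (z, w)) -` N')" by (intro open_vimage oN' continuous_intros)
    ultimately have "((\<lambda>w. \<psi> (\<kappa> z + \<kappa> w - \<kappa> z)) has_derivative (\<lambda>h. frechet_derivative K (at (z, 0)) (0, h))) (at 0)"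
      by (rule has_derivative_transform_within_open) (use zN K_eq in auto)
    from has_derivative_unique[OF Ad_derivative this] show ?thesis by metis
  qed
  have "smooth_on Z (\<lambda>z. frechet_derivative K (at (z, 0)) (0, x))"
    by (rule smooth_on_compose[OF oZ oN' _ smooth_on_Pair[OF oZ smooth_on_id[OF oZ] smooth_on_const[OF oZ]]
          smooth_on_frechet_derivative[OF sK]]) (auto simp: Z_def)
  then have "smooth_on Z (\<lambda>z. Ad (\<kappa> z) x)" by (rule smooth_on_cong[OF oZ, rotated]) (simp add: AK)
  from smooth_on_has_derivative[OF this Z0]
  obtain D where D: "((\<lambda>z. Ad (\<kappa> z) x) has_derivative D) (at 0)" by blast
  define R where "R z e = D\<mu> (0, z) (e, 0)" for z e
  have 00: "(0, 0) \<in> M" by (simp add: M_0_left)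
  have Rlin: "linear (R z)" if "z \<in> E0" for z
    unfolding R_def using \<mu>_left_derivative[of 0 z] that by (blast intro: has_derivative_linear dest: M_0_left[THEN iffD2])
  have R0: "R 0 e = e" for e by (simp add: R_def D\<mu>_00)
  have RA: "R z (Ad (\<kappa> z) x) = L z x" if z: "z \<in> E0" for z
  proof -
    have k0: "\<psi> (\<kappa> z + \<kappa> 0 - \<kappa> z) = 0" by simp
    have "((\<lambda>y. \<mu> y z) has_derivative R z) (at 0)"
      unfolding R_def using \<mu>_left_derivative[of 0 z] z by (simp add: M_0_left)
    from has_derivative_compose[OF Ad_derivative[of "\<kappa> z"], of "\<lambda>y. \<mu> y z" "R z"] this
    have "((\<lambda>w. \<mu> (\<psi> (\<kappa> z + \<kappa> w - \<kappa> z)) z) has_derivative (\<lambda>h. R z (Ad (\<kappa> z) h))) (at 0)" by simp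
    then have "((\<lambda>w. \<mu> z w) has_derivative (\<lambda>h. R z (Ad (\<kappa> z) h))) (at 0)"
    proof (rule has_derivative_eventually_cong)
      show "\<forall>\<^sub>F w in nhds 0. \<mu> (\<psi> (\<kappa> z + \<kappa> w - \<kappa> z)) z = \<mu> z w"
        using eventually_conj_U[of "\<kappa> z"] by eventually_elim (simp add: \<mu>_def \<kappa>_\<psi>)
    qed
    from has_derivative_unique[OF L_derivative[OF z] this] show ?thesis by metis
  qed
  have DR: "((\<lambda>z. R z e) has_derivative (\<lambda>v. frechet_derivative (\<lambda>y. L y v) (at 0) e)) (at 0)" for e
  proof -
    have d: "((\<lambda>z. D\<mu> z h) has_derivative frechet_derivative (\<lambda>z. D\<mu> z h) (at (0, 0))) (at (0, 0))" for h
      by (rule smooth_on_has_derivative[OF smooth_D\<mu> 00])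
    have "((\<lambda>z. (0, z)) has_derivative (\<lambda>v. (0, v))) (at 0)" by (auto intro!: derivative_eq_intros)
    from has_derivative_compose[OF this, of "\<lambda>z. D\<mu> z (e, 0)"] d[of "(e, 0)"]
    have 1: "((\<lambda>z. R z e) has_derivative (\<lambda>v. frechet_derivative (\<lambda>z. D\<mu> z (e, 0)) (at (0, 0)) (0, v))) (at 0)"
      unfolding R_def by simp
    have 2: "frechet_derivative (\<lambda>z. D\<mu> z (e, 0)) (at (0, 0)) (0, v) = frechet_derivative (\<lambda>z. D\<mu> z (0, v)) (at (0, 0)) (e, 0)" for v
      unfolding D\<mu>_def by (rule second_derivative_symmetric[OF smooth_\<mu> open_M 00])
    have 3: "frechet_derivative (\<lambda>z. D\<mu> z (0, v)) (at (0, 0)) (e, 0) = frechet_derivative (\<lambda>y. L y v) (at 0) e" for v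
    proof -
      have "((\<lambda>y. (y, 0)) has_derivative (\<lambda>h. (h, 0))) (at 0)" by (auto intro!: derivative_eq_intros)
      from has_derivative_compose[OF this, of "\<lambda>z. D\<mu> z (0, v)"] d[of "(0, v)"]
      have "((\<lambda>y. D\<mu> (y, 0) (0, v)) has_derivative (\<lambda>h. frechet_derivative (\<lambda>z. D\<mu> z (0, v)) (at (0, 0)) (h, 0))) (at 0)" by simp
      from frechet_derivative_cong[OF open_E0 E0_0 _ this, of "\<lambda>y. L y v"] show ?thesis by (simp add: L_eq)
    qed
    show ?thesis using 1 unfolding 2 3 .
  qed
  have "((\<lambda>z. \<Sum>i\<in>Basis. (Ad (\<kappa> z) x \<bullet> i) *\<^sub>R R z i) has_derivative
      (\<lambda>v. \<Sum>i\<in>Basis. (Ad (\<kappa> 0) x \<bullet> i) *\<^sub>R frechet_derivative (\<lambda>y. L y v) (at 0) i + (D v \<bullet> i) *\<^sub>R R 0 i)) (at 0)"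
    by (intro has_derivative_sum has_derivative_scaleR has_derivative_inner_left D DR)
  then have "((\<lambda>z. L z x) has_derivative
      (\<lambda>v. \<Sum>i\<in>Basis. (Ad (\<kappa> 0) x \<bullet> i) *\<^sub>R frechet_derivative (\<lambda>y. L y v) (at 0) i + (D v \<bullet> i) *\<^sub>R R 0 i)) (at 0)"
    by (rule has_derivative_transform_within_open[OF _ open_E0 E0_0])
       (use linear_basis_expansion[OF Rlin] RA in metis)
  from has_derivative_unique[OF DL this]
  have e: "frechet_derivative (\<lambda>y. L y x) (at 0) v
      = (\<Sum>i\<in>Basis. (x \<bullet> i) *\<^sub>R frechet_derivative (\<lambda>y. L y v) (at 0) i + (D v \<bullet> i) *\<^sub>R i)" for v
    by (simp add: Ad_0 R0 fun_eq_iff)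
  have "D v = B v x" for v
  proof -
    have "frechet_derivative (\<lambda>y. L y x) (at 0) v = frechet_derivative (\<lambda>y. L y v) (at 0) x + D v"
      unfolding e[of v] sum.distrib euclidean_representation
      using linear_basis_expansion[OF has_derivative_linear[OF DL[of v]], of x] by simp
    then show ?thesis by (simp add: B_def)
  qed
  then have "D = (\<lambda>v. B v x)" by auto
  then show ?thesis using D by simp
qed

text \<open>Near time \<open>t\<close> the adjoint action factors as \<open>Ad (\<gamma> t)\<close> times that of \<open>-
  \<gamma> t + \<gamma> s\<close>, which is close to the identity.\<close>

lemma Ad_curve_derivative:
  assumes \<gamma>: "LV \<gamma> v t S" and "t \<in> S"
  shows "((\<lambda>s. Ad (\<gamma> s) x) has_vector_derivative Ad (\<gamma> t) (B v x)) (at t within S)"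
proof -
  have e: "((\<lambda>s. Ad (\<kappa> (\<psi> (- \<gamma> t + \<gamma> s))) x) has_vector_derivative B v x) (at t within S)"
    using \<gamma> Ad_\<kappa>_derivative unfolding LV_def
    by (intro has_vector_derivative_compose[where F="\<lambda>z. Ad (\<kappa> z) x"]) auto
  have d: "((\<lambda>s. Ad (\<gamma> t) (Ad (\<kappa> (\<psi> (- \<gamma> t + \<gamma> s))) x)) has_vector_derivative Ad (\<gamma> t) (B v x)) (at t within S)"
    by (rule bounded_linear.has_vector_derivative[OF linear_Ad[unfolded linear_conv_bounded_linear] e])
  have "\<forall>\<^sub>F s in at t within S. Ad (\<gamma> t) (Ad (\<kappa> (\<psi> (- \<gamma> t + \<gamma> s))) x) = Ad (\<gamma> s) x"
    using LV_eventually[OF \<gamma> open_U U0]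
    by eventually_elim (simp add: \<kappa>_\<psi> Ad_add[symmetric] add.assoc[symmetric])
  then show ?thesis
    by (rule has_vector_derivative_eventually_cong[OF d _ \<open>t \<in> S\<close>]) (simp add: Ad_0)
qed

end

section \<open>Curves of constant left velocity\<close>

text \<open>Existence of solutions of an autonomous Lipschitz differential equation on the unit interval,
  when the field is small enough for the solution to stay in the ball where it is defined.\<close>

lemma picard_lindeloef_unit_interval:
  fixes f :: "'a::euclidean_space \<Rightarrow> 'a"
  assumes r: "r > 0" and lip: "\<And>y z. y \<in> cball 0 r \<Longrightarrow> z \<in> cball 0 r \<Longrightarrow> norm (f y - f z) \<le> norm (y - z) / 2"
    and bd: "\<And>y. y \<in> cball 0 r \<Longrightarrow> norm (f y) \<le> r"
  shows "\<exists>y. y 0 = 0 \<and> (\<forall>t\<in>{0..1}. y t \<in> cball 0 r \<and> (y has_vector_derivative f (y t)) (at t within {0..1}))"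
proof -
  define g where "g y = f (closest_point (cball 0 r) y)" for y
  have cp: "closest_point (cball 0 r) y \<in> cball 0 r" for y :: 'a
    using r by (intro closest_point_in_set) auto
  have glip: "norm (g y - g z) \<le> norm (y - z) / 2" for y z
  proof -
    have "norm (g y - g z) \<le> norm (closest_point (cball 0 r) y - closest_point (cball 0 r) z) / 2"
      unfolding g_def by (rule lip[OF cp cp])
    also have "\<dots> \<le> norm (y - z) / 2"
      using closest_point_lipschitz[OF convex_cball closed_cball, of "0::'a" r y z] r by (auto simp: dist_norm)
    finally show ?thesis .
  qed
  have gbd: "norm (g y) \<le> r" for y unfolding g_def by (rule bd[OF cp])
  have gc: "continuous_on S g" for S
  proof (rule continuous_on_subset[OF _ subset_UNIV])
    have "(1/2)-lipschitz_on UNIV g" by (rule lipschitz_onI) (use glip in \<open>auto simp: dist_norm\<close>)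
    then show "continuous_on UNIV g" by (rule lipschitz_on_continuous_on)
  qed
  define cl where "cl t = max 0 (min 1 t)" for t :: real
  have cl: "cl t \<in> {0..1}" for t by (auto simp: cl_def)
  have clc: "continuous_on UNIV cl" unfolding cl_def[abs_def] by (intro continuous_intros)
  define P where "P y t = integral {0..cl t} (\<lambda>s. g (apply_bcontfun y s))" for y :: "real \<Rightarrow>\<^sub>C 'a" and t
  have gi: "continuous_on {0..1} (\<lambda>s. g (apply_bcontfun y s))" for y :: "real \<Rightarrow>\<^sub>C 'a"
    by (rule continuous_on_compose2[OF gc[of UNIV]]) (auto intro: continuous_on_subset[OF continuous_on_apply_bcontfun])
  have gint: "(\<lambda>s. g (apply_bcontfun y s)) integrable_on {0..t}" if "t \<in> {0..1}" for y :: "real \<Rightarrow>\<^sub>C 'a" and t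
    using that by (intro integrable_continuous_real continuous_on_subset[OF gi]) auto
  have Pbc: "P y \<in> bcontfun" for y
  proof (rule bcontfun_normI)
    have "continuous_on {0..1} (\<lambda>t. integral {0..t} (\<lambda>s. g (apply_bcontfun y s)))"
      by (rule indefinite_integral_continuous_1[OF gint]) simp
    then show "continuous_on UNIV (P y)"
      unfolding P_def[abs_def] by (rule continuous_on_compose2[OF _ clc]) (use cl in auto)
    show "norm (P y t) \<le> r" for t
    proof -
      have "norm (P y t) \<le> integral {0..cl t} (\<lambda>s. r)"
        unfolding P_def using gbd by (intro integral_norm_bound_integral gint[OF cl]) auto
      also have "\<dots> \<le> r" using cl[of t] r by (auto simp: mult_left_le_one_le)
      finally show ?thesis .
    qed
  qed
  have contr: "dist (Bcontfun (P y)) (Bcontfun (P z)) \<le> (1/2) * dist y z" for y z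
  proof (rule dist_bound)
    fix t
    have "P y t - P z t = integral {0..cl t} (\<lambda>s. g (apply_bcontfun y s) - g (apply_bcontfun z s))"
      unfolding P_def by (rule Henstock_Kurzweil_Integration.integral_diff[OF gint[OF cl] gint[OF cl], symmetric])
    also have "norm \<dots> \<le> integral {0..cl t} (\<lambda>s. (1/2) * dist y z)"
    proof (intro integral_norm_bound_integral integrable_diff gint[OF cl])
      fix s
      have "norm (g (apply_bcontfun y s) - g (apply_bcontfun z s)) \<le> norm (apply_bcontfun y s - apply_bcontfun z s) / 2" by (rule glip)
      also have "\<dots> \<le> (1/2) * dist y z" using dist_bounded[of y s z] by (simp add: dist_norm)
      finally show "norm (g (apply_bcontfun y s) - g (apply_bcontfun z s)) \<le> (1/2) * dist y z" .
    qed auto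
    also have "\<dots> \<le> (1/2) * dist y z" using cl[of t] by (auto simp: mult_left_le_one_le)
    finally show "dist (apply_bcontfun (Bcontfun (P y)) t) (apply_bcontfun (Bcontfun (P z)) t) \<le> (1/2) * dist y z"
      by (simp add: Bcontfun_inverse[OF Pbc] dist_norm)
  qed
  have "\<exists>!y. Bcontfun (P y) = y" by (rule banach_fix_type[of "1/2"]) (use contr in auto)
  then obtain w where "Bcontfun (P w) = w" by blast
  then have w: "apply_bcontfun w = P w" using Bcontfun_inverse[OF Pbc, of w] by simp
  have wP: "apply_bcontfun w t = integral {0..t} (\<lambda>s. g (apply_bcontfun w s))" if "t \<in> {0..1}" for t
    using that by (subst w) (simp add: P_def cl_def)
  show ?thesis
  proof (intro exI[of _ "apply_bcontfun w"] conjI ballI)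
    show "apply_bcontfun w 0 = 0" using wP[of 0] by simp
    fix t :: real assume t: "t \<in> {0..1}"
    show wr: "apply_bcontfun w t \<in> cball 0 r"
    proof -
      have "norm (apply_bcontfun w t) \<le> integral {0..t} (\<lambda>s. r)"
        unfolding wP[OF t] using gbd by (intro integral_norm_bound_integral gint[OF t]) auto
      also have "\<dots> \<le> r" using t r by (auto simp: mult_left_le_one_le)
      finally show ?thesis by simp
    qed
    have "((\<lambda>u. integral {0..u} (\<lambda>s. g (apply_bcontfun w s))) has_vector_derivative g (apply_bcontfun w t)) (at t within {0..1})"
      by (rule integral_has_vector_derivative[OF gi t])
    then have "(apply_bcontfun w has_vector_derivative g (apply_bcontfun w t)) (at t within {0..1})"
      by (rule has_vector_derivative_transform[OF t, rotated]) (simp add: wP)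
    then show "(apply_bcontfun w has_vector_derivative f (apply_bcontfun w t)) (at t within {0..1})"
      using wr by (simp add: g_def closest_point_self)
  qed
qed

context lie_group_chart
begin

lemma LV_of_chart_curve:
  assumes y: "(y has_vector_derivative L (y t) x) (at t within S)" and yE: "y t \<in> E0" and "t \<in> S"
  shows "LV (\<lambda>s. \<kappa> (y s)) x t S"
proof -
  define N where "N z = \<psi> (- \<kappa> (y t) + \<kappa> z)" for z
  have 0: "y t \<in> {z \<in> E0. - \<kappa> (y t) + \<kappa> z \<in> U}" using yE U0 by simp
  note sm = smooth_translated_chart[OF U, of "- \<kappa> (y t)"]
  have "((\<lambda>z. \<phi> (- \<kappa> (y t) + \<kappa> z) - \<phi> 0) has_derivative frechet_derivative (\<lambda>z. \<phi> (- \<kappa> (y t) + \<kappa> z)) (at (y t))) (at (y t))"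
    using has_derivative_diff[OF smooth_on_has_derivative[OF sm(2) 0] has_derivative_const, of "\<phi> 0"] by simp
  then obtain D where D: "(N has_derivative D) (at (y t))" unfolding N_def[abs_def] \<psi>_def by blast
  have "((\<lambda>w. N (\<mu> (y t) w)) has_derivative (\<lambda>w. D (L (y t) w))) (at 0)"
    using has_derivative_compose[OF L_derivative[OF yE], of N D] D by (simp add: \<mu>_0_right yE)
  moreover have "((\<lambda>w. N (\<mu> (y t) w)) has_derivative (\<lambda>w. w)) (at 0)"
  proof (rule has_derivative_eventually_cong[OF has_derivative_ident])
    have "open ((\<lambda>w. (y t, w)) -` M)" by (intro open_vimage open_M continuous_intros)
    then have "\<forall>\<^sub>F w in nhds 0. w \<in> (\<lambda>w. (y t, w)) -` M"
      using yE by (intro eventually_nhds_in_open) (simp_all add: M_0_right)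
    then show "\<forall>\<^sub>F w in nhds 0. w = N (\<mu> (y t) w)"
    proof eventually_elim
      case (elim w)
      then have "N (\<mu> (y t) w) = \<psi> (\<kappa> w)" "w \<in> E0" by (simp_all add: N_def \<kappa>_\<mu> add.assoc[symmetric] M_def)
      then show ?case by (simp add: \<psi>_\<kappa>)
    qed
  qed
  ultimately have "(\<lambda>w. D (L (y t) w)) = (\<lambda>w. w)" by (rule has_derivative_unique)
  then have DL: "D (L (y t) x) = x" by metis
  have "((\<lambda>s. N (y s)) has_vector_derivative x) (at t within S)"
    using has_vector_derivative_compose[OF y D] DL by simp
  moreover have "((\<lambda>s. \<kappa> (y s)) \<longlongrightarrow> \<kappa> (y t)) (at t within S)"
    by (rule isCont_tendsto_compose[OF isCont_\<kappa>[OF yE]])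
       (use has_vector_derivative_continuous[OF y] in \<open>simp add: continuous_within\<close>)
  ultimately show ?thesis unfolding LV_def N_def by simp
qed

lemma L_bounds:
  "\<exists>r>0. \<exists>K\<ge>1. cball 0 r \<subseteq> E0 \<and>
    (\<forall>y\<in>cball 0 r. \<forall>z\<in>cball 0 r. \<forall>x. norm (L y x - L z x) \<le> K * norm x * norm (y - z)) \<and>
    (\<forall>y\<in>cball 0 r. \<forall>x. norm (L y x) \<le> K * norm x)"
proof -
  have "\<exists>r>0. \<exists>K\<ge>0. cball 0 r \<subseteq> E0 \<and>
    (\<forall>y\<in>cball 0 r. \<forall>z\<in>cball 0 r. norm (L y i - L z i) \<le> K * norm (y - z))" for i
    by (rule smooth_on_imp_locally_lipschitz[OF smooth_L open_E0 E0_0])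
  then obtain r K where rK: "\<And>i. r i > 0" "\<And>i. K i \<ge> 0" "\<And>i. cball 0 (r i) \<subseteq> E0"
    "\<And>i y z. y \<in> cball 0 (r i) \<Longrightarrow> z \<in> cball 0 (r i) \<Longrightarrow> norm (L y i - L z i) \<le> K i * norm (y - z)"
    by metis
  define r0 where "r0 = Min (r ` Basis)"
  define K0 where "K0 = (\<Sum>i\<in>Basis. K i)"
  have r0: "r0 > 0" unfolding r0_def using rK(1) by (subst Min_gr_iff) auto
  have r0i: "r0 \<le> r i" if "i \<in> Basis" for i unfolding r0_def using that by (intro Min_le) auto
  have K0: "K0 \<ge> 0" unfolding K0_def using rK(2) by (intro sum_nonneg) auto
  have sub: "cball 0 r0 \<subseteq> E0"
    using rK(3)[of "SOME i. i \<in> Basis"] r0i[OF SOME_Basis] by fastforce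
  have lip: "norm (L y x - L z x) \<le> K0 * norm x * norm (y - z)" if yz: "y \<in> cball 0 r0" "z \<in> cball 0 r0" for x y z
  proof -
    have "L y x - L z x = (\<Sum>i\<in>Basis. (x \<bullet> i) *\<^sub>R (L y i - L z i))"
    proof -
      have "y \<in> E0" "z \<in> E0" using yz sub by auto
      then have "L y x = (\<Sum>i\<in>Basis. (x \<bullet> i) *\<^sub>R L y i)" "L z x = (\<Sum>i\<in>Basis. (x \<bullet> i) *\<^sub>R L z i)"
        using linear_basis_expansion[OF linear_L] by blast+
      then show ?thesis by (simp only: scaleR_diff_right sum_subtractf)
    qed
    also have "norm \<dots> \<le> (\<Sum>i\<in>Basis. norm ((x \<bullet> i) *\<^sub>R (L y i - L z i)))" by (rule norm_sum)
    also have "\<dots> \<le> (\<Sum>i\<in>Basis. norm x * (K i * norm (y - z)))"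
    proof (rule sum_mono)
      fix i :: 'e assume i: "i \<in> Basis"
      have "norm (L y i - L z i) \<le> K i * norm (y - z)" using yz r0i[OF i] by (intro rK(4)) auto
      then show "norm ((x \<bullet> i) *\<^sub>R (L y i - L z i)) \<le> norm x * (K i * norm (y - z))"
        using Basis_le_norm[OF i, of x] by (auto intro!: mult_mono)
    qed
    also have "\<dots> = K0 * norm x * norm (y - z)" by (simp add: K0_def sum_distrib_left sum_distrib_right mult.assoc mult.left_commute)
    finally show ?thesis .
  qed
  define K1 where "K1 = K0 * r0 + K0 + 1"
  have K1: "K1 \<ge> 1" "K0 \<le> K1" "K0 * r0 + 1 \<le> K1" using K0 r0 by (auto simp: K1_def)
  show ?thesis
  proof (rule exI[of _ r0], rule conjI[OF r0], rule exI[of _ K1], intro conjI ballI allI K1(1) sub)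
    fix y z x :: 'e assume yz: "y \<in> cball 0 r0" "z \<in> cball 0 r0"
    show "norm (L y x - L z x) \<le> K1 * norm x * norm (y - z)"
      using lip[OF yz, of x] mult_right_mono[OF mult_right_mono[OF K1(2), of "norm x"], of "norm (y - z)"] by simp
  next
    fix y x :: 'e assume y: "y \<in> cball 0 r0"
    have "norm (L y x) \<le> norm (L y x - L 0 x) + norm (L 0 x)" using norm_triangle_sub[of "L y x" "L 0 x"] by simp
    also have "\<dots> \<le> K0 * norm x * norm y + norm x" using lip[OF y, of 0 x] r0 by (simp add: L_0)
    also have "\<dots> \<le> K0 * norm x * r0 + norm x" using y K0 by (intro add_right_mono mult_left_mono) auto
    also have "\<dots> = (K0 * r0 + 1) * norm x" by (simp add: algebra_simps)
    also have "\<dots> \<le> K1 * norm x" using K1(3) by (rule mult_right_mono) simp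
    finally show "norm (L y x) \<le> K1 * norm x" .
  qed
qed

text \<open>In the chart, constant left velocity \<open>x\<close> is the equation \<open>y' = L y x\<close>. The quadratic
  estimate compares it with \<open>y' = L 0 x = x\<close>.\<close>

lemma local_one_parameter_curves:
  "\<exists>\<rho>>0. \<exists>C\<ge>0. \<forall>x. norm x \<le> \<rho> \<longrightarrow> (\<exists>\<gamma>. \<gamma> 0 = 0 \<and> (\<forall>t\<in>{0..1}. LV \<gamma> x t {0..1}) \<and> \<gamma> 1 \<in> U \<and>
      norm (\<psi> (\<gamma> 1) - x) \<le> C * (norm x)\<^sup>2)"
proof -
  obtain r K where r: "r > 0" and K: "K \<ge> 1" and sub: "cball 0 r \<subseteq> E0"
    and lip: "\<And>y z x. y \<in> cball 0 r \<Longrightarrow> z \<in> cball 0 r \<Longrightarrow> norm (L y x - L z x) \<le> K * norm x * norm (y - z)"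
    and bd: "\<And>y x. y \<in> cball 0 r \<Longrightarrow> norm (L y x) \<le> K * norm x"
    using L_bounds by (elim exE conjE) simp
  define \<rho> where "\<rho> = min (r / K) (1 / (2 * K))"
  show ?thesis
  proof (rule exI[of _ \<rho>], rule conjI[OF _ exI[of _ "K * K"]], goal_cases)
    case 1 show ?case using r K by (simp add: \<rho>_def)
  next
    case 2
    show ?case
    proof (intro conjI allI impI)
    show "K * K \<ge> 0" using K by simp
    fix x :: 'e assume x: "norm x \<le> \<rho>"
    have xK: "K * norm x \<le> r" "K * norm x \<le> 1/2"
    proof -
      have "K * norm x \<le> K * (r / K)" "K * norm x \<le> K * (1 / (2 * K))" using x K by (intro mult_left_mono; simp add: \<rho>_def)+
      then show "K * norm x \<le> r" "K * norm x \<le> 1/2" using K by auto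
    qed
    define q where "q = K * norm x"
    have q0: "q \<ge> 0" using K by (simp add: q_def)
    have "\<exists>y. y 0 = 0 \<and> (\<forall>t\<in>{0..1}. y t \<in> cball 0 r \<and> (y has_vector_derivative L (y t) x) (at t within {0..1}))"
    proof (rule picard_lindeloef_unit_interval[OF r])
      fix y z :: 'e assume yz: "y \<in> cball 0 r" "z \<in> cball 0 r"
      have "norm (L y x - L z x) \<le> K * norm x * norm (y - z)" by (rule lip[OF yz])
      also have "\<dots> \<le> (1/2) * norm (y - z)" using xK(2) by (rule mult_right_mono) simp
      finally show "norm (L y x - L z x) \<le> norm (y - z) / 2" by simp
    next
      fix y :: 'e assume "y \<in> cball 0 r"
      then show "norm (L y x) \<le> r" using bd[of y x] xK(1) by simp
    qed
    then obtain y where y: "y 0 = 0" "\<And>t. t \<in> {0..1} \<Longrightarrow> y t \<in> cball 0 r"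
      "\<And>t. t \<in> {0..1} \<Longrightarrow> (y has_vector_derivative L (y t) x) (at t within {0..1})" by blast
    have ynorm: "norm (y t) \<le> K * norm x" if t: "t \<in> {0..1}" for t
    proof -
      have d: "(y has_vector_derivative L (y s) x) (at s within {0..t})" if "s \<in> {0..t}" for s
        using that t by (intro has_vector_derivative_within_subset[OF y(3)[of s]]) auto
      have "0 \<le> t" using t by simp
      from fundamental_theorem_of_calculus[OF this d]
      have i: "((\<lambda>s. L (y s) x) has_integral (y t - y 0)) (cbox 0 t)" by (simp add: box_real)
      have "norm (y t - y 0) \<le> (K * norm x) * measure lborel (cbox 0 t)"
        by (rule has_integral_bound[OF _ i]) (use K t y(2) in \<open>auto intro!: bd\<close>)
      also have "\<dots> \<le> K * norm x" using t K by (auto simp: mult_left_le)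
      finally show ?thesis by (simp add: y(1))
    qed
    have fin: "norm (y 1 - x) \<le> K * K * (norm x)\<^sup>2"
    proof -
      have i: "((\<lambda>t. L (y t) x - x) has_integral (y 1 - y 0 - x)) (cbox 0 1)"
        using has_integral_diff[OF fundamental_theorem_of_calculus[OF zero_le_one y(3)] has_integral_const_real[of x 0 1]]
        by (simp add: box_real)
      have "norm (y 1 - y 0 - x) \<le> (K * K * (norm x)\<^sup>2) * measure lborel (cbox 0 (1::real))"
      proof (rule has_integral_bound[OF _ i])
        show "0 \<le> K * K * (norm x)\<^sup>2" using K by simp
        fix t :: real assume "t \<in> cbox 0 1"
        then have t: "t \<in> {0..1}" by simp
        have "norm (L (y t) x - L 0 x) \<le> K * norm x * norm (y t - 0)" using y(2)[OF t] r by (intro lip) auto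
        also have "\<dots> \<le> K * norm x * (K * norm x)" using ynorm[OF t] K by (intro mult_left_mono) auto
        finally show "norm (L (y t) x - x) \<le> K * K * (norm x)\<^sup>2" by (simp add: L_0 power2_eq_square algebra_simps)
      qed
      then show ?thesis by (simp add: y(1))
    qed
    have yE: "y t \<in> E0" if "t \<in> {0..1}" for t using y(2)[OF that] sub by auto
    have "LV (\<lambda>t. \<kappa> (y t)) x t {0..1}" if t: "t \<in> {0..1}" for t
      by (rule LV_of_chart_curve[OF y(3)[OF t] yE[OF t] t])
    then show "\<exists>\<gamma>. \<gamma> 0 = 0 \<and> (\<forall>t\<in>{0..1}. LV \<gamma> x t {0..1}) \<and> \<gamma> 1 \<in> U \<and> norm (\<psi> (\<gamma> 1) - x) \<le> K * K * (norm x)\<^sup>2"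
      using fin yE[of 1] y(1) by (intro exI[of _ "\<lambda>t. \<kappa> (y t)"]) (auto simp: \<kappa>_U \<psi>_\<kappa>)
    qed
  qed
qed

end

section \<open>The exponential map\<close>

text \<open>All brackets are central: the Lie algebra is nilpotent of step at most two.\<close>

locale nilpotent_lie_group_chart = lie_group_chart A U \<phi>
  for A :: "('g::{topological_group_add, t2_space, second_countable_topology}, 'e::euclidean_space) atlas"
    and U :: "'g set" and \<phi> :: "'g \<Rightarrow> 'e" +
  assumes B_nil: "\<And>x y z. B (B x y) z = 0"
begin

sublocale B: bounded_bilinear B by (rule bounded_bilinear_B)

lemma B_anti: "B x y = - B y x"
  by (simp add: B_def)

lemma B_nil_right: "B z (B x y) = 0"
  using B_nil[of x y z] B_anti[of z "B x y"] by simp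

lemma zero_derivative_unit_interval:
  fixes f :: "real \<Rightarrow> 'a::real_normed_vector"
  assumes "\<And>t. t \<in> {0..1} \<Longrightarrow> (f has_vector_derivative 0) (at t within {0..1})" "t \<in> {0..1}"
  shows "f t = f 0"
proof -
  have "\<exists>c. \<forall>t\<in>{0..1}. f t = c"
  proof (rule has_vector_derivative_zero_constant[of "{0..1}" f])
    show "\<exists>c. \<forall>t\<in>{0..1}. f t = c" if "\<And>s. s \<in> {0..1} \<Longrightarrow> f s = c" for c using that by blast
  qed (use assms(1) in auto)
  then show ?thesis using assms(2) by (metis atLeastAtMost_iff order_refl zero_le_one)
qed

text \<open>The derivative of \<open>Ad (\<gamma> t) x\<close> is \<open>Ad (\<gamma> t) (B (v t) x)\<close>.\<close>

lemma Ad_fixes: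
  assumes \<gamma>: "\<gamma> 0 = 0" "\<And>t. t \<in> {0..1} \<Longrightarrow> LV \<gamma> (v t) t {0..1}" and "\<And>t. B (v t) x = 0" and "t \<in> {0..1}"
  shows "Ad (\<gamma> t) x = x"
proof -
  have "((\<lambda>s. Ad (\<gamma> s) x) has_vector_derivative 0) (at s within {0..1})" if "s \<in> {0..1}" for s
    using Ad_curve_derivative[OF \<gamma>(2)[OF that] that, of x] assms(3) linear_0[OF linear_Ad] by simp
  from zero_derivative_unit_interval[OF this \<open>t \<in> {0..1}\<close>] show ?thesis by (simp add: \<gamma>(1) Ad_0)
qed

lemma Ad_uminus_fixes: "Ad g x = x \<Longrightarrow> Ad (- g) x = x"
  using Ad_uminus_Ad[of g x] by simp

lemma LV_const_zero: "LV (\<lambda>t. 0) 0 t S"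
  by (simp add: LV_def)

text \<open>The short solution for \<open>x / n\<close> is multiplied by itself \<open>n\<close> times. The adjoint action of a
  one-parameter curve fixes its own velocity, so that the velocities of the factors add up.\<close>

lemma one_parameter_curve_exists: "\<exists>\<gamma>. \<gamma> 0 = 0 \<and> (\<forall>t\<in>{0..1}. LV \<gamma> x t {0..1})"
proof -
  obtain \<rho> where \<rho>: "\<rho> > 0" and loc: "\<And>x. norm x \<le> \<rho> \<Longrightarrow> \<exists>\<gamma>. \<gamma> 0 = 0 \<and> (\<forall>t\<in>{0..1}. LV \<gamma> x t {0..1})"
    using local_one_parameter_curves by (elim exE conjE) meson
  obtain n :: nat where n: "norm x / \<rho> \<le> real n" using real_arch_simple by blast
  define u where "u = x /\<^sub>R real (Suc n)"
  have "norm x \<le> real (Suc n) * \<rho>" using n \<rho> by (simp add: field_simps)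
  then have "norm u \<le> \<rho>" by (simp add: u_def field_simps)
  then obtain \<alpha> where \<alpha>: "\<alpha> 0 = 0" "\<And>t. t \<in> {0..1} \<Longrightarrow> LV \<alpha> u t {0..1}" using loc by blast
  have fix_u: "Ad (- \<alpha> t) u = u" if "t \<in> {0..1}" for t
    using Ad_uminus_fixes[OF Ad_fixes[OF \<alpha>(1) \<alpha>(2) B_self that]] by simp
  have "\<exists>\<gamma>. \<gamma> 0 = 0 \<and> (\<forall>t\<in>{0..1}. LV \<gamma> (real k *\<^sub>R u) t {0..1})" for k :: nat
  proof (induction k)
    case 0
    show ?case by (rule exI[of _ "\<lambda>t. 0"]) (simp add: LV_const_zero)
  next
    case (Suc k)
    then obtain \<gamma> where \<gamma>: "\<gamma> 0 = 0" "\<And>t. t \<in> {0..1} \<Longrightarrow> LV \<gamma> (real k *\<^sub>R u) t {0..1}" by blast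
    have "LV (\<lambda>s. \<gamma> s + \<alpha> s) (real (Suc k) *\<^sub>R u) t {0..1}" if t: "t \<in> {0..1}" for t
      using LV_add[OF \<gamma>(2)[OF t] \<alpha>(2)[OF t] t] linear_scale[OF linear_Ad] fix_u[OF t] by (simp add: algebra_simps)
    then show ?case using \<gamma>(1) \<alpha>(1) by (intro exI[of _ "\<lambda>s. \<gamma> s + \<alpha> s"]) simp
  qed
  from this[of "Suc n"] show ?thesis by (simp add: u_def)
qed

definition one_param :: "'e \<Rightarrow> real \<Rightarrow> 'g" where
  "one_param x = (SOME \<gamma>. \<gamma> 0 = 0 \<and> (\<forall>t\<in>{0..1}. LV \<gamma> x t {0..1}))"

definition Exp :: "'e \<Rightarrow> 'g" where "Exp x = one_param x 1"

lemma one_param_0: "one_param x 0 = 0"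
  and one_param_LV: "t \<in> {0..1} \<Longrightarrow> LV (one_param x) x t {0..1}"
  using someI_ex[OF one_parameter_curve_exists[of x]] unfolding one_param_def by blast+

lemma one_param_unique:
  assumes "\<gamma> 0 = 0" "\<And>t. t \<in> {0..1} \<Longrightarrow> LV \<gamma> x t {0..1}" "t \<in> {0..1}"
  shows "\<gamma> t = one_param x t"
  by (rule LV_unique_curve[where u="\<lambda>_. x", OF assms(2) one_param_LV _ assms(3)]) (simp_all add: assms(1) one_param_0)

lemma Exp_unique:
  assumes "\<gamma> 0 = 0" "\<And>t. t \<in> {0..1} \<Longrightarrow> LV \<gamma> x t {0..1}"
  shows "\<gamma> 1 = Exp x"
  unfolding Exp_def by (rule one_param_unique[OF assms]) simp_all

lemma Exp_0: "Exp 0 = 0"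
  using Exp_unique[of "\<lambda>t. 0" 0] LV_const_zero by simp

text \<open>By nilpotency the adjoint action fixes \<open>B y x\<close>, so its derivative along the curve is constant.\<close>

lemma Ad_one_param:
  assumes t: "t \<in> {0..1}"
  shows "Ad (one_param y t) x = x + t *\<^sub>R B y x"
proof -
  have fixB: "Ad (one_param y s) (B y x) = B y x" if "s \<in> {0..1}" for s
    by (rule Ad_fixes[OF one_param_0 one_param_LV _ that]) (simp_all add: B_nil_right)
  have "((\<lambda>s. Ad (one_param y s) x - s *\<^sub>R B y x) has_vector_derivative 0) (at s within {0..1})" if s: "s \<in> {0..1}" for s
  proof -
    have 1: "((\<lambda>s. Ad (one_param y s) x) has_vector_derivative B y x) (at s within {0..1})"
      using Ad_curve_derivative[OF one_param_LV[OF s, of y] s, of x] fixB[OF s] by simp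
    have 2: "((\<lambda>s. s *\<^sub>R B y x) has_vector_derivative B y x) (at s within {0..1})"
      by (auto intro!: derivative_eq_intros simp: has_vector_derivative_def)
    show ?thesis using has_vector_derivative_diff[OF 1 2] by simp
  qed
  from zero_derivative_unit_interval[OF this t] show ?thesis
    by (simp add: one_param_0 Ad_0 algebra_simps)
qed

lemma Ad_uminus_one_param:
  assumes t: "t \<in> {0..1}"
  shows "Ad (- one_param y t) x = x - t *\<^sub>R B y x"
proof -
  let ?g = "one_param y t"
  have "Ad ?g (B y x) = B y x" by (simp add: Ad_one_param[OF t] B_nil_right)
  then have b: "Ad (- ?g) (B y x) = B y x" by (rule Ad_uminus_fixes)
  have "x = Ad (- ?g) (x + t *\<^sub>R B y x)" using Ad_uminus_Ad[of ?g x] by (simp add: Ad_one_param[OF t])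
  also have "\<dots> = Ad (- ?g) x + t *\<^sub>R B y x"
    using linear_add[OF linear_Ad] linear_scale[OF linear_Ad] b by simp
  finally show ?thesis by (simp add: algebra_simps)
qed

lemma LV_reparam:
  assumes \<gamma>: "LV \<gamma> u (h t) S'" and h: "(h has_vector_derivative h') (at t within S)" and sub: "h ` S \<subseteq> S'"
  shows "LV (\<lambda>s. \<gamma> (h s)) (h' *\<^sub>R u) t S"
proof -
  have c: "continuous (at t within S) h" by (rule has_vector_derivative_continuous[OF h])
  have "continuous (at (h t) within h ` S) \<gamma>"
    using \<gamma> sub unfolding LV_def by (meson continuous_within continuous_within_subset)
  then have "continuous (at t within S) (\<gamma> \<circ> h)" by (rule continuous_within_compose[OF c])
  moreover have "((\<lambda>s. \<psi> (- \<gamma> (h t) + \<gamma> s)) has_vector_derivative u) (at (h t) within h ` S)"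
    using \<gamma> sub unfolding LV_def by (blast intro: has_vector_derivative_within_subset)
  from vector_diff_chain_within[OF h this] have "((\<lambda>s. \<psi> (- \<gamma> (h t) + \<gamma> (h s))) has_vector_derivative h' *\<^sub>R u) (at t within S)"
    by (simp add: comp_def)
  ultimately show ?thesis by (simp add: LV_def continuous_within comp_def)
qed

text \<open>The Baker-Campbell-Hausdorff formula of step two, by uniqueness of curves with a given left velocity: the product of
  the one-parameter curves of \<open>x\<close> and \<open>y\<close> has left velocity \<open>x + y + t B x y\<close>,
  and so has the product of the curve of \<open>x + y\<close> and the central curve of \<open>B x y / 2\<close> run
  through at time \<open>t\<^sup>2\<close>. Applying this once more to the two commuting factors merges them.\<close>

theorem Exp_add: "Exp x + Exp y = Exp (x + y + (1/2) *\<^sub>R B x y)"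
proof -
  have split: "Exp x + Exp y = Exp (x + y) + Exp ((1/2) *\<^sub>R B x y)" for x y
  proof -
    define z where "z = (1/2) *\<^sub>R B x y"
    define \<zeta> where "\<zeta> t = one_param z (t\<^sup>2)" for t
    have sq: "t\<^sup>2 \<in> {0..1}" if "t \<in> {0..1}" for t :: real using that by (simp add: power_le_one)
    have \<zeta>LV: "LV \<zeta> ((2 * t) *\<^sub>R z) t {0..1}" if t: "t \<in> {0..1}" for t
      unfolding \<zeta>_def[abs_def]
    proof (rule LV_reparam[where h="\<lambda>t. t\<^sup>2", OF one_param_LV[OF sq[OF t]]])
      show "((\<lambda>t. t\<^sup>2) has_vector_derivative 2 * t) (at t within {0..1})"
        by (auto intro!: derivative_eq_intros simp: has_real_derivative_iff_has_vector_derivative[symmetric])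
    qed (use sq in auto)
    have "LV (\<lambda>t. one_param x t + one_param y t) (x + y + t *\<^sub>R B x y) t {0..1}" if t: "t \<in> {0..1}" for t
      using LV_add[OF one_param_LV[OF t, of x] one_param_LV[OF t, of y] t] B_anti[of y x]
      by (simp add: Ad_uminus_one_param[OF t] algebra_simps)
    moreover have "LV (\<lambda>t. one_param (x + y) t + \<zeta> t) (x + y + t *\<^sub>R B x y) t {0..1}" if t: "t \<in> {0..1}" for t
      using LV_add[OF one_param_LV[OF t, of "x + y"] \<zeta>LV[OF t] t] 
      by (simp add: \<zeta>_def Ad_uminus_one_param[OF sq[OF t]] z_def B.scaleR_left B_nil)
    ultimately have "one_param x 1 + one_param y 1 = one_param (x + y) 1 + \<zeta> 1"
      by (rule LV_unique_curve) (simp_all add: \<zeta>_def one_param_0)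
    then show ?thesis by (simp add: \<zeta>_def Exp_def z_def)
  qed
  have "Exp (x + y) + Exp ((1/2) *\<^sub>R B x y) = Exp (x + y + (1/2) *\<^sub>R B x y) + Exp 0"
    using split[of "x + y" "(1/2) *\<^sub>R B x y"] by (simp add: B.scaleR_right B_nil_right)
  then show ?thesis using split[of x y] by (simp add: Exp_0)
qed

lemma Exp_uminus: "Exp (- x) = - Exp x"
  using Exp_add[of x "- x"] by (simp add: B.minus_right B_self Exp_0 eq_neg_iff_add_eq_0 neg_eq_iff_add_eq_0[symmetric])

text \<open>In this form the formula describes points relative to a base point; it transports what is known about
  \<open>Exp\<close> at 0 to every other point.\<close>

lemma Exp_translate: "- Exp x + Exp y = Exp (y - x - (1/2) *\<^sub>R B x y)"
  using Exp_add[of "- x" y] by (simp add: Exp_uminus B.minus_left algebra_simps)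

definition \<epsilon> :: "'e \<Rightarrow> 'e" where "\<epsilon> x = \<psi> (Exp x)"

lemma Exp_chart_bound:
  "\<exists>\<rho>>0. \<exists>C\<ge>0. \<forall>x. norm x \<le> \<rho> \<longrightarrow> Exp x \<in> U \<and> norm (\<epsilon> x - x) \<le> C * (norm x)\<^sup>2"
proof -
  obtain \<rho> C where \<rho>: "\<rho> > 0" "C \<ge> 0" and loc: "\<And>x. norm x \<le> \<rho> \<Longrightarrow> (\<exists>\<gamma>. \<gamma> 0 = 0 \<and> (\<forall>t\<in>{0..1}. LV \<gamma> x t {0..1}) \<and> \<gamma> 1 \<in> U \<and>
      norm (\<psi> (\<gamma> 1) - x) \<le> C * (norm x)\<^sup>2)"
    using local_one_parameter_curves by (elim exE conjE) meson
  have "Exp x \<in> U \<and> norm (\<epsilon> x - x) \<le> C * (norm x)\<^sup>2" if x: "norm x \<le> \<rho>" for x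
  proof -
    obtain \<gamma> where \<gamma>: "\<gamma> 0 = 0" "\<And>t. t \<in> {0..1} \<Longrightarrow> LV \<gamma> x t {0..1}" "\<gamma> 1 \<in> U" "norm (\<psi> (\<gamma> 1) - x) \<le> C * (norm x)\<^sup>2"
      using loc[OF x] by blast
    then show ?thesis using Exp_unique[OF \<gamma>(1,2)] by (simp add: \<epsilon>_def)
  qed
  with \<rho> show ?thesis by blast
qed

lemma \<epsilon>_0: "\<epsilon> 0 = 0" by (simp add: \<epsilon>_def Exp_0)

lemma eventually_Exp_U: "\<forall>\<^sub>F x in nhds 0. Exp x \<in> U"
proof -
  obtain \<rho> where "\<rho> > 0" "\<And>x. norm x \<le> \<rho> \<Longrightarrow> Exp x \<in> U" using Exp_chart_bound by blast
  then show ?thesis unfolding eventually_nhds_metric by (intro exI[of _ \<rho>]) (auto simp: dist_norm)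
qed

lemma \<epsilon>_derivative_0: "(\<epsilon> has_derivative (\<lambda>x. x)) (at 0)"
proof -
  obtain \<rho> C where "\<rho> > 0" "C \<ge> 0" "\<forall>x. norm x \<le> \<rho> \<longrightarrow> Exp x \<in> U \<and> norm (\<epsilon> x - x) \<le> C * (norm x)\<^sup>2"
    using Exp_chart_bound by (elim exE conjE)
  then have \<rho>: "\<rho> > 0" "C \<ge> 0" "\<And>x. norm x \<le> \<rho> \<Longrightarrow> norm (\<epsilon> x - x) \<le> C * (norm x)\<^sup>2" by auto
  show ?thesis
    unfolding has_derivative_at_alt
  proof (intro conjI allI impI bounded_linear_ident)
    fix e :: real assume e: "e > 0"
    show "\<exists>d>0. \<forall>y. norm (y - 0) < d \<longrightarrow> norm (\<epsilon> y - \<epsilon> 0 - (y - 0)) \<le> e * norm (y - 0)"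
    proof (intro exI[of _ "min \<rho> (e / (C + 1))"] conjI allI impI)
      show "min \<rho> (e / (C + 1)) > 0" using \<rho> e by simp
      fix y :: 'e assume y: "norm (y - 0) < min \<rho> (e / (C + 1))"
      then have "norm y * (C + 1) \<le> e" using \<rho>(2) by (simp add: field_simps)
      moreover have "C * norm y \<le> norm y * (C + 1)" by (simp add: algebra_simps)
      ultimately have "C * norm y \<le> e" by linarith
      then have "(C * norm y) * norm y \<le> e * norm y" by (rule mult_right_mono) simp
      then show "norm (\<epsilon> y - \<epsilon> 0 - (y - 0)) \<le> e * norm (y - 0)"
        using \<rho>(3)[of y] y by (simp add: \<epsilon>_0 power2_eq_square mult.assoc)
    qed
  qed
qed

lemma Exp_tendsto_0: "((\<lambda>x. Exp x) \<longlongrightarrow> 0) (nhds 0)"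
proof -
  have "(\<epsilon> \<longlongrightarrow> \<epsilon> 0) (nhds 0)"
    using has_derivative_continuous[OF \<epsilon>_derivative_0] unfolding continuous_at tendsto_at_iff_tendsto_nhds .
  then have "((\<lambda>x. \<kappa> (\<epsilon> x)) \<longlongrightarrow> 0) (nhds 0)"
    using filterlim_compose[OF tendsto_\<kappa>, of \<epsilon>] by (simp add: \<epsilon>_0)
  moreover have "\<forall>\<^sub>F x in nhds 0. \<kappa> (\<epsilon> x) = Exp x"
    using eventually_Exp_U by eventually_elim (simp add: \<epsilon>_def \<kappa>_\<psi>)
  ultimately show ?thesis using tendsto_cong by fast
qed

text \<open>By \<open>Exp_translate\<close> the point \<open>Exp (X s)\<close> seen from \<open>Exp (X t)\<close> is
  \<open>Exp\<close> of a curve through 0, where \<open>Exp\<close> has derivative the identity in the chart.\<close>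

lemma Exp_LV:
  assumes X: "(X has_vector_derivative X') (at t within S)" and t: "t \<in> S"
  shows "LV (\<lambda>s. Exp (X s)) (X' - (1/2) *\<^sub>R B (X t) X') t S"
proof -
  define Y where "Y s = X s - X t - (1/2) *\<^sub>R B (X t) (X s)" for s
  have Y: "(Y has_vector_derivative (X' - 0 - (1/2) *\<^sub>R B (X t) X')) (at t within S)"
    unfolding Y_def[abs_def]
    by (intro has_vector_derivative_diff X has_vector_derivative_const
        bounded_linear.has_vector_derivative[OF bounded_linear_scaleR_right]
        bounded_linear.has_vector_derivative[OF B.bounded_linear_right])
  have Yt: "Y t = 0" by (simp add: Y_def B_self)
  have tr: "- Exp (X t) + Exp (X s) = Exp (Y s)" for s by (simp add: Exp_translate Y_def)
  have Y0: "(Y \<longlongrightarrow> 0) (at t within S)"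
    using has_vector_derivative_continuous[OF Y] by (simp add: continuous_within Yt)
  have "((\<lambda>s. Exp (Y s)) \<longlongrightarrow> 0) (at t within S)" by (rule filterlim_compose[OF Exp_tendsto_0 Y0])
  then have "((\<lambda>s. Exp (X t) + Exp (Y s)) \<longlongrightarrow> Exp (X t) + 0) (at t within S)" by (intro tendsto_intros)
  moreover have "Exp (X t) + Exp (Y s) = Exp (X s)" for s unfolding tr[symmetric] by (simp only: add_minus_cancel)
  ultimately have 1: "((\<lambda>s. Exp (X s)) \<longlongrightarrow> Exp (X t)) (at t within S)" by simp
  have "((\<lambda>s. \<epsilon> (Y s)) has_vector_derivative (X' - 0 - (1/2) *\<^sub>R B (X t) X')) (at t within S)"
    by (rule has_vector_derivative_compose[OF Y, of \<epsilon> "\<lambda>x. x"]) (simp add: Yt \<epsilon>_derivative_0)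
  then show ?thesis unfolding LV_def tr using 1 by (simp add: \<epsilon>_def)
qed

lemma \<epsilon>_derivative:
  assumes "Exp x \<in> U"
  shows "(\<epsilon> has_derivative (\<lambda>h. L (\<epsilon> x) (h - (1/2) *\<^sub>R B x h))) (at x)"
proof -
  have E: "\<epsilon> x \<in> E0" "\<kappa> (\<epsilon> x) = Exp x" using assms by (simp_all add: \<epsilon>_def \<psi>_E0 \<kappa>_\<psi>)
  define Y where "Y y = y - x - (1/2) *\<^sub>R B x y" for y
  have Y: "(Y has_derivative (\<lambda>h. h - 0 - (1/2) *\<^sub>R B x h)) (at x)"
    unfolding Y_def[abs_def]
    by (intro has_derivative_diff has_derivative_ident has_derivative_const
        bounded_linear.has_derivative[OF bounded_linear_scaleR_right] bounded_linear.has_derivative[OF B.bounded_linear_right])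
  have Yx: "Y x = 0" by (simp add: Y_def B_self)
  have "((\<lambda>y. \<epsilon> (Y y)) has_derivative (\<lambda>h. h - 0 - (1/2) *\<^sub>R B x h)) (at x)"
    using has_derivative_compose[OF Y, of \<epsilon> "\<lambda>x. x"] \<epsilon>_derivative_0 by (simp add: Yx)
  then have "((\<lambda>y. \<mu> (\<epsilon> x) (\<epsilon> (Y y))) has_derivative (\<lambda>h. L (\<epsilon> x) (h - 0 - (1/2) *\<^sub>R B x h))) (at x)"
    using has_derivative_compose[of "\<lambda>y. \<epsilon> (Y y)" _ x UNIV "\<mu> (\<epsilon> x)" "L (\<epsilon> x)"] L_derivative[OF E(1)] by (simp add: Yx \<epsilon>_0)
  then have "(\<epsilon> has_derivative (\<lambda>h. L (\<epsilon> x) (h - 0 - (1/2) *\<^sub>R B x h))) (at x)"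
  proof (rule has_derivative_eventually_cong)
    have "(Y \<longlongrightarrow> Y x) (nhds x)"
      using has_derivative_continuous[OF Y] unfolding continuous_at tendsto_at_iff_tendsto_nhds .
    then have "filterlim Y (nhds 0) (nhds x)" by (simp add: Yx)
    from this[unfolded filterlim_iff, rule_format, OF eventually_Exp_U]
    have "\<forall>\<^sub>F y in nhds x. Exp (Y y) \<in> U" .
    then show "\<forall>\<^sub>F y in nhds x. \<mu> (\<epsilon> x) (\<epsilon> (Y y)) = \<epsilon> y"
    proof eventually_elim
      case (elim y)
      have "- Exp x + Exp y = Exp (Y y)" by (simp add: Exp_translate Y_def)
      then have "Exp x + Exp (Y y) = Exp y" by (metis add_minus_cancel)
      then show ?case using elim by (simp add: \<mu>_def E(2)) (simp add: \<epsilon>_def \<kappa>_\<psi>)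
    qed
  qed
  then show ?thesis by simp
qed

text \<open>The exponential map is bi-Lipschitz near the origin in the identity chart, hence a local
  homeomorphism by invariance of domain.\<close>

lemma Exp_local_homeomorphism:
  "\<exists>\<rho>>0. \<exists>W. open W \<and> 0 \<in> W \<and> W \<subseteq> U \<and> W \<subseteq> Exp ` ball 0 \<rho> \<and> (\<forall>x\<in>ball 0 \<rho>. Exp x \<in> U) \<and>
    (\<forall>x\<in>ball 0 \<rho>. \<forall>y\<in>ball 0 \<rho>. norm (x - y) \<le> 2 * norm (\<epsilon> x - \<epsilon> y) \<and> norm (\<epsilon> x - \<epsilon> y) \<le> 2 * norm (x - y))"
proof -
  obtain r K where r: "r > 0" "K \<ge> 1" and lip0: "\<forall>y\<in>cball 0 r. \<forall>z\<in>cball 0 r. \<forall>x. norm (L y x - L z x) \<le> K * norm x * norm (y - z)"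
    using L_bounds by (elim exE conjE)
  have lip: "norm (L y x - L 0 x) \<le> K * norm x * norm y" if "y \<in> cball 0 r" for y x
    using lip0[rule_format, OF that, of 0 x] r(1) by simp
  obtain \<rho>1 C where \<rho>1': "\<rho>1 > 0" "C \<ge> 0" "\<forall>x. norm x \<le> \<rho>1 \<longrightarrow> Exp x \<in> U \<and> norm (\<epsilon> x - x) \<le> C * (norm x)\<^sup>2"
    using Exp_chart_bound by (elim exE conjE)
  then have \<rho>1: "\<rho>1 > 0" "C \<ge> 0" "\<And>x. norm x \<le> \<rho>1 \<Longrightarrow> Exp x \<in> U"
    "\<And>x. norm x \<le> \<rho>1 \<Longrightarrow> norm (\<epsilon> x - x) \<le> C * (norm x)\<^sup>2" by auto
  obtain b where b: "b > 0" "\<And>x y. norm (B x y) \<le> norm x * norm y * b" using B.pos_bounded by blast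
  define c where "c = K * (1 + b) * (1 + C) + b"
  have c0: "c > 0" unfolding c_def using r b \<rho>1 by (intro add_nonneg_pos mult_nonneg_nonneg) auto
  define \<rho> where "\<rho> = min (min 1 \<rho>1) (min (r / (1 + C)) (1 / (2 * c)))"
  have \<rho>: "\<rho> > 0" "\<rho> \<le> 1" "\<rho> \<le> \<rho>1" "\<rho> \<le> r / (1 + C)" "\<rho> \<le> 1 / (2 * c)"
    using r \<rho>1 c0 by (auto simp: \<rho>_def)
  have \<epsilon>n: "norm (\<epsilon> x) \<le> (1 + C) * norm x" if x: "norm x < \<rho>" for x
  proof -
    have "norm (\<epsilon> x) \<le> norm (\<epsilon> x - x) + norm x" using norm_triangle_sub[of "\<epsilon> x" x] by simp
    also have "\<dots> \<le> C * (norm x * norm x) + norm x" using \<rho>1(4)[of x] x \<rho> by (simp add: power2_eq_square)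
    also have "\<dots> \<le> C * (1 * norm x) + norm x" using x \<rho> \<rho>1(2) by (intro add_right_mono mult_left_mono mult_right_mono) auto
    finally show ?thesis by (simp add: algebra_simps)
  qed
  have der: "norm (L (\<epsilon> x) (h - (1/2) *\<^sub>R B x h) - h) \<le> (1/2) * norm h" if x: "norm x < \<rho>" for x h
  proof -
    define h' where "h' = h - (1/2) *\<^sub>R B x h"
    have "norm (B x h) \<le> norm x * norm h * b" by (rule b(2))
    moreover have "0 \<le> norm x * norm h * b" using b(1) by simp
    moreover have "norm ((1/2) *\<^sub>R B x h) = norm (B x h) / 2" by simp
    ultimately have "norm ((1/2) *\<^sub>R B x h) \<le> norm x * norm h * b" by linarith
    then have Bh: "norm ((1/2) *\<^sub>R B x h) \<le> b * norm x * norm h" by (simp add: mult.commute mult.left_commute)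
    have "norm h' \<le> norm h + norm ((1/2) *\<^sub>R B x h)" unfolding h'_def by (rule norm_triangle_ineq4)
    also have "\<dots> \<le> norm h + b * norm x * norm h" using Bh by simp
    also have "\<dots> \<le> norm h + b * 1 * norm h" using x \<rho> b(1) by (intro add_left_mono mult_right_mono mult_left_mono) auto
    finally have hn: "norm h' \<le> (1 + b) * norm h" by (simp add: algebra_simps)
    have "norm (\<epsilon> x) \<le> (1 + C) * (r / (1 + C))"
      using \<epsilon>n[OF x] x \<rho> \<rho>1(2) by (elim order_trans) (intro mult_left_mono, auto)
    then have er: "\<epsilon> x \<in> cball 0 r" using \<rho>1(2) by simp
    have "norm (L (\<epsilon> x) h' - h') \<le> K * norm h' * norm (\<epsilon> x)" using lip[OF er, of h'] by (simp add: L_0)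
    also have "\<dots> \<le> K * ((1 + b) * norm h) * ((1 + C) * norm x)"
      using hn \<epsilon>n[OF x] r b \<rho>1 by (intro mult_mono mult_left_mono mult_nonneg_nonneg) auto
    finally have 1: "norm (L (\<epsilon> x) h' - h') \<le> K * (1 + b) * (1 + C) * norm x * norm h" by (simp add: algebra_simps)
    have 2: "norm (h' - h) \<le> b * norm x * norm h" using Bh by (simp add: h'_def)
    have "norm (L (\<epsilon> x) h' - h) \<le> norm (L (\<epsilon> x) h' - h') + norm (h' - h)"
      using norm_triangle_ineq[of "L (\<epsilon> x) h' - h'" "h' - h"] by simp
    also have "\<dots> \<le> c * norm x * norm h" using 1 2 by (simp add: c_def algebra_simps)
    also have "\<dots> \<le> (1/2) * norm h"
    proof (rule mult_right_mono)
      have "c * norm x \<le> c * (1 / (2 * c))" using x \<rho> c0 by (intro mult_left_mono) auto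
      then show "c * norm x \<le> 1/2" using c0 by simp
    qed simp
    finally show ?thesis by (simp add: h'_def)
  qed
  have EU: "Exp x \<in> U" if "x \<in> ball 0 \<rho>" for x using \<rho>1(3)[of x] that \<rho> by simp
  have close: "norm ((\<epsilon> x - x) - (\<epsilon> y - y)) \<le> (1/2) * norm (x - y)" if xy: "x \<in> ball 0 \<rho>" "y \<in> ball 0 \<rho>" for x y
  proof (rule differentiable_bound[of "ball 0 \<rho>" "\<lambda>x. \<epsilon> x - x" "\<lambda>x h. L (\<epsilon> x) (h - (1/2) *\<^sub>R B x h) - h"])
    fix z :: 'e assume z: "z \<in> ball 0 \<rho>"
    show "((\<lambda>x. \<epsilon> x - x) has_derivative (\<lambda>h. L (\<epsilon> z) (h - (1/2) *\<^sub>R B z h) - h)) (at z within ball 0 \<rho>)"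
      by (rule has_derivative_at_withinI[OF has_derivative_diff[OF \<epsilon>_derivative[OF EU[OF z]] has_derivative_ident]])
    show "onorm (\<lambda>h. L (\<epsilon> z) (h - (1/2) *\<^sub>R B z h) - h) \<le> 1/2"
      by (rule onorm_bound) (use der[of z] z in auto)
  qed (use xy in auto)
  have bl: "norm (x - y) \<le> 2 * norm (\<epsilon> x - \<epsilon> y) \<and> norm (\<epsilon> x - \<epsilon> y) \<le> 2 * norm (x - y)"
    if xy: "x \<in> ball 0 \<rho>" "y \<in> ball 0 \<rho>" for x y
  proof -
    have e: "(\<epsilon> x - x) - (\<epsilon> y - y) = (\<epsilon> x - \<epsilon> y) - (x - y)" by simp
    show ?thesis
      using close[OF xy] norm_triangle_ineq2[of "x - y" "\<epsilon> x - \<epsilon> y"] norm_triangle_ineq2[of "\<epsilon> x - \<epsilon> y" "x - y"]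
      unfolding e by (simp add: norm_minus_commute)
  qed
  have cont: "continuous_on (ball 0 \<rho>) \<epsilon>"
    using has_derivative_continuous[OF \<epsilon>_derivative[OF EU]] by (simp add: continuous_at_imp_continuous_on)
  have "inj_on \<epsilon> (ball 0 \<rho>)" using bl by (fastforce intro: inj_onI)
  then have o: "open (\<epsilon> ` ball 0 \<rho>)" by (rule invariance_of_domain[OF cont open_ball])
  define W where "W = U \<inter> \<psi> -` (\<epsilon> ` ball 0 \<rho>)"
  have "open W" unfolding W_def by (rule continuous_open_preimage[OF continuous_on_\<psi> open_U o])
  moreover have "0 \<in> W"
  proof -
    have "0 = \<epsilon> 0" "0 \<in> ball (0::'e) \<rho>" using \<rho> by (simp_all add: \<epsilon>_0)
    then have "0 \<in> \<epsilon> ` ball 0 \<rho>" by (rule image_eqI)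
    then show ?thesis using U0 by (simp add: W_def)
  qed
  moreover have "W \<subseteq> Exp ` ball 0 \<rho>"
  proof
    fix p assume "p \<in> W"
    then obtain x where x: "p \<in> U" "x \<in> ball 0 \<rho>" "\<psi> p = \<epsilon> x" by (auto simp: W_def)
    then have "\<kappa> (\<psi> p) = \<kappa> (\<psi> (Exp x))" by (simp add: \<epsilon>_def)
    then have "p = Exp x" using \<kappa>_\<psi>[OF x(1)] \<kappa>_\<psi>[OF EU[OF x(2)]] by simp
    then show "p \<in> Exp ` ball 0 \<rho>" using x(2) by blast
  qed
  moreover have "W \<subseteq> U" by (simp add: W_def)
  ultimately have a1: "open W \<and> 0 \<in> W \<and> W \<subseteq> U \<and> W \<subseteq> Exp ` ball 0 \<rho>" by (intro conjI)
  have a2: "\<forall>x\<in>ball 0 \<rho>. Exp x \<in> U" by (intro ballI EU)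
  have a3: "\<forall>x\<in>ball 0 \<rho>. \<forall>y\<in>ball 0 \<rho>. norm (x - y) \<le> 2 * norm (\<epsilon> x - \<epsilon> y) \<and> norm (\<epsilon> x - \<epsilon> y) \<le> 2 * norm (x - y)"
    by (rule ballI, rule ballI, rule bl)
  show ?thesis
    by (rule exI[of _ \<rho>], rule conjI[OF \<rho>(1)], rule exI[of _ W], insert a1 a2 a3, elim conjE, intro conjI; assumption)
qed

text \<open>The image is a subgroup that contains a neighbourhood of the identity, so it is open and closed.\<close>

lemma Exp_surj:
  assumes "connected (UNIV :: 'g set)"
  shows "range Exp = UNIV"
proof -
  have "\<exists>W. open W \<and> 0 \<in> W \<and> W \<subseteq> range Exp"
    using Exp_local_homeomorphism
    apply (elim exE conjE)
    subgoal for \<rho> W by (rule exI[of _ W]) auto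
    done
  then obtain W where W: "open W" "0 \<in> W" "W \<subseteq> range Exp" by blast
  define H where "H = range Exp"
  have H0: "0 \<in> H" unfolding H_def by (rule range_eqI[of _ _ 0]) (simp add: Exp_0)
  have Hadd: "p + q \<in> H" if pq: "p \<in> H" "q \<in> H" for p q
  proof -
    obtain x y where "p = Exp x" "q = Exp y" using pq by (auto simp: H_def)
    then show ?thesis unfolding H_def by (simp only: Exp_add rangeI)
  qed
  have Hneg: "- p \<in> H" if p: "p \<in> H" for p
  proof -
    obtain x where "p = Exp x" using p by (auto simp: H_def)
    then show ?thesis unfolding H_def by (simp only: Exp_uminus[symmetric] rangeI)
  qed
  have nb: "open ((\<lambda>q. - g + q) -` W)" "g \<in> (\<lambda>q. - g + q) -` W" for g
    using W by (auto intro!: open_vimage continuous_intros)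
  have "open H"
  proof (subst open_subopen, rule ballI)
    fix g assume g: "g \<in> H"
    have "(\<lambda>q. - g + q) -` W \<subseteq> H"
    proof
      fix q assume "q \<in> (\<lambda>q. - g + q) -` W"
      then have "- g + q \<in> H" using W(3) by (auto simp: H_def)
      from Hadd[OF g this] have "g + (- g + q) \<in> H" .
      then show "q \<in> H" by (simp only: add_minus_cancel)
    qed
    then show "\<exists>T. open T \<and> g \<in> T \<and> T \<subseteq> H" using nb[of g] by blast
  qed
  moreover have "open (- H)"
  proof (subst open_subopen, rule ballI)
    fix g assume g: "g \<in> - H"
    have "(\<lambda>q. - g + q) -` W \<subseteq> - H"
    proof
      fix q assume q: "q \<in> (\<lambda>q. - g + q) -` W"
      show "q \<in> - H"
      proof
        assume "q \<in> H"
        moreover have "- g + q \<in> H" using q W(3) by (auto simp: H_def)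
        ultimately have "q + - (- g + q) \<in> H" using Hadd Hneg by metis
        moreover have "q + - (- g + q) = g"
          by (simp add: minus_add add.assoc diff_conv_add_uminus del: add_uminus_conv_diff)
        ultimately show False using g by simp
      qed
    qed
    then show "\<exists>T. open T \<and> g \<in> T \<and> T \<subseteq> - H" using nb[of g] by blast
  qed
  ultimately have "H \<inter> UNIV = {} \<or> - H \<inter> UNIV = {}"
    by (intro connectedD[OF assms]) auto
  then show ?thesis using H0 by (auto simp: H_def)
qed

end

section \<open>Lifting curves to the Lie algebra\<close>

lemma abs_continuous_on_lipschitz_transfer:
  assumes g: "abs_continuous_on S g" and C: "C \<ge> 0"
    and le: "\<And>x y. x \<in> S \<Longrightarrow> y \<in> S \<Longrightarrow> norm (f y - f x) \<le> C * norm (g y - g x)"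
  shows "abs_continuous_on S f"
  unfolding abs_continuous_on_def
proof (intro allI impI)
  fix e :: real assume "e > 0"
  then have "e / (C + 1) > 0" using C by simp
  then obtain \<delta> where \<delta>: "\<delta> > 0" and ac: "\<And>D. D division_of \<Union>D \<and> \<Union>D \<subseteq> S \<and> (\<Sum>k\<in>D. Sup k - Inf k) < \<delta> \<Longrightarrow>
        (\<Sum>k\<in>D. norm (g (Sup k) - g (Inf k))) < e / (C + 1)"
    using g unfolding abs_continuous_on_def by meson
  show "\<exists>\<delta>>0. \<forall>D. D division_of \<Union>D \<and> \<Union>D \<subseteq> S \<and> (\<Sum>k\<in>D. Sup k - Inf k) < \<delta> \<longrightarrow>
        (\<Sum>k\<in>D. norm (f (Sup k) - f (Inf k))) < e"
  proof (intro exI[of _ \<delta>] conjI allI impI \<delta>)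
    fix D :: "real set set"
    assume D: "D division_of \<Union>D \<and> \<Union>D \<subseteq> S \<and> (\<Sum>k\<in>D. Sup k - Inf k) < \<delta>"
    have "(\<Sum>k\<in>D. norm (f (Sup k) - f (Inf k))) \<le> (\<Sum>k\<in>D. C * norm (g (Sup k) - g (Inf k)))"
    proof (rule sum_mono)
      fix k assume k: "k \<in> D"
      then have "k \<noteq> {}" "\<exists>u v. k = cbox u v" "k \<subseteq> S" using D by (auto simp: division_of_def)
      then obtain u v where "k = {u..v}" "u \<le> v" by auto
      then have "Sup k \<in> S" "Inf k \<in> S" using \<open>k \<subseteq> S\<close> by auto
      then show "norm (f (Sup k) - f (Inf k)) \<le> C * norm (g (Sup k) - g (Inf k))" by (intro le)
    qed
    also have "\<dots> = C * (\<Sum>k\<in>D. norm (g (Sup k) - g (Inf k)))" by (simp add: sum_distrib_left)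
    also have "\<dots> \<le> C * (e / (C + 1))" using ac[OF D] C by (intro mult_left_mono) auto
    also have "\<dots> < e" using C \<open>e > 0\<close> by (simp add: field_simps)
    finally show "(\<Sum>k\<in>D. norm (f (Sup k) - f (Inf k))) < e" .
  qed
qed

lemma indefinite_integral_derivative_ae:
  fixes g :: "real \<Rightarrow> 'b::euclidean_space"
  assumes g: "g integrable_on {a..b}" and X: "\<And>t. t \<in> {a..b} \<Longrightarrow> (g has_integral X t) {a..t}"
  obtains N where "negligible N" "\<And>t. t \<in> {a..b} - N \<Longrightarrow> (X has_vector_derivative g t) (at t within {a..b})"
proof -
  have 1: "\<exists>N. negligible N \<and> (\<forall>t\<in>{a..b} - N. ((\<lambda>t. integral {a..t} g) has_vector_derivative g t) (at t within {a..b}))"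
    by (rule lebesgue_differentiation[OF g]) (intro exI conjI ballI; assumption?)
  then obtain N where N: "negligible N"
    "\<forall>t\<in>{a..b} - N. ((\<lambda>t. integral {a..t} g) has_vector_derivative g t) (at t within {a..b})" by (elim exE conjE)
  have "(X has_vector_derivative g t) (at t within {a..b})" if t: "t \<in> {a..b} - N" for t
  proof (rule has_vector_derivative_transform[of t "{a..b}" X "\<lambda>t. integral {a..t} g"])
    show "X s = integral {a..s} g" if "s \<in> {a..b}" for s using integral_unique[OF X[OF that]] by simp
  qed (use t N(2) in auto)
  then show thesis by (rule that[OF N(1)])
qed

context nilpotent_lie_group_chart
begin

lemma eq_add_Exp:
  assumes "- g + h = Exp d" shows "h = g + Exp d"
  using assms by (metis add_minus_cancel)

lemma Exp_relative_position:
  "Exp (X s) = Exp (X t) + Exp (X s - X t - (1/2) *\<^sub>R B (X t) (X s))"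
  using eq_add_Exp[OF Exp_translate] .

text \<open>Left translation identifies the velocities of a curve, which are derivations at the moving point, with its left
  velocities, which are vectors in one fixed space.\<close>

lemma has_velocity_of_LV:
  assumes LV: "LV \<gamma> u t {0..1}" and t: "t \<in> {0..1}" and X: "dL (\<gamma> t) (T u) \<in> tangent_space A (\<gamma> t)"
  shows "has_velocity A \<gamma> (dL (\<gamma> t) (T u)) t"
  unfolding has_velocity_def
proof (intro conjI allI impI X)
  fix f assume f: "smooth_near A (\<gamma> t) f"
  define h where "h q = f (\<gamma> t + q)" for q
  have h: "smooth_near A 0 h" unfolding h_def[abs_def] using f by (simp add: smooth_near_left_translate)
  have "((\<lambda>s. h (\<kappa> (\<psi> (- \<gamma> t + \<gamma> s)))) has_vector_derivative T u h) (at t within {0..1})"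
    using has_vector_derivative_compose[of "\<lambda>s. \<psi> (- \<gamma> t + \<gamma> s)" u t "{0..1}" "\<lambda>y. h (\<kappa> y)" "\<lambda>u. T u h"]
      LV T_has_derivative[OF h] by (simp add: LV_def)
  then have "((\<lambda>s. f (\<gamma> s)) has_vector_derivative T u h) (at t within {0..1})"
  proof (rule has_vector_derivative_eventually_cong[OF _ _ t])
    show "\<forall>\<^sub>F s in at t within {0..1}. h (\<kappa> (\<psi> (- \<gamma> t + \<gamma> s))) = f (\<gamma> s)"
      using LV_eventually[OF LV open_U U0]
      by eventually_elim (simp add: h_def \<kappa>_\<psi> add_minus_cancel)
  qed (simp add: h_def)
  then show "((\<lambda>s. f (\<gamma> s)) has_real_derivative dL (\<gamma> t) (T u) f) (at t within {0..1})"
    by (simp add: has_real_derivative_iff_has_vector_derivative dL_def h_def[abs_def])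
qed

lemma LV_of_has_velocity:
  assumes v: "has_velocity A \<gamma> (dL (\<gamma> t) (T u)) t" and t: "t \<in> {0..1}" and c: "continuous_on {0..1} \<gamma>"
  shows "LV \<gamma> u t {0..1}"
  unfolding LV_def
proof
  show "(\<gamma> \<longlongrightarrow> \<gamma> t) (at t within {0..1})" using c t by (simp add: continuous_on_def)
  show "((\<lambda>s. \<psi> (- \<gamma> t + \<gamma> s)) has_vector_derivative u) (at t within {0..1})"
    unfolding has_vector_derivative_def
  proof (subst has_derivative_componentwise_within, rule ballI)
    fix i :: 'e
    define f where "f p = \<psi> (- \<gamma> t + p) \<bullet> i" for p
    have f0: "(\<lambda>q. f (\<gamma> t + q)) = (\<lambda>q. \<psi> q \<bullet> i)" by (simp add: f_def minus_add_cancel)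
    have "smooth_near A 0 (\<lambda>q. f (\<gamma> t + q))"
      unfolding f0 by (rule smooth_near_linear_coordinate[OF bounded_linear_inner_left])
    then have "smooth_near A (\<gamma> t) f" by (simp add: smooth_near_left_translate)
    then have "((\<lambda>s. f (\<gamma> s)) has_real_derivative dL (\<gamma> t) (T u) f) (at t within {0..1})"
      using v by (simp add: has_velocity_def)
    moreover have "dL (\<gamma> t) (T u) f = u \<bullet> i"
      unfolding dL_def f0 by (rule T_linear_coordinate[OF bounded_linear_inner_left])
    ultimately show "((\<lambda>s. \<psi> (- \<gamma> t + \<gamma> s) \<bullet> i) has_derivative (\<lambda>h. (h *\<^sub>R u) \<bullet> i)) (at t within {0..1})"
      by (simp add: f_def has_field_derivative_def mult_commute_abs)
  qed
qed

lemma has_velocity_unique: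
  assumes "has_velocity A \<gamma> X t" "has_velocity A \<gamma> Y t" "t \<in> {0..1}"
  shows "X = Y"
proof
  fix f show "X f = Y f"
  proof (cases "smooth_near A (\<gamma> t) f")
    case True
    then show ?thesis
      using assms vector_derivative_unique_within_closed_interval[of 0 1 t "\<lambda>s. f (\<gamma> s)" "X f" "Y f"]
      by (simp add: has_velocity_def has_real_derivative_iff_has_vector_derivative box_real)
  qed (use assms in \<open>auto simp: has_velocity_def tangent_space_def\<close>)
qed

lemma velocity_eq: "has_velocity A \<gamma> X t \<Longrightarrow> t \<in> {0..1} \<Longrightarrow> velocity A \<gamma> t = X"
  unfolding velocity_def by (rule the_equality) (auto intro: has_velocity_unique)

lemma LV_unique:
  assumes "LV \<gamma> u t {a..b}" "LV \<gamma> v t {a..b}" "t \<in> {a..b}" "a < b"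
  shows "u = v"
  using assms vector_derivative_unique_within_closed_interval[of a b t "\<lambda>s. \<psi> (- \<gamma> t + \<gamma> s)" u v]
  by (simp add: LV_def box_real)

lemma LV_subset: "LV \<gamma> u t S \<Longrightarrow> S' \<subseteq> S \<Longrightarrow> LV \<gamma> u t S'"
  unfolding LV_def by (meson tendsto_within_subset has_vector_derivative_within_subset)

text \<open>The logarithm is differentiable at the identity, so the logarithm of a curve is differentiable
  wherever the curve has a left velocity.\<close>

lemma log_derivative:
  assumes LV: "LV \<gamma> u t S" and t: "t \<in> S" and X: "\<And>s. s \<in> S \<Longrightarrow> \<gamma> s = p + Exp (X s)"
    and Xc: "continuous (at t within S) X"
  shows "(X has_vector_derivative (u + (1/2) *\<^sub>R B (X t) u)) (at t within S)"
proof -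
  obtain \<rho> W where \<rho>: "\<rho> > 0" "open W" "0 \<in> W" "W \<subseteq> U" "W \<subseteq> Exp ` ball 0 \<rho>" "\<forall>x\<in>ball 0 \<rho>. Exp x \<in> U"
    and bl: "\<forall>x\<in>ball 0 \<rho>. \<forall>y\<in>ball 0 \<rho>. norm (x - y) \<le> 2 * norm (\<epsilon> x - \<epsilon> y) \<and> norm (\<epsilon> x - \<epsilon> y) \<le> 2 * norm (x - y)"
    using Exp_local_homeomorphism by (elim exE conjE)
  have inj: "inj_on \<epsilon> (ball 0 \<rho>)"
  proof (rule inj_onI)
    fix x y assume "x \<in> ball 0 \<rho>" "y \<in> ball 0 \<rho>" "\<epsilon> x = \<epsilon> y"
    then have "norm (x - y) \<le> 2 * norm (\<epsilon> x - \<epsilon> y)" using bl by blast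
    then show "x = y" using \<open>\<epsilon> x = \<epsilon> y\<close> by simp
  qed
  define \<l> where "\<l> = inv_into (ball 0 \<rho>) \<epsilon>"
  have \<l>: "\<l> (\<epsilon> x) = x" if "x \<in> ball 0 \<rho>" for x unfolding \<l>_def using inv_into_f_f[OF inj that] .
  define O' where "O' = \<psi> ` W"
  have O_eq: "O' = E0 \<inter> \<kappa> -` W"
    using \<rho>(4) by (auto simp: O'_def \<psi>_E0 \<kappa>_\<psi> image_iff subset_iff) (metis \<psi>_\<kappa>)
  have O': "open O'" unfolding O_eq by (rule continuous_open_preimage[OF continuous_on_\<kappa> open_E0 \<rho>(2)])
  have "0 \<in> O'" using \<rho>(3) by (simp add: O_eq)
  have Oe: "\<exists>x\<in>ball 0 \<rho>. \<epsilon> x = z" if "z \<in> O'" for z using that \<rho>(5) by (auto simp: O'_def \<epsilon>_def)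
  have \<l>O: "\<l> z \<in> ball 0 \<rho>" "\<epsilon> (\<l> z) = z" if "z \<in> O'" for z using Oe[OF that] \<l> by auto
  have \<l>0: "\<l> 0 = 0" using \<l>[of 0] \<rho>(1) by (simp add: \<epsilon>_0)
  have "continuous (at 0) \<l>"
    unfolding continuous_at_eps_delta
  proof (intro allI impI)
    fix e :: real assume e: "e > 0"
    obtain d where d: "d > 0" "ball 0 d \<subseteq> O'" using O' \<open>0 \<in> O'\<close> open_contains_ball by blast
    show "\<exists>d>0. \<forall>z. dist z 0 < d \<longrightarrow> dist (\<l> z) (\<l> 0) < e"
    proof (intro exI[of _ "min d (e/2)"] conjI allI impI)
      fix z :: 'e assume z: "dist z 0 < min d (e/2)"
      then have zO: "z \<in> O'" using d by (auto simp: subset_iff dist_commute)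
      have "norm (\<l> z - 0) \<le> 2 * norm (\<epsilon> (\<l> z) - \<epsilon> 0)" using bl[rule_format, OF \<l>O(1)[OF zO], of 0] \<rho>(1) by simp
      then show "dist (\<l> z) (\<l> 0) < e" using z \<l>O(2)[OF zO] by (simp add: \<l>0 \<epsilon>_0)
    qed (use d e in auto)
  qed
  then have \<l>d: "(\<l> has_derivative (\<lambda>x. x)) (at 0)"
    using has_derivative_inverse_basic[of \<epsilon> "\<lambda>x. x" \<l> 0 "\<lambda>x. x" O'] \<epsilon>_derivative_0 O' \<open>0 \<in> O'\<close> \<l>O(2)
    by (simp add: \<l>0 bounded_linear_ident comp_def id_def)
  define Y where "Y s = X s - X t - (1/2) *\<^sub>R B (X t) (X s)" for s
  have XY: "X s = X t + Y s + (1/2) *\<^sub>R B (X t) (Y s)" for s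
    by (simp add: Y_def B.diff_right B.scaleR_right B_self B_nil_right)
  have Exp_Y: "Exp (Y s) = - \<gamma> t + \<gamma> s" if "s \<in> S" for s
    unfolding Y_def Exp_translate[symmetric] X[OF that] X[OF t] inverse_translate_cancel ..
  have "continuous (at t within S) Y"
    unfolding Y_def[abs_def]
    by (intro continuous_diff Xc continuous_const continuous_scaleR bounded_linear.continuous[OF B.bounded_linear_right])
  then have "(Y \<longlongrightarrow> 0) (at t within S)" by (simp add: continuous_within Y_def B_self)
  then have evY: "\<forall>\<^sub>F s in at t within S. Y s \<in> ball 0 \<rho>"
    using topological_tendstoD[of Y 0 "at t within S" "ball 0 \<rho>"] \<rho>(1) by simp
  have evS: "\<forall>\<^sub>F s in at t within S. s \<in> S" by (simp add: eventually_at_filter)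
  have "((\<lambda>s. \<l> (\<psi> (- \<gamma> t + \<gamma> s))) has_vector_derivative u) (at t within S)"
    using has_vector_derivative_compose[of "\<lambda>s. \<psi> (- \<gamma> t + \<gamma> s)" u t S \<l> "\<lambda>x. x"] LV \<l>d by (simp add: LV_def)
  then have Yd: "(Y has_vector_derivative u) (at t within S)"
  proof (rule has_vector_derivative_eventually_cong[OF _ _ t])
    show "\<forall>\<^sub>F s in at t within S. \<l> (\<psi> (- \<gamma> t + \<gamma> s)) = Y s"
      using evY evS
    proof eventually_elim
      case (elim s)
      have "\<psi> (- \<gamma> t + \<gamma> s) = \<epsilon> (Y s)" unfolding \<epsilon>_def Exp_Y[OF elim(2)] ..
      then show ?case using \<l>[OF elim(1)] by simp
    qed
  qed (simp add: Y_def B_self \<l>0)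
  have "((\<lambda>s. X t + Y s + (1/2) *\<^sub>R B (X t) (Y s)) has_vector_derivative (0 + u + (1/2) *\<^sub>R B (X t) u)) (at t within S)"
    by (intro has_vector_derivative_add has_vector_derivative_const Yd
        bounded_linear.has_vector_derivative[OF bounded_linear_scaleR_right] bounded_linear.has_vector_derivative[OF B.bounded_linear_right])
  then show ?thesis unfolding XY[symmetric] by simp
qed

text \<open>On \<open>[a, b]\<close> the curve is \<open>Exp X\<close> translated to start at \<open>\<gamma> a\<close>, where
  \<open>X\<close> is the indefinite integral of \<open>g\<close> from \<open>a\<close> and so vanishes there.\<close>

definition lifts :: "(real \<Rightarrow> 'g) \<Rightarrow> real \<Rightarrow> real \<Rightarrow> (real \<Rightarrow> 'e) \<Rightarrow> (real \<Rightarrow> 'e) \<Rightarrow> bool" where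
  "lifts \<gamma> a b X g \<longleftrightarrow> g absolutely_integrable_on {a..b} \<and> (\<forall>t\<in>{a..b}. (g has_integral X t) {a..t}) \<and>
     (\<forall>t\<in>{a..b}. \<gamma> t = \<gamma> a + Exp (X t))"

text \<open>The second piece starts at \<open>X1 b\<close>; the product formula turns it into its image under the linear map
  \<open>v \<mapsto> v + B (X1 b) v / 2\<close>.\<close>

lemma lifts_combine:
  assumes l1: "lifts \<gamma> a b X1 g1" and l2: "lifts \<gamma> b c X2 g2" and ab: "a \<le> b" "b \<le> c"
  shows "\<exists>X g. lifts \<gamma> a c X g"
proof -
  define \<Lambda> where "\<Lambda> v = v + (1/2) *\<^sub>R B (X1 b) v" for v
  have \<Lambda>: "bounded_linear \<Lambda>"
    unfolding \<Lambda>_def[abs_def]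
    by (rule bounded_linear_add[OF bounded_linear_ident bounded_linear_compose[OF bounded_linear_scaleR_right B.bounded_linear_right]])
  define g where "g t = (if t \<le> b then g1 t else \<Lambda> (g2 t))" for t
  define X where "X t = (if t \<le> b then X1 t else X1 b + \<Lambda> (X2 t))" for t
  have g1: "g1 absolutely_integrable_on {a..b}" "\<And>t. t \<in> {a..b} \<Longrightarrow> (g1 has_integral X1 t) {a..t}"
    "\<And>t. t \<in> {a..b} \<Longrightarrow> \<gamma> t = \<gamma> a + Exp (X1 t)" using l1 unfolding lifts_def by blast+
  have g2: "g2 absolutely_integrable_on {b..c}" "\<And>t. t \<in> {b..c} \<Longrightarrow> (g2 has_integral X2 t) {b..t}"
    "\<And>t. t \<in> {b..c} \<Longrightarrow> \<gamma> t = \<gamma> b + Exp (X2 t)" using l2 unfolding lifts_def by blast+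
  have \<Lambda>2: "((\<lambda>t. \<Lambda> (g2 t)) has_integral \<Lambda> (X2 t)) {b..t}" if "t \<in> {b..c}" for t
    using has_integral_linear[OF g2(2)[OF that] \<Lambda>] by (simp add: comp_def)
  have "g absolutely_integrable_on {a..b}"
    by (rule absolutely_integrable_spike[OF g1(1) negligible_empty]) (simp add: g_def)
  moreover have "g absolutely_integrable_on {b..c}"
    by (rule absolutely_integrable_spike[OF absolutely_integrable_linear[OF g2(1) \<Lambda>] negligible_sing[of b]]) (auto simp: g_def)
  ultimately have "g absolutely_integrable_on {a..b} \<union> {b..c}" by (rule set_integrable_Un) auto
  then have ga: "g absolutely_integrable_on {a..c}" using ab by (simp add: ivl_disj_un_two_touch)
  have gX: "(g has_integral X t) {a..t}" if t: "t \<in> {a..c}" for t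
  proof (cases "t \<le> b")
    case True
    then have "(g1 has_integral X1 t) {a..t}" using t by (intro g1(2)) auto
    then have "(g has_integral X1 t) {a..t}" by (rule has_integral_eq[rotated]) (use True in \<open>auto simp: g_def\<close>)
    then show ?thesis using True by (simp add: X_def)
  next
    case False
    then have tb: "t \<in> {b..c}" using t by auto
    have 1: "(g has_integral X1 b) {a..b}"
      by (rule has_integral_eq[OF _ g1(2)]) (use ab in \<open>auto simp: g_def\<close>)
    have 2: "(g has_integral \<Lambda> (X2 t)) {b..t}"
      by (rule has_integral_spike[OF negligible_sing[of b] _ \<Lambda>2[OF tb]]) (auto simp: g_def)
    show ?thesis using has_integral_combine[OF ab(1) _ 1 2] False by (simp add: X_def)
  qed
  have "\<gamma> t = \<gamma> a + Exp (X t)" if t: "t \<in> {a..c}" for t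
  proof (cases "t \<le> b")
    case True then show ?thesis using g1(3)[of t] t by (simp add: X_def)
  next
    case False
    then have tb: "t \<in> {b..c}" using t by auto
    have "\<gamma> t = \<gamma> a + (Exp (X1 b) + Exp (X2 t))"
      using g2(3)[OF tb] g1(3)[of b] ab by (simp add: add.assoc)
    then show ?thesis using False by (simp add: Exp_add X_def \<Lambda>_def add.assoc)
  qed
  then have "lifts \<gamma> a c X g" using ga gX unfolding lifts_def by blast
  then show ?thesis by blast
qed

text \<open>Near any time, the local inverse of \<open>Exp\<close> provides a lift. It is absolutely continuous because that
  inverse is Lipschitz in the chart, so it is the integral of its derivative; Bolzano's principle combines the local
  lifts. This works whether or not \<open>Exp\<close> is injective.\<close>

theorem abs_continuous_curve_lifts:
  assumes ac: "abs_continuous_curve A \<gamma>" and N: "negligible N"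
    and v: "\<And>t. t \<in> {0..1} - N \<Longrightarrow> \<exists>u. LV \<gamma> u t {0..1}" and ab: "0 \<le> a" "a \<le> b" "b \<le> 1"
  shows "\<exists>X g. lifts \<gamma> a b X g"
proof -
  define P where "P a b \<longleftrightarrow> (0 \<le> a \<and> a \<le> b \<and> b \<le> 1 \<longrightarrow> (\<exists>X g. lifts \<gamma> a b X g))" for a b
  have \<gamma>c: "continuous_on {0..1} \<gamma>" using ac by (simp add: abs_continuous_curve_def)
  obtain u where u: "\<And>t. t \<in> {0..1} - N \<Longrightarrow> LV \<gamma> (u t) t {0..1}" using v by metis
  obtain \<rho> W where \<rho>: "\<rho> > 0" "open W" "0 \<in> W" "W \<subseteq> U" "W \<subseteq> Exp ` ball 0 \<rho>" "\<forall>x\<in>ball 0 \<rho>. Exp x \<in> U"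
    and bl: "\<forall>x\<in>ball 0 \<rho>. \<forall>y\<in>ball 0 \<rho>. norm (x - y) \<le> 2 * norm (\<epsilon> x - \<epsilon> y) \<and> norm (\<epsilon> x - \<epsilon> y) \<le> 2 * norm (x - y)"
    using Exp_local_homeomorphism by (elim exE conjE)
  obtain \<beta> where \<beta>: "\<beta> > 0" "\<And>x y. norm (B x y) \<le> norm x * norm y * \<beta>" using B.pos_bounded by blast
  have "P a b"
    using \<open>a \<le> b\<close>
  proof (induction rule: Bolzano)
    case (trans a b c)
    show ?case unfolding P_def
    proof
      assume "0 \<le> a \<and> a \<le> c \<and> c \<le> 1"
      then have "\<exists>X g. lifts \<gamma> a b X g" "\<exists>X g. lifts \<gamma> b c X g" using trans by (auto simp: P_def)
      then show "\<exists>X g. lifts \<gamma> a c X g"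
        by (elim exE) (rule lifts_combine[OF _ _ trans(3,4)])
    qed
  next
    case (local x)
    then have x: "x \<in> {0..1}" using ab by auto
    obtain V \<theta> where V: "(V, \<theta>) \<in> A" "\<gamma> x \<in> V" using atlas_covers[OF atlas] by metis
    note cV = atlas_chart[OF atlas V(1)]
    note T = smooth_left_translation_to_identity_chart[OF V(1), of "- \<gamma> x"]
    have "\<theta> (\<gamma> x) \<in> {z \<in> \<theta> ` V. - \<gamma> x + inv_into V \<theta> z \<in> U}" using V(2) cV(5) U0 by simp
    from smooth_on_imp_locally_lipschitz[OF T(2,1) this]
    obtain r K where r: "r > 0" "K \<ge> 0" and lip: "\<forall>y\<in>cball (\<theta> (\<gamma> x)) r. \<forall>z\<in>cball (\<theta> (\<gamma> x)) r.
        norm (\<psi> (- \<gamma> x + inv_into V \<theta> y) - \<psi> (- \<gamma> x + inv_into V \<theta> z)) \<le> K * norm (y - z)" by (elim exE conjE)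
    define N0 where "N0 = {p \<in> V. \<theta> p \<in> ball (\<theta> (\<gamma> x)) r} \<inter> (\<lambda>p. - \<gamma> x + p) -` W"
    have "open N0"
      unfolding N0_def by (intro open_Int open_chart_preimage[OF atlas V(1)] open_vimage \<rho>(2) continuous_intros open_ball)
    moreover have "\<gamma> x \<in> N0" using V(2) r \<rho>(3) by (simp add: N0_def)
    ultimately have "\<forall>\<^sub>F t in at x within {0..1}. \<gamma> t \<in> N0"
      using topological_tendstoD[of \<gamma> "\<gamma> x" "at x within {0..1}" N0] \<gamma>c x by (simp add: continuous_on_def)
    then obtain d where d: "d > 0" "\<And>t. t \<in> {0..1} \<Longrightarrow> dist t x < d \<Longrightarrow> \<gamma> t \<in> N0"
      unfolding eventually_at using \<open>\<gamma> x \<in> N0\<close> by metis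
    show ?case
    proof (intro exI[of _ d] conjI allI impI d(1))
      fix a b assume xab: "a \<le> x \<and> x \<le> b \<and> b - a < d"
      show "P a b" unfolding P_def
      proof
        assume ab: "0 \<le> a \<and> a \<le> b \<and> b \<le> 1"
        have tN: "\<gamma> t \<in> N0" if "t \<in> {a..b}" for t
          using that ab xab by (intro d(2)) (auto simp: dist_real_def)
        have "\<exists>y. y \<in> ball 0 \<rho> \<and> Exp y = - \<gamma> x + \<gamma> t" if "t \<in> {a..b}" for t
        proof -
          have "- \<gamma> x + \<gamma> t \<in> Exp ` ball 0 \<rho>" using tN[OF that] \<rho>(5) by (auto simp: N0_def)
          then show ?thesis by force
        qed
        then obtain Y where Y: "\<And>t. t \<in> {a..b} \<Longrightarrow> Y t \<in> ball 0 \<rho>" "\<And>t. t \<in> {a..b} \<Longrightarrow> Exp (Y t) = - \<gamma> x + \<gamma> t" by metis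
        have Ylip: "norm (Y t - Y s) \<le> 2 * K * norm (\<theta> (\<gamma> t) - \<theta> (\<gamma> s))" if st: "s \<in> {a..b}" "t \<in> {a..b}" for s t
        proof -
          have e: "\<epsilon> (Y s) = \<psi> (- \<gamma> x + inv_into V \<theta> (\<theta> (\<gamma> s)))" "\<theta> (\<gamma> s) \<in> cball (\<theta> (\<gamma> x)) r" if "s \<in> {a..b}" for s
            using tN[OF that] cV(5) by (simp_all add: \<epsilon>_def Y(2)[OF that] N0_def)
          have "norm (Y t - Y s) \<le> 2 * norm (\<epsilon> (Y t) - \<epsilon> (Y s))" using bl Y(1) st by blast
          also have "norm (\<epsilon> (Y t) - \<epsilon> (Y s)) \<le> K * norm (\<theta> (\<gamma> t) - \<theta> (\<gamma> s))"
            unfolding e(1)[OF st(1)] e(1)[OF st(2)] using lip e(2) st by blast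
          finally show ?thesis by simp
        qed
        define X where "X t = Y t - Y a - (1/2) *\<^sub>R B (Y a) (Y t)" for t
        define C where "C = (1 + norm (Y a) * \<beta>) * (2 * K)"
        have C0: "C \<ge> 0" using r \<beta> by (simp add: C_def)
        have Xlip: "norm (X t - X s) \<le> C * norm ((\<theta> \<circ> \<gamma>) t - (\<theta> \<circ> \<gamma>) s)" if st: "s \<in> {a..b}" "t \<in> {a..b}" for s t
        proof -
          have "X t - X s = (Y t - Y s) - (1/2) *\<^sub>R B (Y a) (Y t - Y s)"
            by (simp add: X_def B.diff_right scaleR_diff_right)
          also have "norm \<dots> \<le> norm (Y t - Y s) + norm ((1/2) *\<^sub>R B (Y a) (Y t - Y s))" by (rule norm_triangle_ineq4)
          also have "\<dots> \<le> norm (Y t - Y s) + norm (Y a) * norm (Y t - Y s) * \<beta>"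
            using \<beta>(2)[of "Y a" "Y t - Y s"] norm_ge_zero[of "B (Y a) (Y t - Y s)"] by (simp only: norm_scaleR; linarith)
          also have "\<dots> = (1 + norm (Y a) * \<beta>) * norm (Y t - Y s)" by (simp add: algebra_simps)
          also have "\<dots> \<le> (1 + norm (Y a) * \<beta>) * (2 * K * norm (\<theta> (\<gamma> t) - \<theta> (\<gamma> s)))"
            using \<beta>(1) Ylip[OF st] by (intro mult_left_mono) auto
          finally show ?thesis by (simp add: C_def mult.assoc)
        qed
        have acX: "abs_continuous_on {a..b} X"
        proof (rule abs_continuous_on_lipschitz_transfer[OF _ C0 Xlip])
          have "\<gamma> ` {a..b} \<subseteq> V" using tN by (auto simp: N0_def)
          then show "abs_continuous_on {a..b} (\<theta> \<circ> \<gamma>)"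
            using ac V(1) ab unfolding abs_continuous_curve_def by fastforce
        qed
        have "\<gamma> ` {a..b} \<subseteq> V" using tN by (auto simp: N0_def)
        then have "continuous_on {a..b} (\<theta> \<circ> \<gamma>)"
          using ab by (intro continuous_on_compose continuous_on_subset[OF \<gamma>c] continuous_on_subset[OF cV(3)]) auto
        then have Xcont: "continuous (at t within {a..b}) X" if t: "t \<in> {a..b}" for t
        proof -
          assume c: "continuous_on {a..b} (\<theta> \<circ> \<gamma>)"
          then have "((\<lambda>s. (\<theta> \<circ> \<gamma>) s) \<longlongrightarrow> (\<theta> \<circ> \<gamma>) t) (at t within {a..b})" using t by (simp add: continuous_on_def)
          then have "((\<lambda>s. C * norm ((\<theta> \<circ> \<gamma>) s - (\<theta> \<circ> \<gamma>) t)) \<longlongrightarrow> C * norm ((\<theta> \<circ> \<gamma>) t - (\<theta> \<circ> \<gamma>) t)) (at t within {a..b})"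
            by (intro tendsto_intros)
          then have lim: "((\<lambda>s. C * norm ((\<theta> \<circ> \<gamma>) s - (\<theta> \<circ> \<gamma>) t)) \<longlongrightarrow> 0) (at t within {a..b})" by simp
          have ev: "\<forall>\<^sub>F s in at t within {a..b}. norm (X s - X t) \<le> C * norm ((\<theta> \<circ> \<gamma>) s - (\<theta> \<circ> \<gamma>) t)"
            using Xlip[OF t] by (simp add: eventually_at_filter)
          have "((\<lambda>s. X s - X t) \<longlongrightarrow> 0) (at t within {a..b})" by (rule Lim_null_comparison[OF ev lim])
          then show ?thesis unfolding continuous_within by (rule Lim_null[THEN iffD2])
        qed
        have \<gamma>X: "\<gamma> t = \<gamma> a + Exp (X t)" if t: "t \<in> {a..b}" for t
        proof -
          have "- \<gamma> a + \<gamma> t = - (- \<gamma> x + \<gamma> a) + (- \<gamma> x + \<gamma> t)" by (simp only: inverse_translate_cancel)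
          also have "\<dots> = - Exp (Y a) + Exp (Y t)" using Y(2)[OF t] Y(2)[of a] ab by simp
          also have "\<dots> = Exp (X t)" unfolding X_def by (rule Exp_translate)
          finally show ?thesis by (rule eq_add_Exp)
        qed
        define g where "g t = u t + (1/2) *\<^sub>R B (X t) (u t)" for t
        have der: "(X has_vector_derivative g t) (at t within {a..b})" if t: "t \<in> {a..b} - N" for t
          unfolding g_def
        proof (rule log_derivative[where \<gamma>=\<gamma> and p="\<gamma> a"])
          show "LV \<gamma> (u t) t {a..b}" using t ab by (intro LV_subset[OF u]) auto
          show "t \<in> {a..b}" using t by simp
          then show "continuous (at t within {a..b}) X" by (rule Xcont)
          show "\<gamma> s = \<gamma> a + Exp (X s)" if "s \<in> {a..b}" for s by (rule \<gamma>X[OF that])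
        qed
        have X0: "X a = 0" by (simp add: X_def B_self)
        have "a \<le> b" using ab by simp
        note FTC = abs_continuous_imp_indefinite_integral[OF acX this N der]
        have "lifts \<gamma> a b X g" unfolding lifts_def
          using FTC(1) FTC(2)[unfolded X0 diff_0_right] \<gamma>X by (intro conjI ballI)
        then show "\<exists>X g. lifts \<gamma> a b X g" by blast
      qed
    qed
  qed
  then show ?thesis using ab by (simp add: P_def)
qed

text \<open>The left velocity \<open>c\<close> of the curve is recovered from the derivative \<open>g\<close> of its lift, and
  \<open>g = c + B X c / 2\<close> by nilpotency.\<close>

lemma lifts_control:
  assumes l: "lifts \<gamma> a b X g" and "a \<le> b"
  defines "c \<equiv> \<lambda>t. g t - (1/2) *\<^sub>R B (X t) (g t)"
  shows "c absolutely_integrable_on {a..b}" "\<And>t. g t = c t + (1/2) *\<^sub>R B (X t) (c t)"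
    "\<exists>N. negligible N \<and> (\<forall>t\<in>{a..b} - N. LV \<gamma> (c t) t {a..b})"
proof -
  have g: "g absolutely_integrable_on {a..b}" and gX: "\<And>t. t \<in> {a..b} \<Longrightarrow> (g has_integral X t) {a..t}"
    and \<gamma>: "\<And>t. t \<in> {a..b} \<Longrightarrow> \<gamma> t = \<gamma> a + Exp (X t)" using l unfolding lifts_def by blast+
  have "continuous_on {a..b} X"
    using indefinite_integral_continuous_on[OF g] by (rule continuous_on_eq) (use gX integral_unique in blast)
  note Bg = absolutely_integrable_bilinear_continuous[OF bounded_bilinear_B this g]
  show "c absolutely_integrable_on {a..b}"
    unfolding c_def by (rule set_integral_diff(1)[OF g absolutely_integrable_scaleR_left[OF Bg]])
  show "g t = c t + (1/2) *\<^sub>R B (X t) (c t)" for t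
    by (simp add: c_def B.diff_right B.scaleR_right B_nil_right)
  obtain N where N: "negligible N" "\<And>t. t \<in> {a..b} - N \<Longrightarrow> (X has_vector_derivative g t) (at t within {a..b})"
    by (rule indefinite_integral_derivative_ae[OF set_lebesgue_integral_eq_integral(1)[OF g] gX]) (assumption, blast)
  have "LV \<gamma> (c t) t {a..b}" if t: "t \<in> {a..b} - N" for t
  proof -
    have t': "t \<in> {a..b}" using t by simp
    have "LV (\<lambda>s. \<gamma> a + Exp (X s)) (c t) t {a..b}"
      unfolding c_def by (rule LV_left_translate[OF Exp_LV[OF N(2)[OF t] t']])
    then have 1: "((\<lambda>s. \<gamma> a + Exp (X s)) \<longlongrightarrow> \<gamma> t) (at t within {a..b})"
      and 2: "((\<lambda>s. \<psi> (- \<gamma> t + (\<gamma> a + Exp (X s)))) has_vector_derivative c t) (at t within {a..b})"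
      by (simp_all add: LV_def \<gamma>[OF t', symmetric])
    have ev: "\<forall>\<^sub>F s in at t within {a..b}. \<gamma> a + Exp (X s) = \<gamma> s"
      unfolding eventually_at_filter by (intro always_eventually allI impI \<gamma>[symmetric])
    show ?thesis unfolding LV_def
    proof
      show "(\<gamma> \<longlongrightarrow> \<gamma> t) (at t within {a..b})" using 1 tendsto_cong[OF ev] by simp
      show "((\<lambda>s. \<psi> (- \<gamma> t + \<gamma> s)) has_vector_derivative c t) (at t within {a..b})"
        by (rule has_vector_derivative_eventually_cong[OF 2 _ t']) (use ev in \<open>auto elim!: eventually_mono simp: \<gamma>[OF t', symmetric]\<close>)
    qed
  qed
  then show "\<exists>N. negligible N \<and> (\<forall>t\<in>{a..b} - N. LV \<gamma> (c t) t {a..b})" using N(1) by blast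
qed

lemma isCont_Exp: "isCont Exp x"
proof -
  have "isCont (\<lambda>y. y - x - (1/2) *\<^sub>R B x y) x"
    by (intro continuous_diff continuous_ident continuous_const continuous_scaleR bounded_linear.continuous[OF B.bounded_linear_right])
  then have "((\<lambda>y. y - x - (1/2) *\<^sub>R B x y) \<longlongrightarrow> 0) (at x)" by (simp add: isCont_def B_self)
  from filterlim_compose[OF Exp_tendsto_0 this]
  have "((\<lambda>y. Exp x + Exp (y - x - (1/2) *\<^sub>R B x y)) \<longlongrightarrow> Exp x + 0) (at x)" by (intro tendsto_intros)
  moreover have "Exp x + Exp (y - x - (1/2) *\<^sub>R B x y) = Exp y" for y
    using Exp_relative_position[of "\<lambda>s::bool. if s then y else x" True False] by simp
  ultimately show ?thesis by (simp add: isCont_def)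
qed

text \<open>Absolute continuity has to be checked in every chart that contains an arc of the curve. Locally such a chart is a
  Lipschitz function of the lift, with increments bounded by a multiple of the integral of \<open>norm g\<close>;
  Bolzano's principle extends this bound to the whole arc.\<close>

theorem Exp_indefinite_integral_abs_continuous:
  assumes g: "g absolutely_integrable_on {0..1}" and gX: "\<And>t. t \<in> {0..1} \<Longrightarrow> (g has_integral X t) {0..t}"
    and \<gamma>: "\<And>t. \<gamma> t = p + Exp (X t)"
  shows "abs_continuous_curve A \<gamma>"
  unfolding abs_continuous_curve_def
proof (intro conjI)
  have gi: "g integrable_on {0..1}" by (rule set_lebesgue_integral_eq_integral(1)[OF g])
  have Xc: "continuous_on {0..1} X"
    using indefinite_integral_continuous_on[OF g] by (rule continuous_on_eq) (use gX integral_unique in blast)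
  have ng: "(\<lambda>t. norm (g t)) absolutely_integrable_on {0..1}"
    using absolutely_integrable_norm[OF g] by (simp add: comp_def)
  have ngi: "(\<lambda>t. norm (g t)) integrable_on {s..t}" if "0 \<le> s" "t \<le> 1" for s t
    by (rule integrable_on_subinterval[OF set_lebesgue_integral_eq_integral(1)[OF ng]]) (use that in auto)
  have Xdiff: "norm (X t - X s) \<le> integral {s..t} (\<lambda>t. norm (g t))" if st: "0 \<le> s" "s \<le> t" "t \<le> 1" for s t
  proof -
    have "integral {0..s} g + integral {s..t} g = integral {0..t} g"
      using st by (intro Henstock_Kurzweil_Integration.integral_combine integrable_on_subinterval[OF gi]) auto
    moreover have "integral {0..s} g = X s" "integral {0..t} g = X t"
      using st by (auto intro!: integral_unique gX)
    ultimately have "X t - X s = integral {s..t} g" by (simp add: algebra_simps)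
    also have "norm \<dots> \<le> integral {s..t} (\<lambda>t. norm (g t))"
      using st by (intro integral_norm_bound_integral integrable_on_subinterval[OF gi] ngi) auto
    finally show ?thesis .
  qed
  show \<gamma>c: "continuous_on {0..1} \<gamma>"
    unfolding \<gamma>[abs_def]
    by (intro continuous_on_add continuous_on_const continuous_on_compose2[OF _ Xc, of UNIV Exp])
       (auto intro: continuous_at_imp_continuous_on isCont_Exp)
  obtain \<rho> W where \<rho>: "\<rho> > 0" "\<forall>x\<in>ball 0 \<rho>. Exp x \<in> U"
    and bl: "\<forall>x\<in>ball 0 \<rho>. \<forall>y\<in>ball 0 \<rho>. norm (x - y) \<le> 2 * norm (\<epsilon> x - \<epsilon> y) \<and> norm (\<epsilon> x - \<epsilon> y) \<le> 2 * norm (x - y)"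
    using Exp_local_homeomorphism by (elim exE conjE)
  obtain \<beta> where \<beta>: "\<beta> > 0" "\<And>x y. norm (B x y) \<le> norm x * norm y * \<beta>" using B.pos_bounded by blast
  have "abs_continuous_on {a..b} (\<theta> \<circ> \<gamma>)" if V: "(V, \<theta>) \<in> A" and ab: "{a..b} \<subseteq> {0..1}" "\<gamma> ` {a..b} \<subseteq> V" for V \<theta> a b
  proof (cases "a \<le> b")
    case False
    then have "{a..b} = {}" by simp
    then show ?thesis unfolding abs_continuous_on_def
    proof (intro allI impI exI[of _ 1] conjI)
      fix e :: real and D :: "real set set" assume "e > 0" "{a..b} = {}" and D: "D division_of \<Union>D \<and> \<Union>D \<subseteq> {a..b} \<and> (\<Sum>k\<in>D. Sup k - Inf k) < 1"
      have "D = {}"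
      proof (rule ccontr)
        assume "D \<noteq> {}"
        then obtain k where "k \<in> D" by blast
        then have "k \<noteq> {}" "k \<subseteq> {a..b}" using D by (auto simp: division_of_def)
        then show False using \<open>{a..b} = {}\<close> by blast
      qed
      then show "(\<Sum>k\<in>D. norm ((\<theta> \<circ> \<gamma>) (Sup k) - (\<theta> \<circ> \<gamma>) (Inf k))) < e" using \<open>e > 0\<close> by simp
    qed simp
  next
    case True
    then have ab01: "0 \<le> a" "b \<le> 1" using ab(1) by auto
    define P where "P c d \<longleftrightarrow> (a \<le> c \<and> d \<le> b \<longrightarrow> (\<exists>K\<ge>0. \<forall>s t. c \<le> s \<and> s \<le> t \<and> t \<le> d \<longrightarrow>
        norm (\<theta> (\<gamma> t) - \<theta> (\<gamma> s)) \<le> K * integral {s..t} (\<lambda>t. norm (g t))))" for c d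
    have "P a b"
      using True
    proof (induction rule: Bolzano)
      case (trans c d e)
      show ?case unfolding P_def
      proof
        assume ce: "a \<le> c \<and> e \<le> b"
        obtain K1 where K1: "K1 \<ge> 0" "\<forall>s t. c \<le> s \<and> s \<le> t \<and> t \<le> d \<longrightarrow> norm (\<theta> (\<gamma> t) - \<theta> (\<gamma> s)) \<le> K1 * integral {s..t} (\<lambda>t. norm (g t))"
          using trans ce unfolding P_def by auto
        obtain K2 where K2: "K2 \<ge> 0" "\<forall>s t. d \<le> s \<and> s \<le> t \<and> t \<le> e \<longrightarrow> norm (\<theta> (\<gamma> t) - \<theta> (\<gamma> s)) \<le> K2 * integral {s..t} (\<lambda>t. norm (g t))"
          using trans ce unfolding P_def by auto
        define K where "K = K1 + K2"
        have I0: "0 \<le> integral {s..t} (\<lambda>t. norm (g t))" if "0 \<le> s" "t \<le> 1" for s t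
          by (rule integral_nonneg[OF ngi[OF that]]) simp
        have le1: "norm (\<theta> (\<gamma> t) - \<theta> (\<gamma> s)) \<le> K * integral {s..t} (\<lambda>t. norm (g t))" if st: "c \<le> s" "s \<le> t" "t \<le> d" for s t
        proof -
          have "norm (\<theta> (\<gamma> t) - \<theta> (\<gamma> s)) \<le> K1 * integral {s..t} (\<lambda>t. norm (g t))" using K1(2) st by blast
          also have "\<dots> \<le> K * integral {s..t} (\<lambda>t. norm (g t))"
            using K2(1) I0[of s t] st ce ab01 trans by (intro mult_right_mono) (auto simp: K_def)
          finally show ?thesis .
        qed
        have le2: "norm (\<theta> (\<gamma> t) - \<theta> (\<gamma> s)) \<le> K * integral {s..t} (\<lambda>t. norm (g t))" if st: "d \<le> s" "s \<le> t" "t \<le> e" for s t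
        proof -
          have "norm (\<theta> (\<gamma> t) - \<theta> (\<gamma> s)) \<le> K2 * integral {s..t} (\<lambda>t. norm (g t))" using K2(2) st by blast
          also have "\<dots> \<le> K * integral {s..t} (\<lambda>t. norm (g t))"
            using K1(1) I0[of s t] st ce ab01 trans by (intro mult_right_mono) (auto simp: K_def)
          finally show ?thesis .
        qed
        have "norm (\<theta> (\<gamma> t) - \<theta> (\<gamma> s)) \<le> K * integral {s..t} (\<lambda>t. norm (g t))" if st: "c \<le> s" "s \<le> t" "t \<le> e" for s t
        proof -
          consider "t \<le> d" | "d \<le> s" | "s \<le> d" "d \<le> t" by linarith
          then show ?thesis
          proof cases
            case 1 then show ?thesis using le1 st by blast
          next
            case 2 then show ?thesis using le2 st by blast
          next
            case 3
            have "norm (\<theta> (\<gamma> t) - \<theta> (\<gamma> s)) \<le> norm (\<theta> (\<gamma> t) - \<theta> (\<gamma> d)) + norm (\<theta> (\<gamma> d) - \<theta> (\<gamma> s))"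
              using norm_triangle_ineq[of "\<theta> (\<gamma> t) - \<theta> (\<gamma> d)" "\<theta> (\<gamma> d) - \<theta> (\<gamma> s)"] by simp
            also have "\<dots> \<le> K * integral {d..t} (\<lambda>t. norm (g t)) + K * integral {s..d} (\<lambda>t. norm (g t))"
              using le1[of s d] le2[of d t] 3 st by (intro add_mono) auto
            also have "\<dots> = K * integral {s..t} (\<lambda>t. norm (g t))"
              using Henstock_Kurzweil_Integration.integral_combine[of s d t "\<lambda>t. norm (g t)"] ngi[of s t] 3 st ce ab01
              by (simp add: distrib_left[symmetric] add.commute)
            finally show ?thesis .
          qed
        qed
        then show "\<exists>K\<ge>0. \<forall>s t. c \<le> s \<and> s \<le> t \<and> t \<le> e \<longrightarrow> norm (\<theta> (\<gamma> t) - \<theta> (\<gamma> s)) \<le> K * integral {s..t} (\<lambda>t. norm (g t))"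
          using K1(1) K2(1) by (intro exI[of _ K]) (simp add: K_def)
      qed
    next
      case (local x)
      then have x: "x \<in> {a..b}" "x \<in> {0..1}" using ab01 by auto
      have "0 \<in> {y \<in> E0. \<gamma> x + \<kappa> y \<in> V}" using ab(2) x by auto
      from smooth_on_imp_locally_lipschitz[OF smooth_translated_chart(2,1)[OF V, of "\<gamma> x"] this]
      obtain r K where r: "r > 0" "K \<ge> 0" and lip: "\<forall>y\<in>cball 0 r. \<forall>z\<in>cball 0 r. norm (\<theta> (\<gamma> x + \<kappa> y) - \<theta> (\<gamma> x + \<kappa> z)) \<le> K * norm (y - z)"
        by (elim exE conjE)
      define Y where "Y s = X s - X x - (1/2) *\<^sub>R B (X x) (X s)" for s
      have \<gamma>Y: "\<gamma> s = \<gamma> x + Exp (Y s)" for s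
        unfolding \<gamma> Y_def using Exp_relative_position[of X s x] by (simp add: add.assoc)
      have "(Y \<longlongrightarrow> Y x) (at x within {0..1})"
      proof -
        have "(X \<longlongrightarrow> X x) (at x within {0..1})" using Xc x by (simp add: continuous_on_def)
        then show ?thesis unfolding Y_def[abs_def]
          by (intro tendsto_diff tendsto_const tendsto_scaleR B.tendsto)
      qed
      then have Y0: "(Y \<longlongrightarrow> 0) (at x within {0..1})" by (simp add: Y_def B_self)
      define r' where "r' = min \<rho> (r / 2)"
      have r': "r' > 0" using r \<rho> by (simp add: r'_def)
      have "\<forall>\<^sub>F s in at x within {0..1}. Y s \<in> ball 0 r'"
        using topological_tendstoD[OF Y0, of "ball 0 r'"] r' by simp
      then obtain d where d: "d > 0" "\<forall>s\<in>{0..1}. s \<noteq> x \<and> dist s x < d \<longrightarrow> Y s \<in> ball 0 r'" unfolding eventually_at by auto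
      have Yx: "Y x = 0" by (simp add: Y_def B_self)
      have Yb: "Y s \<in> ball 0 r'" if "s \<in> {0..1}" "dist s x < d" for s
        using d(2) that Yx r' by (cases "s = x") auto
      define C where "C = K * (2 * (1 + norm (X x) * \<beta>))"
      have C0: "C \<ge> 0" using r \<beta> by (simp add: C_def)
      show ?case
      proof (intro exI[of _ d] conjI allI impI d(1))
        fix c e assume ce: "c \<le> x \<and> x \<le> e \<and> e - c < d"
        show "P c e" unfolding P_def
        proof (rule impI, rule exI[of _ C], intro conjI allI impI C0)
          fix s t assume abce: "a \<le> c \<and> e \<le> b" and st: "c \<le> s \<and> s \<le> t \<and> t \<le> e"
          have S: "s \<in> {0..1}" "t \<in> {0..1}" "dist s x < d" "dist t x < d"
            using abce st ab01 ce by (auto simp: dist_real_def)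
          have Ys: "Y s \<in> ball 0 r'" "Y t \<in> ball 0 r'" using Yb S by auto
          have \<rho>': "y \<in> ball 0 \<rho>" if "y \<in> ball 0 r'" for y using that by (simp add: r'_def)
          have \<epsilon>r: "\<epsilon> y \<in> cball 0 r" "\<gamma> x + Exp y = \<gamma> x + \<kappa> (\<epsilon> y)" if y: "y \<in> ball 0 r'" for y
          proof -
            have "norm (\<epsilon> y - \<epsilon> 0) \<le> 2 * norm (y - 0)" using bl \<rho>'[OF y] \<rho>(1) by (meson centre_in_ball)
            then show "\<epsilon> y \<in> cball 0 r" using y by (simp add: \<epsilon>_0 r'_def)
            show "\<gamma> x + Exp y = \<gamma> x + \<kappa> (\<epsilon> y)" using \<rho>(2) \<rho>'[OF y] by (simp add: \<epsilon>_def \<kappa>_\<psi>)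
          qed
          have "norm (\<theta> (\<gamma> t) - \<theta> (\<gamma> s)) = norm (\<theta> (\<gamma> x + \<kappa> (\<epsilon> (Y t))) - \<theta> (\<gamma> x + \<kappa> (\<epsilon> (Y s))))"
            unfolding \<gamma>Y[of t] \<gamma>Y[of s] \<epsilon>r(2)[OF Ys(1)] \<epsilon>r(2)[OF Ys(2)] ..
          also have "\<dots> \<le> K * norm (\<epsilon> (Y t) - \<epsilon> (Y s))" using lip \<epsilon>r(1) Ys by blast
          also have "norm (\<epsilon> (Y t) - \<epsilon> (Y s)) \<le> 2 * norm (Y t - Y s)" using bl \<rho>' Ys by blast
          also have "norm (Y t - Y s) \<le> (1 + norm (X x) * \<beta>) * norm (X t - X s)"
          proof -
            have "Y t - Y s = (X t - X s) - (1/2) *\<^sub>R B (X x) (X t - X s)"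
              by (simp add: Y_def B.diff_right scaleR_diff_right)
            also have "norm \<dots> \<le> norm (X t - X s) + norm ((1/2) *\<^sub>R B (X x) (X t - X s))" by (rule norm_triangle_ineq4)
            also have "\<dots> \<le> norm (X t - X s) + norm (X x) * norm (X t - X s) * \<beta>"
              using \<beta>(2)[of "X x" "X t - X s"] norm_ge_zero[of "B (X x) (X t - X s)"] by (simp only: norm_scaleR; linarith)
            finally show ?thesis by (simp add: algebra_simps)
          qed
          also have "norm (X t - X s) \<le> integral {s..t} (\<lambda>t. norm (g t))" using S st by (intro Xdiff) auto
          finally have "norm (\<theta> (\<gamma> t) - \<theta> (\<gamma> s)) \<le> K * (2 * ((1 + norm (X x) * \<beta>) * integral {s..t} (\<lambda>t. norm (g t))))"
            using r \<beta> by (simp add: mult_left_mono)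
          then show "norm (\<theta> (\<gamma> t) - \<theta> (\<gamma> s)) \<le> C * integral {s..t} (\<lambda>t. norm (g t))"
            by (simp only: C_def mult.assoc)
        qed
      qed
    qed
    then obtain K where K: "K \<ge> 0" "\<forall>s t. a \<le> s \<and> s \<le> t \<and> t \<le> b \<longrightarrow> norm (\<theta> (\<gamma> t) - \<theta> (\<gamma> s)) \<le> K * integral {s..t} (\<lambda>t. norm (g t))"
      unfolding P_def by auto
    show ?thesis
    proof (rule abs_continuous_onI_indefinite_integral)
      have "(\<lambda>t. norm (g t)) absolutely_integrable_on {a..b}"
        by (rule absolutely_integrable_on_subinterval[OF ng ab(1)])
      from absolutely_integrable_scaleR_left[OF this, of K]
      show "(\<lambda>t. K * norm (g t)) absolutely_integrable_on {a..b}" by simp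
      show "K * norm (g t) \<ge> 0" for t using K(1) by simp
      show "norm ((\<theta> \<circ> \<gamma>) y - (\<theta> \<circ> \<gamma>) x) \<le> integral {x..y} (\<lambda>t. K * norm (g t))" if "a \<le> x" "x \<le> y" "y \<le> b" for x y
        using K(2) that by simp
    qed
  qed
  then show "\<forall>(V, \<theta>)\<in>A. \<forall>a b. {a..b} \<subseteq> {0..1} \<and> \<gamma> ` {a..b} \<subseteq> V \<longrightarrow> abs_continuous_on {a..b} (\<theta> \<circ> \<gamma>)"
    by (intro ballI) auto
qed

end

section \<open>Comparing the two distances\<close>

lemma AE_lebesgue_on_iff_negligible:
  fixes S :: "real set"
  assumes "S \<in> sets lebesgue"
  shows "(AE t in lebesgue_on S. P t) \<longleftrightarrow> (\<exists>N. negligible N \<and> (\<forall>t\<in>S - N. P t))"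
proof -
  have "(AE t in lebesgue_on S. P t) \<longleftrightarrow> (AE t in lebesgue. t \<in> S \<longrightarrow> P t)"
    using assms by (intro AE_restrict_space_iff) simp
  also have "\<dots> \<longleftrightarrow> (\<exists>N\<in>null_sets lebesgue. {t. \<not> (t \<in> S \<longrightarrow> P t)} \<subseteq> N)"
    by (simp add: eventually_ae_filter)
  also have "\<dots> \<longleftrightarrow> (\<exists>N. negligible N \<and> (\<forall>t\<in>S - N. P t))"
    unfolding negligible_iff_null_sets by blast
  finally show ?thesis .
qed

context lie_group_chart
begin

lemma B_nil_of_two_step_nilpotent:
  assumes "two_step_nilpotent A" shows "B (B x y) z = 0"
proof -
  have "T (B x y) \<in> derived_algebra A"
    unfolding derived_algebra_def bracket_span_def lie_bracket_T[symmetric]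
    by (rule span_base) (use T_in_lie_algebra in blast)
  then have "lie_bracket A (T z) (T (B x y)) \<in> bracket_span A (lie_algebra A) (derived_algebra A)"
    unfolding bracket_span_def by (intro span_base) (use T_in_lie_algebra in blast)
  then have "T (B z (B x y)) = 0"
    using assms by (simp add: two_step_nilpotent_def lie_bracket_T)
  then have "T (B z (B x y)) = T 0" by (simp only: linear_0[OF linear_T])
  then have "B z (B x y) = 0" by (simp only: T_inject)
  moreover have "B (B x y) z = - B z (B x y)" by (simp add: B_def)
  ultimately show ?thesis by simp
qed

end

locale subriemannian_group_chart = nilpotent_lie_group_chart A U \<phi>
  for A :: "('g::{topological_group_add, t2_space, second_countable_topology}, 'e::euclidean_space) atlas"
    and U :: "'g set" and \<phi> :: "'g \<Rightarrow> 'e" +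
  fixes \<Delta> :: "'g \<Rightarrow> 'g tangent set" and \<rho> :: "'g \<Rightarrow> 'g tangent \<Rightarrow> 'g tangent \<Rightarrow> real"
  assumes subriemannian: "subriemannian_structure A \<Delta> \<rho>"
    and connected: "connected (UNIV :: 'g set)"
begin

definition D :: "'e set" where "D = {x. T x \<in> \<Delta> 0}"

lemma subspace_\<Delta>: "subspace (\<Delta> p)" and \<Delta>_tangent: "\<Delta> p \<subseteq> tangent_space A p"
  and \<Delta>_translate: "\<Delta> (p + q) = dL p ` \<Delta> q" and \<Delta>_generates: "lie_subalgebra A hull \<Delta> 0 = lie_algebra A"
  and \<rho>_inner: "inner_product_on (\<Delta> p) (\<rho> p)"
  and \<rho>_translate: "X \<in> \<Delta> q \<Longrightarrow> Y \<in> \<Delta> q \<Longrightarrow> \<rho> (p + q) (dL p X) (dL p Y) = \<rho> q X Y"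
  using subriemannian unfolding subriemannian_structure_def by blast+

lemma \<Delta>_0: "\<Delta> 0 = T ` D"
  using \<Delta>_tangent[of 0] lie_algebra_eq by (auto simp: D_def lie_algebra_def)

lemma \<Delta>_eq: "\<Delta> p = dL p ` T ` D"
  using \<Delta>_translate[of p 0] by (simp add: \<Delta>_0)

lemma subspace_D: "subspace D"
  using subspace_\<Delta>[of 0] linear_subspace_vimage[OF linear_T, of "\<Delta> 0"] by (simp add: D_def vimage_def)

text \<open>Any linear projection to \<open>D\<close> extends the metric from \<open>D\<close> to the whole space.\<close>

definition Pr :: "'e \<Rightarrow> 'e" where
  "Pr = (SOME P. linear P \<and> (\<forall>x. P x \<in> D) \<and> (\<forall>x\<in>D. P x = x))"

lemma linear_Pr: "linear Pr" and Pr_D: "Pr x \<in> D" and Pr_id: "x \<in> D \<Longrightarrow> Pr x = x"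
proof -
  have "\<exists>P. range P \<subseteq> D \<and> linear P \<and> (\<forall>x\<in>D. P (id x) = x)"
    by (rule linear_exists_left_inverse_on[OF linear_id subspace_D]) simp
  then have "\<exists>P. linear P \<and> (\<forall>x. P x \<in> D) \<and> (\<forall>x\<in>D. P x = x)" by auto
  from someI_ex[OF this] show "linear Pr" "Pr x \<in> D" "x \<in> D \<Longrightarrow> Pr x = x"
    unfolding Pr_def by blast+
qed

definition R :: "'e \<Rightarrow> 'e \<Rightarrow> real" where "R x y = \<rho> 0 (T (Pr x)) (T (Pr y))"

lemma R_eq: "x \<in> D \<Longrightarrow> y \<in> D \<Longrightarrow> R x y = \<rho> 0 (T x) (T y)"
  by (simp add: R_def Pr_id)

lemma T_Pr: "T (Pr x) \<in> \<Delta> 0" using Pr_D by (simp add: D_def)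

lemmas \<rho>_0_inner = \<rho>_inner[of 0, unfolded inner_product_on_def]
lemmas \<rho>_0_add = \<rho>_0_inner[THEN conjunct1, rule_format]
lemmas \<rho>_0_scale = \<rho>_0_inner[THEN conjunct2, THEN conjunct1, rule_format]
lemmas \<rho>_0_sym = \<rho>_0_inner[THEN conjunct2, THEN conjunct2, THEN conjunct1, rule_format]
lemmas \<rho>_0_pos = \<rho>_0_inner[THEN conjunct2, THEN conjunct2, THEN conjunct2, rule_format]

lemma R_sym: "R x y = R y x"
  unfolding R_def by (rule \<rho>_0_sym[OF T_Pr T_Pr])

lemma bounded_bilinear_R: "bounded_bilinear R"
proof -
  have l: "R (x + y) z = R x z + R y z" "R (c *\<^sub>R x) z = c * R x z" for x y z c
    unfolding R_def linear_add[OF linear_Pr] linear_scale[OF linear_Pr] T_add T_scaleR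
    by (rule \<rho>_0_add[OF T_Pr T_Pr T_Pr] \<rho>_0_scale[OF T_Pr T_Pr])+
  have r: "R z (x + y) = R z x + R z y" "R z (c *\<^sub>R x) = c * R z x" for x y z c
    unfolding R_sym[of z] by (rule l)+
  have "bilinear R"
    unfolding bilinear_def by (intro conjI allI linearI) (simp_all add: l r)
  then show ?thesis by (simp add: bilinear_conv_bounded_bilinear)
qed

lemma R_0: "R 0 0 = 0" by (rule bounded_bilinear.zero_left[OF bounded_bilinear_R])

lemma R_pos: "x \<in> D \<Longrightarrow> x \<noteq> 0 \<Longrightarrow> R x x > 0"
  using \<rho>_0_pos[of "T x"] T_inject[of x 0] by (simp add: R_eq D_def linear_0[OF linear_T])

lemma R_nonneg: "R x x \<ge> 0"
proof -
  have "R x x = R (Pr x) (Pr x)" by (simp add: R_def Pr_id Pr_D)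
  then show ?thesis using R_pos[OF Pr_D, of x] R_0 by (cases "Pr x = 0") auto
qed

text \<open>In a two-step algebra the sum of \<open>D\<close> and its brackets is closed under brackets. Since the distribution is
  bracket-generating, the sum is everything.\<close>

lemma D_generates: "\<exists>d\<in>D. x - d \<in> span {B d e |d e. d \<in> D \<and> e \<in> D}"
proof -
  define Y where "Y = span {B d e |d e. d \<in> D \<and> e \<in> D}"
  define S where "S = {d + z |d z. d \<in> D \<and> z \<in> Y}"
  have Y: "subspace Y" by (simp add: Y_def)
  have S: "subspace S" unfolding S_def by (rule subspace_sums[OF subspace_D Y])
  have BY: "B z w = 0" if "z \<in> Y" for z w
    using that unfolding Y_def
    by (induction rule: span_induct_alt) (auto simp: B.add_left B.scaleR_left B_nil B.zero_left)
  have BS: "B u v \<in> S" if uv: "u \<in> S" "v \<in> S" for u v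
  proof -
    obtain d z d' z' where dz: "u = d + z" "v = d' + z'" "d \<in> D" "d' \<in> D" "z \<in> Y" "z' \<in> Y"
      using uv unfolding S_def by blast
    have "B d z' = 0" using BY[OF dz(6), of d] B_anti[of d z'] by simp
    then have "B u v = 0 + B d d'" using dz by (simp add: B.add_left B.add_right BY)
    moreover have "B d d' \<in> Y" unfolding Y_def by (rule span_base) (use dz in blast)
    ultimately show ?thesis unfolding S_def using subspace_0[OF subspace_D] by blast
  qed
  have "lie_subalgebra A (T ` S)"
    unfolding lie_subalgebra_def
    using linear_subspace_image[OF linear_T S] BS by (auto simp: lie_algebra_eq lie_bracket_T)
  moreover have "\<Delta> 0 \<subseteq> T ` S"
  proof -
    have "d \<in> S" if "d \<in> D" for d using that subspace_0[OF Y] unfolding S_def by force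
    then show ?thesis unfolding \<Delta>_0 by blast
  qed
  ultimately have "lie_algebra A \<subseteq> T ` S" unfolding \<Delta>_generates[symmetric] by (intro hull_minimal)
  then have "T x \<in> T ` S" using T_in_lie_algebra by blast
  then have "x \<in> S" by (auto simp: T_inject)
  then show ?thesis unfolding S_def Y_def by force
qed

sublocale SR: subriemannian_step_two B R D
proof (rule subriemannian_step_two.intro)
  show "x = 0" if "x \<in> D" "R x x = 0" for x using R_pos[OF that(1)] that(2) by fastforce
  show "R x y = R y x" for x y by (rule R_sym)
qed (rule bounded_bilinear_B B_self B_nil bounded_bilinear_R R_nonneg subspace_D D_generates)+

lemma derived_algebra_eq: "derived_algebra A = T ` SR.Z"
proof -
  have "{lie_bracket A u v |u v. u \<in> lie_algebra A \<and> v \<in> lie_algebra A} = {lie_bracket A (T x) (T y) |x y. True}"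
    unfolding lie_algebra_eq by blast
  also have "\<dots> = T ` {B x y |x y. True}" unfolding lie_bracket_T by blast
  finally show ?thesis
    by (simp add: derived_algebra_def bracket_span_def SR.Z_def span_linear_image[OF linear_T])
qed

lemma asymptotic_distribution_eq: "asymptotic_distribution A \<Delta> \<rho> p = dL p ` T ` SR.V"
proof -
  have "{v \<in> \<Delta> 0. \<forall>w \<in> \<Delta> 0 \<inter> derived_algebra A. \<rho> 0 v w = 0} = T ` SR.V"
  proof -
    have "T ` D \<inter> T ` SR.Z = T ` SR.W"
      unfolding SR.W_def by (rule image_Int[symmetric]) (simp add: inj_def T_inject)
    moreover have "{v \<in> T ` D. \<forall>w \<in> T ` SR.W. \<rho> 0 v w = 0} = T ` {x \<in> D. \<forall>y\<in>SR.W. \<rho> 0 (T x) (T y) = 0}" by blast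
    moreover have "{x \<in> D. \<forall>y\<in>SR.W. \<rho> 0 (T x) (T y) = 0} = SR.V"
      unfolding SR.V_def by (intro Collect_cong conj_cong refl ball_cong) (simp add: R_eq SR.W_def)
    ultimately show ?thesis unfolding \<Delta>_0 derived_algebra_eq by simp
  qed
  then show ?thesis by (simp add: asymptotic_distribution_def)
qed

lemma V_subset_D: "SR.V \<subseteq> D" by (auto simp: SR.V_def)

lemma asymptotic_distribution_subset: "asymptotic_distribution A \<Delta> \<rho> p \<subseteq> \<Delta> p"
  unfolding asymptotic_distribution_eq \<Delta>_eq[of p] by (intro image_mono V_subset_D)

lemma dL_T_tangent: "u \<in> D \<Longrightarrow> dL p (T u) \<in> tangent_space A p"
  by (rule subsetD[OF \<Delta>_tangent]) (simp only: \<Delta>_eq[of p] imageI)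

lemma \<rho>_dL_T: "u \<in> D \<Longrightarrow> \<rho> p (dL p (T u)) (dL p (T u)) = R u u"
  using \<rho>_translate[of "T u" 0 "T u" p] by (simp add: R_eq D_def)

lemma curve_length_eq:
  assumes c: "c absolutely_integrable_on {0..1}" and N: "negligible N"
    and v: "\<And>t. t \<in> {0..1} - N \<Longrightarrow> c t \<in> D \<and> has_velocity A \<gamma> (dL (\<gamma> t) (T (c t))) t"
  shows "curve_length A \<rho> \<gamma> = integral {0..1} (\<lambda>t. SR.speed (c t))"
proof -
  define f where "f t = sqrt (\<rho> (\<gamma> t) (velocity A \<gamma> t) (velocity A \<gamma> t))" for t
  have eq: "f t = SR.speed (c t)" if t: "t \<in> {0..1} - N" for t
  proof -
    have "velocity A \<gamma> t = dL (\<gamma> t) (T (c t))" using v[OF t] t by (intro velocity_eq) auto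
    then show ?thesis using v[OF t] by (simp add: f_def \<rho>_dL_T SR.speed_def)
  qed
  have "f absolutely_integrable_on {0..1}"
    by (rule absolutely_integrable_spike[OF SR.speed_integrable[OF c] N eq])
  then have "integrable (lebesgue_on {0..1}) f"
    by (simp add: integrable_restrict_space set_integrable_def)
  then have "curve_length A \<rho> \<gamma> = integral {0..1} f"
    unfolding curve_length_def f_def[abs_def] by (rule lebesgue_integral_eq_integral) simp
  also have "\<dots> = integral {0..1} (\<lambda>t. SR.speed (c t))"
    by (rule integral_spike[OF N]) (simp add: eq)
  finally show ?thesis .
qed

text \<open>One control serves all subintervals, since left velocities are unique wherever they exist. On an interval that is a
  single point uniqueness fails, but there the lift is trivial. Setting the control to 0 where the curve has no
  horizontal velocity puts it in \<open>D\<close> at all times.\<close>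

lemma horizontal_curve_control:
  assumes h: "horizontal_curve A \<Delta> \<gamma>"
  shows "\<exists>c. c absolutely_integrable_on {0..1} \<and> (\<forall>t. c t \<in> D) \<and>
    curve_length A \<rho> \<gamma> = integral {0..1} (\<lambda>t. SR.speed (c t)) \<and>
    (\<forall>a b. 0 \<le> a \<and> a \<le> b \<and> b \<le> 1 \<longrightarrow> (\<exists>X. \<gamma> b = \<gamma> a + Exp (X b) \<and>
       (\<forall>t\<in>{a..b}. ((\<lambda>t. c t + (1/2) *\<^sub>R B (X t) (c t)) has_integral X t) {a..t})))"
proof -
  have ac: "abs_continuous_curve A \<gamma>" and ae: "AE t in lebesgue_on {0..1}. \<exists>X\<in>\<Delta> (\<gamma> t). has_velocity A \<gamma> X t"
    using h by (auto simp: horizontal_curve_def)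
  have \<gamma>c: "continuous_on {0..1} \<gamma>" using ac by (simp add: abs_continuous_curve_def)
  have "\<exists>N. negligible N \<and> (\<forall>t\<in>{0..1} - N. \<exists>X\<in>\<Delta> (\<gamma> t). has_velocity A \<gamma> X t)"
    using ae by (subst (asm) AE_lebesgue_on_iff_negligible) simp_all
  then obtain N where N: "negligible N" "\<forall>t\<in>{0..1} - N. \<exists>X\<in>\<Delta> (\<gamma> t). has_velocity A \<gamma> X t" by (elim exE conjE)
  have "\<forall>t\<in>{0..1} - N. \<exists>u. u \<in> D \<and> has_velocity A \<gamma> (dL (\<gamma> t) (T u)) t"
  proof
    fix t assume "t \<in> {0..1} - N"
    then have "\<exists>X\<in>\<Delta> (\<gamma> t). has_velocity A \<gamma> X t" using N(2) by blast
    then show "\<exists>u. u \<in> D \<and> has_velocity A \<gamma> (dL (\<gamma> t) (T u)) t"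
      unfolding \<Delta>_eq[of "\<gamma> t"] by blast
  qed
  then obtain u where u: "\<forall>t\<in>{0..1} - N. u t \<in> D \<and> has_velocity A \<gamma> (dL (\<gamma> t) (T (u t))) t"
    by (rule bchoice[THEN exE])
  have LVu: "LV \<gamma> (u t) t {0..1}" if "t \<in> {0..1} - N" for t
    using u that by (intro LV_of_has_velocity \<gamma>c) auto
  define c where "c t = (if t \<in> {0..1} - N then u t else 0)" for t
  have cD: "c t \<in> D" for t using u subspace_0[OF subspace_D] by (simp add: c_def)
  have lift: "\<exists>X g. lifts \<gamma> a b X g" if "0 \<le> a" "a \<le> b" "b \<le> 1" for a b
    by (rule abs_continuous_curve_lifts[OF ac N(1) _ that]) (use LVu in blast)
  have lift_c: "\<exists>X c'. lifts \<gamma> a b X (\<lambda>t. c' t + (1/2) *\<^sub>R B (X t) (c' t)) \<and> c' absolutely_integrable_on {a..b} \<and>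
      (\<exists>N'. negligible N' \<and> (\<forall>t\<in>{a..b} - N'. c t = c' t))" if ab: "0 \<le> a" "a < b" "b \<le> 1" for a b
  proof -
    obtain X g where Xg: "lifts \<gamma> a b X g" using lift[of a b] ab by auto
    define c' where "c' t = g t - (1/2) *\<^sub>R B (X t) (g t)" for t
    note lc = lifts_control[OF Xg less_imp_le[OF ab(2)], folded c'_def]
    obtain N' where N': "negligible N'" "\<forall>t\<in>{a..b} - N'. LV \<gamma> (c' t) t {a..b}" using lc(3) by (elim exE conjE)
    have "c t = c' t" if t: "t \<in> {a..b} - (N \<union> N')" for t
    proof -
      have "t \<in> {0..1} - N" using t ab by auto
      then have "LV \<gamma> (c t) t {a..b}"
        using LVu[of t] ab by (simp add: c_def) (rule LV_subset, auto)
      then show ?thesis using N'(2) t ab by (intro LV_unique[of \<gamma> "c t" t a b "c' t"]) auto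
    qed
    then have "\<exists>N'. negligible N' \<and> (\<forall>t\<in>{a..b} - N'. c t = c' t)"
      using negligible_Un[OF N(1) N'(1)] by blast
    moreover have "g = (\<lambda>t. c' t + (1/2) *\<^sub>R B (X t) (c' t))" by (rule ext) (rule lc(2))
    ultimately show ?thesis using Xg lc(1) by metis
  qed
  have "\<exists>X c'. lifts \<gamma> 0 1 X (\<lambda>t. c' t + (1/2) *\<^sub>R B (X t) (c' t)) \<and> c' absolutely_integrable_on {0..1} \<and>
      (\<exists>N'. negligible N' \<and> (\<forall>t\<in>{0..1} - N'. c t = c' t))" by (rule lift_c) auto
  then obtain c' N' where c': "c' absolutely_integrable_on {0..1}" "negligible N'" "\<forall>t\<in>{0..1} - N'. c t = c' t"
    by (elim exE conjE)
  have ci: "c absolutely_integrable_on {0..1}"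
    by (rule absolutely_integrable_spike[OF c'(1,2)]) (use c'(3) in blast)
  have len: "curve_length A \<rho> \<gamma> = integral {0..1} (\<lambda>t. SR.speed (c t))"
    by (rule curve_length_eq[OF ci N(1)]) (use u in \<open>auto simp: c_def\<close>)
  have "\<exists>X. \<gamma> b = \<gamma> a + Exp (X b) \<and>
       (\<forall>t\<in>{a..b}. ((\<lambda>t. c t + (1/2) *\<^sub>R B (X t) (c t)) has_integral X t) {a..t})"
    if ab: "0 \<le> a" "a \<le> b" "b \<le> 1" for a b
  proof (cases "a = b")
    case True
    then show ?thesis
      by (intro exI[of _ "\<lambda>t. 0"] conjI ballI) (auto simp: Exp_0)
  next
    case False
    then have "a < b" using ab by simp
    from lift_c[OF ab(1) this ab(3)]
    obtain X c' N' where X: "lifts \<gamma> a b X (\<lambda>t. c' t + (1/2) *\<^sub>R B (X t) (c' t))"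
      and N': "negligible N'" "\<forall>t\<in>{a..b} - N'. c t = c' t" by (elim exE conjE)
    have "\<gamma> b = \<gamma> a + Exp (X b)" using X ab unfolding lifts_def by (meson atLeastAtMost_iff order_refl)
    moreover have "((\<lambda>t. c t + (1/2) *\<^sub>R B (X t) (c t)) has_integral X t) {a..t}" if t: "t \<in> {a..b}" for t
    proof (rule has_integral_spike[OF N'(1)])
      show "((\<lambda>t. c' t + (1/2) *\<^sub>R B (X t) (c' t)) has_integral X t) {a..t}" using X t unfolding lifts_def by blast
      show "c s + (1/2) *\<^sub>R B (X s) (c s) = c' s + (1/2) *\<^sub>R B (X s) (c' s)" if s: "s \<in> {a..t} - N'" for s
      proof -
        have "c s = c' s" using N'(2) s t by auto
        then show ?thesis by simp
      qed
    qed
    ultimately show ?thesis by blast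
  qed
  then show ?thesis using ci cD len by (intro exI[of _ c] conjI) auto
qed

text \<open>The converse of the lifting: \<open>C\<close> solves the equation modulo the centre, and nilpotency makes \<open>B (Y
  t) = B (C t)\<close>, so that \<open>w\<close> is the left velocity of the curve.\<close>

lemma control_curve:
  assumes w: "SR.control w"
  shows "\<exists>\<gamma>. horizontal_curve A (asymptotic_distribution A \<Delta> \<rho>) \<gamma> \<and> \<gamma> 0 = p \<and> \<gamma> 1 = p + Exp (SR.endpoint w) \<and>
    curve_length A \<rho> \<gamma> = integral {0..1} (\<lambda>t. SR.speed (w t))"
proof -
  have wi: "w absolutely_integrable_on {0..1}" and wV: "\<And>t. w t \<in> SR.V" using w by (auto simp: SR.control_def)
  have wD: "w t \<in> D" for t using wV V_subset_D by blast
  define C where "C t = integral {0..t} w" for t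
  have Cc: "continuous_on {0..1} C" unfolding C_def[abs_def] by (rule indefinite_integral_continuous_on[OF wi])
  note Bi = absolutely_integrable_bilinear_continuous[OF bounded_bilinear_B Cc wi]
  define g where "g t = w t + (1/2) *\<^sub>R B (C t) (w t)" for t
  have gi: "g absolutely_integrable_on {0..1}"
    unfolding g_def[abs_def] by (rule set_integral_add(1)[OF wi absolutely_integrable_scaleR_left[OF Bi]])
  define Y where "Y t = integral {0..t} g" for t
  have on: "f integrable_on {0..t}" if "f absolutely_integrable_on {0..1}" "t \<in> {0..1}" for f :: "real \<Rightarrow> 'e" and t
    by (rule integrable_on_subinterval[OF set_lebesgue_integral_eq_integral(1)[OF that(1)]]) (use that(2) in auto)
  have gY: "(g has_integral Y t) {0..t}" if "t \<in> {0..1}" for t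
    unfolding Y_def by (rule integrable_integral[OF on[OF gi that]])
  have YC: "Y t = C t + (1/2) *\<^sub>R integral {0..t} (\<lambda>t. B (C t) (w t))" if t: "t \<in> {0..1}" for t
    unfolding Y_def C_def g_def[abs_def]
    using integral_add[OF on[OF wi t] integrable_cmul[OF on[OF Bi t], of "1/2"]] by (simp add: C_def)
  have BY: "B (Y t) x = B (C t) x" if t: "t \<in> {0..1}" for t x
  proof -
    have "((\<lambda>t. B (B (C t) (w t)) x) has_integral B (integral {0..t} (\<lambda>t. B (C t) (w t))) x) {0..t}"
      using has_integral_linear[OF integrable_integral[OF on[OF Bi t]] B.bounded_linear_left[of x]] by (simp add: comp_def)
    then have "B (integral {0..t} (\<lambda>t. B (C t) (w t))) x = 0"
      unfolding B_nil using has_integral_is_0[of "{0..t}" "\<lambda>t. 0::'e"] has_integral_unique by blast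
    then show ?thesis by (simp add: YC[OF t] B.add_left B.scaleR_left)
  qed
  define \<gamma> where "\<gamma> t = p + Exp (Y t)" for t
  have ac: "abs_continuous_curve A \<gamma>"
    by (rule Exp_indefinite_integral_abs_continuous[OF gi gY \<gamma>_def])
  have "\<exists>N. negligible N \<and> (\<forall>t\<in>{0..1} - N. (Y has_vector_derivative g t) (at t within {0..1}))"
    using indefinite_integral_derivative_ae[OF set_lebesgue_integral_eq_integral(1)[OF gi] gY] by metis
  then obtain N where N: "negligible N" "\<forall>t\<in>{0..1} - N. (Y has_vector_derivative g t) (at t within {0..1})"
    by (elim exE conjE)
  have vel: "w t \<in> D \<and> has_velocity A \<gamma> (dL (\<gamma> t) (T (w t))) t" if t: "t \<in> {0..1} - N" for t
  proof -
    have t': "t \<in> {0..1}" using t by simp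
    have "LV (\<lambda>s. Exp (Y s)) (g t - (1/2) *\<^sub>R B (Y t) (g t)) t {0..1}"
      by (rule Exp_LV[OF _ t']) (use N(2) t in blast)
    moreover have "g t - (1/2) *\<^sub>R B (Y t) (g t) = w t"
      by (simp add: BY[OF t'] g_def B.add_right B.scaleR_right B_nil_right)
    ultimately have "LV \<gamma> (w t) t {0..1}" unfolding \<gamma>_def[abs_def] by (intro LV_left_translate) simp
    then show ?thesis using has_velocity_of_LV[OF _ t' dL_T_tangent[OF wD]] wD by blast
  qed
  have "\<exists>X\<in>asymptotic_distribution A \<Delta> \<rho> (\<gamma> t). has_velocity A \<gamma> X t" if "t \<in> {0..1} - N" for t
    unfolding asymptotic_distribution_eq by (rule bexI[of _ "dL (\<gamma> t) (T (w t))"]) (use vel[OF that] wV in auto)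
  then have "horizontal_curve A (asymptotic_distribution A \<Delta> \<rho>) \<gamma>"
    using ac N(1) unfolding horizontal_curve_def by (subst AE_lebesgue_on_iff_negligible) auto
  moreover have "\<gamma> 0 = p" by (simp add: \<gamma>_def Y_def Exp_0)
  moreover have "\<gamma> 1 = p + Exp (SR.endpoint w)"
    using YC[of 1] by (simp add: \<gamma>_def SR.endpoint_def C_def)
  moreover have "curve_length A \<rho> \<gamma> = integral {0..1} (\<lambda>t. SR.speed (w t))"
    by (rule curve_length_eq[OF wi N(1) vel])
  ultimately show ?thesis by blast
qed

lemma horizontal_curve_mono: "horizontal_curve A (asymptotic_distribution A \<Delta> \<rho>) \<gamma> \<Longrightarrow> horizontal_curve A \<Delta> \<gamma>"
  unfolding horizontal_curve_def
  using asymptotic_distribution_subset by (auto elim!: eventually_mono)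

lemma cc_dist_le_asymptotic_dist: "cc_dist A \<Delta> \<rho> p q \<le> asymptotic_dist A \<Delta> \<rho> p q"
  unfolding asymptotic_dist_def cc_dist_def
  by (rule INF_superset_mono) (auto intro: horizontal_curve_mono)

lemma cc_dist_nonneg: "cc_dist A \<Delta> \<rho> p q \<ge> 0"
  unfolding cc_dist_def
proof (rule INF_greatest)
  fix \<gamma> assume "\<gamma> \<in> {\<gamma>. horizontal_curve A \<Delta> \<gamma> \<and> p \<in> \<gamma> ` {0..1} \<and> q \<in> \<gamma> ` {0..1}}"
  then have "horizontal_curve A \<Delta> \<gamma>" by simp
  from horizontal_curve_control[OF this]
  have "\<exists>c. c absolutely_integrable_on {0::real..1} \<and> curve_length A \<rho> \<gamma> = integral {0..1} (\<lambda>t. SR.speed (c t))"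
    by (elim exE conjE) (intro exI conjI; assumption)
  then obtain c where c: "c absolutely_integrable_on {0::real..1}"
    and len: "curve_length A \<rho> \<gamma> = integral {0..1} (\<lambda>t. SR.speed (c t))" by (elim exE conjE)
  have "(\<lambda>t. SR.speed (c t)) integrable_on {0..1}"
    by (rule set_lebesgue_integral_eq_integral(1)[OF SR.speed_integrable[OF c]])
  then have "0 \<le> integral {0..1} (\<lambda>t. SR.speed (c t))"
    by (rule Henstock_Kurzweil_Integration.integral_nonneg) (rule SR.speed_nonneg)
  then show "0 \<le> ereal (curve_length A \<rho> \<gamma>)" by (simp add: len)
qed

lemma asymptotic_dist_le:
  assumes w: "SR.control w" and pq: "q = p + Exp (SR.endpoint w) \<or> p = q + Exp (SR.endpoint w)"
  shows "asymptotic_dist A \<Delta> \<rho> p q \<le> ereal (integral {0..1} (\<lambda>t. SR.speed (w t)))"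
proof -
  define p' where "p' = (if q = p + Exp (SR.endpoint w) then p else q)"
  obtain \<gamma> where \<gamma>: "horizontal_curve A (asymptotic_distribution A \<Delta> \<rho>) \<gamma>" "\<gamma> 0 = p'" "\<gamma> 1 = p' + Exp (SR.endpoint w)"
    "curve_length A \<rho> \<gamma> = integral {0..1} (\<lambda>t. SR.speed (w t))"
    using control_curve[OF w, of p'] by (elim exE conjE)
  have "\<gamma> 0 \<in> \<gamma> ` {0..1}" "\<gamma> 1 \<in> \<gamma> ` {0..1}" by auto
  then have "p \<in> \<gamma> ` {0..1}" "q \<in> \<gamma> ` {0..1}"
    unfolding \<gamma>(2,3) using pq unfolding p'_def by (auto split: if_splits simp del: add_left_cancel)
  then show ?thesis
    unfolding asymptotic_dist_def cc_dist_def \<gamma>(4)[symmetric] by (intro INF_lower) (use \<gamma>(1) in simp)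
qed

text \<open>Every horizontal curve through two points is cut at them and lifted. Its control is then replaced by a
  \<open>V\<close>-valued one with the same endpoint, which is again realized as a curve.\<close>

theorem asymptotic_dist_le_cc_dist:
  "\<exists>C\<ge>0. \<forall>p q. asymptotic_dist A \<Delta> \<rho> p q \<le> cc_dist A \<Delta> \<rho> p q + ereal C"
proof -
  obtain C where C: "C \<ge> 0" and rep: "\<forall>(a::real) b c X. 0 \<le> a \<and> a \<le> b \<and> b \<le> 1 \<and> c absolutely_integrable_on {a..b} \<and> (\<forall>t\<in>{a..b}. c t \<in> D) \<and>
      (\<forall>t\<in>{a..b}. ((\<lambda>t. c t + (1/2) *\<^sub>R B (X t) (c t)) has_integral X t) {a..t}) \<longrightarrow>
    (\<exists>w. SR.control w \<and> SR.endpoint w = X b \<and>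
      integral {0..1} (\<lambda>t. SR.speed (w t)) \<le> integral {a..b} (\<lambda>t. SR.speed (c t)) + C)"
    using SR.horizontal_replacement by (elim exE conjE)
  have main: "asymptotic_dist A \<Delta> \<rho> p q \<le> ereal (curve_length A \<rho> \<gamma>) + ereal C"
    if \<gamma>: "horizontal_curve A \<Delta> \<gamma>" "p \<in> \<gamma> ` {0..1}" "q \<in> \<gamma> ` {0..1}" for p q \<gamma>
  proof -
    from horizontal_curve_control[OF \<gamma>(1)]
    obtain c where c: "c absolutely_integrable_on {0..1}" "\<forall>t. c t \<in> D"
      "curve_length A \<rho> \<gamma> = integral {0..1} (\<lambda>t. SR.speed (c t))"
      and lift: "\<forall>a b. 0 \<le> a \<and> a \<le> b \<and> b \<le> 1 \<longrightarrow> (\<exists>X. \<gamma> b = \<gamma> a + Exp (X b) \<and>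
       (\<forall>t\<in>{a..b}. ((\<lambda>t. c t + (1/2) *\<^sub>R B (X t) (c t)) has_integral X t) {a..t}))" by (elim exE conjE)
    obtain s t where st: "s \<in> {0..1}" "t \<in> {0..1}" "p = \<gamma> s" "q = \<gamma> t" using \<gamma>(2,3) by blast
    define a b where "a = min s t" and "b = max s t"
    have ab: "0 \<le> a" "a \<le> b" "b \<le> 1" using st by (auto simp: a_def b_def)
    have "\<exists>X. \<gamma> b = \<gamma> a + Exp (X b) \<and>
      (\<forall>t\<in>{a..b}. ((\<lambda>t. c t + (1/2) *\<^sub>R B (X t) (c t)) has_integral X t) {a..t})"
      by (rule lift[rule_format]) (use ab in simp)
    then obtain X where X: "\<gamma> b = \<gamma> a + Exp (X b)"
      "\<forall>t\<in>{a..b}. ((\<lambda>t. c t + (1/2) *\<^sub>R B (X t) (c t)) has_integral X t) {a..t}" by (elim exE conjE)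
    have cab: "c absolutely_integrable_on {a..b}"
      by (rule absolutely_integrable_on_subinterval[OF c(1)]) (use ab in auto)
    obtain w where w: "SR.control w" "SR.endpoint w = X b"
      "integral {0..1} (\<lambda>t. SR.speed (w t)) \<le> integral {a..b} (\<lambda>t. SR.speed (c t)) + C"
      using rep[rule_format, of a b c X] ab cab c(2) X(2) by auto
    have si: "(\<lambda>t. SR.speed (c t)) integrable_on {0..1}"
      by (rule set_lebesgue_integral_eq_integral(1)[OF SR.speed_integrable[OF c(1)]])
    have "integral {a..b} (\<lambda>t. SR.speed (c t)) \<le> integral {0..1} (\<lambda>t. SR.speed (c t))"
      by (rule integral_subset_le[OF _ integrable_on_subinterval[OF si] si]) (use ab in \<open>auto simp: SR.speed_nonneg\<close>)
    then have le: "integral {0..1} (\<lambda>t. SR.speed (w t)) \<le> curve_length A \<rho> \<gamma> + C" using w(3) c(3) by simp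
    have "q = p + Exp (SR.endpoint w) \<or> p = q + Exp (SR.endpoint w)"
    proof (cases "s \<le> t")
      case True
      then have "a = s" "b = t" by (auto simp: a_def b_def)
      then show ?thesis using X(1) unfolding w(2) st by blast
    next
      case False
      then have "a = t" "b = s" by (auto simp: a_def b_def)
      then show ?thesis using X(1) unfolding w(2) st by blast
    qed
    from asymptotic_dist_le[OF w(1) this] show ?thesis
      using le order_trans by fastforce
  qed
  have "asymptotic_dist A \<Delta> \<rho> p q \<le> cc_dist A \<Delta> \<rho> p q + ereal C" for p q
  proof -
    have "asymptotic_dist A \<Delta> \<rho> p q - ereal C \<le> cc_dist A \<Delta> \<rho> p q"
      unfolding cc_dist_def
    proof (rule INF_greatest)
      fix \<gamma> assume "\<gamma> \<in> {\<gamma>. horizontal_curve A \<Delta> \<gamma> \<and> p \<in> \<gamma> ` {0..1} \<and> q \<in> \<gamma> ` {0..1}}"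
      then show "asymptotic_dist A \<Delta> \<rho> p q - ereal C \<le> ereal (curve_length A \<rho> \<gamma>)"
        using main[of \<gamma> p q] by (simp add: ereal_minus_le_iff add.commute)
    qed
    then show ?thesis by (simp add: ereal_minus_le_iff add.commute)
  qed
  then show ?thesis using C by blast
qed

text \<open>Needed because in the extended reals the difference of two infinite distances is infinite.\<close>

lemma asymptotic_dist_finite: "asymptotic_dist A \<Delta> \<rho> p q < \<infinity>"
proof -
  obtain x where x: "- p + q = Exp x" using Exp_surj[OF connected] by (metis UNIV_I imageE)
  obtain w where w: "SR.control w" "SR.endpoint w = x" using SR.reachable by blast
  have "q = p + Exp (SR.endpoint w)" using x w(2) by (metis add_minus_cancel)
  then have "asymptotic_dist A \<Delta> \<rho> p q \<le> ereal (integral {0..1} (\<lambda>t. SR.speed (w t)))"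
    using asymptotic_dist_le[OF w(1)] by blast
  then show ?thesis by (rule le_less_trans) simp
qed

theorem rough_isometry:
  "\<exists>C::real. C > 0 \<and> (\<forall>p q. \<bar>asymptotic_dist A \<Delta> \<rho> p q - cc_dist A \<Delta> \<rho> p q\<bar> \<le> ereal C)"
proof -
  obtain C where C: "C \<ge> 0" "\<And>p q. asymptotic_dist A \<Delta> \<rho> p q \<le> cc_dist A \<Delta> \<rho> p q + ereal C"
    using asymptotic_dist_le_cc_dist by blast
  have "\<bar>asymptotic_dist A \<Delta> \<rho> p q - cc_dist A \<Delta> \<rho> p q\<bar> \<le> ereal (C + 1)" for p q
  proof -
    have le: "0 \<le> cc_dist A \<Delta> \<rho> p q" "cc_dist A \<Delta> \<rho> p q \<le> asymptotic_dist A \<Delta> \<rho> p q"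
      "asymptotic_dist A \<Delta> \<rho> p q < \<infinity>" "asymptotic_dist A \<Delta> \<rho> p q \<le> cc_dist A \<Delta> \<rho> p q + ereal C"
      by (rule cc_dist_nonneg cc_dist_le_asymptotic_dist asymptotic_dist_finite C(2))+
    obtain d where d: "asymptotic_dist A \<Delta> \<rho> p q = ereal d"
      using le by (cases "asymptotic_dist A \<Delta> \<rho> p q") auto
    obtain d' where d': "cc_dist A \<Delta> \<rho> p q = ereal d'"
      using le d by (cases "cc_dist A \<Delta> \<rho> p q") auto
    show ?thesis using le C(1) unfolding d d' by simp
  qed
  then show ?thesis using C(1) by (intro exI[of _ "C + 1"]) auto
qed

end

theorem corollary3p4:
  fixes A :: "('g::{topological_group_add, t2_space, second_countable_topology},
      'e::euclidean_space) atlas"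
    and \<Delta> :: "'g \<Rightarrow> 'g tangent set"
    and \<rho> :: "'g \<Rightarrow> 'g tangent \<Rightarrow> 'g tangent \<Rightarrow> real"
  assumes "lie_group A"
    and "connected (UNIV :: 'g set)"
    and "simply_connected (UNIV :: 'g set)"
    and "two_step_nilpotent A"
    and "subriemannian_structure A \<Delta> \<rho>"
  shows "\<exists>C::real. C > 0 \<and>
    (\<forall>p q. \<bar>asymptotic_dist A \<Delta> \<rho> p q - cc_dist A \<Delta> \<rho> p q\<bar> \<le> ereal C)"
proof -
  have "smooth_atlas A" using assms(1) by (simp add: lie_group_def)
  then obtain U \<phi> where U: "(U, \<phi>) \<in> A" "0 \<in> U" by (rule atlas_covers)
  interpret lie_group_chart A U \<phi> using assms(1) U by unfold_locales
  interpret subriemannian_group_chart A U \<phi> \<Delta> \<rho>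
    by unfold_locales (rule B_nil_of_two_step_nilpotent[OF assms(4)] assms(5) assms(2))+
  show ?thesis by (rule rough_isometry)
qed

end
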